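(* Let $(M,J)$ be an almost complex manifold of complex dimension $n$, let $\Omega\subset M$ be a smoothly bounded domain with boundary $b\Omega$, and let $L\subset\Omega$ be a generic $(n+1)$-dimensional submanifold with non-empty totally real boundary $N\subset b\Omega$. Suppose that $u$ is a plurisubharmonic function on $\Omega$, bounded above, such that $\limsup_{L\ni q\to N}u(q)=-\infty$. Then $u\equiv-\infty$ on $\Omega$.
   Context: All manifolds and almost complex structures are of class $C^\infty$. An almost complex manifold $(M,J)$ of complex dimension $n$ is a smooth $2n$-dimensional manifold with a smooth field $J$ of endomorphisms of the tangent spaces, $J(p):T_pM\to T_pM$, $J(p)^2=-I$. A real submanifold $L$ of $M$ is generic if for each $p\in L$ the complex span $T_pL+J(p)T_pL$ is all of $T_pM$; a submanifold $N$ is totally real if $T_pN\cap J(p)T_pN=\{0\}$ for every $p\in N$. Here $L\cup N$ is a smooth manifold with boundary $N$, and $N$ has real dimension $n$. The condition $\limsup_{L\ni q\to N}u(q)=-\infty$ means that $u(q)\to-\infty$ as $q\in L$ and the distance from $q$ to $N$ (for a fixed Riemannian metric on $M$) tends to $0$. Let $\mathbb{D}=\{\zeta\in\mathbb{C}:|\zeta|<1\}$ with its standard complex structure $J_{st}$. A $J$-complex disc is a $C^1$ map $f:\mathbb{D}\to M$ with $df\circ J_{st}=J\circ df$. An upper semicontinuous function $u:\Omega\to[-\infty,+\infty)$ is plurisubharmonic if $u\circ f$ is subharmonic on $\mathbb{D}$ for every $J$-complex disc $f:\mathbb{D}\to\Omega$ (the function $\equiv-\infty$ is allowed). *)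

theory Defs
  imports "HOL-Analysis.Analysis"
begin

section \<open>Smooth maps between open subsets of Euclidean spaces\<close>

text \<open>The predicate is meant for an \<^emph>\<open>open\<close> set and a finite-dimensional domain, where
  \<open>C\<^sup>k\<^sup>+\<^sup>1\<close> amounts to: differentiable, with all directional derivatives of class \<open>C\<^sup>k\<close>.\<close>

primrec Ck_on ::
  "nat \<Rightarrow> 'x::real_normed_vector set \<Rightarrow> ('x \<Rightarrow> 'y::real_normed_vector) \<Rightarrow> bool" where
  "Ck_on 0 S f \<longleftrightarrow> continuous_on S f"
| "Ck_on (Suc k) S f \<longleftrightarrow> (\<forall>x\<in>S. f differentiable (at x)) \<and>
     (\<forall>v. Ck_on k S (\<lambda>x. frechet_derivative f (at x) v))"

definition smooth_on :: "'x::real_normed_vector set \<Rightarrow> ('x \<Rightarrow> 'y::real_normed_vector) \<Rightarrow> bool" where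
  "smooth_on S f \<longleftrightarrow> (\<forall>k. Ck_on k S f)"


section \<open>Smooth manifolds\<close>

text \<open>The manifold is a whole type \<open>'a\<close> (Hausdorff and second countable in the statements below),
  modelled on a Euclidean space \<open>'e\<close>. A chart is a pair of a coordinate domain and a coordinate map,
  and the values of the map outside the domain are irrelevant.\<close>

type_synonym ('a, 'e) chart = "'a set \<times> ('a \<Rightarrow> 'e)"

definition is_chart :: "('a::topological_space, 'e::euclidean_space) chart \<Rightarrow> bool" where
  "is_chart c \<longleftrightarrow> open (fst c) \<and> open (snd c ` fst c) \<and>
     homeomorphism (fst c) (snd c ` fst c) (snd c) (inv_into (fst c) (snd c))"

definition coord_change :: "('a, 'e) chart \<Rightarrow> ('a, 'e) chart \<Rightarrow> 'e \<Rightarrow> 'e" where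
  "coord_change c d = snd d \<circ> inv_into (fst c) (snd c)"

definition compatible_charts :: "('a, 'e::euclidean_space) chart \<Rightarrow> ('a, 'e) chart \<Rightarrow> bool" where
  "compatible_charts c d \<longleftrightarrow>
     smooth_on (snd c ` (fst c \<inter> fst d)) (coord_change c d) \<and>
     smooth_on (snd d ` (fst c \<inter> fst d)) (coord_change d c)"

text \<open>A smooth structure is a maximal smooth atlas, so that all smooth local coordinate
  systems of the manifold are members of \<open>\<A>\<close>.\<close>

definition smooth_structure :: "('a::topological_space, 'e::euclidean_space) chart set \<Rightarrow> bool" where
  "smooth_structure \<A> \<longleftrightarrow>
     (\<forall>c\<in>\<A>. is_chart c) \<and> (\<Union>c\<in>\<A>. fst c) = UNIV \<and>
     (\<forall>c\<in>\<A>. \<forall>d\<in>\<A>. compatible_charts c d) \<and>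
     (\<forall>c. is_chart c \<and> (\<forall>d\<in>\<A>. compatible_charts c d) \<longrightarrow> c \<in> \<A>)"

text \<open>A tangent vector at \<open>p\<close> is a family of coordinate vectors, one for each chart
  around \<open>p\<close>, that transforms by the derivatives of the coordinate changes. For charts not
  containing \<open>p\<close> the entry is \<open>0\<close>, so that vectors are equal iff their coordinates are.
  The vector space operations are pointwise.\<close>

type_synonym ('a, 'e) tvec = "('a, 'e) chart \<Rightarrow> 'e"

definition tangent_space ::
  "('a, 'e::euclidean_space) chart set \<Rightarrow> 'a \<Rightarrow> ('a, 'e) tvec set" where
  "tangent_space \<A> p =
     {v. (\<forall>c\<in>\<A>. \<forall>d\<in>\<A>. p \<in> fst c \<inter> fst d \<longrightarrow>
            v d = frechet_derivative (coord_change c d) (at (snd c p)) (v c)) \<and>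
         (\<forall>c. \<not> (c \<in> \<A> \<and> p \<in> fst c) \<longrightarrow> v c = 0)}"

text \<open>The tangent vector at \<open>p\<close> whose coordinates in the chart \<open>c\<close> are \<open>e\<close>.\<close>

definition coord_vec ::
  "('a, 'e::euclidean_space) chart set \<Rightarrow> ('a, 'e) chart \<Rightarrow> 'a \<Rightarrow> 'e \<Rightarrow> ('a, 'e) tvec" where
  "coord_vec \<A> c p e = (\<lambda>d. if d \<in> \<A> \<and> p \<in> fst d
     then frechet_derivative (coord_change c d) (at (snd c p)) e else 0)"

definition Ck_into ::
  "('a::topological_space, 'e::euclidean_space) chart set \<Rightarrow> nat \<Rightarrow>
     'x::real_normed_vector set \<Rightarrow> ('x \<Rightarrow> 'a) \<Rightarrow> bool" where
  "Ck_into \<A> k S f \<longleftrightarrow> continuous_on S f \<and>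
     (\<forall>c\<in>\<A>. Ck_on k (S \<inter> f -` fst c) (snd c \<circ> f))"

definition differential ::
  "('a, 'e::euclidean_space) chart set \<Rightarrow> ('x::real_normed_vector \<Rightarrow> 'a) \<Rightarrow>
     'x \<Rightarrow> 'x \<Rightarrow> ('a, 'e) tvec" where
  "differential \<A> f x v = (\<lambda>c. if c \<in> \<A> \<and> f x \<in> fst c
     then frechet_derivative (snd c \<circ> f) (at x) v else 0)"


section \<open>Submanifolds\<close>

text \<open>Embedded submanifolds, described by slice charts.\<close>

definition submanifold ::
  "('a, 'e::euclidean_space) chart set \<Rightarrow> nat \<Rightarrow> 'a set \<Rightarrow> bool" where
  "submanifold \<A> k L \<longleftrightarrow> (\<forall>p\<in>L. \<exists>c\<in>\<A>. \<exists>S. p \<in> fst c \<and> subspace S \<and> dim S = k \<and>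
     snd c ` (fst c \<inter> L) = snd c ` fst c \<inter> S)"

text \<open>\<open>X\<close> is an embedded \<open>k\<close>-dimensional submanifold with boundary, and \<open>N \<subseteq> X\<close> is precisely its
  boundary: around each point \<open>X\<close> is either a slice free of \<open>N\<close>, or a half-slice whose
  bounding hyperplane is \<open>N\<close>.\<close>

definition submanifold_with_boundary ::
  "('a, 'e::euclidean_space) chart set \<Rightarrow> nat \<Rightarrow> 'a set \<Rightarrow> 'a set \<Rightarrow> bool" where
  "submanifold_with_boundary \<A> k X N \<longleftrightarrow> N \<subseteq> X \<and>
     (\<forall>p\<in>X. \<exists>c\<in>\<A>. \<exists>S. p \<in> fst c \<and> subspace S \<and> dim S = k \<and>
        (snd c ` (fst c \<inter> X) = snd c ` fst c \<inter> S \<and> fst c \<inter> N = {} \<or>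
         (\<exists>\<nu>\<in>S. \<nu> \<noteq> 0 \<and>
            snd c ` (fst c \<inter> X) = snd c ` fst c \<inter> {x\<in>S. 0 \<le> x \<bullet> \<nu>} \<and>
            snd c ` (fst c \<inter> N) = snd c ` fst c \<inter> {x\<in>S. x \<bullet> \<nu> = 0})))"

text \<open>The tangent space of a submanifold (without boundary): the velocities of smooth curves in it.\<close>

definition tangent_space_of ::
  "('a::topological_space, 'e::euclidean_space) chart set \<Rightarrow> 'a set \<Rightarrow> 'a \<Rightarrow> ('a, 'e) tvec set" where
  "tangent_space_of \<A> L p = {differential \<A> \<gamma> 0 1 | \<gamma> :: real \<Rightarrow> 'a.
     \<exists>\<epsilon>>0. (\<forall>k. Ck_into \<A> k {-\<epsilon><..<\<epsilon>} \<gamma>) \<and> \<gamma> ` {-\<epsilon><..<\<epsilon>} \<subseteq> L \<and> \<gamma> 0 = p}"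

text \<open>A smoothly bounded domain is a domain with smooth boundary; relative compactness is not
  required. The half-slice charts of the closure say that the domain
  lies locally on one side of its boundary hypersurface.\<close>

definition smoothly_bounded_domain ::
  "('a::topological_space, 'e::euclidean_space) chart set \<Rightarrow> 'a set \<Rightarrow> bool" where
  "smoothly_bounded_domain \<A> \<Omega> \<longleftrightarrow> open \<Omega> \<and> connected \<Omega> \<and> \<Omega> \<noteq> {} \<and>
     submanifold_with_boundary \<A> (DIM('e)) (closure \<Omega>) (frontier \<Omega>)"


section \<open>Riemannian distance\<close>

definition riemannian_metric ::
  "('a::topological_space, 'e::euclidean_space) chart set \<Rightarrow>
     ('a \<Rightarrow> ('a, 'e) tvec \<Rightarrow> ('a, 'e) tvec \<Rightarrow> real) \<Rightarrow> bool" where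
  "riemannian_metric \<A> g \<longleftrightarrow>
     (\<forall>p. \<forall>u\<in>tangent_space \<A> p. \<forall>v\<in>tangent_space \<A> p. \<forall>w\<in>tangent_space \<A> p. \<forall>a b.
        g p (\<lambda>c. a *\<^sub>R u c + b *\<^sub>R v c) w = a * g p u w + b * g p v w) \<and>
     (\<forall>p. \<forall>v\<in>tangent_space \<A> p. \<forall>w\<in>tangent_space \<A> p. g p v w = g p w v) \<and>
     (\<forall>p. \<forall>v\<in>tangent_space \<A> p. v \<noteq> (\<lambda>c. 0) \<longrightarrow> 0 < g p v v) \<and>
     (\<forall>c\<in>\<A>. \<forall>e e'. smooth_on (snd c ` fst c)
        (\<lambda>x. let p = inv_into (fst c) (snd c) x in g p (coord_vec \<A> c p e) (coord_vec \<A> c p e')))"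

definition piecewise_C1_path ::
  "('a::topological_space, 'e::euclidean_space) chart set \<Rightarrow> (real \<Rightarrow> 'a) \<Rightarrow> bool" where
  "piecewise_C1_path \<A> \<gamma> \<longleftrightarrow> continuous_on {0..1} \<gamma> \<and>
     (\<exists>F. finite F \<and> Ck_into \<A> 1 ({0<..<1} - F) \<gamma>)"

definition curve_length ::
  "('a, 'e::euclidean_space) chart set \<Rightarrow> ('a \<Rightarrow> ('a, 'e) tvec \<Rightarrow> ('a, 'e) tvec \<Rightarrow> real) \<Rightarrow>
     (real \<Rightarrow> 'a) \<Rightarrow> ennreal" where
  "curve_length \<A> g \<gamma> = (\<integral>\<^sup>+ t \<in> {0..1}.
     ennreal (sqrt (g (\<gamma> t) (differential \<A> \<gamma> t 1) (differential \<A> \<gamma> t 1))) \<partial>lborel)"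

text \<open>The distance is \<open>\<infinity>\<close> between different connected components.\<close>

definition riemannian_dist ::
  "('a::topological_space, 'e::euclidean_space) chart set \<Rightarrow>
     ('a \<Rightarrow> ('a, 'e) tvec \<Rightarrow> ('a, 'e) tvec \<Rightarrow> real) \<Rightarrow> 'a \<Rightarrow> 'a \<Rightarrow> ennreal" where
  "riemannian_dist \<A> g p q =
     (INF \<gamma> \<in> {\<gamma>. piecewise_C1_path \<A> \<gamma> \<and> \<gamma> 0 = p \<and> \<gamma> 1 = q}. curve_length \<A> g \<gamma>)"

definition riemannian_setdist ::
  "('a::topological_space, 'e::euclidean_space) chart set \<Rightarrow>
     ('a \<Rightarrow> ('a, 'e) tvec \<Rightarrow> ('a, 'e) tvec \<Rightarrow> real) \<Rightarrow> 'a \<Rightarrow> 'a set \<Rightarrow> ennreal" where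
  "riemannian_setdist \<A> g q N = (INF p\<in>N. riemannian_dist \<A> g q p)"


section \<open>Almost complex structures\<close>

definition almost_complex_structure ::
  "('a::topological_space, 'e::euclidean_space) chart set \<Rightarrow>
     ('a \<Rightarrow> ('a, 'e) tvec \<Rightarrow> ('a, 'e) tvec) \<Rightarrow> bool" where
  "almost_complex_structure \<A> J \<longleftrightarrow>
     (\<forall>p. \<forall>v\<in>tangent_space \<A> p. J p v \<in> tangent_space \<A> p) \<and>
     (\<forall>p. \<forall>v\<in>tangent_space \<A> p. \<forall>w\<in>tangent_space \<A> p. \<forall>a b.
        J p (\<lambda>c. a *\<^sub>R v c + b *\<^sub>R w c) = (\<lambda>c. a *\<^sub>R J p v c + b *\<^sub>R J p w c)) \<and>
     (\<forall>p. \<forall>v\<in>tangent_space \<A> p. J p (J p v) = (\<lambda>c. - v c)) \<and>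
     (\<forall>c\<in>\<A>. \<forall>e. smooth_on (snd c ` fst c)
        (\<lambda>x. let p = inv_into (fst c) (snd c) x in J p (coord_vec \<A> c p e) c))"

definition generic_submanifold ::
  "('a::topological_space, 'e::euclidean_space) chart set \<Rightarrow>
     ('a \<Rightarrow> ('a, 'e) tvec \<Rightarrow> ('a, 'e) tvec) \<Rightarrow> 'a set \<Rightarrow> bool" where
  "generic_submanifold \<A> J L \<longleftrightarrow> (\<forall>p\<in>L.
     {\<lambda>c. v c + J p w c | v w. v \<in> tangent_space_of \<A> L p \<and> w \<in> tangent_space_of \<A> L p}
       = tangent_space \<A> p)"

definition totally_real ::
  "('a::topological_space, 'e::euclidean_space) chart set \<Rightarrow>
     ('a \<Rightarrow> ('a, 'e) tvec \<Rightarrow> ('a, 'e) tvec) \<Rightarrow> 'a set \<Rightarrow> bool" where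
  "totally_real \<A> J N \<longleftrightarrow> (\<forall>p\<in>N.
     tangent_space_of \<A> N p \<inter> J p ` tangent_space_of \<A> N p = {\<lambda>c. 0})"

definition J_complex_disc ::
  "('a::topological_space, 'e::euclidean_space) chart set \<Rightarrow>
     ('a \<Rightarrow> ('a, 'e) tvec \<Rightarrow> ('a, 'e) tvec) \<Rightarrow> (complex \<Rightarrow> 'a) \<Rightarrow> bool" where
  "J_complex_disc \<A> J f \<longleftrightarrow> Ck_into \<A> 1 (ball 0 1) f \<and>
     (\<forall>\<zeta>\<in>ball 0 1. \<forall>w. differential \<A> f \<zeta> (\<i> * w) = J (f \<zeta>) (differential \<A> f \<zeta> w))"


section \<open>Plurisubharmonic functions\<close>

definition usc_on :: "'x::topological_space set \<Rightarrow> ('x \<Rightarrow> ereal) \<Rightarrow> bool" where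
  "usc_on S u \<longleftrightarrow> (\<forall>a. openin (top_of_set S) {x\<in>S. u x < a})"

text \<open>The Lebesgue integral of an extended real function whose positive part has finite integral.
  The value may be \<open>-\<infinity>\<close>.\<close>

definition ereal_integral :: "'x measure \<Rightarrow> ('x \<Rightarrow> ereal) \<Rightarrow> ereal" where
  "ereal_integral M f =
     enn2ereal (\<integral>\<^sup>+ x. e2ennreal (f x) \<partial>M) - enn2ereal (\<integral>\<^sup>+ x. e2ennreal (- f x) \<partial>M)"

text \<open>The function identically \<open>-\<infinity>\<close> is admitted.\<close>

definition subharmonic_on :: "complex set \<Rightarrow> (complex \<Rightarrow> ereal) \<Rightarrow> bool" where
  "subharmonic_on D v \<longleftrightarrow> usc_on D v \<and> (\<forall>z\<in>D. v z < \<infinity>) \<and>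
     (\<forall>z. \<forall>r>0. cball z r \<subseteq> D \<longrightarrow>
        v z \<le> ereal_integral (uniform_measure lborel {0..2 * pi}) (\<lambda>t. v (z + of_real r * cis t)))"

definition plurisubharmonic_on ::
  "('a::topological_space, 'e::euclidean_space) chart set \<Rightarrow>
     ('a \<Rightarrow> ('a, 'e) tvec \<Rightarrow> ('a, 'e) tvec) \<Rightarrow> 'a set \<Rightarrow> ('a \<Rightarrow> ereal) \<Rightarrow> bool" where
  "plurisubharmonic_on \<A> J \<Omega> u \<longleftrightarrow> usc_on \<Omega> u \<and> (\<forall>q\<in>\<Omega>. u q < \<infinity>) \<and>
     (\<forall>f. J_complex_disc \<A> J f \<and> f ` ball 0 1 \<subseteq> \<Omega> \<longrightarrow> subharmonic_on (ball 0 1) (u \<circ> f))"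

end

theory Submission
  imports Defs
begin

text \<open>The theorem has a local part, which produces one open set on which \<open>u = - \<infinity>\<close>,
  and a global part, which spreads this value over the connected set \<open>\<Omega>\<close>.

  The global part is \<open>propagation\<close>. Two nearby points lie on a small
  \<open>J\<close>-complex disc (\<open>full_discs_near\<close>). If \<open>u = - \<infinity>\<close>
  near one of them, then \<open>u = - \<infinity>\<close> on an arc of the circle through this point
  about the other one, and the submean value inequality gives \<open>u = - \<infinity>\<close> at the
  centre.

  For the local part choose \<open>p \<in> N\<close> and a chart in which \<open>L \<union> N\<close>
  is a half-slice with edge \<open>N0\<close>, a linear subspace of half the dimension that is totally
  real at \<open>p\<close>. Translating \<open>N0\<close> slightly into \<open>L\<close> gives affine
  planes \<open>b + N0\<close>. To each of them half-discs are attached: maps \<open>G\<close> of the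
  closed unit disc which satisfy the Cauchy-Riemann equation for \<open>J\<close> in the upper half
  and map the real diameter into \<open>b + N0\<close>. By \<open>attached_discs\<close> the point
  \<open>G (\<i> \<tau>)\<close> can be prescribed arbitrarily in an open set which does not depend on
  \<open>b\<close>. The half-discs leave the plane in a direction close to \<open>J v0\<close> with
  \<open>v0 \<in> N0\<close>. Since \<open>N\<close> is contained in the boundary of
  \<open>\<Omega>\<close> and is totally real of half the dimension, \<open>v0\<close> can be chosen
  so that \<open>J v0\<close> points into \<open>\<Omega>\<close> (\<open>inward_vector\<close>), and
  then the half-discs stay in \<open>\<Omega>\<close>. The diameter lies in \<open>L\<close> near
  \<open>N\<close>, so that \<open>u < - K\<close> on it, where \<open>K\<close> is as large as
  desired when \<open>b\<close> is close to \<open>p\<close>. A conformal map takes the unit disc to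
  the half-disc and the lower half of the unit circle to the diameter, so the submean value inequality
  yields \<open>u \<le> C - (C + K) / 4\<close> at the prescribed point
  (\<open>half_disc_estimate\<close>), for every \<open>K\<close>.

  It remains to construct the discs. A dilation makes \<open>J\<close> close to a constant structure
  \<open>J0\<close>, and in the coordinates of the locale \<open>normal_coordinates\<close> the two
  structures agree along the plane \<open>b + N0\<close>. The equation for discs then reads
  \<open>h = Q1 (F) h + Q2 (F) F\<^sub>x\<close> for the defect
  \<open>h = F\<^sub>x + J0 F\<^sub>y\<close>, with small \<open>Q1\<close> and \<open>Q2\<close>,
  where \<open>F\<close> is recovered from \<open>h\<close> as an affine disc plus the Cauchy-Green
  potential of \<open>h\<close>. This is solved by iteration in a space of Hoelder continuous
  functions (\<open>disc_exists\<close>). For half-discs the defect is extended to the lower half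
  plane by Schwarz reflection with respect to the antilinear involution that fixes \<open>N0\<close>.
  The extension stays Hoelder continuous because \<open>Q2\<close> vanishes on \<open>N0\<close>, and
  its symmetry forces the boundary condition (\<open>half_disc\<close>). The Hoelder estimate for the
  derivatives of the Cauchy-Green potential comes from regularising the kernel \<open>1 / z\<close> at
  the scales \<open>4\<^sup>-\<^sup>m\<close> and summing over \<open>m\<close>
  (\<open>potential'_holder\<close>).\<close>

section \<open>A regularised Cauchy kernel\<close>

text \<open>A \<open>C\<^sup>1\<close> profile that agrees with \<open>1 / s\<close> for
  \<open>s \<ge> 1\<close>: the singularity is cut off by the tangent of \<open>1 / s\<close> at
  \<open>1\<close>.\<close>

definition rho :: "real \<Rightarrow> real" where
  "rho s = (if s \<le> 1 then 2 - s else 1 / s)"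

definition rho' :: "real \<Rightarrow> real" where
  "rho' s = (if s \<le> 1 then -1 else - 1 / s\<^sup>2)"

lemma rho_deriv: "(rho has_real_derivative rho' s) (at s)"
proof -
  consider "s < 1" | "s = 1" | "s > 1" by linarith
  then show ?thesis
  proof cases
    case 1
    have "((\<lambda>s. 2 - s) has_real_derivative -1) (at s)"
      by (auto intro!: derivative_eq_intros)
    moreover have "\<forall>\<^sub>F t in nhds s. rho t = 2 - t"
      using eventually_nhds_in_open[of "{..<1}" s] 1
      by (auto simp: rho_def elim!: eventually_mono)
    ultimately show ?thesis
      using 1 by (subst DERIV_cong_ev[OF refl _ refl, where g="\<lambda>s. 2 - s"]) (auto simp: rho'_def)
  next
    case 3
    have "((\<lambda>s. 1 / s) has_real_derivative - 1 / s\<^sup>2) (at s)"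
      using 3 by (auto intro!: derivative_eq_intros simp: power2_eq_square)
    moreover have "\<forall>\<^sub>F t in nhds s. rho t = 1 / t"
      using eventually_nhds_in_open[of "{1<..}" s] 3
      by (auto simp: rho_def elim!: eventually_mono)
    ultimately show ?thesis
      using 3 by (subst DERIV_cong_ev[OF refl _ refl, where g="\<lambda>s. 1 / s"]) (auto simp: rho'_def)
  next
    case 2
    \<comment> \<open>The two branches have the same value and the same derivative at \<open>1\<close>.\<close>
    have bd: "norm (rho (1 + h) - rho 1 - (-1) * h) \<le> h\<^sup>2" for h
    proof (cases "h \<le> 0")
      case True then show ?thesis by (simp add: rho_def)
    next
      case False
      then have "rho (1 + h) - rho 1 - (-1) * h = h\<^sup>2 / (1 + h)"
        by (simp add: rho_def field_simps power2_eq_square)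
      moreover have "h\<^sup>2 / (1 + h) \<le> h\<^sup>2 / 1"
        using False by (intro divide_left_mono) auto
      ultimately show ?thesis using False by simp
    qed
    have "((\<lambda>h. (rho (1 + h) - rho 1) / h) \<longlongrightarrow> -1) (at 0)"
    proof (rule LIM_I)
      fix r :: real assume "r > 0"
      have "norm ((rho (1 + h) - rho 1) / h - -1) < r" if h: "h \<noteq> 0" "norm (h - 0) < r" for h
      proof -
        have "(rho (1 + h) - rho 1) / h - -1 = (rho (1 + h) - rho 1 - (-1) * h) / h"
          using h by (simp add: field_simps)
        then have "norm ((rho (1 + h) - rho 1) / h - -1) \<le> h\<^sup>2 / \<bar>h\<bar>"
          using bd[of h] h by (auto simp: divide_simps)
        also have "\<dots> = \<bar>h\<bar>" using h by (auto simp: power2_eq_square abs_if)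
        finally show ?thesis using h by simp
      qed
      then show "\<exists>s>0. \<forall>x. x \<noteq> 0 \<and> norm (x - 0) < s \<longrightarrow> norm ((rho (1 + x) - rho 1) / x - -1) < r"
        using \<open>r > 0\<close> by blast
    qed
    then show ?thesis using 2 by (simp add: DERIV_def rho'_def)
  qed
qed

text \<open>The square root of \<open>- rho' (\<bar>z\<bar>\<^sup>2)\<close>. Being a Lipschitz function, it
  makes the derivative of the kernel below Lipschitz.\<close>

definition trunc_inv :: "complex \<Rightarrow> real" where
  "trunc_inv z = 1 / (max 1 (norm z))\<^sup>2"

lemma trunc_inv_bounds: "0 < trunc_inv z" "trunc_inv z \<le> 1" "norm z * trunc_inv z \<le> 1"
proof -
  let ?r = "max 1 (norm z)"
  show "0 < trunc_inv z" unfolding trunc_inv_def by (auto intro!: divide_pos_pos)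
  have "?r\<^sup>2 \<ge> 1" by simp
  then show "trunc_inv z \<le> 1" unfolding trunc_inv_def by (simp add: divide_simps)
  have "norm z \<le> ?r * ?r" using mult_right_mono[of 1 "?r" "?r"] by linarith
  then show "norm z * trunc_inv z \<le> 1" unfolding trunc_inv_def
    by (simp add: divide_simps power2_eq_square)
qed

lemma trunc_inv_lip_aux:
  fixes q r :: real assumes "q \<ge> 1" "r \<ge> 1"
  shows "q * \<bar>1 / q\<^sup>2 - 1 / r\<^sup>2\<bar> \<le> 2 * \<bar>q - r\<bar>"
proof -
  have "q * (1 / q\<^sup>2 - 1 / r\<^sup>2) = (r - q) * ((1/q) * (1 / r) + 1/r * (1/r) )"
    using assms by (simp add: field_simps power2_eq_square)
  then have "q * \<bar>1 / q\<^sup>2 - 1 / r\<^sup>2\<bar> = \<bar>r - q\<bar> * ((1/q) * (1 / r) + 1/r * (1/r))"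
  proof -
    have "\<bar>q * (1 / q\<^sup>2 - 1 / r\<^sup>2)\<bar> = \<bar>r - q\<bar> * \<bar>(1/q) * (1 / r) + 1/r * (1/r)\<bar>"
      unfolding \<open>q * (1 / q\<^sup>2 - 1 / r\<^sup>2) = _\<close> abs_mult ..
    moreover have "\<bar>(1/q) * (1 / r) + 1/r * (1/r)\<bar> = (1/q) * (1 / r) + 1/r * (1/r)"
      using assms by (intro abs_of_nonneg) auto
    moreover have "\<bar>q * (1 / q\<^sup>2 - 1 / r\<^sup>2)\<bar> = q * \<bar>1 / q\<^sup>2 - 1 / r\<^sup>2\<bar>"
      using assms by (simp add: abs_mult)
    ultimately show ?thesis by simp
  qed
  moreover have "(1/q) * (1 / r) + 1/r * (1/r) \<le> 1 * 1 + 1 * 1"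
    using assms by (intro add_mono mult_mono) auto
  ultimately show ?thesis
    using mult_left_mono[of "(1/q) * (1 / r) + 1/r * (1/r)" 2 "\<bar>r - q\<bar>"]
    by (simp add: abs_minus_commute[of r q])
qed

lemma max1_norm_lip: "\<bar>max 1 (norm z) - max 1 (norm w)\<bar> \<le> norm (z - w)"
  using norm_triangle_ineq3[of z w] by (simp add: max_def abs_if split: if_splits)

lemma trunc_inv_lip1: "norm z * \<bar>trunc_inv z - trunc_inv w\<bar> \<le> 2 * norm (z - w)"
proof -
  have "norm z * \<bar>trunc_inv z - trunc_inv w\<bar> \<le> max 1 (norm z) * \<bar>trunc_inv z - trunc_inv w\<bar>"
    by (intro mult_right_mono) auto
  also have "\<dots> \<le> 2 * norm (z - w)"
    unfolding trunc_inv_def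
    using trunc_inv_lip_aux[of "max 1 (norm z)" "max 1 (norm w)"] max1_norm_lip[of z w] by auto
  finally show ?thesis .
qed

lemma trunc_inv_lip: "\<bar>trunc_inv z - trunc_inv w\<bar> \<le> 2 * norm (z - w)"
proof -
  have "1 * \<bar>trunc_inv z - trunc_inv w\<bar> \<le> max 1 (norm z) * \<bar>trunc_inv z - trunc_inv w\<bar>"
    by (intro mult_right_mono) auto
  also have "\<dots> \<le> 2 * norm (z - w)"
    unfolding trunc_inv_def
    using trunc_inv_lip_aux[of "max 1 (norm z)" "max 1 (norm w)"] max1_norm_lip[of z w] by auto
  finally show ?thesis by simp
qed

lemma scaled_trunc_inv_lip:
  fixes a :: complex assumes "norm a = 1"
  shows "\<bar>(a \<bullet> z) * trunc_inv z - (a \<bullet> w) * trunc_inv w\<bar> \<le> 3 * norm (z - w)"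
    and "\<bar>(a \<bullet> z) * trunc_inv z\<bar> \<le> 1"
proof -
  have a: "\<bar>a \<bullet> v\<bar> \<le> norm v" for v
    using Cauchy_Schwarz_ineq2[of a v] assms by simp
  have "(a \<bullet> z) * trunc_inv z - (a \<bullet> w) * trunc_inv w =
      (a \<bullet> z) * (trunc_inv z - trunc_inv w) + (a \<bullet> (z - w)) * trunc_inv w"
    by (simp add: inner_diff_right algebra_simps)
  then have "\<bar>(a \<bullet> z) * trunc_inv z - (a \<bullet> w) * trunc_inv w\<bar> \<le>
     \<bar>a \<bullet> z\<bar> * \<bar>trunc_inv z - trunc_inv w\<bar> + \<bar>a \<bullet> (z - w)\<bar> * \<bar>trunc_inv w\<bar>"
    by (metis abs_mult abs_triangle_ineq)
  also have "\<dots> \<le> norm z * \<bar>trunc_inv z - trunc_inv w\<bar> + norm (z - w) * 1"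
    using a trunc_inv_bounds[of w] by (intro add_mono mult_mono) auto
  also have "\<dots> \<le> 3 * norm (z - w)" using trunc_inv_lip1[of z w] by simp
  finally show "\<bar>(a \<bullet> z) * trunc_inv z - (a \<bullet> w) * trunc_inv w\<bar> \<le> 3 * norm (z - w)" .
  have "\<bar>(a \<bullet> z) * trunc_inv z\<bar> = \<bar>a \<bullet> z\<bar> * trunc_inv z"
    using trunc_inv_bounds(1)[of z] by (simp add: abs_mult)
  also have "\<dots> \<le> norm z * trunc_inv z"
    using a trunc_inv_bounds(1)[of z] by (intro mult_right_mono) auto
  finally show "\<bar>(a \<bullet> z) * trunc_inv z\<bar> \<le> 1" using trunc_inv_bounds(3)[of z] by linarith
qed

lemma rho_norm: "rho ((norm z)\<^sup>2) = trunc_inv z + (max 0 (1 - (norm (z::complex))\<^sup>2))"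
  and rho'_norm: "rho' ((norm z)\<^sup>2) = - (trunc_inv z)\<^sup>2"
proof -
  have "(norm z)\<^sup>2 \<le> 1 \<longleftrightarrow> norm z \<le> 1" by (simp add: power_le_one_iff abs_square_le_1)
  then show "rho ((norm z)\<^sup>2) = trunc_inv z + (max 0 (1 - (norm (z::complex))\<^sup>2))"
    "rho' ((norm z)\<^sup>2) = - (trunc_inv z)\<^sup>2"
    by (auto simp: rho_def rho'_def trunc_inv_def max_def power_divide)
qed

lemma bump_lip: "\<bar>max 0 (1 - (norm (z::complex))\<^sup>2) - max 0 (1 - (norm (w::complex))\<^sup>2)\<bar> \<le> 2 * norm (z - w)"
proof -
  have *: "max 0 (1 - (norm z)\<^sup>2) = 1 - (min 1 (norm z))\<^sup>2" for z :: complex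
    by (auto simp: max_def min_def power_le_one_iff abs_square_le_1)
  let ?p = "min 1 (norm z)" and ?q = "min 1 (norm w)"
  have "(1 - ?p\<^sup>2) - (1 - ?q\<^sup>2) = (?q - ?p) * (?q + ?p)"
    by (simp add: power2_eq_square algebra_simps)
  moreover have "\<bar>(?q - ?p) * (?q + ?p)\<bar> \<le> norm (z - w) * 2"
    unfolding abs_mult
  proof (intro mult_mono)
    show "\<bar>?q - ?p\<bar> \<le> norm (z - w)"
      using norm_triangle_ineq3[of z w] by (simp add: min_def abs_if split: if_splits)
  qed (auto simp: min_def)
  ultimately show ?thesis unfolding * by simp
qed

lemma rho_norm_lip:
    fixes z w :: complex
    shows "\<bar>rho ((norm z)\<^sup>2) - rho ((norm w)\<^sup>2)\<bar> \<le> 4 * norm (z - w)"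
  and rho_norm_bound: "\<bar>rho ((norm z)\<^sup>2)\<bar> \<le> 2" 
proof -
  show "\<bar>rho ((norm z)\<^sup>2) - rho ((norm w)\<^sup>2)\<bar> \<le> 4 * norm (z - w)"
    unfolding rho_norm using trunc_inv_lip[of z w] bump_lip[of z w] by linarith
  have "max 0 (1 - (norm z)\<^sup>2) \<le> 1" "0 \<le> max 0 (1 - (norm z)\<^sup>2)" by auto
  then show "\<bar>rho ((norm z)\<^sup>2)\<bar> \<le> 2"
    unfolding rho_norm using trunc_inv_bounds[of z] by linarith
qed

text \<open>Outside the unit disc \<open>unit_kernel 1\<close> and \<open>unit_kernel (- \<i>)\<close> are the real and the
  imaginary part of \<open>1 / z\<close>. Both parts are kept as real kernels because they act on
  vector-valued densities through \<open>Re + J0 Im\<close>, where \<open>J0\<close> is a linear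
  complex structure on the target.\<close>

definition unit_kernel :: "complex \<Rightarrow> complex \<Rightarrow> real" where
  "unit_kernel a z = (a \<bullet> z) * rho ((norm z)\<^sup>2)"

definition unit_kernel' :: "complex \<Rightarrow> complex \<Rightarrow> complex \<Rightarrow> real" where
  "unit_kernel' a z d = (a \<bullet> d) * rho ((norm z)\<^sup>2) - 2 * ((a \<bullet> z) * trunc_inv z) * ((d \<bullet> z) * trunc_inv z)"

lemma unit_kernel_deriv: "(unit_kernel a has_derivative unit_kernel' a z) (at z)"
proof -
  have "((\<lambda>z. rho (z \<bullet> z)) has_derivative (\<lambda>d. (z \<bullet> d + d \<bullet> z) * rho' (z \<bullet> z))) (at z)"
    by (rule DERIV_compose_FDERIV[OF rho_deriv]) (auto intro!: derivative_eq_intros)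
  then have "((\<lambda>z. (a \<bullet> z) * rho (z \<bullet> z)) has_derivative
      (\<lambda>d. (a \<bullet> z) * ((z \<bullet> d + d \<bullet> z) * rho' (z \<bullet> z)) + (a \<bullet> d) * rho (z \<bullet> z))) (at z)"
    by (auto intro!: derivative_eq_intros)
  moreover have "(\<lambda>d. (a \<bullet> z) * ((z \<bullet> d + d \<bullet> z) * rho' (z \<bullet> z)) + (a \<bullet> d) * rho (z \<bullet> z)) = unit_kernel' a z"
    by (rule ext) (simp add: unit_kernel'_def rho'_norm power2_norm_eq_inner[symmetric] inner_commute[of z] 
        power2_eq_square[of "trunc_inv z"] algebra_simps)
  ultimately show ?thesis
    by (simp add: unit_kernel_def[abs_def] power2_norm_eq_inner)
qed

lemma unit_kernel'_linear: "unit_kernel' a z d = Re d * unit_kernel' a z 1 + Im d * unit_kernel' a z \<i>"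
  by (simp add: unit_kernel'_def inner_complex_def algebra_simps)

lemma unit_kernel_bound:
  assumes "norm a = 1" shows "\<bar>unit_kernel a z\<bar> \<le> 2"
proof -
  have a: "\<bar>a \<bullet> z\<bar> \<le> norm z"
    using Cauchy_Schwarz_ineq2[of a z] assms by simp
  have "\<bar>unit_kernel a z\<bar> \<le> \<bar>(a \<bullet> z) * trunc_inv z\<bar> + \<bar>a \<bullet> z\<bar> * max 0 (1 - (norm z)\<^sup>2)"
    unfolding unit_kernel_def rho_norm distrib_left
    using abs_triangle_ineq[of "(a \<bullet> z) * trunc_inv z" "(a \<bullet> z) * max 0 (1 - (norm z)\<^sup>2)"]
    by (simp add: abs_mult)
  also have "\<dots> \<le> 1 + 1"
  proof (intro add_mono scaled_trunc_inv_lip(2)[OF assms])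
    show "\<bar>a \<bullet> z\<bar> * max 0 (1 - (norm z)\<^sup>2) \<le> 1"
    proof (cases "norm z \<le> 1")
      case True
      then have "\<bar>a \<bullet> z\<bar> * max 0 (1 - (norm z)\<^sup>2) \<le> 1 * 1"
        using a by (intro mult_mono) auto
      then show ?thesis by simp
    next
      case False
      then have "(norm z)\<^sup>2 \<ge> 1" by simp
      then show ?thesis by simp
    qed
  qed
  finally show ?thesis by simp
qed

lemma unit_kernel'_bound_unit:
  assumes "norm a = 1" "norm d = 1" shows "\<bar>unit_kernel' a z d\<bar> \<le> 4"
proof -
  have "\<bar>unit_kernel' a z d\<bar> \<le> \<bar>a \<bullet> d\<bar> * \<bar>rho ((norm z)\<^sup>2)\<bar> + 2 * \<bar>(a \<bullet> z) * trunc_inv z\<bar> * \<bar>(d \<bullet> z) * trunc_inv z\<bar>"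
    unfolding unit_kernel'_def
    using abs_triangle_ineq4[of "(a \<bullet> d) * rho ((norm z)\<^sup>2)" "2 * ((a \<bullet> z) * trunc_inv z) * ((d \<bullet> z) * trunc_inv z)"]
    by (simp only: abs_mult abs_numeral)
  also have "\<dots> \<le> 1 * 2 + 2 * 1 * 1"
    using Cauchy_Schwarz_ineq2[of a d] assms
    by (intro add_mono mult_mono scaled_trunc_inv_lip rho_norm_bound) auto
  finally show ?thesis by simp
qed

lemma unit_kernel'_lip_unit:
  assumes "norm a = 1" "norm d = 1" shows "\<bar>unit_kernel' a z d - unit_kernel' a w d\<bar> \<le> 16 * norm (z - w)"
proof -
  let ?A = "\<lambda>z. (a \<bullet> z) * trunc_inv z" and ?D = "\<lambda>z. (d \<bullet> z) * trunc_inv z"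
  have "unit_kernel' a z d - unit_kernel' a w d = (a \<bullet> d) * (rho ((norm z)\<^sup>2) - rho ((norm w)\<^sup>2))
     - (2 * (?A z - ?A w) * ?D z + 2 * ?A w * (?D z - ?D w))"
    unfolding unit_kernel'_def by (simp add: algebra_simps)
  then have "\<bar>unit_kernel' a z d - unit_kernel' a w d\<bar> \<le> \<bar>a \<bullet> d\<bar> * \<bar>rho ((norm z)\<^sup>2) - rho ((norm w)\<^sup>2)\<bar>
     + (2 * \<bar>?A z - ?A w\<bar> * \<bar>?D z\<bar> + 2 * \<bar>?A w\<bar> * \<bar>?D z - ?D w\<bar>)"
    using abs_triangle_ineq4[of "(a \<bullet> d) * (rho ((norm z)\<^sup>2) - rho ((norm w)\<^sup>2))"
        "2 * (?A z - ?A w) * ?D z + 2 * ?A w * (?D z - ?D w)"]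
      abs_triangle_ineq[of "2 * (?A z - ?A w) * ?D z" "2 * ?A w * (?D z - ?D w)"]
    by (simp only: abs_mult abs_numeral)
  also have "\<dots> \<le> 1 * (4 * norm (z - w)) + (2 * (3 * norm (z - w)) * 1 + 2 * 1 * (3 * norm (z - w)))"
    using Cauchy_Schwarz_ineq2[of a d] assms
    by (intro add_mono mult_mono scaled_trunc_inv_lip rho_norm_lip) auto
  finally show ?thesis by simp
qed

text \<open>The quadratic error is what allows differentiation under the integral sign; it follows from the
  Lipschitz bound for the derivative and the mean value inequality.\<close>

lemma unit_kernel_taylor:
  assumes "norm a = 1"
  shows "\<bar>unit_kernel a (z + d) - unit_kernel a z - unit_kernel' a z d\<bar> \<le> 32 * (norm d)\<^sup>2"
proof -
  have lin: "bounded_linear (unit_kernel' a x)" for x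
    using unit_kernel_deriv by (rule has_derivative_bounded_linear)
  have on: "onorm (\<lambda>v. unit_kernel' a x v - unit_kernel' a z v) \<le> 32 * norm d" if "x \<in> closed_segment z (z + d)" for x
  proof (rule onorm_le)
    fix v :: complex
    have xz: "norm (x - z) \<le> norm d"
      using segment_bound1[OF that] by simp
    have "unit_kernel' a x v - unit_kernel' a z v = Re v * (unit_kernel' a x 1 - unit_kernel' a z 1) + Im v * (unit_kernel' a x \<i> - unit_kernel' a z \<i>)"
      by (subst (1 2) unit_kernel'_linear) (simp add: algebra_simps)
    then have "\<bar>unit_kernel' a x v - unit_kernel' a z v\<bar> \<le> \<bar>Re v\<bar> * \<bar>unit_kernel' a x 1 - unit_kernel' a z 1\<bar> + \<bar>Im v\<bar> * \<bar>unit_kernel' a x \<i> - unit_kernel' a z \<i>\<bar>"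
      by (metis abs_mult abs_triangle_ineq)
    also have "\<dots> \<le> norm v * (16 * norm (x - z)) + norm v * (16 * norm (x - z))"
      by (intro add_mono mult_mono unit_kernel'_lip_unit assms abs_Re_le_cmod abs_Im_le_cmod) auto
    also have "\<dots> \<le> 32 * norm d * norm v" using mult_left_mono[OF xz, of "norm v"] by (simp add: mult.commute)
    finally show "norm (unit_kernel' a x v - unit_kernel' a z v) \<le> 32 * norm d * norm v" by simp
  qed
  have "norm (unit_kernel a (z + d) - unit_kernel a z - unit_kernel' a z (z + d - z)) \<le> norm (z + d - z) * (32 * norm d)"
    by (rule differentiable_bound_linearization[where S="closed_segment z (z + d)" and ?f'="\<lambda>x. unit_kernel' a x"])
       (use on in \<open>auto simp: fun_diff_def in_segment algebra_simps intro!: has_derivative_at_withinI unit_kernel_deriv\<close>)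
  then show ?thesis by (simp add: power2_eq_square)
qed

text \<open>Where the kernel is not regularised it is homogeneous of degree \<open>-1\<close>.\<close>

lemma unit_kernel_scale:
  assumes "norm z \<ge> 1"
  shows "4 * unit_kernel a (4 * z) = unit_kernel a z" "16 * unit_kernel' a (4 * z) d = unit_kernel' a z d"
proof -
  have z: "z \<noteq> 0" using assms by auto
  have i: "v \<bullet> (4 * z) = 4 * (v \<bullet> z)" for v :: complex
    by (simp add: inner_complex_def)
  have e: "trunc_inv (4 * z) = 1 / (16 * (norm z)\<^sup>2)" "trunc_inv z = 1 / (norm z)\<^sup>2"
    using assms by (auto simp: trunc_inv_def max_def norm_mult power_mult_distrib)
  have r: "rho ((norm (4 * z))\<^sup>2) = 1 / (16 * (norm z)\<^sup>2)" "rho ((norm z)\<^sup>2) = 1 / (norm z)\<^sup>2"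
  proof -
    have "(norm z)\<^sup>2 \<ge> 1" using assms by simp
    then have "max 0 (1 - (norm z)\<^sup>2) = 0" "max 0 (1 - (norm (4 * z))\<^sup>2) = 0"
      by (auto simp: norm_mult power_mult_distrib max_def)
    then show "rho ((norm (4 * z))\<^sup>2) = 1 / (16 * (norm z)\<^sup>2)" "rho ((norm z)\<^sup>2) = 1 / (norm z)\<^sup>2"
      unfolding rho_norm e by simp_all
  qed
  show "4 * unit_kernel a (4 * z) = unit_kernel a z"
    unfolding unit_kernel_def r i by simp
  show "16 * unit_kernel' a (4 * z) d = unit_kernel' a z d"
    unfolding unit_kernel'_def r i e using z by (simp add: field_simps)
qed

text \<open>The Cauchy-Riemann operator of the regularised \<open>1 / z\<close> is a bump function supported in
  the unit disc; this is where the Cauchy-Green operator gets its inverse from.\<close>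

lemma unit_kernel_dbar:
  "unit_kernel' 1 z 1 - unit_kernel' (- \<i>) z \<i> = 4 * max 0 (1 - (norm z)\<^sup>2)"
  "unit_kernel' (- \<i>) z 1 + unit_kernel' 1 z \<i> = 0"
proof -
  have s: "(norm z)\<^sup>2 = (Re z)\<^sup>2 + (Im z)\<^sup>2" by (simp add: cmod_power2)
  have "unit_kernel' 1 z 1 - unit_kernel' (- \<i>) z \<i> = 2 * rho ((norm z)\<^sup>2) - 2 * (norm z)\<^sup>2 * (trunc_inv z)\<^sup>2"
    unfolding unit_kernel'_def s by (simp add: inner_complex_def power2_eq_square algebra_simps)
  also have "\<dots> = 4 * max 0 (1 - (norm z)\<^sup>2)"
  proof (cases "norm z \<le> 1")
    case True
    then show ?thesis by (simp add: rho_def trunc_inv_def max_def power_le_one)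
  next
    case False
    then have "(norm z)\<^sup>2 > 1" "z \<noteq> 0" by (auto simp: one_less_power)
    then show ?thesis using False
      by (simp add: rho_def trunc_inv_def max_def power_divide power_le_one power2_eq_square)
  qed
  finally show "unit_kernel' 1 z 1 - unit_kernel' (- \<i>) z \<i> = 4 * max 0 (1 - (norm z)\<^sup>2)" .
  show "unit_kernel' (- \<i>) z 1 + unit_kernel' 1 z \<i> = 0"
    unfolding unit_kernel'_def by (simp add: inner_complex_def)
qed

lemma unit_kernel_cnj: "unit_kernel 1 (cnj z) = unit_kernel 1 z" "unit_kernel (- \<i>) (cnj z) = - unit_kernel (- \<i>) z"
  by (simp_all add: unit_kernel_def inner_complex_def)

section \<open>Convolution with the regularised kernels\<close>

definition conv :: "(complex \<Rightarrow> real) \<Rightarrow> (complex \<Rightarrow> 'e::euclidean_space) \<Rightarrow> complex \<Rightarrow> 'e" where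
  "conv k h z = (\<integral>w. k (z - w) *\<^sub>R h w \<partial>lborel)"

lemma integrable_compact_support:
  fixes F :: "complex \<Rightarrow> 'e::euclidean_space"
  assumes "continuous_on UNIV F" "\<And>w. norm (w - z) > r \<Longrightarrow> F w = 0"
  shows "integrable lborel F"
proof -
  have "F = (\<lambda>w. indicator (cball z r) w *\<^sub>R F w)"
    using assms(2) by (auto simp: indicator_def fun_eq_iff dist_norm norm_minus_commute)
  moreover have "integrable lborel (\<lambda>w. indicator (cball z r) w *\<^sub>R F w)"
    by (intro borel_integrable_compact continuous_on_subset[OF assms(1)]) auto
  ultimately show ?thesis by simp
qed

lemma integrable_conv:
  fixes h :: "complex \<Rightarrow> 'e::euclidean_space"
  assumes "continuous_on UNIV k" "continuous_on UNIV h" "\<And>w. norm w > r \<Longrightarrow> h w = 0"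
  shows "integrable lborel (\<lambda>w. k (z - w) *\<^sub>R h w)"
proof (rule integrable_compact_support)
  show "continuous_on UNIV (\<lambda>w. k (z - w) *\<^sub>R h w)"
    by (intro continuous_intros continuous_on_compose2[OF assms(1)] assms(2)) auto
  show "k (z - w) *\<^sub>R h w = 0" if "norm (w - 0) > r" for w
    using assms(3)[of w] that by simp
qed

text \<open>The constant is the area of the square circumscribed about the disc of radius \<open>r\<close>. A
  non-integrable function has integral \<open>0\<close>, which satisfies the bound too.\<close>

lemma integral_localized_bound:
  fixes F :: "complex \<Rightarrow> 'e::euclidean_space"
  assumes b: "\<And>w. norm (F w) \<le> b" and r: "r \<ge> 0" and s: "\<And>w. norm (w - z) > r \<Longrightarrow> F w = 0"
  shows "norm (\<integral>w. F w \<partial>lborel) \<le> 4 * b * r\<^sup>2"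
proof -
  have b0: "b \<ge> 0" using b[of z] norm_ge_zero order_trans by blast
  let ?Q = "cbox (z - Complex r r) (z + Complex r r)"
  have m: "measure lborel ?Q = 4 * r\<^sup>2"
    using r by (subst measure_lborel_cbox_eq) (auto simp: Basis_complex_def inner_complex_def power2_eq_square)
  show ?thesis
  proof (cases "integrable lborel F")
    case False
    then show ?thesis using b0 by (simp add: not_integrable_integral_eq)
  next
    case True
    have "norm (\<integral>w. F w \<partial>lborel) \<le> (\<integral>w. b * indicator ?Q w \<partial>lborel)"
    proof (rule Bochner_Integration.integral_norm_bound_integral[OF True])
      show "integrable lborel (\<lambda>w. b * indicator ?Q w)"
        by (intro integrable_mult_right) (simp add: emeasure_lborel_cbox_eq)
      fix w
      show "norm (F w) \<le> b * indicator ?Q w"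
      proof (cases "norm (w - z) > r")
        case True then show ?thesis using s b0 by (simp add: indicator_def)
      next
        case False
        then have "\<bar>Re (w - z)\<bar> \<le> r" "\<bar>Im (w - z)\<bar> \<le> r"
          using abs_Re_le_cmod[of "w - z"] abs_Im_le_cmod[of "w - z"] by linarith+
        then have "w \<in> ?Q" by (auto simp: in_cbox_complex_iff abs_le_iff)
        then show ?thesis using b[of w] by simp
      qed
    qed
    also have "\<dots> = 4 * b * r\<^sup>2" using m by simp
    finally show ?thesis .
  qed
qed

text \<open>Differentiation falls on the kernel; the density is merely continuous.\<close>

lemma conv_has_derivative:
  fixes h :: "complex \<Rightarrow> 'e::euclidean_space"
  assumes k: "continuous_on UNIV k" and k': "\<And>d. continuous_on UNIV (\<lambda>x. k' x d)"
    and lin: "\<And>x d. k' x d = Re d * k' x 1 + Im d * k' x \<i>"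
    and taylor: "\<And>x d. \<bar>k (x + d) - k x - k' x d\<bar> \<le> B * (norm d)\<^sup>2"
    and h: "continuous_on UNIV h" "\<And>w. norm w > r \<Longrightarrow> h w = 0"
  shows "(conv k h has_derivative (\<lambda>d. conv (\<lambda>x. k' x d) h z)) (at z)"
proof -
  note int = integrable_conv[OF _ h]
  have hn: "integrable lborel (\<lambda>w. norm (h w))"
    using integrable_compact_support[OF h(1), where z=0 and r=r] h(2) by (intro integrable_norm) simp
  have B: "B \<ge> 0" using taylor[of 0 1] by (simp add: abs_ge_zero order_trans[OF abs_ge_zero])
  let ?K = "\<integral>w. norm (h w) \<partial>lborel"
  have lin2: "conv (\<lambda>x. k' x d) h z = Re d *\<^sub>R conv (\<lambda>x. k' x 1) h z + Im d *\<^sub>R conv (\<lambda>x. k' x \<i>) h z" for d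
  proof -
    have "conv (\<lambda>x. k' x d) h z = (\<integral>w. Re d *\<^sub>R (k' (z - w) 1 *\<^sub>R h w) + Im d *\<^sub>R (k' (z - w) \<i> *\<^sub>R h w) \<partial>lborel)"
      unfolding conv_def by (subst lin) (simp add: scaleR_add_left)
    also have "\<dots> = (\<integral>w. Re d *\<^sub>R (k' (z - w) 1 *\<^sub>R h w) \<partial>lborel) + (\<integral>w. Im d *\<^sub>R (k' (z - w) \<i> *\<^sub>R h w) \<partial>lborel)"
      by (intro Bochner_Integration.integral_add integrable_scaleR_right int k')
    finally show ?thesis unfolding conv_def integral_scaleR_right .
  qed
  have bl: "bounded_linear (\<lambda>d. conv (\<lambda>x. k' x d) h z)"
    by (subst ext[OF lin2], intro bounded_linear_add bounded_linear_scaleR_const bounded_linear_Re bounded_linear_Im)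
  show ?thesis
  proof (rule has_derivativeI_sandwich[of 1 _ _ _ _ "\<lambda>y. B * norm (y - z) * ?K"])
    show "bounded_linear (\<lambda>d. conv (\<lambda>x. k' x d) h z)" by (rule bl)
    show "((\<lambda>y. B * norm (y - z) * ?K) \<longlongrightarrow> 0) (at z)"
      by (auto intro!: tendsto_eq_intros)
    fix y assume y: "y \<noteq> z"
    have eq: "conv k h y - conv k h z - conv (\<lambda>x. k' x (y - z)) h z =
       (\<integral>w. (k (y - w) - k (z - w) - k' (z - w) (y - z)) *\<^sub>R h w \<partial>lborel)"
      unfolding conv_def scaleR_diff_left
      by (subst Bochner_Integration.integral_diff | (rule Bochner_Integration.integrable_diff int k k' | simp))+
    have "norm (\<integral>w. (k (y - w) - k (z - w) - k' (z - w) (y - z)) *\<^sub>R h w \<partial>lborel)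
       \<le> (\<integral>w. B * (norm (y - z))\<^sup>2 * norm (h w) \<partial>lborel)"
    proof (rule Bochner_Integration.integral_norm_bound_integral)
      show "integrable lborel (\<lambda>w. (k (y - w) - k (z - w) - k' (z - w) (y - z)) *\<^sub>R h w)"
        unfolding scaleR_diff_left by (intro Bochner_Integration.integrable_diff int k k')
      show "integrable lborel (\<lambda>w. B * (norm (y - z))\<^sup>2 * norm (h w))"
        by (intro integrable_mult_right hn)
      show "norm ((k (y - w) - k (z - w) - k' (z - w) (y - z)) *\<^sub>R h w) \<le> B * (norm (y - z))\<^sup>2 * norm (h w)" for w
        using taylor[of "z - w" "y - z"] by (auto intro!: mult_right_mono)
    qed
    also have "\<dots> = B * (norm (y - z))\<^sup>2 * ?K" by simp
    finally show "norm (conv k h y - conv k h z - conv (\<lambda>x. k' x (y - z)) h z) / norm (y - z) \<le> B * norm (y - z) * ?K"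
      using y unfolding eq by (simp add: divide_le_eq power2_eq_square mult_ac)
  qed auto
qed

lemma integral_lborel_reflect:
  fixes f :: "complex \<Rightarrow> 'e::euclidean_space"
  shows "(\<integral>w. f (z - w) \<partial>lborel) = (\<integral>w. f w \<partial>lborel)"
proof (cases "f \<in> borel_measurable borel")
  case True
  have "lborel = density (distr lborel borel (\<lambda>x. z + (-1) *\<^sub>R x)) (\<lambda>_. ennreal (\<bar>-1\<bar>^DIM(complex)))"
    using lborel_affine[of "-1" z] by simp
  then have "lborel = distr lborel borel (\<lambda>x::complex. z - x)" by (simp add: density_1)
  then have "(\<integral>w. f w \<partial>lborel) = (\<integral>w. f w \<partial>(distr lborel borel (\<lambda>x::complex. z - x)))" by metis
  also have "\<dots> = (\<integral>w. f (z - w) \<partial>lborel)" by (subst integral_distr) (use True in auto)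
  finally show ?thesis by simp
next
  case False
  have "(\<lambda>w. f (z - w)) \<notin> borel_measurable borel"
  proof
    assume "(\<lambda>w. f (z - w)) \<in> borel_measurable borel"
    then have "(\<lambda>v. (\<lambda>w. f (z - w)) (z - v)) \<in> borel_measurable borel"
      by (rule measurable_compose[rotated]) auto
    then show False using False by simp
  qed
  then show ?thesis using False
    by (metis borel_measurable_integrable measurable_lborel2 not_integrable_integral_eq)
qed

lemma integral_lborel_cnj:
  fixes f :: "complex \<Rightarrow> 'e::euclidean_space"
  assumes [measurable]: "f \<in> borel_measurable borel"
  shows "(\<integral>w. f (cnj w) \<partial>lborel) = (\<integral>w. f w \<partial>lborel)"
proof -
  define c :: "complex \<Rightarrow> real" where "c j = (if j = 1 then 1 else - 1)" for j
  have T: "0 + (\<Sum>j\<in>Basis. (c j * (x \<bullet> j)) *\<^sub>R j) = cnj x" for x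
    by (simp add: Basis_complex_def c_def inner_complex_def complex_eq_iff)
  have "lborel = density (distr lborel borel (\<lambda>x. 0 + (\<Sum>j\<in>Basis. (c j * (x \<bullet> j)) *\<^sub>R j))) (\<lambda>_. (\<Prod>j\<in>Basis. \<bar>c j\<bar>))"
    by (rule lborel_affine_euclidean) (auto simp: c_def)
  then have "lborel = distr lborel borel cnj"
    unfolding T by (simp add: Basis_complex_def c_def density_1)
  then have "(\<integral>w. f w \<partial>lborel) = (\<integral>w. f w \<partial>(distr lborel borel cnj))" by metis
  also have "\<dots> = (\<integral>w. f (cnj w) \<partial>lborel)"
    by (subst integral_distr) (auto intro: borel_measurable_continuous_onI continuous_intros)
  finally show ?thesis by simp
qed

text \<open>The kernel \<open>1 / z\<close> regularised in the disc of radius \<open>4\<^sup>-\<^sup>m\<close>.\<close>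

definition kernel :: "nat \<Rightarrow> complex \<Rightarrow> complex \<Rightarrow> real" where
  "kernel m a z = 4^m * unit_kernel a (4^m * z)"

definition kernel' :: "nat \<Rightarrow> complex \<Rightarrow> complex \<Rightarrow> complex \<Rightarrow> real" where
  "kernel' m a z d = 16^m * unit_kernel' a (4^m * z) d"

lemma unit_kernel_continuous: "continuous_on UNIV (unit_kernel a)"
  by (intro continuous_at_imp_continuous_on ballI has_derivative_continuous[OF unit_kernel_deriv])

lemma kernel_continuous: "continuous_on UNIV (kernel m a)"
  unfolding kernel_def by (intro continuous_intros continuous_on_compose2[OF unit_kernel_continuous]) auto

lemma kernel'_linear: "kernel' m a z d = Re d * kernel' m a z 1 + Im d * kernel' m a z \<i>"
  unfolding kernel'_def by (subst unit_kernel'_linear) (simp only: distrib_left mult_ac)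

lemma pow_16_4: "16^m * (4^m * x) = 64^m * (x::real)"
  by (simp add: power_mult_distrib[symmetric] mult.assoc[symmetric])

lemma kernel'_lip_unit:
  assumes "norm a = 1" "norm d = 1"
  shows "\<bar>kernel' m a z d - kernel' m a w d\<bar> \<le> 16 * 64^m * norm (z - w)"
proof -
  have "\<bar>kernel' m a z d - kernel' m a w d\<bar> = 16^m * \<bar>unit_kernel' a (4^m * z) d - unit_kernel' a (4^m * w) d\<bar>"
    by (simp add: kernel'_def abs_mult flip: right_diff_distrib)
  also have "\<dots> \<le> 16^m * (16 * norm (4^m * z - 4^m * w))"
    by (intro mult_left_mono unit_kernel'_lip_unit assms) auto
  also have "norm (4^m * z - 4^m * w) = 4^m * norm (z - w)"
    by (simp add: norm_mult norm_power flip: right_diff_distrib)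
  finally show ?thesis using pow_16_4[of m 1] by (simp add: mult_ac)
qed

lemma kernel'_continuous:
  assumes "norm a = 1" shows "continuous_on UNIV (\<lambda>x. kernel' m a x d)"
proof -
  have *: "continuous_on UNIV (\<lambda>x. kernel' m a x d)" if "norm d = 1" for d
  proof (rule lipschitz_on_continuous_on)
    show "(16 * 64^m)-lipschitz_on UNIV (\<lambda>x. kernel' m a x d)"
      using kernel'_lip_unit[OF assms that] by (auto intro!: lipschitz_onI simp: dist_norm)
  qed
  show ?thesis by (subst kernel'_linear) (intro continuous_intros *; simp)
qed

lemma kernel_taylor:
  assumes "norm a = 1"
  shows "\<bar>kernel m a (z + d) - kernel m a z - kernel' m a z d\<bar> \<le> 32 * 64^m * (norm d)\<^sup>2"
proof -
  have lin: "unit_kernel' a x (4^m * d) = 4^m * unit_kernel' a x d" for x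
  proof -
    have "(4::complex)^m = of_real (4^m)" by simp
    then have R: "Re (4^m * d) = 4^m * Re d" "Im (4^m * d) = 4^m * Im d"
      by (simp_all only: times_complex.sel complex_of_real_def complex.sel)
    show ?thesis
      unfolding unit_kernel'_linear[of a x "4^m * d"] unit_kernel'_linear[of a x d] R distrib_left mult.assoc ..
  qed
  have p: "(16::real)^m = 4^m * 4^m" "(64::real)^m = 4^m * (4^m * 4^m)"
    by (simp_all flip: power_mult_distrib)
  have "kernel m a (z + d) - kernel m a z - kernel' m a z d =
     4^m * (unit_kernel a (4^m * z + 4^m * d) - unit_kernel a (4^m * z) - unit_kernel' a (4^m * z) (4^m * d))"
    unfolding kernel_def kernel'_def lin p distrib_left[of "4^m" z d] right_diff_distrib mult.assoc ..
  then have "\<bar>kernel m a (z + d) - kernel m a z - kernel' m a z d\<bar> = 4^m *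
     \<bar>unit_kernel a (4^m * z + 4^m * d) - unit_kernel a (4^m * z) - unit_kernel' a (4^m * z) (4^m * d)\<bar>"
    by (simp only: abs_mult) simp
  also have "\<dots> \<le> 4^m * (32 * (norm (4^m * d))\<^sup>2)"
    by (intro mult_left_mono unit_kernel_taylor[OF assms]) simp
  also have "norm (4^m * d) = 4^m * norm d" by (simp add: norm_mult norm_power)
  also have "4^m * (32 * (4^m * norm d)\<^sup>2) = 32 * 64^m * (norm d)\<^sup>2"
    unfolding p power2_eq_square by (simp only: mult_ac)
  finally show ?thesis .
qed

text \<open>Consecutive regularisations differ only in the disc of radius \<open>4\<^sup>-\<^sup>m\<close>,
  which has area of order \<open>16\<^sup>-\<^sup>m\<close>. All convergence estimates rest on this.\<close>

lemma kernel_diff_support: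
  assumes "norm z > (1/4)^m"
  shows "kernel (Suc m) a z = kernel m a z" "kernel' (Suc m) a z d = kernel' m a z d"
proof -
  have "norm (4^m * z) \<ge> 1" using assms by (simp add: norm_mult norm_power field_simps)
  from unit_kernel_scale[OF this] show "kernel (Suc m) a z = kernel m a z" "kernel' (Suc m) a z d = kernel' m a z d"
    unfolding kernel_def kernel'_def by (simp_all add: mult_ac)
qed

lemma conv_kernel_has_derivative:
  fixes h :: "complex \<Rightarrow> 'e::euclidean_space"
  assumes "norm a = 1" "continuous_on UNIV h" "\<And>w. norm w > r \<Longrightarrow> h w = 0"
  shows "(conv (kernel m a) h has_derivative (\<lambda>d. conv (\<lambda>x. kernel' m a x d) h z)) (at z)"
  by (rule conv_has_derivative[where k'="kernel' m a"])
     (rule kernel_continuous kernel'_continuous kernel'_linear kernel_taylor assms | assumption)+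

text \<open>The difference of two regularisations has compact support, so its convolution with a constant is
  constant and the derivative of that convolution vanishes. Here the constant is replaced by a
  compactly supported function which equals \<open>1\<close> on a large disc.\<close>

lemma kernel'_mean_zero:
  assumes a: "norm a = 1"
  shows "(\<integral>w. kernel' (Suc m) a (z - w) d - kernel' m a (z - w) d \<partial>lborel) = 0"
proof -
  define k where "k x = kernel (Suc m) a x - kernel m a x" for x
  define k' where "k' x d = kernel' (Suc m) a x d - kernel' m a x d" for x d
  define R where "R = norm z + 2"
  \<comment> \<open>The convolution kernel lives in the unit disc, so near \<open>z\<close> the values of \<open>h\<close> outside the disc of radius \<open>R\<close> are not seen.\<close>
  define h where "h w = max 0 (min 1 (R + 1 - norm w))" for w :: complex
  have k0: "k x = 0" "k' x d = 0" if "norm x > 1" for x d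
  proof -
    have "(1/4::real)^m \<le> 1" by (simp add: power_le_one)
    then have "norm x > (1/4)^m" using that by linarith
    from kernel_diff_support[OF this] show "k x = 0" "k' x d = 0" unfolding k_def k'_def by simp_all
  qed
  have h1: "h w = 1" if "norm w \<le> R" for w using that by (simp add: h_def)
  have eq: "conv k h x = (\<integral>w. k w \<partial>lborel)" if "x \<in> ball z 1" for x
  proof -
    have "conv k h x = (\<integral>w. k (x - w) \<partial>lborel)"
      unfolding conv_def
    proof (rule Bochner_Integration.integral_cong[OF refl])
      fix w
      show "k (x - w) *\<^sub>R h w = k (x - w)"
      proof (cases "norm (x - w) > 1")
        case False
        have "norm w \<le> norm (x - w) + norm (z - x) + norm z"
          using norm_triangle_ineq2[of w z] norm_triangle_ineq[of "w - x" "x - z"]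
          by (simp add: norm_minus_commute)
        then have "norm w \<le> R" using that False unfolding R_def by (simp add: dist_norm)
        then show ?thesis by (simp add: h1)
      qed (simp add: k0)
    qed
    then show ?thesis by (simp add: integral_lborel_reflect)
  qed
  have d1: "(conv k h has_derivative (\<lambda>d. conv (\<lambda>x. k' x d) h z)) (at z)"
  proof (rule conv_has_derivative)
    show "continuous_on UNIV k" unfolding k_def by (intro continuous_intros kernel_continuous)
    show "continuous_on UNIV (\<lambda>x. k' x d)" for d unfolding k'_def by (intro continuous_intros kernel'_continuous a)
    show "k' x d = Re d * k' x 1 + Im d * k' x \<i>" for x d
      unfolding k'_def by (subst (1 2) kernel'_linear) (simp add: algebra_simps)
    show "\<bar>k (x + d) - k x - k' x d\<bar> \<le> (32 * 64^Suc m + 32 * 64^m) * (norm d)\<^sup>2" for x d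
      using kernel_taylor[OF a, of "Suc m" x d] kernel_taylor[OF a, of m x d] unfolding k_def k'_def distrib_right
      by linarith
    show "continuous_on UNIV h" unfolding h_def by (intro continuous_intros)
    show "norm w > R + 1 \<Longrightarrow> h w = 0" for w unfolding h_def by auto
  qed
  \<comment> \<open>The convolution is locally constant.\<close>
  have d2: "(conv k h has_derivative (\<lambda>d. 0)) (at z)"
  proof (rule has_derivative_transform_within_open[where s="ball z 1"])
    show "((\<lambda>x. \<integral>w. k w \<partial>lborel) has_derivative (\<lambda>d. 0)) (at z)" by simp
  qed (auto simp: eq)
  have "conv (\<lambda>x. k' x d) h z = 0" using has_derivative_unique[OF d1 d2] by metis
  moreover have "conv (\<lambda>x. k' x d) h z = (\<integral>w. k' (z - w) d \<partial>lborel)"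
    unfolding conv_def
  proof (rule Bochner_Integration.integral_cong[OF refl])
    fix w
    show "k' (z - w) d *\<^sub>R h w = k' (z - w) d"
    proof (cases "norm (z - w) > 1")
      case False
      have "norm w \<le> norm (z - w) + norm z"
        using norm_triangle_ineq2[of w z] by (simp add: norm_minus_commute)
      then have "norm w \<le> R" using False unfolding R_def by simp
      then show ?thesis by (simp add: h1)
    qed (simp add: k0)
  qed
  ultimately show ?thesis by (simp add: k'_def)
qed

section \<open>Hoelder continuous densities\<close>

text \<open>The Hoelder condition with exponent \<open>1/2\<close>, one constant bounding both the values and
  the Hoelder quotients.\<close>

definition holder :: "complex set \<Rightarrow> real \<Rightarrow> (complex \<Rightarrow> 'b::real_normed_vector) \<Rightarrow> bool" where
  "holder D M h \<longleftrightarrow> (\<forall>z\<in>D. norm (h z) \<le> M) \<and>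
     (\<forall>z\<in>D. \<forall>w\<in>D. norm (h z - h w) \<le> M * sqrt (norm (z - w)))"

lemma holder_mono: "holder D A f \<Longrightarrow> A \<le> B \<Longrightarrow> holder D B f"
  unfolding holder_def by (meson mult_right_mono order_trans real_sqrt_ge_zero norm_ge_zero)

lemma holderI:
  assumes "\<And>z. z \<in> D \<Longrightarrow> norm (h z) \<le> M" "\<And>z w. z \<in> D \<Longrightarrow> w \<in> D \<Longrightarrow> norm (h z - h w) \<le> M * sqrt (norm (z - w))"
  shows "holder D M h"
  using assms by (auto simp: holder_def)

lemma holderD:
  assumes "holder D M h"
  shows "z \<in> D \<Longrightarrow> norm (h z) \<le> M" "z \<in> D \<Longrightarrow> w \<in> D \<Longrightarrow> norm (h z - h w) \<le> M * sqrt (norm (z - w))"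
  using assms by (auto simp: holder_def)

lemma holder_continuous:
  fixes f :: "complex \<Rightarrow> 'b::real_normed_vector"
  assumes "holder UNIV M f" shows "continuous_on UNIV f"
proof (rule continuous_at_imp_continuous_on, intro ballI)
  fix z :: complex
  have "((\<lambda>w. M * sqrt (norm (w - z))) \<longlongrightarrow> 0) (at z)"
    by (auto intro!: tendsto_eq_intros)
  then have "(f \<longlongrightarrow> f z) (at z)"
    by (intro Lim_transform_bound[where f="\<lambda>w. f w - f z" and g="\<lambda>w. M * sqrt (norm (w - z))", THEN Lim_null[THEN iffD2]])
      (auto intro!: always_eventually order_trans[OF holderD(2)[OF assms] abs_ge_self])
  then show "isCont f z" by (simp add: isCont_def)
qed

lemma geometric_limit:
  fixes x :: "nat \<Rightarrow> 'b::banach"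
  assumes "\<And>m. norm (x (Suc m) - x m) \<le> c * (1/2)^m"
  shows "\<exists>l. x \<longlonglongrightarrow> l \<and> (\<forall>m. norm (x m - l) \<le> 2 * c * (1/2)^m)"
proof -
  have c: "c \<ge> 0" using order_trans[OF norm_ge_zero assms[of 0]] by simp
  have step: "norm (x (m + n) - x m) \<le> 2 * c * (1/2)^m * (1 - (1/2)^n)" for m n
  proof (induction n)
    case (Suc n)
    have "norm (x (m + Suc n) - x m) \<le> norm (x (Suc (m + n)) - x (m + n)) + norm (x (m + n) - x m)"
      using norm_triangle_ineq[of "x (Suc (m + n)) - x (m + n)" "x (m + n) - x m"] by simp
    also have "\<dots> \<le> c * (1/2)^(m + n) + 2 * c * (1/2)^m * (1 - (1/2)^n)"
      by (intro add_mono assms Suc.IH)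
    also have "\<dots> = 2 * c * (1/2)^m * (1 - (1/2)^Suc n)"
      by (simp add: power_add field_simps)
    finally show ?case .
  qed simp
  have step2: "norm (x (m + n) - x m) \<le> 2 * c * (1/2)^m" for m n
  proof -
    have "2 * c * (1/2)^m * (1 - (1/2)^n) \<le> 2 * c * (1/2)^m * 1"
      using c by (intro mult_left_mono) auto
    then show ?thesis using step[of m n] by linarith
  qed
  have "(\<lambda>m. 2 * c * (1/2)^m) \<longlonglongrightarrow> 2 * c * 0"
    by (intro tendsto_intros LIMSEQ_power_zero) simp
  then have lim0: "(\<lambda>m. 2 * c * (1/2)^m) \<longlonglongrightarrow> 0" by simp
  have "Cauchy x"
  proof (rule CauchyI')
    fix e :: real assume "e > 0"
    with lim0 obtain M where M: "2 * c * (1/2)^M < e / 2"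
      using order_tendstoD(2)[OF lim0, of "e/2"] by (auto simp: eventually_sequentially)
    have "norm (x m - x n) < e" if "m \<ge> M" "n > m" for m n
    proof -
      have "norm (x m - x n) \<le> norm (x (M + (m - M)) - x M) + norm (x (M + (n - M)) - x M)"
        using that norm_triangle_ineq4[of "x m - x M" "x n - x M"] by simp
      then show ?thesis using step2[of M "m - M"] step2[of M "n - M"] M by linarith
    qed
    then show "\<exists>M. \<forall>m\<ge>M. \<forall>n>m. dist (x m) (x n) < e" unfolding dist_norm by blast
  qed
  then obtain l where l: "x \<longlonglongrightarrow> l" using Cauchy_convergent[OF \<open>Cauchy x\<close>] unfolding convergent_def by blast
  have "norm (x m - l) \<le> 2 * c * (1/2)^m" for m
  proof (rule LIMSEQ_le_const2)
    have "(\<lambda>n. x (n + m)) \<longlonglongrightarrow> l" using l by (rule LIMSEQ_ignore_initial_segment)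
    then show "(\<lambda>n. norm (x m - x (n + m))) \<longlonglongrightarrow> norm (x m - l)"
      by (intro tendsto_intros)
    show "\<exists>N. \<forall>n\<ge>N. norm (x m - x (n + m)) \<le> 2 * c * (1/2)^m"
      using step2[of m] by (auto simp: norm_minus_commute add.commute)
  qed
  with l show ?thesis by blast
qed

text \<open>The terms grow geometrically as long as \<open>4\<^sup>j d \<le> 1\<close> and decay geometrically
  afterwards, hence the sum is comparable to its largest term, which is about \<open>sqrt d\<close>.
  The induction shifts the index and replaces \<open>d\<close> by \<open>4 d\<close>; the stronger
  bound \<open>4 * sqrt d - d\<close> absorbs the term split off.\<close>

lemma sum_min_dyadic:
  fixes d :: real assumes "d \<ge> 0"
  shows "(\<Sum>j<m. min ((1/2)^j) (2^j * d)) \<le> 4 * sqrt d"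
proof -
  have two: "(\<Sum>j<m. min ((1/2)^j) (2^j * d)) \<le> 2" for m and d :: real
  proof -
    have "(\<Sum>j<m. min ((1/2)^j) (2^j * d)) \<le> (\<Sum>j<m. (1/2)^j)" by (intro sum_mono) simp
    also have "\<dots> \<le> 2" by (simp add: sum_gp_strict)
    finally show ?thesis .
  qed
  have "d \<le> 1 \<Longrightarrow> (\<Sum>j<m. min ((1/2)^j) (2^j * d)) \<le> 4 * sqrt d - d" using assms
  proof (induction m arbitrary: d)
    case 0
    then have "sqrt d * sqrt d \<le> 1 * sqrt d" by (intro mult_right_mono) auto
    then have "d \<le> sqrt d" using 0 by simp
    moreover have "sqrt d \<ge> 0" using 0 by simp
    ultimately have "0 \<le> 4 * sqrt d - d" by linarith
    then show ?case by simp
  next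
    case (Suc m)
    have "(\<Sum>j<Suc m. min ((1/2)^j) (2^j * d)) = d + (\<Sum>j<m. min ((1/2)^Suc j) (2^Suc j * d))"
      using Suc.prems by (subst sum.lessThan_Suc_shift) simp
    also have "(\<Sum>j<m. min ((1/2)^Suc j) (2^Suc j * d)) = (\<Sum>j<m. min ((1/2)^j) (2^j * (4 * d))) / 2"
      unfolding sum_divide_distrib by (intro sum.cong refl) (simp add: min_def)
    also have "d + (\<Sum>j<m. min ((1/2)^j) (2^j * (4 * d))) / 2 \<le> 4 * sqrt d - d"
    proof (cases "4 * d \<le> 1")
      case True
      have "(\<Sum>j<m. min ((1/2)^j) (2^j * (4 * d))) \<le> 4 * sqrt (4 * d) - 4 * d"
        using Suc.IH[of "4 * d"] True Suc.prems by simp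
      then show ?thesis by (simp add: real_sqrt_mult)
    next
      case False
      have s: "sqrt d \<ge> 1/2" using False real_sqrt_le_mono[of "1/4" d] by (simp add: real_sqrt_divide)
      have s1: "sqrt d \<le> 1" using Suc.prems by simp
      have "(sqrt d - 1/2) * (3/2 - sqrt d) \<ge> 0" by (rule mult_nonneg_nonneg) (use s s1 in linarith)+
      then have "2 * d + 1 \<le> 4 * sqrt d"
        using Suc.prems by (simp add: algebra_simps)
      then show ?thesis using two[where m=m and d="4 * d"] by linarith
    qed
    finally show ?case .
  qed
  moreover have "d > 1 \<Longrightarrow> 2 \<le> 4 * sqrt d" using real_sqrt_ge_one[of d] by linarith
  ultimately show ?thesis using two[where m=m and d=d] assms by (cases "d \<le> 1") (auto intro: order_trans)
qed

lemma sqrt_quarter_power: "sqrt ((1/4)^m) = (1/2)^m"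
  by (simp add: real_sqrt_power real_sqrt_divide)

context
  fixes a :: complex and M :: real and h :: "complex \<Rightarrow> 'e::euclidean_space"
  assumes a: "norm a = 1"
    and hol: "holder UNIV M h" and supp: "\<And>z. norm z > 2 \<Longrightarrow> h z = 0"
begin

lemma M_nonneg: "M \<ge> 0"
  using hol order_trans[OF norm_ge_zero[of "h 0"], of M] unfolding holder_def by simp

lemma h_bound: "norm (h z) \<le> M"
  using hol unfolding holder_def by auto

lemma h_holder: "norm (h z - h w) \<le> M * sqrt (norm (z - w))" for z w :: complex
  using hol unfolding holder_def by auto

lemma h_continuous: "continuous_on UNIV h"
  using hol by (rule holder_continuous)

lemma conv_step_bound: "norm (conv (kernel (Suc m) a) h z - conv (kernel m a) h z) \<le> 40 * M * (1/4)^m"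
proof -
  have k: "\<bar>kernel m a x\<bar> \<le> 4^m * 2" for m x
    using unit_kernel_bound[OF a] by (simp add: kernel_def abs_mult)
  have "conv (kernel (Suc m) a) h z - conv (kernel m a) h z =
     (\<integral>w. (kernel (Suc m) a (z - w) - kernel m a (z - w)) *\<^sub>R h w \<partial>lborel)"
    unfolding conv_def scaleR_diff_left
    by (intro Bochner_Integration.integral_diff[symmetric] integrable_conv[OF kernel_continuous h_continuous supp])
  also have "norm \<dots> \<le> 4 * (10 * 4^m * M) * ((1/4)^m)\<^sup>2"
  proof (rule integral_localized_bound)
    fix w
    have "\<bar>kernel (Suc m) a (z - w) - kernel m a (z - w)\<bar> \<le> 10 * 4^m"
      using k[of "Suc m" "z - w"] k[of m "z - w"] unfolding power_Suc by linarith
    then show "norm ((kernel (Suc m) a (z - w) - kernel m a (z - w)) *\<^sub>R h w) \<le> 10 * 4^m * M"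
      using h_bound[of w] by (simp only: norm_scaleR real_norm_def, intro mult_mono) auto
    show "norm (w - z) > (1/4)^m \<Longrightarrow> (kernel (Suc m) a (z - w) - kernel m a (z - w)) *\<^sub>R h w = 0"
      using kernel_diff_support[of m "z - w"] by (simp add: norm_minus_commute)
  qed auto
  also have "\<dots> = 40 * M * (1/4)^m"
    by (simp add: power2_eq_square power_divide)
  finally show ?thesis .
qed

lemma kernel'_bound: "norm d = 1 \<Longrightarrow> \<bar>kernel' m a x d\<bar> \<le> 4 * 16^m"
  using unit_kernel'_bound_unit[OF a] by (simp add: kernel'_def abs_mult)

text \<open>Since the kernel difference has mean zero, any constant may be subtracted from the density. Choosing
  the value of the density at the centre gains a factor \<open>2\<^sup>-\<^sup>m\<close> by the
  Hoelder condition.\<close>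

lemma conv'_diff:
  fixes z d :: complex
  shows "conv (\<lambda>x. kernel' (Suc m) a x d) h z - conv (\<lambda>x. kernel' m a x d) h z =
     (\<integral>w. (kernel' (Suc m) a (z - w) d - kernel' m a (z - w) d) *\<^sub>R (h w - c) \<partial>lborel)"
proof -
  let ?D = "\<lambda>w. kernel' (Suc m) a (z - w) d - kernel' m a (z - w) d"
  have 1: "integrable lborel (\<lambda>w. ?D w *\<^sub>R h w)"
    unfolding scaleR_diff_left
    by (intro Bochner_Integration.integrable_diff integrable_conv[OF kernel'_continuous[OF a] h_continuous supp])
  have D: "integrable lborel ?D"
  proof (rule integrable_compact_support[where z=z and r=1])
    show "continuous_on UNIV ?D"
      by (intro continuous_intros continuous_on_compose2[OF kernel'_continuous[OF a]]) auto
    fix w assume "norm (w - z) > 1"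
    moreover have "(1/4::real)^m \<le> 1" by (simp add: power_le_one)
    ultimately have "norm (z - w) > (1/4)^m" unfolding norm_minus_commute[of z w] by linarith
    from kernel_diff_support(2)[OF this] show "?D w = 0" by simp
  qed
  have 2: "integrable lborel (\<lambda>w. ?D w *\<^sub>R c)" using D by (rule integrable_scaleR_left)
  have "(\<integral>w. ?D w *\<^sub>R (h w - c) \<partial>lborel) = (\<integral>w. ?D w *\<^sub>R h w \<partial>lborel) - (\<integral>w. ?D w *\<^sub>R c \<partial>lborel)"
    unfolding scaleR_diff_right by (rule Bochner_Integration.integral_diff[OF 1 2])
  also have "(\<integral>w. ?D w *\<^sub>R c \<partial>lborel) = 0"
    using kernel'_mean_zero[OF a, of m z d] D by (subst integral_scaleR_left) auto
  also have "(\<integral>w. ?D w *\<^sub>R h w \<partial>lborel) = conv (\<lambda>x. kernel' (Suc m) a x d) h z - conv (\<lambda>x. kernel' m a x d) h z"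
    unfolding conv_def scaleR_diff_left
    by (intro Bochner_Integration.integral_diff integrable_conv[OF kernel'_continuous[OF a] h_continuous supp])
  finally show ?thesis by simp
qed

text \<open>The kernel derivative is of size \<open>16\<^sup>m\<close> on a set of area
  \<open>16\<^sup>-\<^sup>m\<close>; the Hoelder gain \<open>2\<^sup>-\<^sup>m\<close> makes the
  sequence of derivatives converge geometrically.\<close>

lemma conv'_step_bound:
  assumes d: "norm d = 1"
  shows "norm (conv (\<lambda>x. kernel' (Suc m) a x d) h z - conv (\<lambda>x. kernel' m a x d) h z) \<le> 272 * M * (1/2)^m"
proof -
  have "norm (\<integral>w. (kernel' (Suc m) a (z - w) d - kernel' m a (z - w) d) *\<^sub>R (h w - h z) \<partial>lborel)
     \<le> 4 * (68 * 16^m * (M * (1/2)^m)) * ((1/4)^m)\<^sup>2"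
  proof (rule integral_localized_bound)
    fix w
    show z: "norm (w - z) > (1/4)^m \<Longrightarrow> (kernel' (Suc m) a (z - w) d - kernel' m a (z - w) d) *\<^sub>R (h w - h z) = 0"
      using kernel_diff_support[of m "z - w"] by (simp add: norm_minus_commute)
    show "norm ((kernel' (Suc m) a (z - w) d - kernel' m a (z - w) d) *\<^sub>R (h w - h z)) \<le> 68 * 16^m * (M * (1/2)^m)"
    proof (cases "norm (w - z) > (1/4)^m")
      case True then show ?thesis unfolding z[OF True] using M_nonneg by simp
    next
      case False
      have "\<bar>kernel' (Suc m) a (z - w) d - kernel' m a (z - w) d\<bar> \<le> 68 * 16^m"
        using kernel'_bound[OF d, of "Suc m" "z - w"] kernel'_bound[OF d, of m "z - w"] unfolding power_Suc by linarith
      moreover have "norm (h w - h z) \<le> M * (1/2)^m"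
      proof -
        have "sqrt (norm (w - z)) \<le> (1/2)^m"
          using False unfolding sqrt_quarter_power[symmetric] by (intro real_sqrt_le_mono) simp
        then show ?thesis using h_holder[of w z] mult_left_mono[OF _ M_nonneg] order_trans by blast
      qed
      ultimately show ?thesis by (simp only: norm_scaleR real_norm_def, intro mult_mono) auto
    qed
  qed auto
  also have "\<dots> = 272 * M * (1/2)^m"
  proof -
    have "(16::real)^m * ((1/4)^m)\<^sup>2 = 1"
      by (simp add: power2_eq_square power_divide flip: power_mult_distrib)
    then show ?thesis by (simp add: mult_ac)
  qed
  finally show ?thesis unfolding conv'_diff[of m d z "h z"] .
qed

text \<open>For distant points this is the preceding bound used twice. For points closer than
  \<open>4\<^sup>-\<^sup>m\<close> the Lipschitz constant \<open>64\<^sup>m\<close> of the kernel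
  derivative replaces one size bound.\<close>

lemma conv'_step_lip:
  assumes d: "norm d = 1"
  shows "norm ((conv (\<lambda>x. kernel' (Suc m) a x d) h z - conv (\<lambda>x. kernel' m a x d) h z)
     - (conv (\<lambda>x. kernel' (Suc m) a x d) h z' - conv (\<lambda>x. kernel' m a x d) h z'))
   \<le> 33280 * M * min ((1/2)^m) (2^m * norm (z - z'))"
proof -
  let ?D = "\<lambda>z w. kernel' (Suc m) a (z - w) d - kernel' m a (z - w) d"
  let ?L = "norm ((conv (\<lambda>x. kernel' (Suc m) a x d) h z - conv (\<lambda>x. kernel' m a x d) h z)
     - (conv (\<lambda>x. kernel' (Suc m) a x d) h z' - conv (\<lambda>x. kernel' m a x d) h z'))"
  have 1: "?L \<le> 33280 * M * (1/2)^m"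
  proof -
    have "?L \<le> 272 * M * (1/2)^m + 272 * M * (1/2)^m"
      by (rule order_trans[OF norm_triangle_ineq4 add_mono[OF conv'_step_bound[OF d] conv'_step_bound[OF d]]])
    also have "\<dots> = 544 * (M * (1/2)^m)" by simp
    also have "\<dots> \<le> 33280 * (M * (1/2)^m)" using M_nonneg by (intro mult_right_mono) auto
    finally show ?thesis by simp
  qed
  have 2: "?L \<le> 33280 * M * (2^m * norm (z - z'))" if near: "norm (z - z') \<le> (1/4)^m"
  proof -
    have int: "integrable lborel (\<lambda>w. ?D y w *\<^sub>R (h w - h z))" for y
    proof (rule integrable_compact_support[where z=y and r=1])
      show "continuous_on UNIV (\<lambda>w. ?D y w *\<^sub>R (h w - h z))"
        by (intro continuous_intros continuous_on_compose2[OF kernel'_continuous[OF a]] h_continuous) auto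
      fix w assume "norm (w - y) > 1"
      moreover have "(1/4::real)^m \<le> 1" by (simp add: power_le_one)
      ultimately have "norm (y - w) > (1/4)^m" unfolding norm_minus_commute[of y w] by linarith
      from kernel_diff_support(2)[OF this] show "?D y w *\<^sub>R (h w - h z) = 0" by simp
    qed
    have "?L = norm (\<integral>w. (?D z w - ?D z' w) *\<^sub>R (h w - h z) \<partial>lborel)"
      unfolding conv'_diff[of m d _ "h z"] scaleR_diff_left[of "?D z _" "?D z' _"]
      by (subst Bochner_Integration.integral_diff[OF int int]) simp
    also have "\<dots> \<le> 4 * (1040 * 64^m * norm (z - z') * (2 * M * (1/2)^m)) * (2 * (1/4)^m)\<^sup>2"
    proof (rule integral_localized_bound)
      fix w
      show zero: "norm (w - z) > 2 * (1/4)^m \<Longrightarrow> (?D z w - ?D z' w) *\<^sub>R (h w - h z) = 0"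
      proof -
        assume far: "norm (w - z) > 2 * (1/4)^m"
        have "norm (w - z) \<le> norm (z' - w) + norm (z - z')"
          using norm_triangle_ineq[of "z' - w" "z - z'"] by (simp add: norm_minus_commute)
        moreover have "(1/4::real)^m \<ge> 0" by simp
        ultimately have "norm (z - w) > (1/4)^m" "norm (z' - w) > (1/4)^m"
          using far near unfolding norm_minus_commute[of z w] by linarith+
        then show ?thesis using kernel_diff_support(2) by simp
      qed
      show "norm ((?D z w - ?D z' w) *\<^sub>R (h w - h z)) \<le> 1040 * 64^m * norm (z - z') * (2 * M * (1/2)^m)"
      proof (cases "norm (w - z) > 2 * (1/4)^m")
        case True then show ?thesis unfolding zero[OF True] using M_nonneg by simp
      next
        case False
        have "\<bar>kernel' k a (z - w) d - kernel' k a (z' - w) d\<bar> \<le> 16 * 64^k * norm (z - z')" for k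
          using kernel'_lip_unit[OF a d, of k "z - w" "z' - w"] by simp
        from this[of m] this[of "Suc m"]
        have "\<bar>?D z w - ?D z' w\<bar> \<le> 1040 * 64^m * norm (z - z')"
          unfolding power_Suc by linarith
        moreover have "norm (h w - h z) \<le> 2 * M * (1/2)^m"
        proof -
          have "sqrt (norm (w - z)) \<le> sqrt (4 * (1/4)^m)"
            using False zero_le_power[of "1/4::real" m] by (intro real_sqrt_le_mono) linarith
          also have "\<dots> = 2 * (1/2)^m" by (simp add: real_sqrt_mult sqrt_quarter_power)
          finally show ?thesis using h_holder[of w z] mult_left_mono[OF _ M_nonneg, of "sqrt (norm (w - z))" "2 * (1/2)^m"]
            by linarith
        qed
        ultimately show ?thesis by (simp only: norm_scaleR real_norm_def, intro mult_mono) auto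
      qed
    qed simp
    also have "\<dots> = 33280 * M * (2^m * norm (z - z'))"
    proof -
      have "(64::real)^m * (1/2)^m * ((1/4)^m)\<^sup>2 = 2^m"
        by (simp add: power2_eq_square power_divide divide_simps flip: power_mult_distrib)
      then show ?thesis by (simp add: power_mult_distrib mult_ac)
    qed
    finally show ?thesis .
  qed
  show ?thesis
  proof (cases "norm (z - z') \<le> (1/4)^m")
    case True
    then show ?thesis using 1 2 by (simp add: min_def)
  next
    case False
    have "(1/2::real)^m = 2^m * (1/4)^m" by (simp add: power_divide divide_simps flip: power_mult_distrib)
    also have "\<dots> \<le> 2^m * norm (z - z')" using False by (intro mult_left_mono) auto
    finally show ?thesis using 1 by (simp add: min_def)
  qed
qed

end

section \<open>The limit of the regularised potentials\<close>

text \<open>The densities for which the Cauchy-Green potential is formed. The radius \<open>2\<close> leaves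
  room for a cut-off function that equals \<open>1\<close> on the closed unit disc.\<close>

definition admissible :: "real \<Rightarrow> (complex \<Rightarrow> 'e::euclidean_space) \<Rightarrow> bool" where
  "admissible M h \<longleftrightarrow> holder UNIV M h \<and> (\<forall>z. norm z > 2 \<longrightarrow> h z = 0)"

lemma admissibleD:
  assumes "admissible M h"
  shows "holder UNIV M h" "norm z > 2 \<Longrightarrow> h z = 0" "continuous_on UNIV h" "M \<ge> 0"
    "norm (h z) \<le> M" "norm (h z - h w) \<le> M * sqrt (norm (z - w))"
proof -
  show *: "holder UNIV M h" "norm z > 2 \<Longrightarrow> h z = 0" for z using assms by (auto simp: admissible_def)
  show "continuous_on UNIV h" by (rule h_continuous[OF norm_one *])
  show "M \<ge> 0" by (rule M_nonneg[OF norm_one *])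
  show "norm (h z) \<le> M" by (rule h_bound[OF norm_one *])
  show "norm (h z - h w) \<le> M * sqrt (norm (z - w))" by (rule h_holder[OF norm_one *])
qed

text \<open>The potential of the density with respect to the unregularised kernel.\<close>

definition potential :: "complex \<Rightarrow> (complex \<Rightarrow> 'e::euclidean_space) \<Rightarrow> complex \<Rightarrow> 'e" where
  "potential a h z = lim (\<lambda>m. conv (kernel m a) h z)"

definition potential' :: "complex \<Rightarrow> (complex \<Rightarrow> 'e::euclidean_space) \<Rightarrow> complex \<Rightarrow> complex \<Rightarrow> 'e" where
  "potential' a h z d = lim (\<lambda>m. conv (\<lambda>x. kernel' m a x d) h z)"

lemma linear_complex_expand:
  assumes "linear (f :: complex \<Rightarrow> 'b::real_vector)"
  shows "f d = Re d *\<^sub>R f 1 + Im d *\<^sub>R f \<i>"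
proof -
  have "d = Re d *\<^sub>R 1 + Im d *\<^sub>R \<i>" by (simp add: complex_eq_iff)
  then have "f d = f (Re d *\<^sub>R 1 + Im d *\<^sub>R \<i>)" by simp
  also have "\<dots> = Re d *\<^sub>R f 1 + Im d *\<^sub>R f \<i>"
    by (simp only: linear_add[OF assms] linear_scale[OF assms])
  finally show ?thesis .
qed

context
  fixes a :: complex and M :: real and h :: "complex \<Rightarrow> 'e::euclidean_space"
  assumes a: "norm a = 1" and adm: "admissible M h"
begin

lemma conv_kernel_deriv: "(conv (kernel m a) h has_derivative (\<lambda>d. conv (\<lambda>x. kernel' m a x d) h z)) (at z)"
  by (rule conv_kernel_has_derivative[OF a admissibleD(3)[OF adm] admissibleD(2)[OF adm]])

lemma conv'_expand: "conv (\<lambda>x. kernel' m a x d) h z =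
    Re d *\<^sub>R conv (\<lambda>x. kernel' m a x 1) h z + Im d *\<^sub>R conv (\<lambda>x. kernel' m a x \<i>) h z"
  by (rule linear_complex_expand) (use conv_kernel_deriv has_derivative_linear in blast)

lemma potential_tendsto: "(\<lambda>m. conv (kernel m a) h z) \<longlonglongrightarrow> potential a h z"
  and potential_bound: "norm (potential a h z) \<le> 112 * M"
proof -
  have "\<exists>l. (\<lambda>m. conv (kernel m a) h z) \<longlonglongrightarrow> l \<and>
      (\<forall>m. norm (conv (kernel m a) h z - l) \<le> 2 * (40 * M) * (1/2)^m)"
  proof (rule geometric_limit)
    fix m
    have "norm (conv (kernel (Suc m) a) h z - conv (kernel m a) h z) \<le> 40 * M * (1/4)^m"
      by (rule conv_step_bound[OF a admissibleD(1)[OF adm] admissibleD(2)[OF adm]])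
    also have "\<dots> \<le> 40 * M * (1/2)^m"
      using admissibleD(4)[OF adm] by (intro mult_left_mono power_mono) auto
    finally show "norm (conv (kernel (Suc m) a) h z - conv (kernel m a) h z) \<le> 40 * M * (1/2)^m" .
  qed
  then obtain l where l: "(\<lambda>m. conv (kernel m a) h z) \<longlonglongrightarrow> l"
    "norm (conv (kernel 0 a) h z - l) \<le> 2 * (40 * M) * (1/2)^0" by blast
  then show lim: "(\<lambda>m. conv (kernel m a) h z) \<longlonglongrightarrow> potential a h z"
    unfolding potential_def by (simp add: limI)
  have "norm (conv (kernel 0 a) h z) \<le> 4 * (2 * M) * 2\<^sup>2"
    unfolding conv_def
  proof (rule integral_localized_bound[where z=0])
    fix w
    show "norm (kernel 0 a (z - w) *\<^sub>R h w) \<le> 2 * M"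
      using unit_kernel_bound[OF a, of "z - w"] admissibleD(5)[OF adm, of w]
      by (simp only: norm_scaleR real_norm_def, intro mult_mono) (auto simp: kernel_def)
    show "norm (w - 0) > 2 \<Longrightarrow> kernel 0 a (z - w) *\<^sub>R h w = 0"
      using admissibleD(2)[OF adm] by simp
  qed simp
  moreover have "norm (potential a h z) \<le> norm (conv (kernel 0 a) h z) + norm (conv (kernel 0 a) h z - potential a h z)"
    using norm_triangle_ineq4[of "conv (kernel 0 a) h z" "conv (kernel 0 a) h z - potential a h z"] by simp
  moreover have "l = potential a h z" using l(1) lim LIMSEQ_unique by blast
  ultimately show "norm (potential a h z) \<le> 112 * M" using l(2) by simp
qed

lemma potential'_tendsto_unit:
  assumes d: "norm d = 1"
  shows "(\<lambda>m. conv (\<lambda>x. kernel' m a x d) h z) \<longlonglongrightarrow> potential' a h z d"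
    and "norm (conv (\<lambda>x. kernel' m a x d) h z - potential' a h z d) \<le> 544 * M * (1/2)^m"
proof -
  have "\<exists>l. (\<lambda>m. conv (\<lambda>x. kernel' m a x d) h z) \<longlonglongrightarrow> l \<and>
      (\<forall>m. norm (conv (\<lambda>x. kernel' m a x d) h z - l) \<le> 2 * (272 * M) * (1/2)^m)"
    by (rule geometric_limit, rule conv'_step_bound[OF a admissibleD(1)[OF adm] admissibleD(2)[OF adm] d])
  then obtain l where l: "(\<lambda>m. conv (\<lambda>x. kernel' m a x d) h z) \<longlonglongrightarrow> l"
      "\<And>m. norm (conv (\<lambda>x. kernel' m a x d) h z - l) \<le> 2 * (272 * M) * (1/2)^m" by blast
  have "l = potential' a h z d" unfolding potential'_def using l(1) by (simp add: limI)
  then show "(\<lambda>m. conv (\<lambda>x. kernel' m a x d) h z) \<longlonglongrightarrow> potential' a h z d"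
    "norm (conv (\<lambda>x. kernel' m a x d) h z - potential' a h z d) \<le> 544 * M * (1/2)^m"
    using l(1) l(2)[of m] by auto
qed

lemma potential'_tendsto: "(\<lambda>m. conv (\<lambda>x. kernel' m a x d) h z) \<longlonglongrightarrow> potential' a h z d"
  and potential'_expand: "potential' a h z d = Re d *\<^sub>R potential' a h z 1 + Im d *\<^sub>R potential' a h z \<i>"
proof -
  have "(\<lambda>m. Re d *\<^sub>R conv (\<lambda>x. kernel' m a x 1) h z + Im d *\<^sub>R conv (\<lambda>x. kernel' m a x \<i>) h z)
    \<longlonglongrightarrow> Re d *\<^sub>R potential' a h z 1 + Im d *\<^sub>R potential' a h z \<i>"
    by (intro tendsto_intros potential'_tendsto_unit) auto
  then have l: "(\<lambda>m. conv (\<lambda>x. kernel' m a x d) h z) \<longlonglongrightarrow> Re d *\<^sub>R potential' a h z 1 + Im d *\<^sub>R potential' a h z \<i>"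
    by (subst conv'_expand)
  then show "potential' a h z d = Re d *\<^sub>R potential' a h z 1 + Im d *\<^sub>R potential' a h z \<i>"
    unfolding potential'_def[of a h z d] by (rule limI)
  with l show "(\<lambda>m. conv (\<lambda>x. kernel' m a x d) h z) \<longlonglongrightarrow> potential' a h z d" by simp
qed

text \<open>The derivatives of the regularised potentials converge uniformly, so the derivative of the limit is
  the limit of the derivatives. No singular integral has to be written down.\<close>

lemma potential_has_derivative: "(potential a h has_derivative potential' a h z) (at z)"
proof -
  have "\<exists>g. \<forall>x\<in>UNIV. (\<lambda>n. conv (kernel n a) h x) \<longlonglongrightarrow> g x \<and> (g has_derivative potential' a h x) (at x within UNIV)"
  proof (rule has_derivative_sequence[where f'="\<lambda>m z d. conv (\<lambda>x. kernel' m a x d) h z" and ?x0.0=0])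
    show "(\<lambda>n. conv (kernel n a) h 0) \<longlonglongrightarrow> potential a h 0" by (rule potential_tendsto)
    fix e :: real assume e: "e > 0"
    have "(\<lambda>m. 2 * (544 * M) * (1/2)^m) \<longlonglongrightarrow> 2 * (544 * M) * 0"
      by (intro tendsto_intros LIMSEQ_power_zero) simp
    then have "\<forall>\<^sub>F m in sequentially. 2 * (544 * M) * (1/2)^m < e"
      using e by (intro order_tendstoD(2)[of _ 0]) auto
    then show "\<forall>\<^sub>F m in sequentially. \<forall>x\<in>UNIV. \<forall>d. norm (conv (\<lambda>x. kernel' m a x d) h x - potential' a h x d) \<le> e * norm d"
    proof eventually_elim
      case (elim m)
      have "norm (conv (\<lambda>x. kernel' m a x d) h x - potential' a h x d) \<le> e * norm d" for x d
      proof -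
        let ?E = "\<lambda>d. conv (\<lambda>x. kernel' m a x d) h x - potential' a h x d"
        have "?E d = Re d *\<^sub>R ?E 1 + Im d *\<^sub>R ?E \<i>"
          by (subst conv'_expand, subst potential'_expand) (simp add: algebra_simps)
        then have "norm (?E d) \<le> \<bar>Re d\<bar> * norm (?E 1) + \<bar>Im d\<bar> * norm (?E \<i>)"
          by (metis norm_triangle_ineq norm_scaleR)
        also have "\<dots> \<le> norm d * (544 * M * (1/2)^m) + norm d * (544 * M * (1/2)^m)"
          by (intro add_mono mult_mono potential'_tendsto_unit abs_Re_le_cmod abs_Im_le_cmod) auto
        also have "\<dots> = norm d * (2 * (544 * M) * (1/2)^m)" by simp
        also have "\<dots> \<le> norm d * e" using elim by (intro mult_left_mono) auto
        finally show ?thesis by (simp add: mult.commute)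
      qed
      then show ?case by blast
    qed
  qed (auto intro: conv_kernel_deriv)
  then obtain g where g: "\<And>x. (\<lambda>n. conv (kernel n a) h x) \<longlonglongrightarrow> g x" "\<And>x. (g has_derivative potential' a h x) (at x)"
    by auto
  have "g = potential a h" using g(1) potential_tendsto LIMSEQ_unique by blast
  then show ?thesis using g(2) by simp
qed

lemma potential'_base:
  assumes d: "norm d = 1"
  shows "norm (conv (\<lambda>x. kernel' 0 a x d) h z) \<le> 64 * M"
    and "norm (conv (\<lambda>x. kernel' 0 a x d) h z - conv (\<lambda>x. kernel' 0 a x d) h z') \<le> 256 * M * norm (z - z')"
proof -
  have supp: "norm (w - 0) > 2 \<Longrightarrow> h w = 0" for w using admissibleD(2)[OF adm] by simp
  have "norm (conv (\<lambda>x. kernel' 0 a x d) h z) \<le> 4 * (4 * M) * 2\<^sup>2"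
    unfolding conv_def
  proof (rule integral_localized_bound[where z=0])
    fix w
    show "norm (kernel' 0 a (z - w) d *\<^sub>R h w) \<le> 4 * M"
      using unit_kernel'_bound_unit[OF a d, of "z - w"] admissibleD(5)[OF adm, of w]
      by (simp only: norm_scaleR real_norm_def, intro mult_mono) (auto simp: kernel'_def)
  qed (use supp in auto)
  then show "norm (conv (\<lambda>x. kernel' 0 a x d) h z) \<le> 64 * M" by simp
  have int: "integrable lborel (\<lambda>w. kernel' 0 a (y - w) d *\<^sub>R h w)" for y
    by (rule integrable_conv[OF kernel'_continuous[OF a] admissibleD(3)[OF adm] admissibleD(2)[OF adm]])
  have "conv (\<lambda>x. kernel' 0 a x d) h z - conv (\<lambda>x. kernel' 0 a x d) h z' =
      (\<integral>w. (kernel' 0 a (z - w) d - kernel' 0 a (z' - w) d) *\<^sub>R h w \<partial>lborel)"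
    unfolding conv_def scaleR_diff_left by (rule Bochner_Integration.integral_diff[OF int int, symmetric])
  also have "norm \<dots> \<le> 4 * (16 * norm (z - z') * M) * 2\<^sup>2"
  proof (rule integral_localized_bound[where z=0])
    fix w
    show "norm ((kernel' 0 a (z - w) d - kernel' 0 a (z' - w) d) *\<^sub>R h w) \<le> 16 * norm (z - z') * M"
      using kernel'_lip_unit[OF a d, of 0 "z - w" "z' - w"] admissibleD(5)[OF adm, of w]
      by (simp only: norm_scaleR real_norm_def, intro mult_mono) auto
  qed (use supp in auto)
  finally show "norm (conv (\<lambda>x. kernel' 0 a x d) h z - conv (\<lambda>x. kernel' 0 a x d) h z') \<le> 256 * M * norm (z - z')"
    by (simp add: mult_ac)
qed

text \<open>The increment between two points is telescoped over the dyadic scales. At scale \<open>j\<close> it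
  is at most a constant times \<open>min (2\<^sup>-\<^sup>j) (2\<^sup>j d)\<close>, and these bounds
  add up to \<open>O (sqrt d)\<close>.\<close>

lemma potential'_holder:
  assumes d: "norm d = 1"
  shows "holder UNIV (140000 * M) (\<lambda>z. potential' a h z d)"
  unfolding holder_def
proof (intro conjI ballI)
  note M0 = admissibleD(4)[OF adm]
  let ?G = "\<lambda>m z. conv (\<lambda>x. kernel' m a x d) h z"
  fix z z' :: complex
  have "norm (potential' a h z d) \<le> norm (?G 0 z) + norm (?G 0 z - potential' a h z d)"
    using norm_triangle_ineq4[of "?G 0 z" "?G 0 z - potential' a h z d"] by simp
  also have "\<dots> \<le> 64 * M + 544 * M * (1/2)^0"
    by (intro add_mono potential'_base potential'_tendsto_unit d)
  finally show bd: "norm (potential' a h z d) \<le> 140000 * M" using M0 by simp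
  have tele: "norm (?G m z - ?G m z') \<le> norm (?G 0 z - ?G 0 z') +
      (\<Sum>j<m. 33280 * M * min ((1/2)^j) (2^j * norm (z - z')))" for m
  proof (induction m)
    case (Suc m)
    have "norm (?G (Suc m) z - ?G (Suc m) z') \<le> norm ((?G (Suc m) z - ?G m z) - (?G (Suc m) z' - ?G m z')) + norm (?G m z - ?G m z')"
      using norm_triangle_ineq[of "(?G (Suc m) z - ?G m z) - (?G (Suc m) z' - ?G m z')" "?G m z - ?G m z'"]
      by (simp add: algebra_simps)
    then show ?case
      using Suc.IH conv'_step_lip[OF a admissibleD(1)[OF adm] admissibleD(2)[OF adm] d, of m z z'] by simp
  qed simp
  have base: "norm (?G 0 z - ?G 0 z') \<le> 256 * M * sqrt (norm (z - z'))"
  proof (cases "norm (z - z') \<le> 1")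
    case True
    then have "sqrt (norm (z - z')) * sqrt (norm (z - z')) \<le> sqrt (norm (z - z')) * 1"
      by (intro mult_left_mono) auto
    then have "norm (z - z') \<le> sqrt (norm (z - z'))" by simp
    then show ?thesis using potential'_base(2)[OF d, of z z'] M0 mult_left_mono[of _ _ "256 * M"]
      by (meson order_trans mult_nonneg_nonneg zero_le_numeral)
  next
    case False
    then have "sqrt (norm (z - z')) \<ge> 1" by simp
    then have "128 * M * 1 \<le> 256 * M * sqrt (norm (z - z'))" using M0 by (intro mult_mono) auto
    then show ?thesis
      using norm_triangle_ineq4[of "?G 0 z" "?G 0 z'"] potential'_base(1)[OF d, of z] potential'_base(1)[OF d, of z'] by linarith
  qed
  have "norm (?G m z - ?G m z') \<le> 140000 * M * sqrt (norm (z - z'))" for m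
  proof -
    have "norm (?G m z - ?G m z') \<le> 256 * M * sqrt (norm (z - z')) + 33280 * M * (4 * sqrt (norm (z - z')))"
      using tele[of m] base sum_min_dyadic[of "norm (z - z')" m] M0
        mult_left_mono[OF sum_min_dyadic[of "norm (z - z')" m], of "33280 * M"]
      unfolding sum_distrib_left[symmetric] by simp
    also have "\<dots> = 133376 * (M * sqrt (norm (z - z')))" by simp
    also have "\<dots> \<le> 140000 * (M * sqrt (norm (z - z')))" using M0 by (intro mult_right_mono) auto
    finally show ?thesis by simp
  qed
  moreover have "(\<lambda>m. norm (?G m z - ?G m z')) \<longlonglongrightarrow> norm (potential' a h z d - potential' a h z' d)"
    by (intro tendsto_intros potential'_tendsto)
  ultimately show "norm (potential' a h z d - potential' a h z' d) \<le> 140000 * M * sqrt (norm (z - z'))"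
    by (intro LIMSEQ_le_const2) auto
qed

end

section \<open>The Cauchy-Green operator of a linear complex structure\<close>

text \<open>The Cauchy-Riemann operator applied to the \<open>m\<close>-th regularisation of
  \<open>1 / z\<close>: an approximate identity of constant mass.\<close>

definition bump :: "nat \<Rightarrow> complex \<Rightarrow> real" where
  "bump m z = kernel' m 1 z 1 - kernel' m (- \<i>) z \<i>"

definition bump_mass :: real where
  "bump_mass = (\<integral>w. bump 0 w \<partial>lborel)"

lemma bump_eq: "bump m z = 16^m * (4 * max 0 (1 - (norm (4^m * z))\<^sup>2))"
  unfolding bump_def kernel'_def right_diff_distrib[symmetric] unit_kernel_dbar ..

lemma kernel'_dbar_zero: "kernel' m (- \<i>) z 1 + kernel' m 1 z \<i> = 0"
  unfolding kernel'_def distrib_left[symmetric] unit_kernel_dbar by simp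

lemma bump_bounds: "0 \<le> bump m z" "bump m z \<le> 4 * 16^m"
proof -
  have "max 0 (1 - (norm (4^m * z))\<^sup>2) \<le> 1" "max 0 (1 - (norm (4^m * z))\<^sup>2) \<ge> 0" by auto
  then show "0 \<le> bump m z" "bump m z \<le> 4 * 16^m" unfolding bump_eq by simp_all
qed

lemma bump_support: "norm z > (1/4)^m \<Longrightarrow> bump m z = 0"
proof -
  assume "norm z > (1/4)^m"
  then have "norm (4^m * z) \<ge> 1" by (simp add: norm_mult norm_power field_simps)
  then have "(norm (4^m * z))\<^sup>2 \<ge> 1" by simp
  then show ?thesis unfolding bump_eq by simp
qed

lemma bump_continuous: "continuous_on UNIV (bump m)"
  unfolding bump_def by (intro continuous_intros kernel'_continuous) auto

lemma bump_integrable: "integrable lborel (\<lambda>w. bump m (z - w))"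
proof (rule integrable_compact_support[where z=z and r="(1/4)^m"])
  show "continuous_on UNIV (\<lambda>w. bump m (z - w))"
    by (intro continuous_intros continuous_on_compose2[OF bump_continuous]) auto
  show "norm (w - z) > (1/4)^m \<Longrightarrow> bump m (z - w) = 0" for w
    using bump_support[where z="z - w" and m=m] by (simp add: norm_minus_commute)
qed

lemma bump_integral: "(\<integral>w. bump m (z - w) \<partial>lborel) = bump_mass"
proof (induction m)
  case 0
  show ?case unfolding bump_mass_def by (rule integral_lborel_reflect)
next
  case (Suc m)
  have int: "integrable lborel (\<lambda>w. kernel' (Suc m) a (z - w) d - kernel' m a (z - w) d)" if a: "norm a = 1" for a d
  proof (rule integrable_compact_support[where z=z and r="(1/4)^m"])
    show "continuous_on UNIV (\<lambda>w. kernel' (Suc m) a (z - w) d - kernel' m a (z - w) d)"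
      by (intro continuous_intros continuous_on_compose2[OF kernel'_continuous[OF a]]) auto
    show "norm (w - z) > (1/4)^m \<Longrightarrow> kernel' (Suc m) a (z - w) d - kernel' m a (z - w) d = 0" for w
      using kernel_diff_support(2)[of m "z - w"] by (simp add: norm_minus_commute)
  qed
  have "(\<integral>w. bump (Suc m) (z - w) \<partial>lborel) - (\<integral>w. bump m (z - w) \<partial>lborel) =
     (\<integral>w. (kernel' (Suc m) 1 (z - w) 1 - kernel' m 1 (z - w) 1) -
          (kernel' (Suc m) (- \<i>) (z - w) \<i> - kernel' m (- \<i>) (z - w) \<i>) \<partial>lborel)"
    by (subst Bochner_Integration.integral_diff[OF bump_integrable bump_integrable, symmetric])
       (simp add: bump_def algebra_simps)
  also have "\<dots> = 0"
    by (subst Bochner_Integration.integral_diff[OF int int]) (simp_all add: kernel'_mean_zero)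
  finally show ?case using Suc.IH by simp
qed

text \<open>The mass is in fact \<open>2 \<pi>\<close>; positivity suffices for the normalisation.\<close>

lemma bump_mass_pos: "bump_mass > 0"
proof -
  let ?Q = "cbox (Complex 0 0) (Complex (1/2) (1/2))"
  have m: "measure lborel ?Q = 1/4"
    by (subst measure_lborel_cbox_eq) (auto simp: Basis_complex_def inner_complex_def)
  have "1/2 = (\<integral>w. 2 * (indicator ?Q w :: real) \<partial>lborel)" using m by simp
  also have "\<dots> \<le> (\<integral>w. bump 0 w \<partial>lborel)"
  proof (rule integral_mono)
    show "integrable lborel (\<lambda>w. 2 * indicator ?Q w :: real)"
      by (intro integrable_mult_right) (simp add: emeasure_lborel_cbox_eq)
    show "integrable lborel (bump 0)"
    proof (rule integrable_compact_support[where z=0 and r=1])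
      show "norm (w - 0) > 1 \<Longrightarrow> bump 0 w = 0" for w using bump_support[where m=0 and z=w] by simp
    qed (rule bump_continuous)
    fix w
    show "2 * indicator ?Q w \<le> bump 0 w"
    proof (cases "w \<in> ?Q")
      case True
      then have "\<bar>Re w\<bar> \<le> 1/2" "\<bar>Im w\<bar> \<le> 1/2" by (auto simp: in_cbox_complex_iff)
      then have "(Re w)\<^sup>2 \<le> (1/2)\<^sup>2" "(Im w)\<^sup>2 \<le> (1/2)\<^sup>2"
        using power_mono[of "\<bar>Re w\<bar>" "1/2" 2] power_mono[of "\<bar>Im w\<bar>" "1/2" 2] by simp_all
      then have "(norm w)\<^sup>2 \<le> 1/2" unfolding cmod_power2 by (simp add: power_divide)
      then show ?thesis using True by (simp add: bump_eq)
    next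
      case False then show ?thesis using bump_bounds(1)[of 0 w] by simp
    qed
  qed
  finally show ?thesis unfolding bump_mass_def by linarith
qed

lemma conv_bump_tendsto:
  fixes h :: "complex \<Rightarrow> 'e::euclidean_space"
  assumes adm: "admissible M h"
  shows "(\<lambda>m. conv (bump m) h z) \<longlonglongrightarrow> bump_mass *\<^sub>R h z"
proof -
  have "norm (conv (bump m) h z - bump_mass *\<^sub>R h z) \<le> 16 * M * (1/2)^m" for m
  proof -
    have "conv (bump m) h z - bump_mass *\<^sub>R h z = (\<integral>w. bump m (z - w) *\<^sub>R (h w - h z) \<partial>lborel)"
    proof -
      have "bump_mass *\<^sub>R h z = (\<integral>w. bump m (z - w) *\<^sub>R h z \<partial>lborel)"
        by (subst integral_scaleR_left) (auto simp: bump_integral intro: bump_integrable)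
      then show ?thesis
        unfolding conv_def scaleR_diff_right
        by (subst Bochner_Integration.integral_diff)
           (auto intro!: integrable_conv[OF bump_continuous admissibleD(3)[OF adm]] admissibleD(2)[OF adm]
             integrable_scaleR_left bump_integrable)
    qed
    also have "norm \<dots> \<le> 4 * (4 * 16^m * (M * (1/2)^m)) * ((1/4)^m)\<^sup>2"
    proof (rule integral_localized_bound)
      fix w
      show zero: "norm (w - z) > (1/4)^m \<Longrightarrow> bump m (z - w) *\<^sub>R (h w - h z) = 0"
        using bump_support[where z="z - w" and m=m] by (simp add: norm_minus_commute)
      show "norm (bump m (z - w) *\<^sub>R (h w - h z)) \<le> 4 * 16^m * (M * (1/2)^m)"
      proof (cases "norm (w - z) > (1/4)^m")
        case True then show ?thesis unfolding zero[OF True] using admissibleD(4)[OF adm] by simp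
      next
        case False
        then have "sqrt (norm (w - z)) \<le> (1/2)^m"
          unfolding sqrt_quarter_power[symmetric] by (intro real_sqrt_le_mono) simp
        then have "norm (h w - h z) \<le> M * (1/2)^m"
          using admissibleD(6)[OF adm, of w z] mult_left_mono[OF _ admissibleD(4)[OF adm]] order_trans by blast
        then show ?thesis using bump_bounds[of m "z - w"]
          by (simp only: norm_scaleR real_norm_def, intro mult_mono) auto
      qed
    qed simp
    also have "\<dots> = 16 * M * (1/2)^m"
    proof -
      have "(16::real)^m * ((1/4)^m)\<^sup>2 = 1"
        by (simp add: power2_eq_square power_divide flip: power_mult_distrib)
      then show ?thesis by (simp add: mult_ac)
    qed
    finally show ?thesis .
  qed
  note bd = this
  have "(\<lambda>m. 16 * M * (1/2)^m) \<longlonglongrightarrow> 16 * M * 0"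
    by (intro tendsto_mult_left LIMSEQ_power_zero) simp
  then have lim: "(\<lambda>m. 16 * M * (1/2)^m) \<longlonglongrightarrow> 0" by simp
  have "(\<lambda>m. conv (bump m) h z - bump_mass *\<^sub>R h z) \<longlonglongrightarrow> 0"
    by (rule Lim_null_comparison[OF always_eventually lim], rule allI, rule bd)
  then show ?thesis by (simp add: LIM_zero_cancel)
qed

locale complex_structure =
  fixes J0 :: "'e::euclidean_space \<Rightarrow> 'e"
  assumes linJ: "linear J0" and J_J: "J0 (J0 x) = - x"
begin

lemma J_bounded_linear: "bounded_linear J0"
  using linJ by (simp add: linear_conv_bounded_linear)

text \<open>The Cauchy-Green potential of a vector-valued density, with multiplication by \<open>\<i>\<close> on
  the target given by \<open>J0\<close>.\<close>

definition cauchy_green :: "(complex \<Rightarrow> 'e) \<Rightarrow> complex \<Rightarrow> 'e" where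
  "cauchy_green h z = (1 / bump_mass) *\<^sub>R (potential 1 h z + J0 (potential (- \<i>) h z))"

definition cauchy_green' :: "(complex \<Rightarrow> 'e) \<Rightarrow> complex \<Rightarrow> complex \<Rightarrow> 'e" where
  "cauchy_green' h z d = (1 / bump_mass) *\<^sub>R (potential' 1 h z d + J0 (potential' (- \<i>) h z d))"

lemma cauchy_green_has_derivative:
  assumes "admissible M h" shows "(cauchy_green h has_derivative cauchy_green' h z) (at z)"
  unfolding cauchy_green_def[abs_def] cauchy_green'_def[abs_def]
  by (rule has_derivative_scaleR_right has_derivative_add
      bounded_linear.has_derivative[OF J_bounded_linear] potential_has_derivative[OF _ assms] | simp)+

text \<open>In the regularised potentials the Cauchy-Riemann operator falls on the kernel and produces
  \<open>bump m\<close>; in the limit the density comes back.\<close>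

lemma cauchy_green_dbar:
  assumes adm: "admissible M h"
  shows "cauchy_green' h z 1 + J0 (cauchy_green' h z \<i>) = h z"
proof -
  let ?c = "\<lambda>a d. potential' a h z d"
  have i: "norm (- \<i>) = 1" "norm (1::complex) = 1" by simp_all
  have int: "integrable lborel (\<lambda>w. kernel' m a (z - w) d *\<^sub>R h w)" if "norm a = 1" for m a d
    by (rule integrable_conv[OF kernel'_continuous[OF that] admissibleD(3)[OF adm] admissibleD(2)[OF adm]])
  have "(\<lambda>m. conv (\<lambda>x. kernel' m 1 x 1) h z - conv (\<lambda>x. kernel' m (- \<i>) x \<i>) h z) \<longlonglongrightarrow> ?c 1 1 - ?c (- \<i>) \<i>"
    by (intro tendsto_intros potential'_tendsto[OF _ adm]) auto
  moreover have "conv (\<lambda>x. kernel' m 1 x 1) h z - conv (\<lambda>x. kernel' m (- \<i>) x \<i>) h z = conv (bump m) h z" for m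
    unfolding conv_def bump_def scaleR_diff_left
    by (rule Bochner_Integration.integral_diff[OF int int, symmetric]) auto
  ultimately have 1: "?c 1 1 - ?c (- \<i>) \<i> = bump_mass *\<^sub>R h z"
    using conv_bump_tendsto[OF adm, of z] LIMSEQ_unique by auto
  have "(\<lambda>m. conv (\<lambda>x. kernel' m (- \<i>) x 1) h z + conv (\<lambda>x. kernel' m 1 x \<i>) h z) \<longlonglongrightarrow> ?c (- \<i>) 1 + ?c 1 \<i>"
    by (intro tendsto_intros potential'_tendsto[OF _ adm]) auto
  moreover have "conv (\<lambda>x. kernel' m (- \<i>) x 1) h z + conv (\<lambda>x. kernel' m 1 x \<i>) h z = 0" for m
  proof -
    have "conv (\<lambda>x. kernel' m (- \<i>) x 1) h z + conv (\<lambda>x. kernel' m 1 x \<i>) h z =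
      (\<integral>w. (kernel' m (- \<i>) (z - w) 1 + kernel' m 1 (z - w) \<i>) *\<^sub>R h w \<partial>lborel)"
      unfolding conv_def scaleR_add_left
      by (rule Bochner_Integration.integral_add[OF int int, symmetric]) auto
    then show ?thesis by (simp add: kernel'_dbar_zero)
  qed
  ultimately have "(\<lambda>m::nat. 0) \<longlonglongrightarrow> ?c (- \<i>) 1 + ?c 1 \<i>" by simp
  then have 2: "?c (- \<i>) 1 + ?c 1 \<i> = 0"
    using LIMSEQ_unique tendsto_const by metis
  have "cauchy_green' h z 1 + J0 (cauchy_green' h z \<i>) =
     (1 / bump_mass) *\<^sub>R ((?c 1 1 + J0 (?c (- \<i>) 1)) + J0 (?c 1 \<i> + J0 (?c (- \<i>) \<i>)))"
    unfolding cauchy_green'_def linear_scale[OF linJ] scaleR_add_right[symmetric] ..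
  also have "(?c 1 1 + J0 (?c (- \<i>) 1)) + J0 (?c 1 \<i> + J0 (?c (- \<i>) \<i>)) =
     (?c 1 1 - ?c (- \<i>) \<i>) + J0 (?c (- \<i>) 1 + ?c 1 \<i>)"
    by (simp add: linear_add[OF linJ] J_J algebra_simps)
  also have "\<dots> = bump_mass *\<^sub>R h z" unfolding 1 2 using linear_0[OF linJ] by simp
  finally show ?thesis using bump_mass_pos by simp
qed

lemma cauchy_green_diff:
  assumes "admissible M1 h1" "admissible M2 h2" "admissible M3 (\<lambda>z. h1 z - h2 z)"
  shows "cauchy_green (\<lambda>z. h1 z - h2 z) z = cauchy_green h1 z - cauchy_green h2 z"
    and "cauchy_green' (\<lambda>z. h1 z - h2 z) z d = cauchy_green' h1 z d - cauchy_green' h2 z d"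
proof -
  have c: "conv k (\<lambda>z. h1 z - h2 z) z = conv k h1 z - conv k h2 z" if "continuous_on UNIV k" for k
    unfolding conv_def scaleR_diff_right
    by (intro Bochner_Integration.integral_diff
        integrable_conv[OF that admissibleD(3)[OF assms(1)] admissibleD(2)[OF assms(1)]]
        integrable_conv[OF that admissibleD(3)[OF assms(2)] admissibleD(2)[OF assms(2)]])
  have 1: "potential a (\<lambda>z. h1 z - h2 z) z = potential a h1 z - potential a h2 z" if a: "norm a = 1" for a
    by (rule LIMSEQ_unique[OF potential_tendsto[OF a assms(3)]])
       (unfold c[OF kernel_continuous], intro tendsto_intros potential_tendsto[OF a assms(1)] potential_tendsto[OF a assms(2)])
  have 2: "potential' a (\<lambda>z. h1 z - h2 z) z d = potential' a h1 z d - potential' a h2 z d" if a: "norm a = 1" for a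
    by (rule LIMSEQ_unique[OF potential'_tendsto[OF a assms(3)]])
       (unfold c[OF kernel'_continuous[OF a]], intro tendsto_intros potential'_tendsto[OF a assms(1)] potential'_tendsto[OF a assms(2)])
  show "cauchy_green (\<lambda>z. h1 z - h2 z) z = cauchy_green h1 z - cauchy_green h2 z"
    and "cauchy_green' (\<lambda>z. h1 z - h2 z) z d = cauchy_green' h1 z d - cauchy_green' h2 z d"
    unfolding cauchy_green_def cauchy_green'_def by (simp_all add: 1 2 linear_diff[OF linJ] algebra_simps)
qed

text \<open>The kernel is conjugation symmetric, so a density that is symmetric under an antilinear involution
  has a potential with the same symmetry. This is how half-discs get their boundary values.\<close>

lemma cauchy_green_reflect:
  assumes adm: "admissible M h" and sig: "linear \<sigma>" "\<And>x. \<sigma> (J0 x) = - J0 (\<sigma> x)"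
    and sym: "\<And>z. h (cnj z) = \<sigma> (h z)"
  shows "cauchy_green h (cnj z) = \<sigma> (cauchy_green h z)"
proof -
  have bs: "bounded_linear \<sigma>" using sig(1) linear_conv_bounded_linear by blast
  have meas: "(\<lambda>w. kernel m a (cnj z - w) *\<^sub>R h w) \<in> borel_measurable borel" for m a
    by (intro borel_measurable_continuous_onI continuous_intros admissibleD(3)[OF adm]
        continuous_on_compose2[OF kernel_continuous]) auto
  have int: "integrable lborel (\<lambda>w. kernel m a (z - w) *\<^sub>R h w)" for m a
    by (rule integrable_conv[OF kernel_continuous admissibleD(3)[OF adm] admissibleD(2)[OF adm]])
  have key: "conv (kernel m a) h (cnj z) = e *\<^sub>R \<sigma> (conv (kernel m a) h z)"
    if e: "\<And>w. kernel m a (cnj w) = e * kernel m a w" for m a and e :: real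
  proof -
    have "conv (kernel m a) h (cnj z) = (\<integral>w. kernel m a (cnj z - cnj w) *\<^sub>R h (cnj w) \<partial>lborel)"
      unfolding conv_def by (rule integral_lborel_cnj[OF meas, symmetric])
    also have "\<dots> = (\<integral>w. e *\<^sub>R \<sigma> (kernel m a (z - w) *\<^sub>R h w) \<partial>lborel)"
      using e[of "z - _"] by (simp add: sym linear_scale[OF sig(1)])
    also have "\<dots> = e *\<^sub>R \<sigma> (conv (kernel m a) h z)"
      unfolding conv_def by (subst integral_bounded_linear[OF bs int, symmetric]) simp
    finally show ?thesis .
  qed
  have p: "4^m * cnj w = cnj (4^m * w)" for m w by simp
  have 1: "potential 1 h (cnj z) = \<sigma> (potential 1 h z)"
  proof (rule LIMSEQ_unique[OF potential_tendsto[OF _ adm]])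
    have "conv (kernel m 1) h (cnj z) = \<sigma> (conv (kernel m 1) h z)" for m
      using key[of m 1 1] unfolding kernel_def p unit_kernel_cnj by simp
    then show "(\<lambda>m. conv (kernel m 1) h (cnj z)) \<longlonglongrightarrow> \<sigma> (potential 1 h z)"
      using bounded_linear.tendsto[OF bs potential_tendsto[OF _ adm]] by simp
  qed simp
  have 2: "potential (- \<i>) h (cnj z) = - \<sigma> (potential (- \<i>) h z)"
  proof (rule LIMSEQ_unique[OF potential_tendsto[OF _ adm]])
    have "conv (kernel m (- \<i>)) h (cnj z) = - \<sigma> (conv (kernel m (- \<i>)) h z)" for m
      using key[of m "- \<i>" "- 1"] unfolding kernel_def p unit_kernel_cnj by simp
    then show "(\<lambda>m. conv (kernel m (- \<i>)) h (cnj z)) \<longlonglongrightarrow> - \<sigma> (potential (- \<i>) h z)"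
      using tendsto_minus[OF bounded_linear.tendsto[OF bs potential_tendsto[OF _ adm, of "- \<i>"]]] by simp
  qed simp
  show ?thesis
    unfolding cauchy_green_def 1 2
    by (simp add: linear_scale[OF sig(1)] linear_add[OF sig(1)] sig(2) linear_neg[OF linJ])
qed

definition cauchy_green_const :: real where
  "cauchy_green_const = (560000 / bump_mass) * (1 + onorm J0)"

lemma onorm_J_nonneg: "onorm J0 \<ge> 0"
  by (rule onorm_pos_le[OF J_bounded_linear])

lemma norm_J_le: "norm (J0 x) \<le> onorm J0 * norm x"
  by (rule onorm[OF J_bounded_linear])

lemma holder_combine:
  assumes "holder D A f" "holder D A g"
  shows "holder D ((1 / bump_mass) * (1 + onorm J0) * A) (\<lambda>z. (1 / bump_mass) *\<^sub>R (f z + J0 (g z)))"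
proof -
  have *: "norm ((1 / bump_mass) *\<^sub>R (x + J0 y)) \<le> (1 / bump_mass) * (1 + onorm J0) * B"
    if "norm x \<le> B" "norm y \<le> B" for x y B
  proof -
    have "norm (x + J0 y) \<le> norm x + onorm J0 * norm y"
      using norm_triangle_ineq[of x "J0 y"] norm_J_le[of y] by linarith
    also have "\<dots> \<le> B + onorm J0 * B"
      using that onorm_J_nonneg by (intro add_mono mult_left_mono)
    finally have "(1 / bump_mass) * norm (x + J0 y) \<le> (1 / bump_mass) * ((1 + onorm J0) * B)"
      using bump_mass_pos by (intro mult_left_mono) (auto simp: algebra_simps)
    then show ?thesis using bump_mass_pos by simp
  qed
  show ?thesis unfolding holder_def
  proof (intro conjI ballI)
    fix z assume "z \<in> D"
    then show "norm ((1 / bump_mass) *\<^sub>R (f z + J0 (g z))) \<le> (1 / bump_mass) * (1 + onorm J0) * A"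
      using assms by (intro *) (auto simp: holder_def)
  next
    fix z w assume zw: "z \<in> D" "w \<in> D"
    have "(1 / bump_mass) *\<^sub>R (f z + J0 (g z)) - (1 / bump_mass) *\<^sub>R (f w + J0 (g w)) =
      (1 / bump_mass) *\<^sub>R ((f z - f w) + J0 (g z - g w))"
      by (simp add: linear_diff[OF linJ] algebra_simps)
    also have "norm \<dots> \<le> (1 / bump_mass) * (1 + onorm J0) * (A * sqrt (norm (z - w)))"
      using assms zw by (intro *) (auto simp: holder_def)
    finally show "norm ((1 / bump_mass) *\<^sub>R (f z + J0 (g z)) - (1 / bump_mass) *\<^sub>R (f w + J0 (g w)))
      \<le> (1 / bump_mass) * (1 + onorm J0) * A * sqrt (norm (z - w))" by simp
  qed
qed

lemma cauchy_green_const_nonneg: "cauchy_green_const \<ge> 0"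
  unfolding cauchy_green_const_def using onorm_J_nonneg bump_mass_pos by simp

lemma cauchy_green_const_quarter: "(1 / bump_mass) * (1 + onorm J0) * (140000 * M) = cauchy_green_const / 4 * M"
  using bump_mass_pos by (simp add: cauchy_green_const_def field_simps)

lemma cauchy_green'_holder_unit:
  assumes "admissible M h" "norm d = 1"
  shows "holder UNIV (cauchy_green_const / 4 * M) (\<lambda>z. cauchy_green' h z d)"
proof -
  have "holder UNIV ((1 / bump_mass) * (1 + onorm J0) * (140000 * M)) (\<lambda>z. cauchy_green' h z d)"
    unfolding cauchy_green'_def by (intro holder_combine potential'_holder[OF _ assms(1) assms(2)]) auto
  then show ?thesis unfolding cauchy_green_const_quarter .
qed

lemma cauchy_green'_expand:
  assumes "admissible M h"
  shows "cauchy_green' h z d = Re d *\<^sub>R cauchy_green' h z 1 + Im d *\<^sub>R cauchy_green' h z \<i>"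
  by (rule linear_complex_expand) (use cauchy_green_has_derivative[OF assms] has_derivative_linear in blast)

lemma cauchy_green_bound:
  assumes "admissible M h" shows "norm (cauchy_green h z) \<le> cauchy_green_const / 4 * M"
proof -
  have b: "norm (potential a h z) \<le> 140000 * M" if "norm a = 1" for a
    using potential_bound[OF that assms, of z] admissibleD(4)[OF assms] by linarith
  have "holder {z} ((1 / bump_mass) * (1 + onorm J0) * (140000 * M)) (\<lambda>z. cauchy_green h z)"
    unfolding cauchy_green_def by (intro holder_combine) (auto simp: holder_def b)
  then show ?thesis unfolding cauchy_green_const_quarter by (simp add: holder_def)
qed

lemma cauchy_green_holder:
  assumes adm: "admissible M h" shows "holder UNIV (cauchy_green_const * M) (cauchy_green h)"
  unfolding holder_def
proof (intro conjI ballI)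
  fix z w :: complex
  define c where "c = cauchy_green_const / 4 * M"
  have cM: "cauchy_green_const * M = 4 * c" by (simp add: c_def)
  have c0: "c \<ge> 0" using cauchy_green_const_nonneg admissibleD(4)[OF adm] by (simp add: c_def)
  have bd: "norm (cauchy_green h x) \<le> c" for x using cauchy_green_bound[OF adm, of x] by (simp add: c_def)
  show "norm (cauchy_green h z) \<le> cauchy_green_const * M" using bd[of z] c0 unfolding cM by simp
  have "norm (cauchy_green h z - cauchy_green h w) \<le> (2 * c) * norm (z - w)"
  proof (rule differentiable_bound[where S=UNIV and f'="cauchy_green' h"])
    fix x :: complex
    show "(cauchy_green h has_derivative cauchy_green' h x) (at x within UNIV)" using cauchy_green_has_derivative[OF adm] .
    show "onorm (cauchy_green' h x) \<le> 2 * c"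
    proof (rule onorm_le)
      fix d
      have "norm (cauchy_green' h x d) \<le> \<bar>Re d\<bar> * norm (cauchy_green' h x 1) + \<bar>Im d\<bar> * norm (cauchy_green' h x \<i>)"
        unfolding cauchy_green'_expand[OF adm, of x d] by (metis norm_triangle_ineq norm_scaleR)
      also have "\<dots> \<le> norm d * c + norm d * c"
        using cauchy_green'_holder_unit[OF adm, of 1] cauchy_green'_holder_unit[OF adm, of \<i>] unfolding c_def
        by (intro add_mono mult_mono abs_Re_le_cmod abs_Im_le_cmod) (auto simp: holder_def)
      finally show "norm (cauchy_green' h x d) \<le> 2 * c * norm d" by simp
    qed
  qed auto
  moreover have "norm (cauchy_green h z - cauchy_green h w) \<le> 2 * c"
    using norm_triangle_ineq4[of "cauchy_green h z" "cauchy_green h w"] bd[of z] bd[of w] by linarith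
  moreover have "min 1 (norm (z - w)) \<le> sqrt (norm (z - w))"
  proof (cases "norm (z - w) \<le> 1")
    case True
    then have "sqrt (norm (z - w)) * sqrt (norm (z - w)) \<le> sqrt (norm (z - w)) * 1"
      by (intro mult_left_mono) auto
    then show ?thesis by simp
  qed simp
  ultimately have "norm (cauchy_green h z - cauchy_green h w) \<le> (2 * c) * sqrt (norm (z - w))"
    using c0 mult_left_mono[of "min 1 (norm (z - w))" "sqrt (norm (z - w))" "2 * c"]
    by (cases "1 \<le> norm (z - w)") (auto simp: min_def intro: order_trans)
  also have "\<dots> \<le> cauchy_green_const * M * sqrt (norm (z - w))" using c0 unfolding cM by (intro mult_right_mono) auto
  finally show "norm (cauchy_green h z - cauchy_green h w) \<le> cauchy_green_const * M * sqrt (norm (z - w))" .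
qed

lemma cauchy_green'_holder:
  assumes "admissible M h" "norm d = 1"
  shows "holder UNIV (cauchy_green_const * M) (\<lambda>z. cauchy_green' h z d)"
  by (rule holder_mono[OF cauchy_green'_holder_unit[OF assms]])
     (use cauchy_green_const_nonneg admissibleD(4)[OF assms(1)] in simp)

end

section \<open>Nonlinear operators on Hoelder continuous functions\<close>

text \<open>A quantitative form of being \<open>C\<^sup>1\<^sup>,\<^sup>1\<close>, on differences only. The
  third condition bounds the mixed second difference; it is exactly what makes
  \<open>F \<mapsto> Q \<circ> F\<close> a Lipschitz map for the Hoelder norm, and it is stable under
  products and compositions without reference to derivatives.\<close>

definition four_point :: "'a::real_normed_vector set \<Rightarrow> real \<Rightarrow> ('a \<Rightarrow> 'b::real_normed_vector) \<Rightarrow> bool" where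
  "four_point B M F \<longleftrightarrow> (\<forall>a\<in>B. norm (F a) \<le> M) \<and> (\<forall>a\<in>B. \<forall>b\<in>B. norm (F a - F b) \<le> M * norm (a - b)) \<and>
     (\<forall>a\<in>B. \<forall>b\<in>B. \<forall>c\<in>B. \<forall>d\<in>B. norm (F a - F b - (F c - F d)) \<le>
        M * (norm (a - b - (c - d)) + (norm (a - b) + norm (c - d)) * (norm (a - c) + norm (b - d))))"

lemma holder_subset: "holder D M h \<Longrightarrow> D' \<subseteq> D \<Longrightarrow> holder D' M h"
  unfolding holder_def by blast

lemma holder_nonneg: "holder D M h \<Longrightarrow> D \<noteq> {} \<Longrightarrow> M \<ge> 0"
  unfolding holder_def by (meson ex_in_conv norm_ge_zero order_trans)

lemma holder_add:
  assumes "holder D A f" "holder D B g" shows "holder D (A + B) (\<lambda>z. f z + g z)"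
proof (rule holderI)
  show "norm (f z + g z) \<le> A + B" if "z \<in> D" for z
    using norm_triangle_ineq[of "f z" "g z"] holderD(1)[OF assms(1) that] holderD(1)[OF assms(2) that] by linarith
  show "norm (f z + g z - (f w + g w)) \<le> (A + B) * sqrt (norm (z - w))" if "z \<in> D" "w \<in> D" for z w
    using norm_triangle_ineq[of "f z - f w" "g z - g w"] holderD(2)[OF assms(1) that] holderD(2)[OF assms(2) that]
    by (simp add: algebra_simps)
qed

lemma min_le_sqrt: "0 \<le> x \<Longrightarrow> min 1 x \<le> sqrt x"
proof (cases "x \<le> 1")
  case True
  assume "0 \<le> x"
  then have "sqrt x * sqrt x \<le> sqrt x * 1" using True by (intro mult_left_mono) auto
  then show ?thesis using \<open>0 \<le> x\<close> True by simp
qed simp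

lemma holder_blinfun_apply:
  assumes T: "holder D A T" and h: "holder D B h"
  shows "holder D (2 * A * B) (\<lambda>z. blinfun_apply (T z) (h z))"
proof (rule holderI)
  fix z assume z: "z \<in> D"
  then have A: "A \<ge> 0" and B: "B \<ge> 0" using holder_nonneg T h by blast+
  have ap: "norm (blinfun_apply S x) \<le> a * b" if "norm S \<le> a" "norm x \<le> b" "a \<ge> 0" for S x a b
    using that norm_blinfun[of S x] mult_mono[of "norm S" a "norm x" b] by simp
  have "norm (T z (h z)) \<le> A * B" by (intro ap holderD(1)[OF T z] holderD(1)[OF h z] A)
  also have "\<dots> \<le> 2 * A * B" using A B by simp
  finally show "norm (T z (h z)) \<le> 2 * A * B" .
  fix w assume w: "w \<in> D"
  have "T z (h z) - T w (h w) = T z (h z - h w) + (T z - T w) (h w)"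
    by (simp add: blinfun.diff_right blinfun.diff_left)
  also have "norm \<dots> \<le> A * (B * sqrt (norm (z - w))) + (A * sqrt (norm (z - w))) * B"
    using A by (intro norm_triangle_le add_mono ap holderD[OF T] holderD[OF h] z w) auto
  finally show "norm (T z (h z) - T w (h w)) \<le> 2 * A * B * sqrt (norm (z - w))" by (simp add: algebra_simps)
qed

lemma holder_comp:
  assumes Q: "four_point B \<epsilon> Q" and F: "holder D \<Lambda> F" and FB: "\<And>z. z \<in> D \<Longrightarrow> F z \<in> B"
    and \<Lambda>: "\<Lambda> \<ge> 1" and \<epsilon>: "\<epsilon> \<ge> 0"
  shows "holder D (\<epsilon> * \<Lambda>) (\<lambda>z. Q (F z))"
proof (rule holderI)
  fix z assume z: "z \<in> D"
  have "norm (Q (F z)) \<le> \<epsilon> * 1" using Q FB[OF z] by (simp add: four_point_def)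
  also have "\<dots> \<le> \<epsilon> * \<Lambda>" using \<Lambda> \<epsilon> by (intro mult_left_mono) auto
  finally show "norm (Q (F z)) \<le> \<epsilon> * \<Lambda>" .
  fix w assume w: "w \<in> D"
  have "norm (Q (F z) - Q (F w)) \<le> \<epsilon> * norm (F z - F w)" using Q FB z w by (simp add: four_point_def)
  also have "\<dots> \<le> \<epsilon> * (\<Lambda> * sqrt (norm (z - w)))" by (intro mult_left_mono \<epsilon> holderD[OF F] z w)
  finally show "norm (Q (F z) - Q (F w)) \<le> \<epsilon> * \<Lambda> * sqrt (norm (z - w))" by simp
qed

text \<open>The mixed second difference of \<open>Q\<close> at the points \<open>F z, F' z, F w, F' w\<close> is
  estimated by the four point condition; a Lipschitz bound for \<open>Q\<close> alone would not give a
  Hoelder estimate with the factor \<open>\<delta>\<close>.\<close>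

lemma holder_comp_diff:
  assumes Q: "four_point B \<epsilon> Q" and F: "holder D \<Lambda> F" "holder D \<Lambda> F'"
    and FB: "\<And>z. z \<in> D \<Longrightarrow> F z \<in> B" "\<And>z. z \<in> D \<Longrightarrow> F' z \<in> B"
    and d: "holder D \<delta> (\<lambda>z. F z - F' z)"
    and \<Lambda>: "\<Lambda> \<ge> 1" and \<epsilon>: "\<epsilon> \<ge> 0"
  shows "holder D (5 * \<epsilon> * \<delta> * \<Lambda>) (\<lambda>z. Q (F z) - Q (F' z))"
proof (rule holderI)
  fix z assume z: "z \<in> D"
  have \<delta>: "\<delta> \<ge> 0" using holder_nonneg d z by blast
  have "norm (Q (F z) - Q (F' z)) \<le> \<epsilon> * norm (F z - F' z)" using Q FB z by (simp add: four_point_def)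
  also have "\<dots> \<le> \<epsilon> * \<delta>" by (intro mult_left_mono \<epsilon> holderD[OF d] z)
  also have "\<dots> = 1 * (\<epsilon> * \<delta>) * 1" by simp
  also have "\<dots> \<le> 5 * (\<epsilon> * \<delta>) * \<Lambda>" using \<Lambda> \<epsilon> \<delta> by (intro mult_mono) auto
  finally show "norm (Q (F z) - Q (F' z)) \<le> 5 * \<epsilon> * \<delta> * \<Lambda>" by simp
  fix w assume w: "w \<in> D"
  let ?s = "sqrt (norm (z - w))"
  have "norm (Q (F z) - Q (F' z) - (Q (F w) - Q (F' w))) \<le>
     \<epsilon> * (norm (F z - F' z - (F w - F' w)) + (norm (F z - F' z) + norm (F w - F' w)) * (norm (F z - F w) + norm (F' z - F' w)))"
    using Q FB z w by (simp add: four_point_def)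
  also have "\<dots> \<le> \<epsilon> * (\<delta> * ?s + (\<delta> + \<delta>) * (\<Lambda> * ?s + \<Lambda> * ?s))"
    using \<delta> by (intro mult_left_mono add_mono mult_mono \<epsilon> holderD(2)[OF d] holderD(1)[OF d] holderD(2)[OF F(1)] holderD(2)[OF F(2)] z w) auto
  also have "\<dots> = (\<epsilon> * \<delta> * ?s) * (1 + 4 * \<Lambda>)" by (simp add: algebra_simps)
  also have "\<dots> \<le> (\<epsilon> * \<delta> * ?s) * (5 * \<Lambda>)" using \<Lambda> \<epsilon> \<delta> by (intro mult_left_mono) auto
  finally show "norm (Q (F z) - Q (F' z) - (Q (F w) - Q (F' w))) \<le> 5 * \<epsilon> * \<delta> * \<Lambda> * ?s" by (simp add: mult_ac)
qed

definition cutoff :: "complex \<Rightarrow> real" where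
  "cutoff z = max 0 (min 1 (2 - norm z))"

lemma cutoff_simps: "norm z \<le> 1 \<Longrightarrow> cutoff z = 1" "norm z \<ge> 2 \<Longrightarrow> cutoff z = 0"
    "0 \<le> cutoff z" "cutoff z \<le> 1" "cutoff (cnj z) = cutoff z"
  by (auto simp: cutoff_def)

lemma cutoff_diff: "\<bar>cutoff z - cutoff w\<bar> \<le> sqrt (norm (z - w))"
proof -
  have "\<bar>cutoff z - cutoff w\<bar> \<le> min 1 (norm (z - w))"
    unfolding cutoff_def using norm_triangle_ineq3[of z w] by (auto simp: max_def min_def abs_if split: if_splits)
  then show ?thesis using min_le_sqrt[of "norm (z - w)"] by linarith
qed

lemma holder_cutoff:
  fixes G :: "complex \<Rightarrow> 'b::real_normed_vector"
  assumes G: "holder (D \<inter> cball 0 2) A G" and A: "A \<ge> 0"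
  shows "holder D (2 * A) (\<lambda>z. cutoff z *\<^sub>R G z)"
proof (rule holderI)
  have bd: "norm (cutoff z *\<^sub>R G z) \<le> cutoff z * A" if "z \<in> D" for z
  proof (cases "norm z \<le> 2")
    case True
    then show ?thesis using holderD(1)[OF G, of z] that by (auto intro!: mult_left_mono simp: cutoff_simps)
  qed (simp add: cutoff_simps)
  show "norm (cutoff z *\<^sub>R G z) \<le> 2 * A" if "z \<in> D" for z
    using bd[OF that] mult_right_mono[OF cutoff_simps(4)[of z] A] A by linarith
  have one: "norm (cutoff z *\<^sub>R G z - cutoff w *\<^sub>R G w) \<le> 2 * A * sqrt (norm (z - w))"
    if "z \<in> D" "w \<in> D" "norm w > 2" for z w
  proof -
    have "norm (cutoff z *\<^sub>R G z - cutoff w *\<^sub>R G w) \<le> cutoff z * A"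
      using bd[OF that(1)] that(3) by (simp add: cutoff_simps)
    also have "\<dots> \<le> sqrt (norm (z - w)) * A"
      using cutoff_diff[of z w] that(3) by (intro mult_right_mono A) (auto simp: cutoff_simps)
    also have "\<dots> \<le> 2 * A * sqrt (norm (z - w))" using A by simp
    finally show ?thesis .
  qed
  fix z w assume zw: "z \<in> D" "w \<in> D"
  show "norm (cutoff z *\<^sub>R G z - cutoff w *\<^sub>R G w) \<le> 2 * A * sqrt (norm (z - w))"
  proof (cases "norm w > 2 \<or> norm z > 2")
    case True
    then show ?thesis using one[OF zw] one[OF zw(2,1)] by (auto simp: norm_minus_commute)
  next
    case False
    then have in2: "z \<in> D \<inter> cball 0 2" "w \<in> D \<inter> cball 0 2" using zw by auto
    have "cutoff z *\<^sub>R G z - cutoff w *\<^sub>R G w = cutoff z *\<^sub>R (G z - G w) + (cutoff z - cutoff w) *\<^sub>R G w"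
      by (simp add: algebra_simps)
    also have "norm \<dots> \<le> 1 * (A * sqrt (norm (z - w))) + sqrt (norm (z - w)) * A"
    proof (intro norm_triangle_le add_mono)
      show "norm (cutoff z *\<^sub>R (G z - G w)) \<le> 1 * (A * sqrt (norm (z - w)))"
        unfolding norm_scaleR by (intro mult_mono holderD(2)[OF G] in2) (auto simp: cutoff_simps)
      show "norm ((cutoff z - cutoff w) *\<^sub>R G w) \<le> sqrt (norm (z - w)) * A"
        unfolding norm_scaleR by (intro mult_mono holderD(1)[OF G] in2 cutoff_diff) auto
    qed
    finally show ?thesis by simp
  qed
qed

text \<open>The extension of a map from the closed upper half plane which is compatible with conjugation in the
  source and \<open>\<sigma>\<close> in the target.\<close>

definition reflect :: "('b \<Rightarrow> 'b) \<Rightarrow> (complex \<Rightarrow> 'b) \<Rightarrow> complex \<Rightarrow> 'b" where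
  "reflect \<sigma> G z = (if Im z \<ge> 0 then G z else \<sigma> (G (cnj z)))"

lemma norm_diff_cnj: "norm (cnj z - cnj w) = norm (z - w)"
  by (metis complex_cnj_diff complex_mod_cnj)

text \<open>For points on different sides of the real axis the values are compared with those at the projections
  to the axis, where \<open>G\<close> vanishes; without this vanishing the extension could jump.\<close>

lemma holder_reflect:
  fixes G :: "complex \<Rightarrow> 'b::real_normed_vector"
  assumes G: "holder {z. Im z \<ge> 0} A G" and zero: "\<And>z. Im z = 0 \<Longrightarrow> G z = 0"
    and \<sigma>: "linear \<sigma>" "\<And>x. norm (\<sigma> x) \<le> s * norm x" "s \<ge> 1"
  shows "holder UNIV ((1 + s) * A) (reflect \<sigma> G)"
proof (rule holderI)
  have A: "A \<ge> 0" using holder_nonneg[OF G] by auto (metis Im_i_times Re_complex_of_real zero_le_one)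
  have sA: "x \<le> s * y \<Longrightarrow> y \<le> A * r \<Longrightarrow> r \<ge> 0 \<Longrightarrow> x \<le> (1 + s) * A * r" for x y r
  proof -
    assume a: "x \<le> s * y" "y \<le> A * r" "r \<ge> 0"
    have "s * y \<le> s * (A * r)" using a \<sigma>(3) by (intro mult_left_mono) auto
    moreover have "0 \<le> A * r" using A a by simp
    ultimately show ?thesis using a(1) by (simp add: algebra_simps)
  qed
  have sA1: "y \<le> A * r \<Longrightarrow> r \<ge> 0 \<Longrightarrow> y \<le> (1 + s) * A * r" for y r
  proof -
    assume a: "y \<le> A * r" "r \<ge> 0"
    have "0 \<le> s * (A * r)" using A a \<sigma>(3) by simp
    then show ?thesis using a(1) by (simp add: algebra_simps)
  qed
  fix z w :: complex
  show "norm (reflect \<sigma> G z) \<le> (1 + s) * A"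
  proof (cases "Im z \<ge> 0")
    case True
    then show ?thesis using holderD(1)[OF G, of z] sA1[of "norm (G z)" 1] by (simp add: reflect_def)
  next
    case False
    then show ?thesis using holderD(1)[OF G, of "cnj z"] sA[OF \<sigma>(2)[of "G (cnj z)"], of 1] by (simp add: reflect_def)
  qed
  have mixed: "norm (G z - \<sigma> (G (cnj w))) \<le> (1 + s) * A * sqrt (norm (z - w))" if "Im z \<ge> 0" "Im w < 0" for z w
  proof -
    have d: "\<bar>Im z\<bar> \<le> norm (z - w)" "\<bar>Im w\<bar> \<le> norm (z - w)"
      using abs_Im_le_cmod[of "z - w"] that by auto
    have "norm (G z - G (of_real (Re z))) \<le> A * sqrt (norm (z - of_real (Re z)))"
      using that by (intro holderD(2)[OF G]) auto
    moreover have "norm (z - of_real (Re z)) = \<bar>Im z\<bar>"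
      by (simp add: cmod_def)
    ultimately have 1: "norm (G z) \<le> A * sqrt \<bar>Im z\<bar>" using zero[of "of_real (Re z)"] by simp
    have "norm (G (cnj w) - G (of_real (Re w))) \<le> A * sqrt (norm (cnj w - of_real (Re w)))"
      using that by (intro holderD(2)[OF G]) auto
    moreover have "norm (cnj w - of_real (Re w)) = \<bar>Im w\<bar>"
      by (simp add: cmod_def)
    ultimately have 2: "norm (G (cnj w)) \<le> A * sqrt \<bar>Im w\<bar>" using zero[of "of_real (Re w)"] by simp
    have "norm (G z - \<sigma> (G (cnj w))) \<le> norm (G z) + s * norm (G (cnj w))"
      using norm_triangle_ineq4[of "G z" "\<sigma> (G (cnj w))"] \<sigma>(2)[of "G (cnj w)"] by linarith
    also have "\<dots> \<le> A * sqrt (norm (z - w)) + s * (A * sqrt (norm (z - w)))"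
    proof (intro add_mono mult_left_mono)
      show "norm (G z) \<le> A * sqrt (norm (z - w))"
        using 1 mult_left_mono[OF real_sqrt_le_mono[OF d(1)] A] by linarith
      show "norm (G (cnj w)) \<le> A * sqrt (norm (z - w))"
        using 2 mult_left_mono[OF real_sqrt_le_mono[OF d(2)] A] by linarith
    qed (use \<sigma>(3) in simp)
    finally show ?thesis by (simp add: algebra_simps)
  qed
  consider "Im z \<ge> 0" "Im w \<ge> 0" | "Im z \<ge> 0" "Im w < 0" | "Im z < 0" "Im w \<ge> 0" | "Im z < 0" "Im w < 0" by linarith
  then show "norm (reflect \<sigma> G z - reflect \<sigma> G w) \<le> (1 + s) * A * sqrt (norm (z - w))"
  proof cases
    case 1
    then show ?thesis using holderD(2)[OF G, of z w] by (simp add: reflect_def sA1)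
  next
    case 2
    then show ?thesis using mixed[OF 2] by (simp add: reflect_def)
  next
    case 3
    then show ?thesis using mixed[OF 3(2,1)] by (simp add: reflect_def norm_minus_commute)
  next
    case 4
    have "norm (\<sigma> (G (cnj z)) - \<sigma> (G (cnj w))) \<le> s * norm (G (cnj z) - G (cnj w))"
      using \<sigma>(2) by (simp flip: linear_diff[OF \<sigma>(1)])
    then show ?thesis using 4 sA[OF _ holderD(2)[OF G, of "cnj z" "cnj w"]] by (simp add: reflect_def norm_diff_cnj)
  qed
qed

lemma holder_limit:
  assumes "\<And>n. holder D (M n) (hs n)" "\<And>z. z \<in> D \<Longrightarrow> (\<lambda>n. hs n z) \<longlonglongrightarrow> h z" "M \<longlonglongrightarrow> L"
  shows "holder D L h"
proof (rule holderI)
  show "norm (h z) \<le> L" if "z \<in> D" for z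
    by (rule LIMSEQ_le[OF tendsto_norm[OF assms(2)[OF that]] assms(3)]) (use holderD(1)[OF assms(1) that] in auto)
  show "norm (h z - h w) \<le> L * sqrt (norm (z - w))" if "z \<in> D" "w \<in> D" for z w
    by (rule LIMSEQ_le[OF tendsto_norm[OF tendsto_diff[OF assms(2) assms(2)]] tendsto_mult_right[OF assms(3)]])
       (use that holderD(2)[OF assms(1) that] in auto)
qed

text \<open>Banach iteration starting from \<open>0\<close>. Completeness of the Hoelder norm is replaced by the
  observation that Hoelder bounds survive pointwise limits, so the constraint set only has to be
  closed under these.\<close>

lemma holder_fixed_point:
  fixes \<F> :: "(complex \<Rightarrow> 'b::banach) \<Rightarrow> complex \<Rightarrow> 'b"
  assumes zero: "(\<lambda>z. 0) \<in> \<C>" and M: "M \<ge> 0"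
    and closed: "\<And>hs h. (\<And>n. hs n \<in> \<C>) \<Longrightarrow> (\<And>z. (\<lambda>n. hs n z) \<longlonglongrightarrow> h z) \<Longrightarrow> h \<in> \<C>"
    and self: "\<And>h. h \<in> \<C> \<Longrightarrow> holder UNIV M h \<Longrightarrow> \<F> h \<in> \<C> \<and> holder UNIV M (\<F> h)"
    and contr: "\<And>h h' \<delta>. h \<in> \<C> \<Longrightarrow> holder UNIV M h \<Longrightarrow> h' \<in> \<C> \<Longrightarrow> holder UNIV M h' \<Longrightarrow>
       holder UNIV \<delta> (\<lambda>z. h z - h' z) \<Longrightarrow> holder UNIV (\<delta> / 2) (\<lambda>z. \<F> h z - \<F> h' z)"
  shows "\<exists>h\<in>\<C>. holder UNIV M h \<and> \<F> h = h"
proof -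
  define hs where "hs n = (\<F> ^^ n) (\<lambda>z. 0)" for n
  have hs_Suc: "hs (Suc n) = \<F> (hs n)" for n by (simp add: hs_def)
  have hs: "hs n \<in> \<C> \<and> holder UNIV M (hs n)" for n
  proof (induction n)
    case 0 show ?case using zero M by (simp add: hs_def holder_def)
  next
    case (Suc n) then show ?case unfolding hs_Suc using self by blast
  qed
  have step: "holder UNIV (M * (1/2)^n) (\<lambda>z. hs (Suc n) z - hs n z)" for n
  proof (induction n)
    case 0 show ?case using hs[of 1] by (simp add: hs_def)
  next
    case (Suc n)
    show ?case using contr[OF hs[THEN conjunct1] hs[THEN conjunct2] hs[THEN conjunct1] hs[THEN conjunct2] Suc.IH]
      unfolding hs_Suc[symmetric] by simp
  qed
  have far: "holder UNIV (2 * M * (1/2)^n * (1 - (1/2)^k)) (\<lambda>z. hs (n + k) z - hs n z)" for n k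
  proof (induction k)
    case 0 show ?case by (simp add: holder_def)
  next
    case (Suc k)
    have "holder UNIV (M * (1/2)^(n + k) + 2 * M * (1/2)^n * (1 - (1/2)^k)) (\<lambda>z. (hs (Suc (n + k)) z - hs (n + k) z) + (hs (n + k) z - hs n z))"
      by (rule holder_add[OF step Suc.IH])
    moreover have "M * (1/2)^(n + k) + 2 * M * (1/2)^n * (1 - (1/2)^k) = 2 * M * (1/2)^n * (1 - (1/2)^Suc k)"
      by (simp add: power_add field_simps)
    ultimately show ?case by simp
  qed
  have "\<exists>l. (\<lambda>n. hs n z) \<longlonglongrightarrow> l \<and> (\<forall>n. norm (hs n z - l) \<le> 2 * M * (1/2)^n)" for z
    by (rule geometric_limit) (use holderD(1)[OF step] in auto)
  then obtain h where h: "\<And>z. (\<lambda>n. hs n z) \<longlonglongrightarrow> h z" by metis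
  have hC: "h \<in> \<C>" by (rule closed[of hs]) (use hs h in auto)
  have hM: "holder UNIV M h" by (rule holder_limit[OF _ h tendsto_const]) (use hs in auto)
  have pow0: "(\<lambda>n. c * (1/2)^n) \<longlonglongrightarrow> 0" for c :: real
    using tendsto_mult_left[OF LIMSEQ_power_zero[of "1/2::real"], of c] by simp
  have near: "holder UNIV (2 * M * (1/2)^n) (\<lambda>z. h z - hs n z)" for n
  proof (rule holder_limit[OF far[of n]])
    show "(\<lambda>k. hs (n + k) z - hs n z) \<longlonglongrightarrow> h z - hs n z" for z
      using LIMSEQ_ignore_initial_segment[OF h[of z], of n] by (intro tendsto_intros) (simp add: add.commute)
    have "(\<lambda>k. 2 * M * (1/2)^n * (1 - 1 * (1/2)^k)) \<longlonglongrightarrow> 2 * M * (1/2)^n * (1 - 0)"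
      by (intro tendsto_mult_left tendsto_diff tendsto_const pow0)
    then show "(\<lambda>k. 2 * M * (1/2)^n * (1 - (1/2)^k)) \<longlonglongrightarrow> 2 * M * (1/2)^n" by simp
  qed
  have "\<F> h z = h z" for z
  proof -
    have "norm (\<F> h z - hs (Suc n) z) \<le> M * (1/2)^n" for n
      using holderD(1)[OF contr[OF hC hM hs[THEN conjunct1] hs[THEN conjunct2] near[of n]]]
      unfolding hs_Suc by simp
    then have "(\<lambda>n. \<F> h z - hs (Suc n) z) \<longlonglongrightarrow> 0"
      by (intro Lim_null_comparison[OF always_eventually pow0[of M]] allI)
    moreover have "(\<lambda>n. \<F> h z - hs (Suc n) z) \<longlonglongrightarrow> \<F> h z - h z"
      by (intro tendsto_intros LIMSEQ_Suc h)
    ultimately show ?thesis using LIMSEQ_unique by fastforce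
  qed
  then show ?thesis using hC hM by blast
qed

lemma nonlinearity_self:
  fixes Q1 Q2 :: "'e::real_normed_vector \<Rightarrow> 'e \<Rightarrow>\<^sub>L 'e"
  assumes Q: "four_point B \<epsilon> Q1" "four_point B \<epsilon> Q2" and \<epsilon>: "\<epsilon> \<ge> 0" and \<Lambda>: "\<Lambda> \<ge> 1"
    and F: "holder (D \<inter> cball 0 2) \<Lambda> F" "holder (D \<inter> cball 0 2) \<Lambda> Fx" and h: "holder (D \<inter> cball 0 2) 1 h"
    and FB: "\<And>z. z \<in> D \<inter> cball 0 2 \<Longrightarrow> F z \<in> B"
  shows "holder D (8 * \<epsilon> * \<Lambda>\<^sup>2) (\<lambda>z. cutoff z *\<^sub>R (Q1 (F z) (h z) + Q2 (F z) (Fx z)))"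
proof -
  have "holder (D \<inter> cball 0 2) (2 * (\<epsilon> * \<Lambda>) * 1 + 2 * (\<epsilon> * \<Lambda>) * \<Lambda>) (\<lambda>z. Q1 (F z) (h z) + Q2 (F z) (Fx z))"
    by (intro holder_add holder_blinfun_apply holder_comp[OF Q(1) F(1) FB] holder_comp[OF Q(2) F(1) FB] \<Lambda> \<epsilon> h F)
  moreover have "2 * (\<epsilon> * \<Lambda>) * 1 + 2 * (\<epsilon> * \<Lambda>) * \<Lambda> \<le> 4 * \<epsilon> * \<Lambda>\<^sup>2"
  proof -
    have "\<epsilon> * \<Lambda> * 1 \<le> \<epsilon> * \<Lambda> * \<Lambda>" using \<epsilon> \<Lambda> by (intro mult_left_mono) auto
    then show ?thesis by (simp add: power2_eq_square mult_ac)
  qed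
  ultimately have "holder (D \<inter> cball 0 2) (4 * \<epsilon> * \<Lambda>\<^sup>2) (\<lambda>z. Q1 (F z) (h z) + Q2 (F z) (Fx z))"
    by (rule holder_mono)
  from holder_cutoff[OF this] show ?thesis using \<epsilon> by (simp add: mult.assoc)
qed

text \<open>The difference is written as a sum of products, each having a factor of size
  \<open>\<epsilon>\<close> from \<open>Q1\<close> or \<open>Q2\<close> and a factor of size
  \<open>\<delta>\<close>.\<close>

lemma nonlinearity_contraction:
  fixes Q1 Q2 :: "'e::real_normed_vector \<Rightarrow> 'e \<Rightarrow>\<^sub>L 'e"
  assumes Q: "four_point B \<epsilon> Q1" "four_point B \<epsilon> Q2" and \<epsilon>: "\<epsilon> \<ge> 0" and \<Lambda>: "\<Lambda> \<ge> 1" and K: "K \<ge> 1" and \<delta>: "\<delta> \<ge> 0"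
    and F: "holder (D \<inter> cball 0 2) \<Lambda> F" "holder (D \<inter> cball 0 2) \<Lambda> Fx" and h: "holder (D \<inter> cball 0 2) 1 h"
    and FB: "\<And>z. z \<in> D \<inter> cball 0 2 \<Longrightarrow> F z \<in> B"
    and F': "holder (D \<inter> cball 0 2) \<Lambda> F'" "holder (D \<inter> cball 0 2) \<Lambda> Fx'" and h': "holder (D \<inter> cball 0 2) 1 h'"
    and FB': "\<And>z. z \<in> D \<inter> cball 0 2 \<Longrightarrow> F' z \<in> B"
    and dF: "holder (D \<inter> cball 0 2) (K * \<delta>) (\<lambda>z. F z - F' z)" "holder (D \<inter> cball 0 2) (K * \<delta>) (\<lambda>z. Fx z - Fx' z)"
    and dh: "holder (D \<inter> cball 0 2) \<delta> (\<lambda>z. h z - h' z)"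
  shows "holder D (48 * \<epsilon> * K * \<Lambda>\<^sup>2 * \<delta>) (\<lambda>z. cutoff z *\<^sub>R (Q1 (F z) (h z) + Q2 (F z) (Fx z))
     - cutoff z *\<^sub>R (Q1 (F' z) (h' z) + Q2 (F' z) (Fx' z)))"
proof -
  let ?D = "D \<inter> cball 0 2"
  \<comment> \<open>One summand for each of the four products in the decomposition below.\<close>
  let ?A = "2 * (\<epsilon> * \<Lambda>) * \<delta> + 2 * (5 * \<epsilon> * (K * \<delta>) * \<Lambda>) * 1 + (2 * (\<epsilon> * \<Lambda>) * (K * \<delta>) + 2 * (5 * \<epsilon> * (K * \<delta>) * \<Lambda>) * \<Lambda>)"
  have "holder ?D ?A (\<lambda>z. (Q1 (F z) (h z - h' z) + (Q1 (F z) - Q1 (F' z)) (h' z))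
      + (Q2 (F z) (Fx z - Fx' z) + (Q2 (F z) - Q2 (F' z)) (Fx' z)))"
    by (intro holder_add holder_blinfun_apply holder_comp[OF Q(1) F(1) FB] holder_comp[OF Q(2) F(1) FB]
       holder_comp_diff[OF Q(1) F(1) F'(1) FB FB'] holder_comp_diff[OF Q(2) F(1) F'(1) FB FB'] dF dh h' F' \<Lambda> \<epsilon>)
  moreover have "?A \<le> 24 * \<epsilon> * K * \<Lambda>\<^sup>2 * \<delta>"
  proof -
    have e: "\<epsilon> * \<delta> \<ge> 0" using \<epsilon> \<delta> by simp
    have "\<Lambda> * 1 \<le> \<Lambda> * \<Lambda>" using \<Lambda> by (intro mult_left_mono) auto
    moreover have K\<Lambda>: "1 * (\<Lambda> * \<Lambda>) \<le> K * (\<Lambda> * \<Lambda>)" using K by (intro mult_right_mono) auto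
    moreover have "K * \<Lambda> \<le> K * (\<Lambda> * \<Lambda>)" using calculation(1) K by (intro mult_left_mono) auto
    ultimately have "2 * \<Lambda> + 10 * (K * \<Lambda>) + (2 * (K * \<Lambda>) + 10 * (K * (\<Lambda> * \<Lambda>))) \<le> 24 * (K * (\<Lambda> * \<Lambda>))" by linarith
    then have "(\<epsilon> * \<delta>) * (2 * \<Lambda> + 10 * (K * \<Lambda>) + (2 * (K * \<Lambda>) + 10 * (K * (\<Lambda> * \<Lambda>)))) \<le> (\<epsilon> * \<delta>) * (24 * (K * (\<Lambda> * \<Lambda>)))"
      using e by (rule mult_left_mono)
    then show ?thesis by (simp add: algebra_simps power2_eq_square)
  qed
  ultimately have "holder ?D (24 * \<epsilon> * K * \<Lambda>\<^sup>2 * \<delta>) (\<lambda>z. (Q1 (F z) (h z - h' z) + (Q1 (F z) - Q1 (F' z)) (h' z))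
      + (Q2 (F z) (Fx z - Fx' z) + (Q2 (F z) - Q2 (F' z)) (Fx' z)))"
    by (rule holder_mono)
  from holder_cutoff[OF this] have "holder D (2 * (24 * \<epsilon> * K * \<Lambda>\<^sup>2 * \<delta>)) (\<lambda>z. cutoff z *\<^sub>R ((Q1 (F z) (h z - h' z) + (Q1 (F z) - Q1 (F' z)) (h' z))
      + (Q2 (F z) (Fx z - Fx' z) + (Q2 (F z) - Q2 (F' z)) (Fx' z))))"
    using \<epsilon> \<delta> K by simp
  moreover have "cutoff z *\<^sub>R ((Q1 (F z) (h z - h' z) + (Q1 (F z) - Q1 (F' z)) (h' z))
      + (Q2 (F z) (Fx z - Fx' z) + (Q2 (F z) - Q2 (F' z)) (Fx' z))) = cutoff z *\<^sub>R (Q1 (F z) (h z) + Q2 (F z) (Fx z))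
     - cutoff z *\<^sub>R (Q1 (F' z) (h' z) + Q2 (F' z) (Fx' z))" for z
    by (simp add: blinfun.diff_left blinfun.diff_right algebra_simps)
  ultimately show ?thesis by (simp add: mult.assoc)
qed

section \<open>Perturbed affine discs\<close>

context complex_structure
begin

text \<open>The complex affine disc through \<open>\<alpha>\<close> with velocity \<open>\<beta>\<close>.\<close>

definition affine_disc :: "'e \<Rightarrow> 'e \<Rightarrow> complex \<Rightarrow> 'e" where
  "affine_disc \<alpha> \<beta> z = \<alpha> + Re z *\<^sub>R \<beta> + Im z *\<^sub>R J0 \<beta>"

definition affine_disc' :: "'e \<Rightarrow> complex \<Rightarrow> 'e" where
  "affine_disc' \<beta> d = Re d *\<^sub>R \<beta> + Im d *\<^sub>R J0 \<beta>"

lemma affine_disc_has_derivative: "(affine_disc \<alpha> \<beta> has_derivative affine_disc' \<beta>) (at z)"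
  unfolding affine_disc_def[abs_def] affine_disc'_def[abs_def] by (auto intro!: derivative_eq_intros)

lemma affine_disc'_simps: "affine_disc' \<beta> 1 = \<beta>" "affine_disc' \<beta> \<i> = J0 \<beta>"
  by (simp_all add: affine_disc'_def)

lemma affine_disc_diff: "affine_disc \<alpha> \<beta> z - affine_disc \<alpha>' \<beta>' z = affine_disc (\<alpha> - \<alpha>') (\<beta> - \<beta>') z"
  by (simp add: affine_disc_def linear_diff[OF linJ] algebra_simps)

lemma affine_disc_holder:
  assumes "norm \<alpha> \<le> m" "norm \<beta> \<le> m"
  shows "holder (cball 0 2) (3 * (1 + onorm J0) * m) (affine_disc \<alpha> \<beta>)"
proof (rule holderI)
  have m: "m \<ge> 0" using assms(1) norm_ge_zero order_trans by blast
  have lin: "norm (Re v *\<^sub>R \<beta> + Im v *\<^sub>R J0 \<beta>) \<le> norm v * ((1 + onorm J0) * m)" for v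
  proof -
    have "norm (Re v *\<^sub>R \<beta> + Im v *\<^sub>R J0 \<beta>) \<le> \<bar>Re v\<bar> * norm \<beta> + \<bar>Im v\<bar> * norm (J0 \<beta>)"
      by (metis norm_triangle_ineq norm_scaleR)
    also have "\<dots> \<le> norm v * m + norm v * (onorm J0 * m)"
      by (intro add_mono mult_mono abs_Re_le_cmod abs_Im_le_cmod assms
         order_trans[OF norm_J_le mult_left_mono[OF _ onorm_J_nonneg]]) auto
    finally show ?thesis by (simp add: algebra_simps)
  qed
  fix z :: complex assume z: "z \<in> cball 0 2"
  have "norm (affine_disc \<alpha> \<beta> z) \<le> norm \<alpha> + norm (Re z *\<^sub>R \<beta> + Im z *\<^sub>R J0 \<beta>)"
    unfolding affine_disc_def add.assoc by (rule norm_triangle_ineq)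
  also have "\<dots> \<le> m + 2 * ((1 + onorm J0) * m)"
    using z m onorm_J_nonneg by (intro add_mono assms order_trans[OF lin] mult_right_mono) auto
  also have "\<dots> \<le> 3 * (1 + onorm J0) * m" using m onorm_J_nonneg by (simp add: algebra_simps)
  finally show "norm (affine_disc \<alpha> \<beta> z) \<le> 3 * (1 + onorm J0) * m" .
  fix w :: complex assume w: "w \<in> cball 0 2"
  have "norm (z - w) \<le> 4" using z w norm_triangle_ineq4[of z w] by simp
  then have s: "sqrt (norm (z - w)) \<le> 2" using real_sqrt_le_mono by fastforce
  have "affine_disc \<alpha> \<beta> z - affine_disc \<alpha> \<beta> w = Re (z - w) *\<^sub>R \<beta> + Im (z - w) *\<^sub>R J0 \<beta>"
    by (simp add: affine_disc_def algebra_simps)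
  then have "norm (affine_disc \<alpha> \<beta> z - affine_disc \<alpha> \<beta> w) \<le> (sqrt (norm (z - w)) * sqrt (norm (z - w))) * ((1 + onorm J0) * m)"
    using lin[of "z - w"] by simp
  also have "\<dots> \<le> (sqrt (norm (z - w)) * 3) * ((1 + onorm J0) * m)"
    using s m onorm_J_nonneg by (intro mult_right_mono mult_left_mono) auto
  finally show "norm (affine_disc \<alpha> \<beta> z - affine_disc \<alpha> \<beta> w) \<le> 3 * (1 + onorm J0) * m * sqrt (norm (z - w))"
    by (simp add: algebra_simps)
qed

text \<open>The disc determined by its Cauchy-Riemann defect \<open>h\<close>: an affine disc plus the potential
  of \<open>h\<close>. The functionals \<open>A\<close> and \<open>B\<close> select the affine part so
  that the normalisation of the disc (two prescribed values, or a value together with a boundary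
  condition) does not depend on \<open>h\<close>.\<close>

definition perturbed_disc :: "((complex \<Rightarrow> 'e) \<Rightarrow> 'e) \<Rightarrow> ((complex \<Rightarrow> 'e) \<Rightarrow> 'e) \<Rightarrow> 'e \<Rightarrow> 'e \<Rightarrow> (complex \<Rightarrow> 'e) \<Rightarrow> complex \<Rightarrow> 'e" where
  "perturbed_disc A B \<alpha> \<beta> h z = affine_disc (\<alpha> - A (cauchy_green h)) (\<beta> - B (cauchy_green h)) z + cauchy_green h z"

definition perturbed_disc' :: "((complex \<Rightarrow> 'e) \<Rightarrow> 'e) \<Rightarrow> 'e \<Rightarrow> (complex \<Rightarrow> 'e) \<Rightarrow> complex \<Rightarrow> complex \<Rightarrow> 'e" where
  "perturbed_disc' B \<beta> h z d = affine_disc' (\<beta> - B (cauchy_green h)) d + cauchy_green' h z d"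

definition normalizer :: "real \<Rightarrow> ((complex \<Rightarrow> 'e) \<Rightarrow> 'e) \<Rightarrow> bool" where
  "normalizer k A \<longleftrightarrow> k \<ge> 0 \<and> (\<forall>g g'. A (\<lambda>z. g z - g' z) = A g - A g') \<and>
     (\<forall>g m. (\<forall>z. norm (g z) \<le> m) \<longrightarrow> norm (A g) \<le> k * m)"

definition perturbed_disc_const :: "real \<Rightarrow> real" where
  "perturbed_disc_const k = 1 + cauchy_green_const * (1 + 3 * (1 + onorm J0) * k)"

text \<open>The cut-off right hand side of the nonlinear Cauchy-Riemann equation. On the unit disc a fixed point
  in \<open>h\<close> solves the equation, because the defect of
  \<open>perturbed_disc A B \<alpha> \<beta> h\<close> is \<open>h\<close>.\<close>

definition disc_rhs where
  "disc_rhs Q1 Q2 A B \<alpha> \<beta> h z = cutoff z *\<^sub>R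
     (blinfun_apply (Q1 (perturbed_disc A B \<alpha> \<beta> h z)) (h z) + blinfun_apply (Q2 (perturbed_disc A B \<alpha> \<beta> h z)) (perturbed_disc' B \<beta> h z 1))"

lemma perturbed_disc_has_derivative:
  assumes "admissible M h"
  shows "(perturbed_disc A B \<alpha> \<beta> h has_derivative perturbed_disc' B \<beta> h z) (at z)"
  unfolding perturbed_disc_def[abs_def] perturbed_disc'_def[abs_def]
  by (intro has_derivative_add affine_disc_has_derivative cauchy_green_has_derivative[OF assms])

lemma perturbed_disc_dbar:
  assumes "admissible M h"
  shows "perturbed_disc' B \<beta> h z 1 + J0 (perturbed_disc' B \<beta> h z \<i>) = h z"
  using cauchy_green_dbar[OF assms, of z]
  by (simp add: perturbed_disc'_def affine_disc'_simps linear_add[OF linJ] J_J algebra_simps)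

lemma normalizerD:
  assumes "normalizer k A"
  shows "k \<ge> 0" "A (\<lambda>z. g z - g' z) = A g - A g'" "(\<And>z. norm (g z) \<le> m) \<Longrightarrow> norm (A g) \<le> k * m"
  using assms by (auto simp: normalizer_def)

context
  fixes A B :: "(complex \<Rightarrow> 'e) \<Rightarrow> 'e" and k :: real
  assumes AB: "normalizer k A" "normalizer k B"
begin

lemma perturbed_disc_pert_holder:
  assumes adm: "admissible M h"
  shows "holder (cball 0 2) (perturbed_disc_const k * M) (\<lambda>z. perturbed_disc A B \<alpha> \<beta> h z - affine_disc \<alpha> \<beta> z)"
    and "holder UNIV (perturbed_disc_const k * M) (\<lambda>z. perturbed_disc' B \<beta> h z 1 - \<beta>)"
    and "norm (perturbed_disc' B \<beta> h z \<i> - J0 \<beta>) \<le> perturbed_disc_const k * M"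
proof -
  note M = admissibleD(4)[OF adm] and k = normalizerD(1)[OF AB(1)]
  have g: "norm (cauchy_green h z) \<le> cauchy_green_const * M" for z
    using holderD(1)[OF cauchy_green_holder[OF adm]] by simp
  have c: "norm (- A (cauchy_green h)) \<le> k * (cauchy_green_const * M)" "norm (- B (cauchy_green h)) \<le> k * (cauchy_green_const * M)"
    using normalizerD(3)[OF AB(1) g] normalizerD(3)[OF AB(2) g] by auto
  have K: "3 * (1 + onorm J0) * (k * (cauchy_green_const * M)) + cauchy_green_const * M \<le> perturbed_disc_const k * M"
    using M unfolding perturbed_disc_const_def by (simp add: algebra_simps)
  have "holder (cball 0 2) (3 * (1 + onorm J0) * (k * (cauchy_green_const * M)) + cauchy_green_const * M) (\<lambda>z. affine_disc (- A (cauchy_green h)) (- B (cauchy_green h)) z + cauchy_green h z)"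
    by (intro holder_add affine_disc_holder c holder_subset[OF cauchy_green_holder[OF adm]]) auto
  then show "holder (cball 0 2) (perturbed_disc_const k * M) (\<lambda>z. perturbed_disc A B \<alpha> \<beta> h z - affine_disc \<alpha> \<beta> z)"
    using holder_mono[OF _ K] by (simp add: perturbed_disc_def add_diff_eq[symmetric] affine_disc_diff algebra_simps flip: add_diff_eq)
      (simp add: affine_disc_def linear_diff[OF linJ] linear_neg[OF linJ] algebra_simps)
  have pos: "k * (cauchy_green_const * M) \<ge> 0" using k cauchy_green_const_nonneg M by simp
  have Jm: "onorm J0 * (k * (cauchy_green_const * M)) \<ge> 0" using onorm_J_nonneg pos by simp
  have K1: "k * (cauchy_green_const * M) + cauchy_green_const * M \<le> perturbed_disc_const k * M" using K pos Jm by (simp add: algebra_simps)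
  have "holder UNIV (k * (cauchy_green_const * M) + cauchy_green_const * M) (\<lambda>z. - B (cauchy_green h) + cauchy_green' h z 1)"
    by (intro holder_add cauchy_green'_holder[OF adm]) (use c pos in \<open>auto simp: holder_def\<close>)
  then show "holder UNIV (perturbed_disc_const k * M) (\<lambda>z. perturbed_disc' B \<beta> h z 1 - \<beta>)"
    using holder_mono[OF _ K1] by (simp add: perturbed_disc'_def affine_disc'_simps)
  have "perturbed_disc' B \<beta> h z \<i> - J0 \<beta> = J0 (- B (cauchy_green h)) + cauchy_green' h z \<i>"
    by (simp add: perturbed_disc'_def affine_disc'_simps linear_diff[OF linJ] linear_neg[OF linJ])
  also have "norm \<dots> \<le> onorm J0 * (k * (cauchy_green_const * M)) + cauchy_green_const * M"
    by (intro norm_triangle_le add_mono order_trans[OF norm_J_le mult_left_mono[OF c(2) onorm_J_nonneg]]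
       holderD(1)[OF cauchy_green'_holder[OF adm]]) auto
  also have "\<dots> \<le> perturbed_disc_const k * M" using K pos Jm by (simp add: algebra_simps)
  finally show "norm (perturbed_disc' B \<beta> h z \<i> - J0 \<beta>) \<le> perturbed_disc_const k * M" .
qed

lemma perturbed_disc_diff:
  assumes "admissible M1 h1" "admissible M2 h2" and d: "admissible \<delta> (\<lambda>z. h1 z - h2 z)"
  shows "holder (cball 0 2) (perturbed_disc_const k * \<delta>) (\<lambda>z. perturbed_disc A B \<alpha> \<beta> h1 z - perturbed_disc A B \<alpha> \<beta> h2 z)"
    and "holder UNIV (perturbed_disc_const k * \<delta>) (\<lambda>z. perturbed_disc' B \<beta> h1 z 1 - perturbed_disc' B \<beta> h2 z 1)"
proof -
  have A: "cauchy_green (\<lambda>z. h1 z - h2 z) = (\<lambda>z. cauchy_green h1 z - cauchy_green h2 z)"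
    using cauchy_green_diff(1)[OF assms] by auto
  have "perturbed_disc A B \<alpha> \<beta> h1 z - perturbed_disc A B \<alpha> \<beta> h2 z = perturbed_disc A B 0 0 (\<lambda>z. h1 z - h2 z) z - affine_disc 0 0 z" for z
    unfolding perturbed_disc_def A normalizerD(2)[OF AB(1)] normalizerD(2)[OF AB(2)]
    by (simp add: affine_disc_def linear_diff[OF linJ] linear_0[OF linJ] linear_neg[OF linJ] algebra_simps)
  then show "holder (cball 0 2) (perturbed_disc_const k * \<delta>) (\<lambda>z. perturbed_disc A B \<alpha> \<beta> h1 z - perturbed_disc A B \<alpha> \<beta> h2 z)"
    using perturbed_disc_pert_holder(1)[OF d, of 0 0] by simp
  have "perturbed_disc' B \<beta> h1 z 1 - perturbed_disc' B \<beta> h2 z 1 = perturbed_disc' B 0 (\<lambda>z. h1 z - h2 z) z 1 - 0" for z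
    unfolding perturbed_disc'_def A normalizerD(2)[OF AB(2)] cauchy_green_diff(2)[OF assms] affine_disc'_simps by simp
  then show "holder UNIV (perturbed_disc_const k * \<delta>) (\<lambda>z. perturbed_disc' B \<beta> h1 z 1 - perturbed_disc' B \<beta> h2 z 1)"
    using perturbed_disc_pert_holder(2)[OF d, of 0] by simp
qed

lemma perturbed_disc_const_ge_1: "perturbed_disc_const k \<ge> 1"
  unfolding perturbed_disc_const_def using cauchy_green_const_nonneg onorm_J_nonneg normalizerD(1)[OF AB(1)] by simp

text \<open>A bound for all candidate discs with defect in the unit ball, including their
  \<open>x\<close>-derivatives.\<close>

definition disc_radius :: "real \<Rightarrow> real" where
  "disc_radius b = 1 + 3 * (1 + onorm J0) * b + perturbed_disc_const k"

definition disc_const :: "real \<Rightarrow> real \<Rightarrow> real" where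
  "disc_const b r = 96 * r * perturbed_disc_const k * (disc_radius b)\<^sup>2"

lemma perturbed_disc_in_ball:
  assumes "admissible 1 h" "norm \<alpha> \<le> b" "norm \<beta> \<le> b"
  shows "holder (cball 0 2) (disc_radius b) (perturbed_disc A B \<alpha> \<beta> h)"
    and "norm z \<le> 2 \<Longrightarrow> perturbed_disc A B \<alpha> \<beta> h z \<in> cball 0 (disc_radius b)"
proof -
  have "holder (cball 0 2) (perturbed_disc_const k * 1 + 3 * (1 + onorm J0) * b) (\<lambda>z. (perturbed_disc A B \<alpha> \<beta> h z - affine_disc \<alpha> \<beta> z) + affine_disc \<alpha> \<beta> z)"
    by (intro holder_add perturbed_disc_pert_holder(1)[OF assms(1)] affine_disc_holder assms)
  then show 1: "holder (cball 0 2) (disc_radius b) (perturbed_disc A B \<alpha> \<beta> h)"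
    using holder_mono[of "cball 0 2" "perturbed_disc_const k * 1 + 3 * (1 + onorm J0) * b" _ "disc_radius b"]
    by (simp add: disc_radius_def)
  then show "norm z \<le> 2 \<Longrightarrow> perturbed_disc A B \<alpha> \<beta> h z \<in> cball 0 (disc_radius b)"
    using holderD(1)[OF 1, of z] by simp
qed

text \<open>The common core of the construction of discs and of half-discs. The operator \<open>\<R>\<close> is
  the identity for discs and the reflection for half-discs, where the equation is imposed on
  \<open>D\<close>, the closed upper half plane, only; \<open>\<C>\<close> collects the symmetries of
  the defects. The scalar \<open>c\<close> in the hypothesis on \<open>\<R>\<close>, used with the
  values \<open>0\<close> and \<open>1\<close>, treats bounds and differences together.\<close>

lemma disc_exists:
  fixes Q1 Q2 :: "'e \<Rightarrow> 'e \<Rightarrow>\<^sub>L 'e" and \<R> :: "(complex \<Rightarrow> 'e) \<Rightarrow> complex \<Rightarrow> 'e"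
  assumes b: "norm \<alpha> \<le> b" "norm \<beta> \<le> b" and r: "r \<ge> 1"
    and \<epsilon>: "\<epsilon> \<ge> 0" "disc_const b r * \<epsilon> \<le> 1"
    and Q: "four_point (cball 0 (disc_radius b)) \<epsilon> Q1" "four_point (cball 0 (disc_radius b)) \<epsilon> Q2"
    and R1: "\<And>h h' a c. h \<in> \<C> \<Longrightarrow> h' \<in> \<C> \<Longrightarrow> admissible 1 h \<Longrightarrow> admissible 1 h' \<Longrightarrow>
         holder D a (\<lambda>z. disc_rhs Q1 Q2 A B \<alpha> \<beta> h z - c *\<^sub>R disc_rhs Q1 Q2 A B \<alpha> \<beta> h' z) \<Longrightarrow>
         holder UNIV (r * a) (\<lambda>z. \<R> (disc_rhs Q1 Q2 A B \<alpha> \<beta> h) z - c *\<^sub>R \<R> (disc_rhs Q1 Q2 A B \<alpha> \<beta> h') z)"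
    and C0: "(\<lambda>z. 0) \<in> \<C>"
    and C1: "\<And>hs h. (\<And>n. hs n \<in> \<C>) \<Longrightarrow> (\<And>z. (\<lambda>n. hs n z) \<longlonglongrightarrow> h z) \<Longrightarrow> h \<in> \<C>"
    and C2: "\<And>h z. h \<in> \<C> \<Longrightarrow> norm z > 2 \<Longrightarrow> h z = 0"
    and C3: "\<And>h. h \<in> \<C> \<Longrightarrow> admissible 1 h \<Longrightarrow> \<R> (disc_rhs Q1 Q2 A B \<alpha> \<beta> h) \<in> \<C>"
  shows "\<exists>h\<in>\<C>. admissible (disc_const b r * \<epsilon>) h \<and> \<R> (disc_rhs Q1 Q2 A B \<alpha> \<beta> h) = h"
proof -
  let ?N = "disc_rhs Q1 Q2 A B \<alpha> \<beta>"
  let ?M = "disc_const b r * \<epsilon>"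
  define \<Lambda> where "\<Lambda> = disc_radius b"
  define K where "K = perturbed_disc_const k"
  have K1: "K \<ge> 1" using perturbed_disc_const_ge_1 by (simp add: K_def)
  have b0: "b \<ge> 0" using b(1) norm_ge_zero order_trans by blast
  have \<Lambda>1: "\<Lambda> \<ge> 1" unfolding \<Lambda>_def disc_radius_def using b0 onorm_J_nonneg perturbed_disc_const_ge_1 by simp
  have M0: "?M \<ge> 0" unfolding disc_const_def using \<epsilon> r K1 K_def by simp
  have adm: "admissible m h" if "h \<in> \<C>" "holder UNIV m h" for h m
    using that C2 by (auto simp: admissible_def)
  have adm1: "admissible 1 h" if "h \<in> \<C>" "holder UNIV ?M h" for h
    by (rule adm[OF that(1) holder_mono[OF that(2) \<epsilon>(2)]])
  have FH: "holder (D \<inter> cball 0 2) \<Lambda> (perturbed_disc A B \<alpha> \<beta> h)" "holder (D \<inter> cball 0 2) \<Lambda> (\<lambda>z. perturbed_disc' B \<beta> h z 1)"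
      "z \<in> D \<inter> cball 0 2 \<Longrightarrow> perturbed_disc A B \<alpha> \<beta> h z \<in> cball 0 (disc_radius b)"
      "holder (D \<inter> cball 0 2) 1 h"
    if a: "admissible 1 h" for h z
  proof -
    note 1 = perturbed_disc_in_ball(1)[OF a b]
    then show "holder (D \<inter> cball 0 2) \<Lambda> (perturbed_disc A B \<alpha> \<beta> h)"
      unfolding \<Lambda>_def by (rule holder_subset) auto
    show "z \<in> D \<inter> cball 0 2 \<Longrightarrow> perturbed_disc A B \<alpha> \<beta> h z \<in> cball 0 (disc_radius b)"
      using perturbed_disc_in_ball(2)[OF a b] by simp
    have "holder UNIV (K * 1 + b) (\<lambda>z. (perturbed_disc' B \<beta> h z 1 - \<beta>) + \<beta>)"
      unfolding K_def by (intro holder_add perturbed_disc_pert_holder(2)[OF a]) (use b b0 in \<open>simp add: holder_def\<close>)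
    moreover have "K * 1 + b \<le> \<Lambda>" unfolding \<Lambda>_def disc_radius_def K_def
      using b0 onorm_J_nonneg mult_right_mono[of 1 "3 * (1 + onorm J0)" b] by simp
    ultimately have "holder UNIV \<Lambda> (\<lambda>z. perturbed_disc' B \<beta> h z 1)" using holder_mono by fastforce
    then show "holder (D \<inter> cball 0 2) \<Lambda> (\<lambda>z. perturbed_disc' B \<beta> h z 1)" by (rule holder_subset) auto
    show "holder (D \<inter> cball 0 2) 1 h" using a unfolding admissible_def by (blast intro: holder_subset)
  qed
  have "\<exists>h\<in>\<C>. holder UNIV ?M h \<and> \<R> (?N h) = h"
  proof (rule holder_fixed_point[OF C0 M0 C1])
    fix h assume h: "h \<in> \<C>" "holder UNIV ?M h"
    note a = adm1[OF h]
    have "holder D (8 * \<epsilon> * \<Lambda>\<^sup>2) (?N h)"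
      unfolding disc_rhs_def by (rule nonlinearity_self[OF Q \<epsilon>(1) \<Lambda>1 FH(1,2,4,3)[OF a]])
    then have "holder UNIV (r * (8 * \<epsilon> * \<Lambda>\<^sup>2)) (\<lambda>z. \<R> (?N h) z - 0 *\<^sub>R \<R> (?N h) z)"
      by (intro R1[OF h(1) h(1) a a]) simp
    moreover have "r * (8 * \<epsilon> * \<Lambda>\<^sup>2) \<le> ?M"
    proof -
      have "1 * (8 * (r * \<epsilon> * \<Lambda>\<^sup>2)) \<le> (12 * K) * (8 * (r * \<epsilon> * \<Lambda>\<^sup>2))"
        using K1 r \<epsilon> by (intro mult_right_mono) auto
      then show ?thesis unfolding disc_const_def \<Lambda>_def[symmetric] K_def[symmetric] by (simp add: mult_ac)
    qed
    ultimately have "holder UNIV ?M (\<R> (?N h))" using holder_mono by fastforce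
    then show "\<R> (?N h) \<in> \<C> \<and> holder UNIV ?M (\<R> (?N h))" using C3[OF h(1) a] by blast
  next
    fix h h' \<delta> assume h: "h \<in> \<C>" "holder UNIV ?M h" and h': "h' \<in> \<C>" "holder UNIV ?M h'"
      and d: "holder UNIV \<delta> (\<lambda>z. h z - h' z)"
    note a = adm1[OF h] and a' = adm1[OF h']
    have ad: "admissible \<delta> (\<lambda>z. h z - h' z)" unfolding admissible_def using d C2[OF h(1)] C2[OF h'(1)] by auto
    note \<delta> = admissibleD(4)[OF ad]
    have "holder D (48 * \<epsilon> * K * \<Lambda>\<^sup>2 * \<delta>) (\<lambda>z. ?N h z - ?N h' z)"
      unfolding disc_rhs_def
    proof (rule nonlinearity_contraction[OF Q \<epsilon>(1) \<Lambda>1 K1 \<delta> FH(1,2,4,3)[OF a] FH(1,2,4,3)[OF a']])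
      show "holder (D \<inter> cball 0 2) (K * \<delta>) (\<lambda>z. perturbed_disc A B \<alpha> \<beta> h z - perturbed_disc A B \<alpha> \<beta> h' z)"
        unfolding K_def by (rule holder_subset[OF perturbed_disc_diff(1)[OF a a' ad]]) auto
      show "holder (D \<inter> cball 0 2) (K * \<delta>) (\<lambda>z. perturbed_disc' B \<beta> h z 1 - perturbed_disc' B \<beta> h' z 1)"
        unfolding K_def by (rule holder_subset[OF perturbed_disc_diff(2)[OF a a' ad]]) auto
      show "holder (D \<inter> cball 0 2) \<delta> (\<lambda>z. h z - h' z)" by (rule holder_subset[OF d]) auto
    qed
    then have "holder UNIV (r * (48 * \<epsilon> * K * \<Lambda>\<^sup>2 * \<delta>)) (\<lambda>z. \<R> (?N h) z - 1 *\<^sub>R \<R> (?N h') z)"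
      by (intro R1[OF h(1) h'(1) a a']) simp
    moreover have "r * (48 * \<epsilon> * K * \<Lambda>\<^sup>2 * \<delta>) \<le> \<delta> / 2"
    proof -
      have "r * (48 * \<epsilon> * K * \<Lambda>\<^sup>2 * \<delta>) = (disc_const b r * \<epsilon>) * (\<delta> / 2)"
        unfolding disc_const_def \<Lambda>_def[symmetric] K_def[symmetric] by simp
      also have "\<dots> \<le> 1 * (\<delta> / 2)" using \<epsilon>(2) \<delta> by (intro mult_right_mono) auto
      finally show ?thesis by simp
    qed
    ultimately show "holder UNIV (\<delta> / 2) (\<lambda>z. \<R> (?N h) z - \<R> (?N h') z)" using holder_mono by fastforce
  qed
  then show ?thesis using adm by blast
qed

end

end

section \<open>Discs and half-discs for nearly constant structures\<close>

context complex_structure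
begin

lemma perturbed_disc'_continuous:
  assumes "admissible M h"
  shows "continuous_on UNIV (\<lambda>z. perturbed_disc' B \<beta> h z 1)" "continuous_on UNIV (\<lambda>z. perturbed_disc' B \<beta> h z \<i>)"
  unfolding perturbed_disc'_def
  by (intro continuous_intros holder_continuous[OF cauchy_green'_holder[OF assms]]; simp)+

text \<open>Two values of an affine disc can be prescribed, and the normalising functionals preserve them under
  perturbation. The factor \<open>2\<close> in \<open>B\<close> is the inverse distance of the points
  \<open>0\<close> and \<open>1/2\<close>.\<close>

lemma full_disc:
  fixes b :: real
  assumes b: "b \<ge> 0"
  shows "\<exists>\<epsilon>0>0. \<exists>R>0. \<forall>\<epsilon> Q1 Q2 q w. 0 \<le> \<epsilon> \<and> \<epsilon> \<le> \<epsilon>0 \<and>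
     four_point (cball 0 R) \<epsilon> (Q1 :: 'e \<Rightarrow> 'e \<Rightarrow>\<^sub>L 'e) \<and> four_point (cball 0 R) \<epsilon> (Q2 :: 'e \<Rightarrow> 'e \<Rightarrow>\<^sub>L 'e) \<and>
     norm q \<le> b \<and> norm w \<le> b \<longrightarrow>
     (\<exists>F F'. (\<forall>z. (F has_derivative F' z) (at z)) \<and> continuous_on UNIV (\<lambda>z. F' z 1) \<and> continuous_on UNIV (\<lambda>z. F' z \<i>) \<and>
        F 0 = q \<and> F (1/2) = w \<and> (\<forall>z. norm z \<le> 1 \<longrightarrow> F z \<in> cball 0 R \<and>
          F' z 1 + J0 (F' z \<i>) = Q1 (F z) (F' z 1 + J0 (F' z \<i>)) + Q2 (F z) (F' z 1)))"
proof -
  define A :: "(complex \<Rightarrow> 'e) \<Rightarrow> 'e" where "A g = g 0" for g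
  define B :: "(complex \<Rightarrow> 'e) \<Rightarrow> 'e" where "B g = 2 *\<^sub>R (g (1/2) - g 0)" for g
  have AB: "normalizer 4 A" "normalizer 4 B"
  proof -
    show "normalizer 4 A" unfolding normalizer_def A_def
    proof (intro conjI allI impI)
      fix g :: "complex \<Rightarrow> 'e" and m assume g: "\<forall>z. norm (g z) \<le> m"
      then have "norm (g 0) \<le> m" "0 \<le> m" using norm_ge_zero order_trans by blast+
      then show "norm (g 0) \<le> 4 * m" by linarith
    qed auto
    show "normalizer 4 B" unfolding normalizer_def B_def
    proof (intro conjI allI impI)
      fix g :: "complex \<Rightarrow> 'e" and m assume g: "\<forall>z. norm (g z) \<le> m"
      then have "norm (g (1/2)) \<le> m" "norm (g 0) \<le> m" by blast+
      then show "norm (2 *\<^sub>R (g (1/2) - g 0)) \<le> 4 * m" using norm_triangle_ineq4[of "g (1/2)" "g 0"] by simp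
    qed (auto simp: algebra_simps)
  qed
  define b' where "b' = 4 * b"
  define R where "R = disc_radius 4 b'"
  define E where "E = disc_const 4 b' 1"
  have R: "R > 0" unfolding R_def disc_radius_def[OF AB] b'_def
    using perturbed_disc_const_ge_1[OF AB] onorm_J_nonneg b by (simp add: add_pos_nonneg add_nonneg_pos)
  have E: "E > 0" unfolding E_def disc_const_def[OF AB] R_def[symmetric] using R perturbed_disc_const_ge_1[OF AB] by simp
  show ?thesis
  proof (rule exI[of _ "1 / E"], intro conjI exI[of _ R] allI impI, goal_cases)
    case (3 \<epsilon> Q1 Q2 q w)
    then have \<epsilon>: "\<epsilon> \<ge> 0" "E * \<epsilon> \<le> 1" and Q: "four_point (cball 0 R) \<epsilon> Q1" "four_point (cball 0 R) \<epsilon> Q2"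
      and qw: "norm q \<le> b" "norm w \<le> b" using E by (auto simp: field_simps)
    define \<beta> where "\<beta> = 2 *\<^sub>R (w - q)"
    have n: "norm q \<le> b'" "norm \<beta> \<le> b'"
      using qw b norm_triangle_ineq4[of w q] by (auto simp: b'_def \<beta>_def)
    have "\<exists>h\<in>{h. \<forall>z. norm z > 2 \<longrightarrow> h z = 0}. admissible (E * \<epsilon>) h \<and> (\<lambda>G. G) (disc_rhs Q1 Q2 A B q \<beta> h) = h"
      unfolding E_def
    proof (rule disc_exists[OF AB n order_refl \<epsilon>(1) _ Q[unfolded R_def], where D=UNIV])
      show "disc_const 4 b' 1 * \<epsilon> \<le> 1" using \<epsilon>(2) by (simp add: E_def)
      fix hs :: "nat \<Rightarrow> complex \<Rightarrow> 'e" and h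
      assume hs: "\<And>n. hs n \<in> {h. \<forall>z. norm z > 2 \<longrightarrow> h z = 0}" and l: "\<And>z. (\<lambda>n. hs n z) \<longlonglongrightarrow> h z"
      show "h \<in> {h. \<forall>z. norm z > 2 \<longrightarrow> h z = 0}"
      proof (intro CollectI allI impI)
        fix z :: complex assume "norm z > 2"
        then have "(\<lambda>n. hs n z) = (\<lambda>n. 0)" using hs by auto
        then show "h z = 0" using l[of z] LIMSEQ_const_iff by metis
      qed
    qed (auto simp: disc_rhs_def cutoff_simps)
    then obtain h where adm: "admissible (E * \<epsilon>) h" and h: "disc_rhs Q1 Q2 A B q \<beta> h = h" by auto
    have adm1: "admissible 1 h" using adm holder_mono[OF _ \<epsilon>(2)] unfolding admissible_def by blast
    show ?case
    proof (rule exI[of _ "perturbed_disc A B q \<beta> h"], rule exI[of _ "perturbed_disc' B \<beta> h"], intro conjI allI impI)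
      show "perturbed_disc A B q \<beta> h 0 = q" by (simp add: perturbed_disc_def affine_disc_def A_def)
      have "(1/2) *\<^sub>R (\<beta> - B (cauchy_green h)) = (w - q) - (cauchy_green h (1/2) - cauchy_green h 0)"
        by (simp add: \<beta>_def B_def algebra_simps)
      then show "perturbed_disc A B q \<beta> h (1/2) = w" by (simp add: perturbed_disc_def affine_disc_def A_def)
      fix z :: complex
      show "(perturbed_disc A B q \<beta> h has_derivative perturbed_disc' B \<beta> h z) (at z)" by (rule perturbed_disc_has_derivative[OF adm])
      assume z: "norm z \<le> 1"
      show "perturbed_disc A B q \<beta> h z \<in> cball 0 R" unfolding R_def using perturbed_disc_in_ball(2)[OF AB adm1 n] z by simp
      have "h z = disc_rhs Q1 Q2 A B q \<beta> h z" using h by simp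
      then show "perturbed_disc' B \<beta> h z 1 + J0 (perturbed_disc' B \<beta> h z \<i>) = Q1 (perturbed_disc A B q \<beta> h z) (perturbed_disc' B \<beta> h z 1 + J0 (perturbed_disc' B \<beta> h z \<i>))
          + Q2 (perturbed_disc A B q \<beta> h z) (perturbed_disc' B \<beta> h z 1)"
        unfolding perturbed_disc_dbar[OF adm] using z by (simp add: disc_rhs_def cutoff_simps)
    qed (use perturbed_disc'_continuous[OF adm] in auto)
  qed (use E R in auto)
qed

end

text \<open>An antilinear involution; its fixed vectors form a maximal totally real subspace.\<close>

locale real_form = complex_structure J0 for J0 :: "'e::euclidean_space \<Rightarrow> 'e" +
  fixes \<sigma> :: "'e \<Rightarrow> 'e"
  assumes lin\<sigma>: "linear \<sigma>" and \<sigma>_\<sigma>: "\<sigma> (\<sigma> x) = x" and \<sigma>_J: "\<sigma> (J0 x) = - J0 (\<sigma> x)"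
begin

lemma \<sigma>_bounded_linear: "bounded_linear \<sigma>"
  using lin\<sigma> by (simp add: linear_conv_bounded_linear)

lemma norm_\<sigma>_le: "norm (\<sigma> x) \<le> onorm \<sigma> * norm x"
  by (rule onorm[OF \<sigma>_bounded_linear])

lemma onorm_\<sigma>_nonneg: "onorm \<sigma> \<ge> 0"
  by (rule onorm_pos_le[OF \<sigma>_bounded_linear])

definition re_at :: "'e \<Rightarrow> 'e" where "re_at Z = (1/2) *\<^sub>R (Z + \<sigma> Z)"

text \<open>With \<open>re_at\<close>, the two real vectors for which the affine disc
  \<open>\<alpha> + z \<beta>\<close> passes through \<open>Z\<close> at the time
  \<open>\<i> \<tau>\<close> and maps the real axis into the fixed space of \<open>\<sigma>\<close>.\<close>

definition im_at :: "real \<Rightarrow> 'e \<Rightarrow> 'e" where "im_at \<tau> Z = - (1 / (2 * \<tau>)) *\<^sub>R J0 (Z - \<sigma> Z)"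

lemma re_im_at: "\<tau> > 0 \<Longrightarrow> re_at Z + \<tau> *\<^sub>R J0 (im_at \<tau> Z) = Z"
  unfolding re_at_def im_at_def
  by (simp add: linear_scale[OF linJ] J_J linear_neg[OF linJ] scaleR_half_double algebra_simps flip: scaleR_add_left)

lemma re_at_fixed: "\<sigma> (re_at Z) = re_at Z"
  unfolding re_at_def by (simp add: linear_scale[OF lin\<sigma>] linear_add[OF lin\<sigma>] \<sigma>_\<sigma> add.commute)

lemma im_at_fixed: "\<sigma> (im_at \<tau> Z) = im_at \<tau> Z"
  unfolding im_at_def
  by (simp add: linear_scale[OF lin\<sigma>] linear_diff[OF lin\<sigma>] linear_neg[OF lin\<sigma>] \<sigma>_J \<sigma>_\<sigma> linear_diff[OF linJ] algebra_simps)

lemma re_at_diff: "re_at (x - y) = re_at x - re_at y"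
  and im_at_diff: "im_at \<tau> (x - y) = im_at \<tau> x - im_at \<tau> y"
  unfolding re_at_def im_at_def by (simp_all add: linear_diff[OF lin\<sigma>] linear_diff[OF linJ] linear_add[OF linJ] algebra_simps)

lemma norm_re_im_at:
  assumes \<tau>: "\<tau> > 0" and Z: "norm Z \<le> m"
  shows "norm (re_at Z) \<le> (1 + onorm \<sigma>) * (1 + onorm J0 / \<tau>) * m"
    and "norm (im_at \<tau> Z) \<le> (1 + onorm \<sigma>) * (1 + onorm J0 / \<tau>) * m"
proof -
  have m: "m \<ge> 0" using Z norm_ge_zero order_trans by blast
  have S: "norm (\<sigma> Z) \<le> onorm \<sigma> * m" using order_trans[OF norm_\<sigma>_le mult_left_mono[OF Z onorm_\<sigma>_nonneg]] .
  have s: "norm (Z + \<sigma> Z) \<le> (1 + onorm \<sigma>) * m" "norm (Z - \<sigma> Z) \<le> (1 + onorm \<sigma>) * m"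
    using norm_triangle_ineq[of Z "\<sigma> Z"] norm_triangle_ineq4[of Z "\<sigma> Z"] S Z by (auto simp: algebra_simps)
  have p: "0 \<le> (1 + onorm \<sigma>) * m" using m onorm_\<sigma>_nonneg by simp
  have q: "0 \<le> onorm J0 / \<tau> * ((1 + onorm \<sigma>) * m)" using p \<tau> onorm_J_nonneg by simp
  have "norm (re_at Z) \<le> (1 + onorm \<sigma>) * m" unfolding re_at_def using s p by simp
  also have "\<dots> \<le> (1 + onorm \<sigma>) * (1 + onorm J0 / \<tau>) * m" using q by (simp add: algebra_simps add_divide_distrib)
  finally show "norm (re_at Z) \<le> (1 + onorm \<sigma>) * (1 + onorm J0 / \<tau>) * m" .
  have "norm (im_at \<tau> Z) = 1 / (2 * \<tau>) * norm (J0 (Z - \<sigma> Z))" unfolding im_at_def using \<tau> by simp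
  also have "\<dots> \<le> 1 / (2 * \<tau>) * (onorm J0 * ((1 + onorm \<sigma>) * m))"
    using \<tau> by (intro mult_left_mono order_trans[OF norm_J_le mult_left_mono[OF s(2) onorm_J_nonneg]]) auto
  also have "\<dots> = (onorm J0 / \<tau> * ((1 + onorm \<sigma>) * m)) / 2" by simp
  also have "\<dots> \<le> (1 + onorm \<sigma>) * (1 + onorm J0 / \<tau>) * m" 
  proof -
    have "(1 + onorm \<sigma>) * (1 + onorm J0 / \<tau>) * m = (1 + onorm \<sigma>) * m + onorm J0 / \<tau> * ((1 + onorm \<sigma>) * m)"
      by (simp add: algebra_simps add_divide_distrib)
    moreover have "y / 2 \<le> x" if "x = p + y" "0 \<le> y" "0 \<le> p" for x y p :: real using that by linarith
    ultimately show ?thesis using q p by blast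
  qed
  finally show "norm (im_at \<tau> Z) \<le> (1 + onorm \<sigma>) * (1 + onorm J0 / \<tau>) * m" .
qed

lemma affine_disc_fixed: "\<sigma> \<alpha> = \<alpha> \<Longrightarrow> \<sigma> \<beta> = \<beta> \<Longrightarrow> \<sigma> (affine_disc \<alpha> \<beta> (of_real x)) = affine_disc \<alpha> \<beta> (of_real x)"
  unfolding affine_disc_def by (simp add: linear_add[OF lin\<sigma>] linear_scale[OF lin\<sigma>] linear_0[OF lin\<sigma>])

text \<open>The condition that \<open>Q2\<close> vanishes on the real vectors makes the right hand side vanish
  on the real axis (there the defect \<open>h\<close> vanishes as well). Hence its reflection is again
  Hoelder continuous, the potential of the reflected density is symmetric, and so the real axis is
  mapped to real vectors.\<close>

lemma half_disc:
  fixes b \<tau> :: real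
  assumes b: "b \<ge> 0" and \<tau>: "\<tau> > 0"
  shows "\<exists>\<epsilon>0>0. \<exists>K>0. \<exists>R>0. \<forall>\<epsilon> Q1 Q2 Z. 0 \<le> \<epsilon> \<and> \<epsilon> \<le> \<epsilon>0 \<and>
     four_point (cball 0 R) \<epsilon> (Q1 :: 'e \<Rightarrow> 'e \<Rightarrow>\<^sub>L 'e) \<and> four_point (cball 0 R) \<epsilon> (Q2 :: 'e \<Rightarrow> 'e \<Rightarrow>\<^sub>L 'e) \<and>
     (\<forall>X\<in>cball 0 R. \<sigma> X = X \<longrightarrow> Q2 X = 0) \<and> norm Z \<le> b \<longrightarrow>
     (\<exists>F F'. (\<forall>z. (F has_derivative F' z) (at z)) \<and> continuous_on UNIV (\<lambda>z. F' z 1) \<and> continuous_on UNIV (\<lambda>z. F' z \<i>) \<and>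
        F (\<i> * of_real \<tau>) = Z \<and> (\<forall>x::real. \<sigma> (F (of_real x)) = F (of_real x)) \<and>
        (\<forall>z. norm z \<le> 1 \<longrightarrow> F z \<in> cball 0 R) \<and>
        (\<forall>z. norm z \<le> 1 \<and> Im z \<ge> 0 \<longrightarrow>
          F' z 1 + J0 (F' z \<i>) = Q1 (F z) (F' z 1 + J0 (F' z \<i>)) + Q2 (F z) (F' z 1)) \<and>
        (\<forall>z. norm (F' z 1 - im_at \<tau> Z) \<le> K * \<epsilon>) \<and> (\<forall>z. norm (F' z \<i> - J0 (im_at \<tau> Z)) \<le> K * \<epsilon>))"
proof -
  define k where "k = (1 + onorm \<sigma>) * (1 + onorm J0 / \<tau>)"
  define A where "A g = re_at (g (\<i> * of_real \<tau>))" for g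
  define B where "B g = im_at \<tau> (g (\<i> * of_real \<tau>))" for g
  have k0: "k \<ge> 0" unfolding k_def using onorm_\<sigma>_nonneg onorm_J_nonneg \<tau> by simp
  have AB: "normalizer k A" "normalizer k B"
    unfolding normalizer_def A_def B_def using norm_re_im_at[OF \<tau>] k0 by (auto simp: k_def re_at_diff im_at_diff)
  define s where "s = 1 + onorm \<sigma>"
  have s: "s \<ge> 1" "1 + s \<ge> 1" using onorm_\<sigma>_nonneg by (auto simp: s_def)
  have s\<sigma>: "norm (\<sigma> x) \<le> s * norm x" for x
    using norm_\<sigma>_le[of x] by (simp add: s_def algebra_simps) (use norm_ge_zero[of x] in linarith)
  define b' where "b' = k * b"
  have b': "b' \<ge> 0" using k0 b by (simp add: b'_def)
  define R where "R = disc_radius k b'"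
  define E where "E = disc_const k b' (1 + s)"
  have R: "R > 0" unfolding R_def disc_radius_def[OF AB]
    using perturbed_disc_const_ge_1[OF AB] onorm_J_nonneg b' by (simp add: add_pos_nonneg add_nonneg_pos)
  have E: "E > 0" unfolding E_def disc_const_def[OF AB] R_def[symmetric] using R perturbed_disc_const_ge_1[OF AB] s by simp
  define K where "K = perturbed_disc_const k * E"
  have K: "K > 0" unfolding K_def using E perturbed_disc_const_ge_1[OF AB] by simp
  show ?thesis
  proof (rule exI[of _ "1 / E"], intro conjI, goal_cases)
    case 2
    show ?case
    proof (rule exI[of _ K], intro conjI exI[of _ R] allI impI, goal_cases)
      case (3 \<epsilon> Q1 Q2 Z)
      then have \<epsilon>: "\<epsilon> \<ge> 0" "E * \<epsilon> \<le> 1" and Q: "four_point (cball 0 R) \<epsilon> Q1" "four_point (cball 0 R) \<epsilon> Q2"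
        and Q0: "\<And>X. X \<in> cball 0 R \<Longrightarrow> \<sigma> X = X \<Longrightarrow> Q2 X = 0"
        and Z: "norm Z \<le> b" using E by (auto simp: field_simps)
      define \<alpha> \<beta> where "\<alpha> = re_at Z" and "\<beta> = im_at \<tau> Z"
      have n: "norm \<alpha> \<le> b'" "norm \<beta> \<le> b'"
        using norm_re_im_at[OF \<tau> Z] by (auto simp: \<alpha>_def \<beta>_def b'_def k_def)
      let ?N = "disc_rhs Q1 Q2 A B \<alpha> \<beta>"
      define \<C> where "\<C> = {h. (\<forall>z. norm z > 2 \<longrightarrow> h z = 0) \<and> (\<forall>z. h (cnj z) = \<sigma> (h z)) \<and> (\<forall>z. Im z = 0 \<longrightarrow> h z = 0)}"
      have fixF: "\<sigma> (perturbed_disc A B \<alpha> \<beta> h (of_real x)) = perturbed_disc A B \<alpha> \<beta> h (of_real x)"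
        if h: "h \<in> \<C>" "admissible m h" for h m x
      proof -
        have "cauchy_green h (cnj (of_real x)) = \<sigma> (cauchy_green h (of_real x))"
          by (rule cauchy_green_reflect[OF h(2) lin\<sigma> \<sigma>_J]) (use h(1) \<C>_def in auto)
        moreover have "\<sigma> (affine_disc (\<alpha> - A (cauchy_green h)) (\<beta> - B (cauchy_green h)) (of_real x)) = affine_disc (\<alpha> - A (cauchy_green h)) (\<beta> - B (cauchy_green h)) (of_real x)"
          by (intro affine_disc_fixed) (simp_all add: A_def B_def \<alpha>_def \<beta>_def linear_diff[OF lin\<sigma>] re_at_fixed im_at_fixed)
        ultimately show ?thesis unfolding perturbed_disc_def by (simp add: linear_add[OF lin\<sigma>])
      qed
      \<comment> \<open>On the axis the disc is real, so \<open>Q2\<close> vanishes there, and the other term contains \<open>h\<close>.\<close>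
      have N0: "?N h z = 0" if h: "h \<in> \<C>" "admissible 1 h" and z: "Im z = 0" for h z
      proof (cases "norm z > 2")
        case False
        have zr: "z = of_real (Re z)" using z by (simp add: complex_eq_iff)
        have "Q2 (perturbed_disc A B \<alpha> \<beta> h z) = 0"
          using fixF[OF h, of "Re z"] perturbed_disc_in_ball(2)[OF AB h(2) n, of z] False zr
          by (intro Q0) (auto simp: R_def)
        moreover have "h z = 0" using h z by (auto simp: \<C>_def)
        ultimately show ?thesis unfolding disc_rhs_def by simp
      qed (simp add: disc_rhs_def cutoff_simps)
      have "\<exists>h\<in>\<C>. admissible (E * \<epsilon>) h \<and> reflect \<sigma> (?N h) = h"
        unfolding E_def
      proof (rule disc_exists[OF AB n s(2) \<epsilon>(1) _ Q[unfolded R_def], where D="{z. Im z \<ge> 0}"])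
        show "disc_const k b' (1 + s) * \<epsilon> \<le> 1" using \<epsilon>(2) by (simp add: E_def)
        show "(\<lambda>z. 0) \<in> \<C>" by (simp add: \<C>_def linear_0[OF lin\<sigma>])
        show "h z = 0" if "h \<in> \<C>" "norm z > 2" for h z using that by (auto simp: \<C>_def)
        show "reflect \<sigma> (?N h) \<in> \<C>" if h: "h \<in> \<C>" "admissible 1 h" for h
          unfolding \<C>_def
        proof (intro CollectI conjI allI impI)
          fix z :: complex
          show "norm z > 2 \<Longrightarrow> reflect \<sigma> (?N h) z = 0"
            by (simp add: reflect_def disc_rhs_def cutoff_simps linear_0[OF lin\<sigma>])
          show "Im z = 0 \<Longrightarrow> reflect \<sigma> (?N h) z = 0" using N0[OF h] by (simp add: reflect_def)
          consider "Im z > 0" | "Im z = 0" | "Im z < 0" by linarith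
          then show "reflect \<sigma> (?N h) (cnj z) = \<sigma> (reflect \<sigma> (?N h) z)"
            by cases (auto simp: reflect_def \<sigma>_\<sigma> N0[OF h] linear_0[OF lin\<sigma>])
        qed
      next
        fix h h' a c assume h: "h \<in> \<C>" "h' \<in> \<C>" "admissible 1 h" "admissible 1 h'"
          and ho: "holder {z. 0 \<le> Im z} a (\<lambda>z. ?N h z - c *\<^sub>R ?N h' z)"
        have "holder UNIV ((1 + s) * a) (reflect \<sigma> (\<lambda>z. ?N h z - c *\<^sub>R ?N h' z))"
          by (rule holder_reflect[OF ho _ lin\<sigma> s\<sigma> s(1)]) (simp add: N0 h)
        moreover have "reflect \<sigma> (\<lambda>z. ?N h z - c *\<^sub>R ?N h' z) = (\<lambda>z. reflect \<sigma> (?N h) z - c *\<^sub>R reflect \<sigma> (?N h') z)"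
          by (auto simp: reflect_def linear_diff[OF lin\<sigma>] linear_scale[OF lin\<sigma>])
        ultimately show "holder UNIV ((1 + s) * a) (\<lambda>z. reflect \<sigma> (?N h) z - c *\<^sub>R reflect \<sigma> (?N h') z)" by simp
      next
        fix hs :: "nat \<Rightarrow> complex \<Rightarrow> 'e" and h
        assume hs: "\<And>n. hs n \<in> \<C>" and l: "\<And>z. (\<lambda>n. hs n z) \<longlonglongrightarrow> h z"
        have z0: "h z = 0" if "\<And>n. hs n z = 0" for z
        proof -
          have "(\<lambda>n. hs n z) = (\<lambda>n. 0)" using that by auto
          then show "h z = 0" using l[of z] LIMSEQ_const_iff by metis
        qed
        show "h \<in> \<C>" unfolding \<C>_def
        proof (intro CollectI conjI allI impI)
          fix z :: complex
          show "norm z > 2 \<Longrightarrow> h z = 0" "Im z = 0 \<Longrightarrow> h z = 0" using hs by (auto intro!: z0 simp: \<C>_def)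
          have "(\<lambda>n. hs n (cnj z)) = (\<lambda>n. \<sigma> (hs n z))" using hs by (auto simp: \<C>_def)
          then have "(\<lambda>n. \<sigma> (hs n z)) \<longlonglongrightarrow> h (cnj z)" using l[of "cnj z"] by simp
          moreover have "(\<lambda>n. \<sigma> (hs n z)) \<longlonglongrightarrow> \<sigma> (h z)"
            by (intro bounded_linear.tendsto[OF \<sigma>_bounded_linear] l)
          ultimately show "h (cnj z) = \<sigma> (h z)" using LIMSEQ_unique by blast
        qed
      qed
      then obtain h where hC: "h \<in> \<C>" and adm: "admissible (E * \<epsilon>) h" and h: "reflect \<sigma> (?N h) = h" by auto
      have adm1: "admissible 1 h" using adm holder_mono[OF _ \<epsilon>(2)] unfolding admissible_def by blast
      show ?case
      proof (rule exI[of _ "perturbed_disc A B \<alpha> \<beta> h"], rule exI[of _ "perturbed_disc' B \<beta> h"], intro conjI allI impI; (elim conjE)?)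
        show "perturbed_disc A B \<alpha> \<beta> h (\<i> * of_real \<tau>) = Z"
        proof -
          have "perturbed_disc A B \<alpha> \<beta> h (\<i> * of_real \<tau>) = (\<alpha> + \<tau> *\<^sub>R J0 \<beta>) - (A (cauchy_green h) + \<tau> *\<^sub>R J0 (B (cauchy_green h))) + cauchy_green h (\<i> * of_real \<tau>)"
            by (simp add: perturbed_disc_def affine_disc_def linear_diff[OF linJ] algebra_simps)
          then show ?thesis unfolding \<alpha>_def \<beta>_def A_def B_def re_im_at[OF \<tau>] by simp
        qed
        show "\<sigma> (perturbed_disc A B \<alpha> \<beta> h (of_real x)) = perturbed_disc A B \<alpha> \<beta> h (of_real x)" for x by (rule fixF[OF hC adm])
        fix z :: complex
        show "(perturbed_disc A B \<alpha> \<beta> h has_derivative perturbed_disc' B \<beta> h z) (at z)" by (rule perturbed_disc_has_derivative[OF adm])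
        show "norm z \<le> 1 \<Longrightarrow> perturbed_disc A B \<alpha> \<beta> h z \<in> cball 0 R" unfolding R_def using perturbed_disc_in_ball(2)[OF AB adm1 n] by simp
        show "norm (perturbed_disc' B \<beta> h z 1 - im_at \<tau> Z) \<le> K * \<epsilon>"
          using holderD(1)[OF perturbed_disc_pert_holder(2)[OF AB adm, of \<beta>]] by (simp add: \<beta>_def K_def mult.assoc)
        show "norm (perturbed_disc' B \<beta> h z \<i> - J0 (im_at \<tau> Z)) \<le> K * \<epsilon>"
          using perturbed_disc_pert_holder(3)[OF AB adm, of \<beta>] by (simp add: \<beta>_def K_def mult.assoc)
        assume z: "norm z \<le> 1" "0 \<le> Im z"
        have "h z = reflect \<sigma> (?N h) z" using h by simp
        then show "perturbed_disc' B \<beta> h z 1 + J0 (perturbed_disc' B \<beta> h z \<i>) = Q1 (perturbed_disc A B \<alpha> \<beta> h z) (perturbed_disc' B \<beta> h z 1 + J0 (perturbed_disc' B \<beta> h z \<i>))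
            + Q2 (perturbed_disc A B \<alpha> \<beta> h z) (perturbed_disc' B \<beta> h z 1)"
          unfolding perturbed_disc_dbar[OF adm] using z by (simp add: disc_rhs_def reflect_def cutoff_simps)
      qed (use perturbed_disc'_continuous[OF adm] in auto)
    qed (use K R in auto)
  qed (use E in auto)
qed

end

section \<open>Maps with bounded mixed second differences\<close>

lemma four_pointD:
  assumes "four_point B M F"
  shows "a \<in> B \<Longrightarrow> norm (F a) \<le> M" "a \<in> B \<Longrightarrow> b \<in> B \<Longrightarrow> norm (F a - F b) \<le> M * norm (a - b)"
    "a \<in> B \<Longrightarrow> b \<in> B \<Longrightarrow> c \<in> B \<Longrightarrow> d \<in> B \<Longrightarrow> norm (F a - F b - (F c - F d)) \<le>
        M * (norm (a - b - (c - d)) + (norm (a - b) + norm (c - d)) * (norm (a - c) + norm (b - d)))"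
  using assms unfolding four_point_def by auto

text \<open>Bounded mixed second differences, with an unspecified constant. The closure properties below replace
  computations with second derivatives.\<close>

definition regular_on :: "'a::real_normed_vector set \<Rightarrow> ('a \<Rightarrow> 'b::real_normed_vector) \<Rightarrow> bool" where
  "regular_on B F \<longleftrightarrow> (\<exists>M\<ge>0. four_point B M F)"

lemma four_point_mono:
  assumes "four_point B M F" "M \<le> M'" shows "four_point B M' F"
proof -
  have *: "M * x \<le> M' * x" if "x \<ge> 0" for x using assms(2) that by (rule mult_right_mono)
  show ?thesis unfolding four_point_def
    by (intro conjI ballI order_trans[OF four_pointD(1)[OF assms(1)]] order_trans[OF four_pointD(2)[OF assms(1)]]
       order_trans[OF four_pointD(3)[OF assms(1)]] * assms(2)) auto
qed

lemma regular_on_const: "regular_on B (\<lambda>y. c)"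
  unfolding regular_on_def by (rule exI[of _ "norm c"]) (simp add: four_point_def)

lemma regular_on_add:
  assumes "regular_on B F" "regular_on B G" shows "regular_on B (\<lambda>y. F y + G y)"
proof -
  obtain M N where M: "M \<ge> 0" "four_point B M F" and N: "N \<ge> 0" "four_point B N G"
    using assms by (auto simp: regular_on_def)
  have "four_point B (M + N) (\<lambda>y. F y + G y)"
    unfolding four_point_def
  proof (intro conjI ballI)
    fix a assume a: "a \<in> B"
    show "norm (F a + G a) \<le> M + N"
      by (intro norm_triangle_le add_mono four_pointD(1)[OF M(2)] four_pointD(1)[OF N(2)] a)
    fix b assume b: "b \<in> B"
    have "norm ((F a - F b) + (G a - G b)) \<le> M * norm (a - b) + N * norm (a - b)"
      by (intro norm_triangle_le add_mono four_pointD(2)[OF M(2)] four_pointD(2)[OF N(2)] a b)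
    then show "norm (F a + G a - (F b + G b)) \<le> (M + N) * norm (a - b)"
      by (simp add: algebra_simps)
    fix c d assume cd: "c \<in> B" "d \<in> B"
    let ?e = "norm (a - b - (c - d)) + (norm (a - b) + norm (c - d)) * (norm (a - c) + norm (b - d))"
    have "norm ((F a - F b - (F c - F d)) + (G a - G b - (G c - G d))) \<le> M * ?e + N * ?e"
      by (intro norm_triangle_le add_mono four_pointD(3)[OF M(2)] four_pointD(3)[OF N(2)] a b cd)
    then show "norm (F a + G a - (F b + G b) - (F c + G c - (F d + G d))) \<le> (M + N) * ?e"
      unfolding distrib_right[of M N] by (simp add: algebra_simps)
  qed
  then show ?thesis unfolding regular_on_def using M(1) N(1) by (intro exI[of _ "M + N"]) auto
qed

lemma regular_on_linear_compose:
  assumes L: "bounded_linear L" and F: "regular_on B F" shows "regular_on B (\<lambda>y. L (F y))"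
proof -
  obtain M where M: "M \<ge> 0" "four_point B M F" using F by (auto simp: regular_on_def)
  obtain K where K: "K \<ge> 0" "\<And>x. norm (L x) \<le> norm x * K" using bounded_linear.nonneg_bounded[OF L] by auto
  note lin = bounded_linear.linear[OF L]
  have *: "norm (L x) \<le> K * M * e" if "norm x \<le> M * e" for x e
    using K(2)[of x] mult_right_mono[OF that K(1)] by (simp add: mult_ac)
  have "four_point B (K * M) (\<lambda>y. L (F y))"
    unfolding four_point_def
  proof (intro conjI ballI)
    fix a assume a: "a \<in> B"
    show "norm (L (F a)) \<le> K * M" using *[of "F a" 1] four_pointD(1)[OF M(2) a] by simp
    fix b assume b: "b \<in> B"
    show "norm (L (F a) - L (F b)) \<le> K * M * norm (a - b)"
      unfolding linear_diff[OF lin, symmetric] by (intro * four_pointD(2)[OF M(2)] a b)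
    fix c d assume cd: "c \<in> B" "d \<in> B"
    show "norm (L (F a) - L (F b) - (L (F c) - L (F d))) \<le> K * M * (norm (a - b - (c - d)) + (norm (a - b) + norm (c - d)) * (norm (a - c) + norm (b - d)))"
      unfolding linear_diff[OF lin, symmetric] by (intro * four_pointD(3)[OF M(2)] a b cd)
  qed
  then show ?thesis unfolding regular_on_def using M(1) K(1) by (intro exI[of _ "K * M"]) auto
qed

lemma regular_on_id:
  assumes "bounded B" shows "regular_on B (\<lambda>y. y)"
proof -
  obtain K where K: "K > 0" "\<And>x. x \<in> B \<Longrightarrow> norm x \<le> K" using assms bounded_normE by metis
  have "four_point B (max 1 K) (\<lambda>y. y)"
    unfolding four_point_def
  proof (intro conjI ballI)
    have *: "x \<le> y \<Longrightarrow> 0 \<le> y \<Longrightarrow> x \<le> max 1 K * y" for x y :: real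
      using mult_right_mono[of 1 "max 1 K" y] by auto
    fix a assume a: "a \<in> B" then show "norm a \<le> max 1 K" using K(2)[of a] by auto
    fix b
    show "norm (a - b) \<le> max 1 K * norm (a - b)" by (rule *) auto
    fix c d
    show "norm (a - b - (c - d)) \<le> max 1 K * (norm (a - b - (c - d)) + (norm (a - b) + norm (c - d)) * (norm (a - c) + norm (b - d)))"
      by (rule *) auto
  qed
  then show ?thesis unfolding regular_on_def by (intro exI[of _ "max 1 K"]) auto
qed

lemma regular_on_linear: "bounded B \<Longrightarrow> bounded_linear L \<Longrightarrow> regular_on B L"
  by (rule regular_on_linear_compose[OF _ regular_on_id])

lemma regular_on_bilinear:
  assumes P: "bounded_bilinear prd" and F: "regular_on B F" and G: "regular_on B G"
  shows "regular_on B (\<lambda>y. prd (F y) (G y))"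
proof -
  obtain M' N' where M': "M' \<ge> 0" "four_point B M' F" and N': "N' \<ge> 0" "four_point B N' G"
    using F G by (auto simp: regular_on_def)
  define M where "M = max M' N'"
  have M: "M \<ge> 0" "four_point B M F" "four_point B M G"
    using M' N' four_point_mono unfolding M_def by (auto intro: four_point_mono)
  obtain K where K: "K \<ge> 0" "\<And>x y. norm (prd x y) \<le> norm x * norm y * K"
    using bounded_bilinear.nonneg_bounded[OF P] by auto
  have *: "norm (prd x y) \<le> K * M * M * (e * f)" if "norm x \<le> M * e" "norm y \<le> M * f" "e \<ge> 0" for x y e f
  proof -
    have "norm x * norm y \<le> (M * e) * (M * f)" using that M by (intro mult_mono) auto
    from mult_right_mono[OF this K(1)] K(2)[of x y] show ?thesis by (simp add: mult_ac)
  qed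
  note bil = bounded_bilinear.diff_left[OF P] bounded_bilinear.diff_right[OF P]
  have "four_point B (4 * (K * M * M)) (\<lambda>y. prd (F y) (G y))"
    unfolding four_point_def
  proof (intro conjI ballI)
    have KM: "0 \<le> K * M * M" using K M by simp
    fix a assume a: "a \<in> B"
    have "norm (prd (F a) (G a)) \<le> K * M * M" using *[of "F a" 1 "G a" 1] four_pointD(1)[OF M(2) a] four_pointD(1)[OF M(3) a] by simp
    then show "norm (prd (F a) (G a)) \<le> 4 * (K * M * M)" using KM by linarith
    fix b assume b: "b \<in> B"
    have "norm (prd (F a - F b) (G a) + prd (F b) (G a - G b)) \<le> K * M * M * (norm (a - b) * 1) + K * M * M * (1 * norm (a - b))"
      using four_pointD(1)[OF M(3) a] four_pointD(1)[OF M(2) b]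
      by (intro norm_triangle_le add_mono * four_pointD(2)[OF M(2) a b] four_pointD(2)[OF M(3) a b]) auto
    also have "\<dots> \<le> 4 * (K * M * M) * norm (a - b)" 
      using mult_nonneg_nonneg[OF KM norm_ge_zero[of "a - b"]] by (simp add: mult_ac)
    finally show "norm (prd (F a) (G a) - prd (F b) (G b)) \<le> 4 * (K * M * M) * norm (a - b)"
      by (simp add: bil)
    fix c d assume cd: "c \<in> B" "d \<in> B"
    let ?ab = "norm (a - b)" and ?cd = "norm (c - d)" and ?ac = "norm (a - c)" and ?bd = "norm (b - d)"
    let ?e = "norm (a - b - (c - d)) + (?ab + ?cd) * (?ac + ?bd)"
    have "prd (F a) (G a) - prd (F b) (G b) - (prd (F c) (G c) - prd (F d) (G d)) =
       (prd (F a - F b - (F c - F d)) (G a) + prd (F c - F d) (G a - G c)) +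
       (prd (F b) (G a - G b - (G c - G d)) + prd (F b - F d) (G c - G d))"
      by (simp add: bil)
    also have "norm \<dots> \<le> (K * M * M * (?e * 1) + K * M * M * (?cd * ?ac)) + (K * M * M * (1 * ?e) + K * M * M * (?bd * ?cd))"
      using four_pointD(1)[OF M(3) a] four_pointD(1)[OF M(2) b]
      by (intro norm_triangle_le add_mono * four_pointD(2)[OF M(2)] four_pointD(2)[OF M(3)]
          four_pointD(3)[OF M(2)] four_pointD(3)[OF M(3)] a b cd) auto
    also have "\<dots> = (K * M * M) * (2 * ?e + ?cd * ?ac + ?bd * ?cd)" by (simp add: algebra_simps)
    also have "\<dots> \<le> (K * M * M) * (4 * ?e)"
    proof (intro mult_left_mono KM)
      have "?cd * ?ac \<le> (?ab + ?cd) * (?ac + ?bd)" "?bd * ?cd \<le> (?ab + ?cd) * (?ac + ?bd)"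
        by (auto simp: algebra_simps intro: add_nonneg_nonneg)
      then have "?cd * ?ac \<le> ?e" "?bd * ?cd \<le> ?e" using norm_ge_zero[of "a - b - (c - d)"] by linarith+
      moreover have "2 * e + x + y \<le> 4 * e" if "x \<le> e" "y \<le> e" for x y e :: real using that by linarith
      ultimately show "2 * ?e + ?cd * ?ac + ?bd * ?cd \<le> 4 * ?e" by blast
    qed
    finally show "norm (prd (F a) (G a) - prd (F b) (G b) - (prd (F c) (G c) - prd (F d) (G d))) \<le> 4 * (K * M * M) * ?e"
      by (simp add: mult_ac)
  qed
  then show ?thesis unfolding regular_on_def using K(1) M(1) by (intro exI[of _ "4 * (K * M * M)"]) auto
qed

text \<open>The second difference of the inner function is multiplied by a Lipschitz constant, and products of
  its first differences are again of the quadratic form allowed in the bound.\<close>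

lemma regular_on_compose:
  assumes F: "regular_on B F" and G: "regular_on B' G" and FB: "\<And>y. y \<in> B \<Longrightarrow> F y \<in> B'"
  shows "regular_on B (\<lambda>y. G (F y))"
proof -
  obtain M' N' where M': "M' \<ge> 0" "four_point B M' F" and N': "N' \<ge> 0" "four_point B' N' G"
    using F G by (auto simp: regular_on_def)
  define M where "M = max 1 M'"
  have M: "M \<ge> 1" "four_point B M F" using M' four_point_mono unfolding M_def by (auto intro: four_point_mono)
  note N = N'
  have "four_point B (N' * (2 * (M * M))) (\<lambda>y. G (F y))"
    unfolding four_point_def
  proof (intro conjI ballI)
    have MM: "M \<le> M * M" "1 \<le> M * M" using M(1) mult_mono[of 1 M 1 M] by auto
    fix a assume a: "a \<in> B"
    have "N' * 1 \<le> N' * (2 * (M * M))" using N(1) MM by (intro mult_left_mono) auto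
    then show "norm (G (F a)) \<le> N' * (2 * (M * M))" using four_pointD(1)[OF N(2) FB[OF a]] by simp
    fix b assume b: "b \<in> B"
    have "norm (G (F a) - G (F b)) \<le> N' * norm (F a - F b)" by (intro four_pointD(2)[OF N(2)] FB a b)
    also have "\<dots> \<le> N' * (M * norm (a - b))" by (intro mult_left_mono four_pointD(2)[OF M(2)] a b N)
    also have "\<dots> \<le> N' * ((2 * (M * M)) * norm (a - b))" using MM by (intro mult_left_mono mult_right_mono N) auto
    finally show "norm (G (F a) - G (F b)) \<le> N' * (2 * (M * M)) * norm (a - b)" by (simp add: mult_ac)
    fix c d assume cd: "c \<in> B" "d \<in> B"
    let ?q = "(norm (a - b) + norm (c - d)) * (norm (a - c) + norm (b - d))"
    have "norm (G (F a) - G (F b) - (G (F c) - G (F d))) \<le> N' * (norm (F a - F b - (F c - F d)) +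
        (norm (F a - F b) + norm (F c - F d)) * (norm (F a - F c) + norm (F b - F d)))"
      by (intro four_pointD(3)[OF N(2)] FB a b cd)
    also have "\<dots> \<le> N' * (M * (norm (a - b - (c - d)) + ?q) +
        (M * norm (a - b) + M * norm (c - d)) * (M * norm (a - c) + M * norm (b - d)))"
      using M(1) by (intro mult_left_mono add_mono mult_mono four_pointD(2)[OF M(2)] four_pointD(3)[OF M(2)] a b cd N) auto
    also have "\<dots> = N' * (M * norm (a - b - (c - d)) + (M + M * M) * ?q)" by (simp add: algebra_simps)
    also have "\<dots> \<le> N' * (2 * (M * M) * norm (a - b - (c - d)) + (M * M + M * M) * ?q)"
      using MM M(1) by (intro mult_left_mono add_mono mult_right_mono N) auto
    finally have "norm (G (F a) - G (F b) - (G (F c) - G (F d))) \<le> N' * (2 * (M * M)) * (norm (a - b - (c - d)) + ?q)"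
      by (simp add: algebra_simps)
    then show "norm (G (F a) - G (F b) - (G (F c) - G (F d))) \<le> N' * (2 * (M * M)) * (norm (a - b - (c - d)) + ?q)" .
  qed
  then show ?thesis unfolding regular_on_def using M(1) N(1) by (intro exI[of _ "N' * (2 * (M * M))"]) auto
qed

lemma regular_on_blinfun:
  fixes T :: "'a::real_normed_vector \<Rightarrow> 'e::euclidean_space \<Rightarrow>\<^sub>L 'f::real_normed_vector"
  assumes "\<And>\<beta>. \<beta> \<in> Basis \<Longrightarrow> regular_on B (\<lambda>y. T y \<beta>)"
  shows "regular_on B T"
proof -
  from assms have "\<forall>\<beta>\<in>Basis. \<exists>M\<ge>0. four_point B M (\<lambda>y. T y \<beta>)" by (auto simp: regular_on_def)
  then obtain m where m: "\<And>\<beta>. \<beta> \<in> Basis \<Longrightarrow> m \<beta> \<ge> 0 \<and> four_point B (m \<beta>) (\<lambda>y. T y \<beta>)" by metis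
  let ?M = "\<Sum>\<beta>\<in>Basis. m \<beta>"
  have *: "norm S \<le> ?M * e" if "\<And>\<beta>. \<beta> \<in> Basis \<Longrightarrow> norm (blinfun_apply S \<beta>) \<le> m \<beta> * e" for S :: "'e \<Rightarrow>\<^sub>L 'f" and e
  proof -
    have "norm S \<le> (\<Sum>\<beta>\<in>Basis. norm (S \<beta>))" by (rule norm_blinfun_euclidean_le)
    also have "\<dots> \<le> (\<Sum>\<beta>\<in>Basis. m \<beta> * e)" by (intro sum_mono that)
    finally show ?thesis by (simp add: sum_distrib_right)
  qed
  have "four_point B ?M T"
    unfolding four_point_def
  proof (intro conjI ballI)
    fix a assume a: "a \<in> B"
    show "norm (T a) \<le> ?M" using *[of "T a" 1] m four_pointD(1) a by fastforce
    fix b assume b: "b \<in> B"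
    show "norm (T a - T b) \<le> ?M * norm (a - b)"
      by (intro *, unfold blinfun.diff_left) (use m four_pointD(2) a b in blast)
    fix c d assume cd: "c \<in> B" "d \<in> B"
    show "norm (T a - T b - (T c - T d)) \<le> ?M * (norm (a - b - (c - d)) + (norm (a - b) + norm (c - d)) * (norm (a - c) + norm (b - d)))"
      by (intro *, unfold blinfun.diff_left) (use m four_pointD(3) a b cd in blast)
  qed
  then show ?thesis unfolding regular_on_def using m by (intro exI[of _ ?M]) (auto intro: sum_nonneg)
qed

lemma onorm_le_sum_Basis:
  fixes f :: "'e::euclidean_space \<Rightarrow> 'b::real_normed_vector"
  assumes "linear f" shows "onorm f \<le> (\<Sum>\<beta>\<in>Basis. norm (f \<beta>))"
proof (rule onorm_le)
  fix x
  have "f x = f (\<Sum>\<beta>\<in>Basis. (x \<bullet> \<beta>) *\<^sub>R \<beta>)" by (simp add: euclidean_representation)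
  also have "\<dots> = (\<Sum>\<beta>\<in>Basis. (x \<bullet> \<beta>) *\<^sub>R f \<beta>)" by (simp add: linear_sum[OF assms] linear_scale[OF assms])
  finally have "norm (f x) \<le> (\<Sum>\<beta>\<in>Basis. norm ((x \<bullet> \<beta>) *\<^sub>R f \<beta>))" 
    using norm_sum[of "\<lambda>\<beta>. (x \<bullet> \<beta>) *\<^sub>R f \<beta>" Basis] by simp
  also have "\<dots> \<le> (\<Sum>\<beta>\<in>Basis. norm (f \<beta>) * norm x)"
  proof (intro sum_mono)
    fix \<beta> :: 'e assume "\<beta> \<in> Basis"
    then have "\<bar>x \<bullet> \<beta>\<bar> * norm (f \<beta>) \<le> norm x * norm (f \<beta>)" by (intro mult_right_mono Basis_le_norm) auto
    then show "norm ((x \<bullet> \<beta>) *\<^sub>R f \<beta>) \<le> norm (f \<beta>) * norm x" by (simp add: mult.commute[of _ "norm x"])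
  qed
  finally show "norm (f x) \<le> (\<Sum>\<beta>\<in>Basis. norm (f \<beta>)) * norm x" by (simp add: sum_distrib_right)
qed

lemma Ck_Suc_derivative:
  assumes "Ck_on (Suc k) S f" "x \<in> S"
  shows "(f has_derivative frechet_derivative f (at x)) (at x)"
  using assms frechet_derivative_works by auto

lemma Ck_continuous:
  assumes "Ck_on k S f" shows "continuous_on S f"
  using assms
proof (cases k)
  case (Suc j)
  then show ?thesis using assms Ck_Suc_derivative
    by (metis continuous_at_imp_continuous_on has_derivative_continuous)
qed simp

text \<open>The mixed second difference of the four points is the increment of
  \<open>s \<mapsto> f (b + s (a - b)) - f (d + s (c - d))\<close>, so it is bounded through the
  derivative of that curve and the Lipschitz constant of the derivative of \<open>f\<close>.\<close>

lemma four_point_C2: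
  fixes f :: "'e::euclidean_space \<Rightarrow> 'b::real_normed_vector"
  assumes f: "Ck_on 2 V f" and B: "compact B" "convex B" "B \<subseteq> V"
  shows "regular_on B f"
proof -
  define D where "D x v = frechet_derivative f (at x) v" for x v
  define DD where "DD v x w = frechet_derivative (\<lambda>x. D x v) (at x) w" for v x w
  have f2: "Ck_on (Suc (Suc 0)) V f" using f by (simp add: numeral_2_eq_2)
  have D: "(f has_derivative D x) (at x)" if "x \<in> V" for x
    using Ck_Suc_derivative[OF f2 that] by (simp add: D_def[abs_def])
  have D1: "Ck_on (Suc 0) V (\<lambda>x. D x v)" for v using f2 by (simp add: D_def[abs_def])
  have DD: "((\<lambda>x. D x v) has_derivative DD v x) (at x)" if "x \<in> V" for x v
    using Ck_Suc_derivative[OF D1 that] by (simp add: DD_def[abs_def])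
  have DDc: "continuous_on V (\<lambda>x. DD v x w)" for v w using D1[of v] by (simp add: DD_def[abs_def])
  have bdd: "\<exists>m\<ge>0. \<forall>x\<in>B. norm (g x) \<le> m" if "continuous_on V g" for g :: "'e \<Rightarrow> 'b"
  proof -
    have "bounded (g ` B)" by (rule compact_imp_bounded[OF compact_continuous_image[OF continuous_on_subset[OF that B(3)] B(1)]])
    then obtain m where "\<forall>y\<in>g ` B. norm y \<le> m" unfolding bounded_iff by blast
    then show ?thesis by (intro exI[of _ "max 0 m"]) auto
  qed
  obtain m0 where m0: "m0 \<ge> 0" "\<And>x. x \<in> B \<Longrightarrow> norm (f x) \<le> m0" using bdd[OF Ck_continuous[OF f]] by blast
  obtain m1 where m1: "\<And>v. m1 v \<ge> 0" "\<And>v x. x \<in> B \<Longrightarrow> norm (D x v) \<le> m1 v" using bdd[OF Ck_continuous[OF D1]] by metis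
  have "\<exists>m\<ge>0. \<forall>x\<in>B. norm (DD v x w) \<le> m" for v w by (rule bdd[OF DDc])
  then obtain m2 where m2: "\<And>v w. m2 v w \<ge> 0" "\<And>v w x. x \<in> B \<Longrightarrow> norm (DD v x w) \<le> m2 v w" by metis
  define M1 where "M1 = (\<Sum>\<beta>\<in>Basis. m1 \<beta>)"
  define M2 where "M2 = (\<Sum>\<beta>\<in>Basis. \<Sum>\<gamma>\<in>Basis. m2 \<beta> \<gamma>)"
  have M12: "M1 \<ge> 0" "M2 \<ge> 0" unfolding M1_def M2_def by (auto intro!: sum_nonneg m1 m2)
  have linD: "linear (D x)" if "x \<in> B" for x using D B that has_derivative_linear by blast
  have oD: "onorm (D x) \<le> M1" if "x \<in> B" for x
    unfolding M1_def by (rule order_trans[OF onorm_le_sum_Basis[OF linD[OF that]] sum_mono]) (use m1 that in auto)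
  have nD: "norm (D x v) \<le> M1 * norm v" if "x \<in> B" for x v
    using onorm[of "D x" v] oD[OF that] linD[OF that] mult_right_mono[OF oD[OF that], of "norm v"]
    by (simp add: linear_conv_bounded_linear)
  have lipD: "norm (D x v - D y v) \<le> M2 * norm (x - y) * norm v" if xy: "x \<in> B" "y \<in> B" for x y v
  proof -
    have 1: "norm (D x \<beta> - D y \<beta>) \<le> (\<Sum>\<gamma>\<in>Basis. m2 \<beta> \<gamma>) * norm (x - y)" for \<beta>
    proof (rule differentiable_bound[OF B(2) _ _ xy])
      fix z assume z: "z \<in> B"
      show "((\<lambda>x. D x \<beta>) has_derivative DD \<beta> z) (at z within B)" using DD z B has_derivative_at_withinI by blast
      show "onorm (DD \<beta> z) \<le> (\<Sum>\<gamma>\<in>Basis. m2 \<beta> \<gamma>)"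
        by (rule order_trans[OF onorm_le_sum_Basis sum_mono]) (use m2 z B in \<open>auto intro: has_derivative_linear[OF DD]\<close>)
    qed
    have lin: "linear (\<lambda>v. D x v - D y v)" using linD xy by (intro linear_compose_sub) auto
    have "onorm (\<lambda>v. D x v - D y v) \<le> (\<Sum>\<beta>\<in>Basis. (\<Sum>\<gamma>\<in>Basis. m2 \<beta> \<gamma>) * norm (x - y))"
      by (rule order_trans[OF onorm_le_sum_Basis[OF lin] sum_mono]) (rule 1)
    also have "\<dots> = M2 * norm (x - y)" unfolding M2_def by (simp add: sum_distrib_right)
    finally have o1: "onorm (\<lambda>v. D x v - D y v) \<le> M2 * norm (x - y)" .
    have o2: "norm (D x v - D y v) \<le> onorm (\<lambda>v. D x v - D y v) * norm v"
      using lin by (intro onorm) (simp add: linear_conv_bounded_linear)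
    show ?thesis by (rule order_trans[OF o2 mult_right_mono[OF o1 norm_ge_zero]])
  qed
  have "four_point B (m0 + M1 + M2) f"
    unfolding four_point_def
  proof (intro conjI ballI)
    fix a assume a: "a \<in> B"
    show "norm (f a) \<le> m0 + M1 + M2" using m0(2)[OF a] M12 by linarith
    fix b assume b: "b \<in> B"
    have "norm (f a - f b) \<le> M1 * norm (a - b)"
      by (rule differentiable_bound[OF B(2) _ oD a b]) (use D B has_derivative_at_withinI in blast)
    also have "\<dots> \<le> (m0 + M1 + M2) * norm (a - b)" using m0 M12 by (intro mult_right_mono) auto
    finally show "norm (f a - f b) \<le> (m0 + M1 + M2) * norm (a - b)" .
    fix c d assume cd: "c \<in> B" "d \<in> B"
    let ?q = "(norm (a - b) + norm (c - d)) * (norm (a - c) + norm (b - d))"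
    define \<phi> where "\<phi> s = f (b + s *\<^sub>R (a - b)) - f (d + s *\<^sub>R (c - d))" for s :: real
    define \<phi>' where "\<phi>' s = D (b + s *\<^sub>R (a - b)) (a - b) - D (d + s *\<^sub>R (c - d)) (c - d)" for s :: real
    have inB: "b + s *\<^sub>R (a - b) \<in> B" "d + s *\<^sub>R (c - d) \<in> B" if "s \<in> {0..1}" for s
    proof -
      have "b + s *\<^sub>R (a - b) = (1 - s) *\<^sub>R b + s *\<^sub>R a" "d + s *\<^sub>R (c - d) = (1 - s) *\<^sub>R d + s *\<^sub>R c"
        by (simp_all add: algebra_simps)
      then show "b + s *\<^sub>R (a - b) \<in> B" "d + s *\<^sub>R (c - d) \<in> B"
        using that a b cd convexD_alt[OF B(2)] by auto
    qed
    have "norm (\<phi> 1 - \<phi> 0) \<le> (M1 * norm (a - b - (c - d)) + M2 * ?q) * norm (1 - 0 :: real)"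
    proof (rule differentiable_bound[where S="{0..1}" and f'="\<lambda>s t. t *\<^sub>R \<phi>' s"])
      fix s :: real assume s: "s \<in> {0..1}"
      have "((\<lambda>s. f (b + s *\<^sub>R (a - b))) has_derivative (\<lambda>t. D (b + s *\<^sub>R (a - b)) (t *\<^sub>R (a - b)))) (at s within {0..1})"
        by (rule has_derivative_compose[where f="\<lambda>s. b + s *\<^sub>R (a - b)"]) (use D inB[OF s] B in \<open>auto intro!: derivative_eq_intros\<close>)
      moreover have "((\<lambda>s. f (d + s *\<^sub>R (c - d))) has_derivative (\<lambda>t. D (d + s *\<^sub>R (c - d)) (t *\<^sub>R (c - d)))) (at s within {0..1})"
        by (rule has_derivative_compose[where f="\<lambda>s. d + s *\<^sub>R (c - d)"]) (use D inB[OF s] B in \<open>auto intro!: derivative_eq_intros\<close>)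
      ultimately have "(\<phi> has_derivative (\<lambda>t. D (b + s *\<^sub>R (a - b)) (t *\<^sub>R (a - b)) - D (d + s *\<^sub>R (c - d)) (t *\<^sub>R (c - d)))) (at s within {0..1})"
        unfolding \<phi>_def[abs_def] by (rule has_derivative_diff)
      then show "(\<phi> has_derivative (\<lambda>t. t *\<^sub>R \<phi>' s)) (at s within {0..1})"
        unfolding \<phi>'_def linear_scale[OF linD[OF inB(1)[OF s]]] linear_scale[OF linD[OF inB(2)[OF s]]] scaleR_diff_right[symmetric] .
      have "\<phi>' s = D (b + s *\<^sub>R (a - b)) (a - b - (c - d)) + (D (b + s *\<^sub>R (a - b)) (c - d) - D (d + s *\<^sub>R (c - d)) (c - d))"
        unfolding \<phi>'_def by (simp add: linear_diff[OF linD] inB[OF s])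
      also have "norm \<dots> \<le> M1 * norm (a - b - (c - d)) + M2 * norm (b + s *\<^sub>R (a - b) - (d + s *\<^sub>R (c - d))) * norm (c - d)"
        by (intro norm_triangle_le add_mono nD lipD inB[OF s])
      also have "\<dots> \<le> M1 * norm (a - b - (c - d)) + M2 * (norm (a - c) + norm (b - d)) * (norm (a - b) + norm (c - d))"
      proof (intro add_mono mult_mono mult_left_mono)
        have "b + s *\<^sub>R (a - b) - (d + s *\<^sub>R (c - d)) = (1 - s) *\<^sub>R (b - d) + s *\<^sub>R (a - c)"
          by (simp add: algebra_simps)
        also have "norm \<dots> \<le> 1 * norm (b - d) + 1 * norm (a - c)"
          using s by (intro norm_triangle_le add_mono) (auto intro!: mult_left_le_one_le)
        finally show "norm (b + s *\<^sub>R (a - b) - (d + s *\<^sub>R (c - d))) \<le> norm (a - c) + norm (b - d)" by simp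
      qed (use M12 in auto)
      finally have "norm (\<phi>' s) \<le> M1 * norm (a - b - (c - d)) + M2 * ?q" by (simp add: mult_ac)
      then show "onorm (\<lambda>t. t *\<^sub>R \<phi>' s) \<le> M1 * norm (a - b - (c - d)) + M2 * ?q"
        by (intro onorm_le) (simp add: mult.commute mult_left_mono)
    qed auto
    also have "\<dots> \<le> (m0 + M1 + M2) * (norm (a - b - (c - d)) + ?q)"
      unfolding distrib_left using m0 M12 by (simp, intro add_mono mult_right_mono) auto
    finally show "norm (f a - f b - (f c - f d)) \<le> (m0 + M1 + M2) * (norm (a - b - (c - d)) + ?q)"
      by (simp add: \<phi>_def algebra_simps)
  qed
  then show ?thesis unfolding regular_on_def using m0 M12 by (intro exI[of _ "m0 + M1 + M2"]) auto
qed

section \<open>Coordinates adapted to a totally real plane\<close>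

text \<open>\<open>J\<close> is the matrix of an almost complex structure in a chart and \<open>DJ v\<close> its
  derivative in the direction \<open>v\<close>. \<open>P\<close> is meant to be the projection to a
  totally real subspace along its image under \<open>J p\<close>, or the identity.\<close>

locale normal_coordinates =
  fixes J :: "'e::euclidean_space \<Rightarrow> 'e \<Rightarrow>\<^sub>L 'e" and DJ :: "'e \<Rightarrow> 'e \<Rightarrow> 'e \<Rightarrow>\<^sub>L 'e"
    and p :: 'e and r0 :: real and P :: "'e \<Rightarrow> 'e"
  assumes r0: "r0 > 0"
    and J_sq: "x \<in> cball p r0 \<Longrightarrow> J x (J x e) = - e"
    and J_rgl: "regular_on (cball p r0) J" and DJ_rgl: "regular_on (cball p r0) (DJ v)"
    and J_deriv: "x \<in> cball p r0 \<Longrightarrow> (J has_derivative (\<lambda>v. DJ v x)) (at x)"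
    and linP: "linear P"
begin

lemma P_bounded_linear: "bounded_linear P"
  using linP by (simp add: linear_conv_bounded_linear)

text \<open>If \<open>P\<close> is the projection to a totally real subspace along its image, then
  \<open>Z = P Z + J p (\<kappa> Z)\<close> with \<open>P Z\<close> and \<open>\<kappa> Z\<close> in
  the subspace.\<close>

definition \<kappa> :: "'e \<Rightarrow> 'e" where "\<kappa> Z = - J p (Z - P Z)"

lemma \<kappa>_bounded_linear: "bounded_linear \<kappa>"
  unfolding \<kappa>_def[abs_def]
  by (intro bounded_linear_minus bounded_linear_compose[OF blinfun.bounded_linear_right]
      bounded_linear_sub bounded_linear_ident P_bounded_linear)

lemma \<kappa>_linear: "linear \<kappa>"
  using \<kappa>_bounded_linear bounded_linear.linear by blast

lemma p_in: "p \<in> cball p r0" using r0 by simp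

lemma J_\<kappa>: "J p (\<kappa> Z) = Z - P Z"
  unfolding \<kappa>_def by (simp add: blinfun.minus_right J_sq[OF p_in])

text \<open>The coordinates around \<open>b\<close> that send \<open>X + J p Y\<close> to
  \<open>b + X + J (b + X) Y\<close> for \<open>X\<close> and \<open>Y\<close> in the range of
  \<open>P\<close>. On the range of \<open>P\<close> they are the translation by \<open>b\<close>, and
  there \<open>J\<close> is pulled back to the constant structure \<open>J p\<close>. For
  \<open>P = id\<close> they are a translation.\<close>

definition Phi :: "'e \<Rightarrow> 'e \<Rightarrow> 'e" where
  "Phi b Z = b + P Z + J (b + P Z) (\<kappa> Z)"

definition Amap :: "'e \<Rightarrow> 'e \<Rightarrow> 'e \<Rightarrow>\<^sub>L 'e" where
  "Amap b Z = Blinfun (\<lambda>W. P W + J (b + P Z) (\<kappa> W) + DJ (P W) (b + P Z) (\<kappa> Z))"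

lemma Amap_apply:
  assumes "b + P Z \<in> cball p r0"
  shows "Amap b Z W = P W + J (b + P Z) (\<kappa> W) + DJ (P W) (b + P Z) (\<kappa> Z)"
proof -
  have "bounded_linear (\<lambda>v. DJ v (b + P Z))"
    using has_derivative_bounded_linear[OF J_deriv[OF assms]] .
  then have "bounded_linear (\<lambda>W. P W + J (b + P Z) (\<kappa> W) + DJ (P W) (b + P Z) (\<kappa> Z))"
    by (intro bounded_linear_add P_bounded_linear bounded_linear_compose[OF blinfun.bounded_linear_right \<kappa>_bounded_linear]
       bounded_linear_compose[OF blinfun.bounded_linear_left] bounded_linear_compose[OF _ P_bounded_linear])
  then show ?thesis unfolding Amap_def by (simp add: bounded_linear_Blinfun_apply)
qed

lemma Phi_has_derivative:
  assumes "b + P Z \<in> cball p r0"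
  shows "(Phi b has_derivative Amap b Z) (at Z)"
proof -
  have 1: "((\<lambda>Z. b + P Z) has_derivative P) (at Z)"
    by (auto intro!: derivative_eq_intros bounded_linear_imp_has_derivative P_bounded_linear)
  have "((\<lambda>Z. J (b + P Z)) has_derivative (\<lambda>W. DJ (P W) (b + P Z))) (at Z)"
    by (rule has_derivative_compose[OF 1 J_deriv[OF assms]])
  from bounded_bilinear.FDERIV[OF bounded_bilinear_blinfun_apply this
      bounded_linear_imp_has_derivative[OF \<kappa>_bounded_linear]]
  have "((\<lambda>Z. J (b + P Z) (\<kappa> Z)) has_derivative (\<lambda>W. J (b + P Z) (\<kappa> W) + DJ (P W) (b + P Z) (\<kappa> Z))) (at Z)" .
  from has_derivative_add[OF 1 this]
  have "(Phi b has_derivative (\<lambda>W. P W + (J (b + P Z) (\<kappa> W) + DJ (P W) (b + P Z) (\<kappa> Z)))) (at Z)"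
    unfolding Phi_def[abs_def] by (simp add: add.assoc)
  moreover have "blinfun_apply (Amap b Z) = (\<lambda>W. P W + (J (b + P Z) (\<kappa> W) + DJ (P W) (b + P Z) (\<kappa> Z)))"
    using Amap_apply[OF assms] by (auto simp: add.assoc)
  ultimately show ?thesis by simp
qed

text \<open>With \<open>Q2\<close>, the coefficients of the equation for \<open>J\<close>-complex discs in the
  coordinates \<open>Phi b\<close>, solved for the Cauchy-Riemann defect with respect to
  \<open>J p\<close>. Both vanish at the origin for \<open>b = p\<close>, hence are small nearby.\<close>

definition Q1 :: "'e \<Rightarrow> 'e \<Rightarrow> 'e \<Rightarrow>\<^sub>L 'e" where
  "Q1 b Z = id_blinfun + (J p o\<^sub>L (Amap b Z o\<^sub>L J p))"

definition Q2 :: "'e \<Rightarrow> 'e \<Rightarrow> 'e \<Rightarrow>\<^sub>L 'e" where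
  "Q2 b Z = J p o\<^sub>L ((J (Phi b Z) o\<^sub>L Amap b Z) - (Amap b Z o\<^sub>L J p))"

lemma holomorphic_from_rhs:
  assumes "Fx + J p Fy = Q1 b Z (Fx + J p Fy) + Q2 b Z Fx"
  shows "Amap b Z Fy = J (Phi b Z) (Amap b Z Fx)"
proof -
  let ?h = "Fx + J p Fy"
  have JJ: "J p (J p x) = - x" for x by (rule J_sq[OF p_in])
  have "J p (Amap b Z (J p ?h)) + J p (J (Phi b Z) (Amap b Z Fx) - Amap b Z (J p Fx)) = 0"
    using assms by (simp add: Q1_def Q2_def blinfun.add_left blinfun.diff_left algebra_simps)
  then have "J p (Amap b Z (J p ?h) + J (Phi b Z) (Amap b Z Fx) - Amap b Z (J p Fx)) = 0"
    by (simp add: blinfun.add_right blinfun.diff_right algebra_simps)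
  from arg_cong[OF this, of "\<lambda>x. J p x"]
  have "Amap b Z (J p ?h) + J (Phi b Z) (Amap b Z Fx) - Amap b Z (J p Fx) = 0"
    unfolding JJ by (simp add: blinfun.zero_right)
  then show ?thesis by (simp add: blinfun.add_right blinfun.diff_right blinfun.minus_right JJ algebra_simps)
qed

text \<open>On the range of \<open>P\<close> the coordinates pull \<open>J\<close> back to \<open>J p\<close>
  exactly, and \<open>Q2\<close> measures the difference of these two structures.\<close>

lemma Q2_zero:
  assumes PJ: "\<And>x. P (J p x) = J p (x - P x)" and PZ: "P Z = Z" and x: "b + Z \<in> cball p r0"
  shows "Q2 b Z = 0"
proof -
  have x': "b + P Z \<in> cball p r0" using x PZ by simp
  have k: "\<kappa> Z = 0" unfolding \<kappa>_def PZ by (simp add: blinfun.zero_right)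
  have A: "Amap b Z W = P W + J (b + Z) (\<kappa> W)" for W
    unfolding Amap_apply[OF x'] k PZ by (simp add: blinfun.zero_right)
  have Phi: "Phi b Z = b + Z" unfolding Phi_def k PZ by (simp add: blinfun.zero_right)
  have JJ: "J p (J p x) = - x" for x by (rule J_sq[OF p_in])
  have kJ: "\<kappa> (J p W) = P W" for W
    unfolding \<kappa>_def PJ by (simp add: blinfun.diff_right JJ)
  have PJk: "P (J p W) = - \<kappa> W" for W unfolding \<kappa>_def PJ by simp
  have "Q2 b Z W = 0" for W
    unfolding Q2_def Phi
    by (simp add: blinfun.diff_left A kJ PJk blinfun.add_right J_sq[OF x] blinfun.zero_right)
  then show ?thesis by (intro blinfun_eqI) simp
qed

text \<open>The arguments \<open>Z\<close> and \<open>b\<close> are estimated as one variable, so that all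
  constants are uniform in \<open>b\<close>.\<close>

definition parameter_ball :: "real \<Rightarrow> ('e \<times> 'e) set" where
  "parameter_ball r = cball 0 r \<times> cball p r"

lemma parameter_ball_bounded: "bounded (parameter_ball r)"
  unfolding parameter_ball_def by (intro bounded_Times) auto

text \<open>The bounds on the coordinates and on the coefficients after dilation by \<open>\<delta>\<close>. The
  dilation makes the coefficients of size \<open>\<delta>\<close> on balls of fixed radius.\<close>

definition estimate :: "real \<Rightarrow> real \<Rightarrow> bool" where
  "estimate r M \<longleftrightarrow> r > 0 \<and> M \<ge> 0 \<and>
     (\<forall>Z b. norm Z \<le> r \<and> norm (b - p) \<le> r \<longrightarrow> b + P Z \<in> cball p r0 \<and> Phi b Z \<in> cball p r0 \<and>
       norm (Amap b Z - id_blinfun) \<le> M * (norm Z + norm (b - p)) \<and>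
       norm (Phi b Z - (b + Z)) \<le> M * norm Z * (norm Z + norm (b - p)) \<and>
       (\<forall>Z'. norm Z' \<le> r \<longrightarrow> norm (Amap b Z - Amap b Z') \<le> M * norm (Z - Z'))) \<and>
     (\<forall>\<delta> b R. 0 < \<delta> \<and> \<delta> \<le> 1 \<and> 0 \<le> R \<and> \<delta> * R \<le> r \<and> norm (b - p) \<le> \<delta> \<and> norm (b - p) \<le> r \<longrightarrow>
       four_point (cball 0 R) (M * \<delta> * (R + 1)) (\<lambda>Z. Q1 b (\<delta> *\<^sub>R Z)) \<and>
       four_point (cball 0 R) (M * \<delta> * (R + 1)) (\<lambda>Z. Q2 b (\<delta> *\<^sub>R Z)))"

lemma estimate_exists: "\<exists>r M. estimate r M"
proof -
  obtain k where k: "k \<ge> 0" "\<And>x. norm (P x) \<le> norm x * k" using bounded_linear.nonneg_bounded[OF P_bounded_linear] by auto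
  obtain k' where k': "k' \<ge> 0" "\<And>x. norm (\<kappa> x) \<le> norm x * k'" using bounded_linear.nonneg_bounded[OF \<kappa>_bounded_linear] by auto
  obtain MJ where MJ: "MJ \<ge> 0" "four_point (cball p r0) MJ J" using J_rgl by (auto simp: regular_on_def)
  \<comment> \<open>The coordinates enlarge norms at most by the factor \<open>c\<close>.\<close>
  define c where "c = 1 + k + MJ * k'"
  have c: "c \<ge> 1" using k k' MJ by (simp add: c_def)
  define r where "r = r0 / c"
  have r: "r > 0" using r0 c by (simp add: r_def)
  have rc: "r * c = r0" using c by (simp add: r_def)
  have in0: "norm (b + P Z - p) \<le> r * (1 + k)" if "norm Z \<le> r" "norm (b - p) \<le> r" for b Z
  proof -
    have "norm ((b - p) + P Z) \<le> r + r * k"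
      by (intro norm_triangle_le add_mono that order_trans[OF k(2) mult_right_mono[OF that(1) k(1)]])
    then show ?thesis by (simp add: algebra_simps)
  qed
  have in1: "b + P Z \<in> cball p r0" if "norm Z \<le> r" "norm (b - p) \<le> r" for b Z
  proof -
    have "r * (1 + k) \<le> r * c" using r k' MJ by (intro mult_left_mono) (auto simp: c_def)
    then show ?thesis using in0[OF that] rc by (simp add: dist_norm norm_minus_commute)
  qed
  have in2: "Phi b Z \<in> cball p r0" if Z: "norm Z \<le> r" "norm (b - p) \<le> r" for b Z
  proof -
    have "norm (J (b + P Z) (\<kappa> Z)) \<le> MJ * (r * k')"
      using norm_blinfun[of "J (b + P Z)" "\<kappa> Z"] mult_mono[OF four_pointD(1)[OF MJ(2) in1[OF Z]]
        order_trans[OF k'(2) mult_right_mono[OF Z(1) k'(1)]]] MJ(1) by simp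
    then have "norm ((b + P Z - p) + J (b + P Z) (\<kappa> Z)) \<le> r * (1 + k) + MJ * (r * k')"
      by (intro norm_triangle_le add_mono in0 Z)
    also have "\<dots> = r0" using rc by (simp add: c_def algebra_simps)
    finally show ?thesis by (simp add: dist_norm Phi_def norm_minus_commute algebra_simps)
  qed
  have parameter_ball_in: "y \<in> parameter_ball r \<Longrightarrow> norm (fst y) \<le> r \<and> norm (snd y - p) \<le> r" for y
    by (auto simp: parameter_ball_def dist_norm norm_minus_commute)
  have lin1: "bounded_linear (\<lambda>y::'e \<times> 'e. snd y + P (fst y))" "bounded_linear (\<lambda>y::'e \<times> 'e. \<kappa> (fst y))"
    by (intro bounded_linear_add bounded_linear_snd bounded_linear_compose[OF P_bounded_linear]
        bounded_linear_compose[OF \<kappa>_bounded_linear] bounded_linear_fst)+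
  have Rx: "regular_on (parameter_ball r) (\<lambda>y. snd y + P (fst y))" and Rk: "regular_on (parameter_ball r) (\<lambda>y. \<kappa> (fst y))"
    by (rule regular_on_linear[OF parameter_ball_bounded lin1(1)], rule regular_on_linear[OF parameter_ball_bounded lin1(2)])
  have Jx: "regular_on (parameter_ball r) (\<lambda>y. J (snd y + P (fst y)))"
    by (rule regular_on_compose[OF Rx J_rgl]) (use in1 parameter_ball_in in auto)
  have DJx: "regular_on (parameter_ball r) (\<lambda>y. DJ v (snd y + P (fst y)))" for v
    by (rule regular_on_compose[OF Rx DJ_rgl]) (use in1 parameter_ball_in in auto)
  have RA: "regular_on (parameter_ball r) (\<lambda>y. Amap (snd y) (fst y))"
  proof (rule regular_on_blinfun)
    fix \<beta> :: 'e
    have "regular_on (parameter_ball r) (\<lambda>y. P \<beta> + J (snd y + P (fst y)) (\<kappa> \<beta>) + DJ (P \<beta>) (snd y + P (fst y)) (\<kappa> (fst y)))"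
      by (intro regular_on_add regular_on_const regular_on_bilinear[OF bounded_bilinear_blinfun_apply] Jx DJx Rk)
    moreover have "Amap (snd y) (fst y) \<beta> = P \<beta> + J (snd y + P (fst y)) (\<kappa> \<beta>) + DJ (P \<beta>) (snd y + P (fst y)) (\<kappa> (fst y))"
      if "y \<in> parameter_ball r" for y by (rule Amap_apply) (use in1 parameter_ball_in[OF that] in auto)
    ultimately show "regular_on (parameter_ball r) (\<lambda>y. Amap (snd y) (fst y) \<beta>)"
      unfolding regular_on_def four_point_def by (simp cong: ball_cong)
  qed
  have RPhi: "regular_on (parameter_ball r) (\<lambda>y. Phi (snd y) (fst y))"
    unfolding Phi_def by (intro regular_on_add[OF Rx] regular_on_bilinear[OF bounded_bilinear_blinfun_apply] Jx Rk)
  have JPhi: "regular_on (parameter_ball r) (\<lambda>y. J (Phi (snd y) (fst y)))"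
    by (rule regular_on_compose[OF RPhi J_rgl]) (use in2 parameter_ball_in in auto)
  have RQ1: "regular_on (parameter_ball r) (\<lambda>y. Q1 (snd y) (fst y))"
    unfolding Q1_def by (intro regular_on_add regular_on_const regular_on_bilinear[OF bounded_bilinear_blinfun_compose] RA)
  have RQ2: "regular_on (parameter_ball r) (\<lambda>y. Q2 (snd y) (fst y))"
  proof -
    have "Q2 b Z = J p o\<^sub>L ((J (Phi b Z) o\<^sub>L Amap b Z) + (Amap b Z o\<^sub>L (- J p)))" for b Z
      unfolding Q2_def by (simp add: bounded_bilinear.minus_right[OF bounded_bilinear_blinfun_compose])
    then show ?thesis
      by (simp only:) (intro regular_on_add regular_on_const regular_on_bilinear[OF bounded_bilinear_blinfun_compose] RA JPhi)
  qed
  obtain M0 M1 M2 where M: "M0 \<ge> 0" "four_point (parameter_ball r) M0 (\<lambda>y. Amap (snd y) (fst y))"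
    "M1 \<ge> 0" "four_point (parameter_ball r) M1 (\<lambda>y. Q1 (snd y) (fst y))"
    "M2 \<ge> 0" "four_point (parameter_ball r) M2 (\<lambda>y. Q2 (snd y) (fst y))"
    using RA RQ1 RQ2 unfolding regular_on_def by blast
  define M where "M = M0 + M1 + M2 + MJ * (1 + k) * k'"
  have Mpos: "MJ * (1 + k) * k' \<ge> 0" using MJ k k' by simp
  have M_ge: "M0 \<le> M" "M1 \<le> M" "M2 \<le> M" "MJ * (1 + k) * k' \<le> M" "M \<ge> 0" using M Mpos by (auto simp: M_def)
  have A0: "Amap p 0 = id_blinfun"
    by (rule blinfun_eqI) (use Amap_apply[of p 0] r0 in \<open>simp add: linear_0[OF linP] linear_0[OF \<kappa>_linear] blinfun.zero_right J_\<kappa>\<close>)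
  have Q10: "Q1 p 0 = 0"
    unfolding Q1_def A0 by (rule blinfun_eqI) (simp add: blinfun.add_left J_sq[OF p_in])
  have Phi0: "Phi p 0 = p" unfolding Phi_def by (simp add: linear_0[OF linP] linear_0[OF \<kappa>_linear] blinfun.zero_right)
  have Q20: "Q2 p 0 = 0"
    unfolding Q2_def A0 Phi0 by (rule blinfun_eqI) (simp add: blinfun.diff_left blinfun.zero_right)
  have pair: "norm ((Z, b) - (0, p)) \<le> norm Z + norm (b - p)" for Z b :: 'e
    using norm_Pair_le[of Z "b - p"] by simp
  show ?thesis unfolding estimate_def
  proof (rule exI[of _ r], rule exI[of _ M], intro conjI allI impI r M_ge)
    fix Z b :: 'e assume Z': "norm Z \<le> r \<and> norm (b - p) \<le> r"
    then have Z: "norm Z \<le> r" "norm (b - p) \<le> r" by auto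
    show "b + P Z \<in> cball p r0" "Phi b Z \<in> cball p r0" using in1[OF Z] in2[OF Z] .
    have g: "(Z, b) \<in> parameter_ball r" "(0, p) \<in> parameter_ball r" using Z r by (auto simp: parameter_ball_def dist_norm norm_minus_commute)
    have "norm (Amap b Z - id_blinfun) \<le> M0 * norm ((Z, b) - (0, p))"
      using four_pointD(2)[OF M(2) g] by (simp add: A0)
    also have "\<dots> \<le> M * (norm Z + norm (b - p))" using M M_ge pair by (intro mult_mono) auto
    finally show "norm (Amap b Z - id_blinfun) \<le> M * (norm Z + norm (b - p))" .
    have "Phi b Z - (b + Z) = (J (b + P Z) - J p) (\<kappa> Z)"
      by (simp add: Phi_def blinfun.diff_left J_\<kappa>)
    also have "norm \<dots> \<le> (MJ * norm (b + P Z - p)) * (norm Z * k')"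
      using norm_blinfun[of "J (b + P Z) - J p" "\<kappa> Z"]
        mult_mono[OF four_pointD(2)[OF MJ(2) in1[OF Z] p_in] k'(2)[of Z]] MJ(1) by simp
    also have "\<dots> \<le> (MJ * ((1 + k) * (norm Z + norm (b - p)))) * (norm Z * k')"
    proof (intro mult_right_mono mult_left_mono MJ)
      have "norm ((b - p) + P Z) \<le> norm (b - p) + norm Z * k" by (intro norm_triangle_le add_mono k) auto
      also have "\<dots> \<le> (1 + k) * (norm Z + norm (b - p))" using k by (simp add: algebra_simps)
      finally show "norm (b + P Z - p) \<le> (1 + k) * (norm Z + norm (b - p))" by (simp add: algebra_simps)
    qed (use k' in auto)
    also have "\<dots> = (MJ * (1 + k) * k') * (norm Z * (norm Z + norm (b - p)))" by (simp add: mult_ac)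
    also have "\<dots> \<le> M * (norm Z * (norm Z + norm (b - p)))" by (intro mult_right_mono M_ge) auto
    finally show "norm (Phi b Z - (b + Z)) \<le> M * norm Z * (norm Z + norm (b - p))" by (simp add: mult_ac)
    fix Z' :: 'e assume "norm Z' \<le> r"
    then have g': "(Z', b) \<in> parameter_ball r" using Z by (auto simp: parameter_ball_def dist_norm norm_minus_commute)
    have "norm (Amap b Z - Amap b Z') \<le> M0 * norm (Z - Z')"
      using four_pointD(2)[OF M(2) g(1) g'] by (simp add: norm_Pair)
    also have "\<dots> \<le> M * norm (Z - Z')" by (intro mult_right_mono M_ge) auto
    finally show "norm (Amap b Z - Amap b Z') \<le> M * norm (Z - Z')" .
  next
    fix \<delta> R :: real and b :: 'e
    assume d': "0 < \<delta> \<and> \<delta> \<le> 1 \<and> 0 \<le> R \<and> \<delta> * R \<le> r \<and> norm (b - p) \<le> \<delta> \<and> norm (b - p) \<le> r"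
    then have d: "0 < \<delta>" "\<delta> \<le> 1" "0 \<le> R" "\<delta> * R \<le> r" "norm (b - p) \<le> \<delta>" "norm (b - p) \<le> r" by auto
    \<comment> \<open>A coefficient that vanishes at \<open>(0, p)\<close> is of size \<open>\<delta>\<close> on the \<open>\<delta>\<close>-ball, and every difference carries a factor \<open>\<delta>\<close>.\<close>
    have scale: "four_point (cball 0 R) (M * \<delta> * (R + 1)) (\<lambda>Z. Q b (\<delta> *\<^sub>R Z))"
      if Q: "four_point (parameter_ball r) m (\<lambda>y. Q (snd y) (fst y))" "m \<ge> 0" "m \<le> M" "Q p 0 = 0" for Q :: "'e \<Rightarrow> 'e \<Rightarrow> 'e \<Rightarrow>\<^sub>L 'e" and m
    proof -
      have g: "(\<delta> *\<^sub>R Z, b) \<in> parameter_ball r" if "Z \<in> cball 0 R" for Z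
      proof -
        have "\<delta> * norm Z \<le> \<delta> * R" using that d by (intro mult_left_mono) auto
        moreover have "norm (\<delta> *\<^sub>R Z) = \<delta> * norm Z" using d by simp
        ultimately have "norm (\<delta> *\<^sub>R Z) \<le> r" using d(4) by linarith
        then show ?thesis using d by (simp add: parameter_ball_def dist_norm norm_minus_commute)
      qed
      have g0: "(0, p) \<in> parameter_ball r" using r by (simp add: parameter_ball_def)
      have pr: "norm ((\<delta> *\<^sub>R a, b) - (\<delta> *\<^sub>R a', b)) = \<delta> * norm (a - a')" for a a' :: 'e
        using d by (simp add: norm_Pair flip: scaleR_diff_right)
      have "four_point (cball 0 R) (m * \<delta> * (R + 1)) (\<lambda>Z. Q b (\<delta> *\<^sub>R Z))"
        unfolding four_point_def
      proof (intro conjI ballI)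
        have le: "x \<le> m * \<delta> * y \<Longrightarrow> 0 \<le> y \<Longrightarrow> x \<le> m * \<delta> * (R + 1) * y" for x y
        proof -
          assume a: "x \<le> m * \<delta> * y" "0 \<le> y"
          have "0 \<le> m * \<delta> * y * R" using Q d a by simp
          then show ?thesis using a by (simp add: algebra_simps)
        qed
        fix a :: 'e assume a: "a \<in> cball 0 R"
        have "norm (Q b (\<delta> *\<^sub>R a)) \<le> m * norm ((\<delta> *\<^sub>R a, b) - (0, p))"
          using four_pointD(2)[OF Q(1) g[OF a] g0] Q(4) by simp
        also have "\<dots> \<le> m * (\<delta> * R + \<delta>)"
        proof (intro mult_left_mono Q order_trans[OF pair] add_mono d)
          show "norm (\<delta> *\<^sub>R a) \<le> \<delta> * R" using a d by simp
        qed
        finally show "norm (Q b (\<delta> *\<^sub>R a)) \<le> m * \<delta> * (R + 1)" by (simp add: algebra_simps)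
        fix a' :: 'e assume a': "a' \<in> cball 0 R"
        have "norm (Q b (\<delta> *\<^sub>R a) - Q b (\<delta> *\<^sub>R a')) \<le> m * (\<delta> * norm (a - a'))"
          using four_pointD(2)[OF Q(1) g[OF a] g[OF a']] unfolding pr by simp
        then show "norm (Q b (\<delta> *\<^sub>R a) - Q b (\<delta> *\<^sub>R a')) \<le> m * \<delta> * (R + 1) * norm (a - a')"
          by (intro le) auto
        fix e e' :: 'e assume e: "e \<in> cball 0 R" "e' \<in> cball 0 R"
        let ?q = "(norm (a - a') + norm (e - e')) * (norm (a - e) + norm (a' - e'))"
        have pr2: "norm ((\<delta> *\<^sub>R a, b) - (\<delta> *\<^sub>R a', b) - ((\<delta> *\<^sub>R e, b) - (\<delta> *\<^sub>R e', b))) = \<delta> * norm (a - a' - (e - e'))"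
          using d by (simp add: norm_Pair flip: scaleR_diff_right)
        have "norm (Q b (\<delta> *\<^sub>R a) - Q b (\<delta> *\<^sub>R a') - (Q b (\<delta> *\<^sub>R e) - Q b (\<delta> *\<^sub>R e')))
          \<le> m * (\<delta> * norm (a - a' - (e - e')) + (\<delta> * norm (a - a') + \<delta> * norm (e - e')) * (\<delta> * norm (a - e) + \<delta> * norm (a' - e')))"
          using four_pointD(3)[OF Q(1) g[OF a] g[OF a'] g[OF e(1)] g[OF e(2)]] unfolding pr pr2 by simp
        also have "\<dots> = m * \<delta> * (norm (a - a' - (e - e')) + \<delta> * ?q)" by (simp add: algebra_simps)
        also have "\<dots> \<le> m * \<delta> * (norm (a - a' - (e - e')) + 1 * ?q)"
          using d Q by (intro mult_left_mono add_left_mono mult_right_mono) auto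
        finally show "norm (Q b (\<delta> *\<^sub>R a) - Q b (\<delta> *\<^sub>R a') - (Q b (\<delta> *\<^sub>R e) - Q b (\<delta> *\<^sub>R e')))
          \<le> m * \<delta> * (R + 1) * (norm (a - a' - (e - e')) + ?q)" by (intro le) auto
      qed
      then show ?thesis by (rule four_point_mono) (use Q d in \<open>auto intro!: mult_right_mono\<close>)
    qed
    show "four_point (cball 0 R) (M * \<delta> * (R + 1)) (\<lambda>Z. Q1 b (\<delta> *\<^sub>R Z))"
      by (rule scale[OF M(4) M(3) M_ge(2) Q10])
    show "four_point (cball 0 R) (M * \<delta> * (R + 1)) (\<lambda>Z. Q2 b (\<delta> *\<^sub>R Z))"
      by (rule scale[OF M(6) M(5) M_ge(3) Q20])
  qed
qed

end

section \<open>Charts and almost complex structures\<close>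

lemma regular_on_cong:
  assumes "\<And>x. x \<in> B \<Longrightarrow> F x = G x" shows "regular_on B F \<longleftrightarrow> regular_on B G"
  using assms unfolding regular_on_def four_point_def by (simp cong: ball_cong)

lemma has_derivative_blinfun:
  fixes f f' :: "'x::real_normed_vector \<Rightarrow> 'e::euclidean_space \<Rightarrow>\<^sub>L 'f::real_normed_vector"
  assumes "\<And>\<beta>. \<beta> \<in> Basis \<Longrightarrow> ((\<lambda>y. f y \<beta>) has_derivative (\<lambda>v. f' v \<beta>)) (at x)"
  shows "(f has_derivative f') (at x)"
proof -
  have rep: "T = (\<Sum>\<beta>\<in>Basis. blinfun_scaleR_left (T \<beta>) o\<^sub>L blinfun_inner_left \<beta>)" for T :: "'e \<Rightarrow>\<^sub>L 'f"
  proof (rule blinfun_eqI)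
    fix e :: 'e
    have "T e = T (\<Sum>\<beta>\<in>Basis. (e \<bullet> \<beta>) *\<^sub>R \<beta>)" by (simp add: euclidean_representation)
    then show "T e = (\<Sum>\<beta>\<in>Basis. blinfun_scaleR_left (T \<beta>) o\<^sub>L blinfun_inner_left \<beta>) e"
      by (simp add: blinfun.sum_left blinfun.sum_right blinfun.scaleR_right inner_commute)
  qed
  have bl: "bounded_linear (\<lambda>u. blinfun_scaleR_left u o\<^sub>L blinfun_inner_left \<beta>)" for \<beta> :: 'e and u :: 'f
    by (intro bounded_linear_intros)
  have "((\<lambda>y. \<Sum>\<beta>\<in>Basis. blinfun_scaleR_left (f y \<beta>) o\<^sub>L blinfun_inner_left \<beta>) has_derivative
      (\<lambda>v. \<Sum>\<beta>\<in>Basis. blinfun_scaleR_left (f' v \<beta>) o\<^sub>L blinfun_inner_left \<beta>)) (at x)"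
    by (intro has_derivative_sum bounded_linear.has_derivative[OF bl] assms)
  then show ?thesis by (subst (asm) (1 2) rep[symmetric]) simp
qed

lemma Ck_on_SucI:
  assumes "\<And>x. x \<in> S \<Longrightarrow> (f has_derivative f' x) (at x)"
    and "\<And>v. Ck_on k S (\<lambda>x. frechet_derivative f (at x) v)"
  shows "Ck_on (Suc k) S f"
  unfolding Ck_on.simps by (intro conjI ballI allI assms(2)) (rule differentiableI[OF assms(1)])

lemma Ck_on_cong:
  fixes f g :: "'x::real_normed_vector \<Rightarrow> 'y::real_normed_vector"
  assumes S: "open S"
  shows "(\<And>x. x \<in> S \<Longrightarrow> f x = g x) \<Longrightarrow> Ck_on k S f \<Longrightarrow> Ck_on k S g"
proof (induction k arbitrary: f g)
  case 0 then show ?case using continuous_on_cong[of S S f g] by simp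
next
  case (Suc k)
  have g: "(g has_derivative frechet_derivative f (at x)) (at x)" if "x \<in> S" for x
    by (rule has_derivative_transform_within_open[OF Ck_Suc_derivative[OF Suc.prems(2) that] S that]) (rule Suc.prems(1))
  have "frechet_derivative f (at x) = frechet_derivative g (at x)" if "x \<in> S" for x
    by (rule frechet_derivative_at[OF g[OF that]])
  note eq = this
  have "Ck_on k S (\<lambda>x. frechet_derivative g (at x) v)" for v
  proof (rule Suc.IH)
    show "frechet_derivative f (at x) v = frechet_derivative g (at x) v" if "x \<in> S" for x by (simp only: eq[OF that])
    show "Ck_on k S (\<lambda>x. frechet_derivative f (at x) v)" using Suc.prems(2) by (simp only: Ck_on.simps)
  qed
  from Ck_on_SucI[OF g this] show ?case .
qed

lemma Ck_on_affine_curve: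
  fixes f :: "'x::real_normed_vector \<Rightarrow> 'y::real_normed_vector"
  assumes S: "open S" and ST: "\<And>t. t \<in> S \<Longrightarrow> a + t *\<^sub>R X \<in> T"
  shows "Ck_on k T f \<Longrightarrow> Ck_on k S (\<lambda>t::real. f (a + t *\<^sub>R X))"
proof (induction k arbitrary: f)
  case 0
  then show ?case using ST by (auto intro!: continuous_on_compose2[of T f] continuous_intros)
next
  case (Suc k)
  have d: "((\<lambda>t. f (a + t *\<^sub>R X)) has_derivative (\<lambda>v. frechet_derivative f (at (a + t *\<^sub>R X)) (v *\<^sub>R X))) (at t)" if "t \<in> S" for t
    by (rule has_derivative_compose[where f="\<lambda>t. a + t *\<^sub>R X", OF _ Ck_Suc_derivative[OF Suc.prems ST[OF that]]])
       (auto intro!: derivative_eq_intros)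
  have "Ck_on k S (\<lambda>t. frechet_derivative f (at (a + t *\<^sub>R X)) (v *\<^sub>R X))" for v
    using Suc.prems by (intro Suc.IH) auto
  then have "Ck_on k S (\<lambda>t. frechet_derivative (\<lambda>t. f (a + t *\<^sub>R X)) (at t) v)" for v
    by (rule Ck_on_cong[OF S, rotated]) (rule fun_cong[OF frechet_derivative_at[OF d]])
  from Ck_on_SucI[OF d this] show ?case .
qed

locale smooth_manifold =
  fixes \<A> :: "('a::t2_space, 'e::euclidean_space) chart set"
  assumes smooth: "smooth_structure \<A>"
begin

abbreviation inv_chart :: "('a, 'e) chart \<Rightarrow> 'e \<Rightarrow> 'a" where
  "inv_chart c \<equiv> inv_into (fst c) (snd c)"

lemma chart: assumes "c \<in> \<A>"
  shows "open (fst c)" "open (snd c ` fst c)" "homeomorphism (fst c) (snd c ` fst c) (snd c) (inv_chart c)"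
  using smooth assms unfolding smooth_structure_def is_chart_def by blast+

lemma chart_inverse: assumes "c \<in> \<A>"
  shows "x \<in> snd c ` fst c \<Longrightarrow> inv_chart c x \<in> fst c" "x \<in> snd c ` fst c \<Longrightarrow> snd c (inv_chart c x) = x"
    "q \<in> fst c \<Longrightarrow> inv_chart c (snd c q) = q"
    "continuous_on (snd c ` fst c) (inv_chart c)" "continuous_on (fst c) (snd c)"
  using chart(3)[OF assms] unfolding homeomorphism_def by auto

lemma chart_image_open:
  assumes "c \<in> \<A>" "open W" shows "open (snd c ` (fst c \<inter> W))"
proof -
  have "snd c ` (fst c \<inter> W) = (snd c ` fst c) \<inter> inv_chart c -` W"
    using chart_inverse(1-3)[OF assms(1)] by (auto simp: image_iff)
  then show ?thesis
    using continuous_open_preimage[OF chart_inverse(4)[OF assms(1)] chart(2)[OF assms(1)] assms(2)] by simp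
qed

lemma change_Ck:
  assumes "c \<in> \<A>" "d \<in> \<A>" shows "Ck_on k (snd c ` (fst c \<inter> fst d)) (coord_change c d)"
  using smooth assms unfolding smooth_structure_def compatible_charts_def smooth_on_def by blast

definition change_D :: "('a, 'e) chart \<Rightarrow> ('a, 'e) chart \<Rightarrow> 'e \<Rightarrow> 'e \<Rightarrow> 'e" where
  "change_D c d x = frechet_derivative (coord_change c d) (at x)"

lemma change_deriv:
  assumes "c \<in> \<A>" "d \<in> \<A>" "x \<in> snd c ` (fst c \<inter> fst d)"
  shows "(coord_change c d has_derivative change_D c d x) (at x)"
  unfolding change_D_def by (rule Ck_Suc_derivative[OF change_Ck[OF assms(1,2)] assms(3)])

lemma change_D_linear:
  assumes "c \<in> \<A>" "d \<in> \<A>" "x \<in> snd c ` (fst c \<inter> fst d)" shows "linear (change_D c d x)"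
  using change_deriv[OF assms] has_derivative_linear by blast

lemma change_D_continuous:
  assumes "c \<in> \<A>" "d \<in> \<A>" shows "continuous_on (snd c ` (fst c \<inter> fst d)) (\<lambda>x. change_D c d x v)"
  using change_Ck[OF assms, of "Suc 0"] by (simp add: change_D_def)

lemma change_D_same:
  assumes "c \<in> \<A>" "x \<in> snd c ` fst c" shows "change_D c c x v = v"
proof -
  have "(coord_change c c has_derivative (\<lambda>v. v)) (at x)"
    by (rule has_derivative_transform_within_open[OF has_derivative_ident chart(2)[OF assms(1)] assms(2)])
       (simp add: coord_change_def chart_inverse[OF assms(1)])
  then show ?thesis using has_derivative_unique[OF change_deriv[OF assms(1,1)]] assms(2) by (metis Int_absorb)
qed

lemma change_D_chain:
  assumes "c \<in> \<A>" "d \<in> \<A>" "e \<in> \<A>" "p \<in> fst c" "p \<in> fst d" "p \<in> fst e"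
  shows "change_D d e (snd d p) (change_D c d (snd c p) v) = change_D c e (snd c p) v"
proof -
  have x: "snd c p \<in> snd c ` (fst c \<inter> (fst d \<inter> fst e))" using assms by auto
  have y: "coord_change c d (snd c p) = snd d p" using assms by (simp add: coord_change_def chart_inverse)
  have "((coord_change d e \<circ> coord_change c d) has_derivative (change_D d e (snd d p) \<circ> change_D c d (snd c p))) (at (snd c p))"
    using assms y by (intro diff_chain_at change_deriv) (auto intro!: change_deriv)
  then have "(coord_change c e has_derivative (change_D d e (snd d p) \<circ> change_D c d (snd c p))) (at (snd c p))"
  proof (rule has_derivative_transform_within_open)
    show "open (snd c ` (fst c \<inter> (fst d \<inter> fst e)))" by (intro chart_image_open assms open_Int chart(1))
    show "(coord_change d e \<circ> coord_change c d) z = coord_change c e z" if "z \<in> snd c ` (fst c \<inter> (fst d \<inter> fst e))" for z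
      using that assms by (auto simp: coord_change_def chart_inverse)
  qed (rule x)
  then show ?thesis using has_derivative_unique[OF change_deriv[OF assms(1,3)], of "snd c p"] assms
    by (metis IntI comp_apply imageI)
qed

lemma coord_vec_apply: "d \<in> \<A> \<Longrightarrow> p \<in> fst d \<Longrightarrow> coord_vec \<A> c p e d = change_D c d (snd c p) e"
  by (simp add: coord_vec_def change_D_def)

lemma coord_vec_tangent:
  assumes "c \<in> \<A>" "p \<in> fst c" shows "coord_vec \<A> c p e \<in> tangent_space \<A> p"
  unfolding tangent_space_def
proof (intro CollectI conjI ballI allI impI)
  fix d d' assume d: "d \<in> \<A>" "d' \<in> \<A>" "p \<in> fst d \<inter> fst d'"
  then show "coord_vec \<A> c p e d' = frechet_derivative (coord_change d d') (at (snd d p)) (coord_vec \<A> c p e d)"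
    using change_D_chain[OF assms(1) d(1,2) assms(2)] by (simp add: coord_vec_apply flip: change_D_def)
qed (auto simp: coord_vec_def)

lemma tangent_vec_eq:
  assumes "c \<in> \<A>" "p \<in> fst c" "v \<in> tangent_space \<A> p" shows "v = coord_vec \<A> c p (v c)"
proof
  fix d
  show "v d = coord_vec \<A> c p (v c) d"
  proof (cases "d \<in> \<A> \<and> p \<in> fst d")
    case True
    then have "v d = frechet_derivative (coord_change c d) (at (snd c p)) (v c)"
      using assms unfolding tangent_space_def by blast
    then show ?thesis using True unfolding coord_vec_def by simp
  next
    case False
    then have "v d = 0" using assms(3) unfolding tangent_space_def by blast
    then show ?thesis unfolding coord_vec_def by (simp only: if_not_P[OF False])
  qed
qed

lemma coord_vec_same: "c \<in> \<A> \<Longrightarrow> p \<in> fst c \<Longrightarrow> coord_vec \<A> c p e c = e"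
  by (simp add: coord_vec_apply change_D_same)

lemma coord_vec_linear:
  assumes "c \<in> \<A>" "p \<in> fst c"
  shows "coord_vec \<A> c p (a *\<^sub>R x + b *\<^sub>R y) = (\<lambda>d. a *\<^sub>R coord_vec \<A> c p x d + b *\<^sub>R coord_vec \<A> c p y d)"
proof
  fix d
  show "coord_vec \<A> c p (a *\<^sub>R x + b *\<^sub>R y) d = a *\<^sub>R coord_vec \<A> c p x d + b *\<^sub>R coord_vec \<A> c p y d"
  proof (cases "d \<in> \<A> \<and> p \<in> fst d")
    case True
    then have "linear (change_D c d (snd c p))" using assms by (intro change_D_linear) auto
    then show ?thesis using True by (simp add: coord_vec_apply linear_add linear_scale)
  qed (auto simp: coord_vec_def)
qed

text \<open>A map that is given in one chart is differentiated in every other chart.\<close>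

lemma change_compose_deriv:
  fixes G :: "'x::real_normed_vector \<Rightarrow> 'e"
  assumes c: "c \<in> \<A>" and d: "d \<in> \<A>" and G: "G x \<in> snd c ` fst c" "inv_chart c (G x) \<in> fst d" "(G has_derivative G') (at x)"
  shows "((snd d \<circ> (inv_chart c \<circ> G)) has_derivative (\<lambda>v. change_D c d (G x) (G' v))) (at x)"
proof -
  have "G x \<in> snd c ` (fst c \<inter> fst d)"
    using G chart_inverse(1,2)[OF c G(1)] by (metis IntI image_eqI)
  from has_derivative_compose[OF G(3) change_deriv[OF c d this]]
  show ?thesis by (simp add: coord_change_def comp_def)
qed

lemma differential_chart:
  fixes G :: "'x::real_normed_vector \<Rightarrow> 'e"
  assumes c: "c \<in> \<A>" and G: "G x \<in> snd c ` fst c" "(G has_derivative G') (at x)"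
  shows "differential \<A> (inv_chart c \<circ> G) x v = coord_vec \<A> c (inv_chart c (G x)) (G' v)"
proof
  fix d
  show "differential \<A> (inv_chart c \<circ> G) x v d = coord_vec \<A> c (inv_chart c (G x)) (G' v) d"
  proof (cases "d \<in> \<A> \<and> inv_chart c (G x) \<in> fst d")
    case True
    then have "frechet_derivative (snd d \<circ> (inv_chart c \<circ> G)) (at x) = (\<lambda>v. change_D c d (G x) (G' v))"
      using frechet_derivative_at[OF change_compose_deriv[OF c _ G(1) _ G(2)]] by metis
    then show ?thesis using True chart_inverse(2)[OF c G(1)] by (simp add: differential_def coord_vec_apply)
  qed (auto simp: differential_def coord_vec_def)
qed

text \<open>Being \<open>C\<^sup>1\<close> has to be verified in all charts; it suffices to know the derivative
  in one of them.\<close>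

lemma C1_into_chart:
  fixes G :: "'x::real_normed_vector \<Rightarrow> 'e"
  assumes c: "c \<in> \<A>" and G: "\<And>x. x \<in> S \<Longrightarrow> G x \<in> snd c ` fst c" "\<And>x. x \<in> S \<Longrightarrow> (G has_derivative G' x) (at x)"
    and G': "\<And>v. continuous_on S (\<lambda>x. G' x v)"
  shows "Ck_into \<A> 1 S (inv_chart c \<circ> G)"
  unfolding Ck_into_def
proof (intro conjI ballI)
  have Gc: "continuous_on S G"
    using G(2) by (meson continuous_at_imp_continuous_on has_derivative_continuous)
  show "continuous_on S (inv_chart c \<circ> G)"
    by (rule continuous_on_compose[OF Gc continuous_on_subset[OF chart_inverse(4)[OF c]]]) (use G(1) in auto)
  fix d assume d: "d \<in> \<A>"
  let ?S = "S \<inter> (inv_chart c \<circ> G) -` fst d"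
  have D: "((snd d \<circ> (inv_chart c \<circ> G)) has_derivative (\<lambda>v. change_D c d (G x) (G' x v))) (at x)" if "x \<in> ?S" for x
    using that G by (intro change_compose_deriv c d) auto
  have inW: "G x \<in> snd c ` (fst c \<inter> fst d)" if "x \<in> ?S" for x
    using that G(1)[of x] chart_inverse(1,2)[OF c, of "G x"] by (auto intro!: image_eqI[of _ _ "inv_chart c (G x)"])
  have "continuous_on ?S (\<lambda>x. frechet_derivative (snd d \<circ> (inv_chart c \<circ> G)) (at x) v)" for v
  proof -
    have "continuous_on ?S (\<lambda>x. \<Sum>\<beta>\<in>Basis. (G' x v \<bullet> \<beta>) *\<^sub>R change_D c d (G x) \<beta>)"
      by (intro continuous_intros continuous_on_subset[OF G'] continuous_on_compose2[OF change_D_continuous[OF c d]]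
          continuous_on_subset[OF Gc]) (use inW in auto)
    moreover have "(\<Sum>\<beta>\<in>Basis. (G' x v \<bullet> \<beta>) *\<^sub>R change_D c d (G x) \<beta>) = frechet_derivative (snd d \<circ> (inv_chart c \<circ> G)) (at x) v"
      if "x \<in> ?S" for x
    proof -
      note lin = change_D_linear[OF c d inW[OF that]]
      have "(\<Sum>\<beta>\<in>Basis. (G' x v \<bullet> \<beta>) *\<^sub>R change_D c d (G x) \<beta>) = change_D c d (G x) (\<Sum>\<beta>\<in>Basis. (G' x v \<bullet> \<beta>) *\<^sub>R \<beta>)"
        by (simp add: linear_sum[OF lin] linear_scale[OF lin])
      also have "\<dots> = change_D c d (G x) (G' x v)" by (simp add: euclidean_representation)
      also have "\<dots> = frechet_derivative (snd d \<circ> (inv_chart c \<circ> G)) (at x) v"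
        using frechet_derivative_at[OF D[OF that]] by metis
      finally show ?thesis .
    qed
    ultimately show ?thesis by (subst continuous_on_cong[OF refl]) (auto simp: eq_commute)
  qed
  then have "Ck_on (Suc 0) ?S (snd d \<circ> (inv_chart c \<circ> G))"
    by (intro Ck_on_SucI[OF D]) simp_all
  then show "Ck_on 1 ?S (snd d \<circ> (inv_chart c \<circ> G))" by (simp only: One_nat_def)
qed

end

locale almost_complex_manifold = smooth_manifold \<A> for \<A> :: "('a::t2_space, 'e::euclidean_space) chart set" +
  fixes J :: "'a \<Rightarrow> ('a, 'e) tvec \<Rightarrow> ('a, 'e) tvec"
  assumes structure_J: "almost_complex_structure \<A> J"
begin

text \<open>The almost complex structure in a chart: \<open>Jc\<close> as a function, \<open>JB\<close> as a
  bounded linear map.\<close>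

definition Jc :: "('a, 'e) chart \<Rightarrow> 'e \<Rightarrow> 'e \<Rightarrow> 'e" where
  "Jc c x e = J (inv_chart c x) (coord_vec \<A> c (inv_chart c x) e) c"

lemma J_coord_vec:
  assumes "c \<in> \<A>" "x \<in> snd c ` fst c"
  shows "J (inv_chart c x) (coord_vec \<A> c (inv_chart c x) e) = coord_vec \<A> c (inv_chart c x) (Jc c x e)"
proof -
  have "J (inv_chart c x) (coord_vec \<A> c (inv_chart c x) e) \<in> tangent_space \<A> (inv_chart c x)"
    using structure_J coord_vec_tangent[OF assms(1) chart_inverse(1)[OF assms]] unfolding almost_complex_structure_def by blast
  from tangent_vec_eq[OF assms(1) chart_inverse(1)[OF assms] this] show ?thesis unfolding Jc_def .
qed

lemma Jc_linear:
  assumes c: "c \<in> \<A>" "x \<in> snd c ` fst c" shows "linear (Jc c x)"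
proof -
  note t = coord_vec_tangent[OF c(1) chart_inverse(1)[OF c]]
  have *: "Jc c x (a *\<^sub>R v + b *\<^sub>R w) = a *\<^sub>R Jc c x v + b *\<^sub>R Jc c x w" for a b v w
    using structure_J t unfolding almost_complex_structure_def Jc_def coord_vec_linear[OF c(1) chart_inverse(1)[OF c]] by simp
  show ?thesis
    by (rule linearI) (use *[of 1 _ 1] *[of _ _ 0 0] in auto)
qed

lemma Jc_Jc:
  assumes c: "c \<in> \<A>" "x \<in> snd c ` fst c" shows "Jc c x (Jc c x e) = - e"
proof -
  note p = chart_inverse(1)[OF c]
  have "J (inv_chart c x) (J (inv_chart c x) (coord_vec \<A> c (inv_chart c x) e)) = (\<lambda>d. - coord_vec \<A> c (inv_chart c x) e d)"
    using structure_J coord_vec_tangent[OF c(1) p] unfolding almost_complex_structure_def by blast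
  then have "J (inv_chart c x) (coord_vec \<A> c (inv_chart c x) (Jc c x e)) c = - coord_vec \<A> c (inv_chart c x) e c"
    unfolding J_coord_vec[OF c] by metis
  then show ?thesis using coord_vec_same[OF c(1) p] by (simp add: Jc_def[of c x "Jc c x e"])
qed

lemma Jc_Ck: "c \<in> \<A> \<Longrightarrow> Ck_on k (snd c ` fst c) (\<lambda>x. Jc c x e)"
  using structure_J unfolding almost_complex_structure_def smooth_on_def Jc_def Let_def by blast

definition JB :: "('a, 'e) chart \<Rightarrow> 'e \<Rightarrow> 'e \<Rightarrow>\<^sub>L 'e" where "JB c x = Blinfun (Jc c x)"

definition DJB :: "('a, 'e) chart \<Rightarrow> 'e \<Rightarrow> 'e \<Rightarrow> 'e \<Rightarrow>\<^sub>L 'e" where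
  "DJB c v x = Blinfun (\<lambda>e. frechet_derivative (\<lambda>x. Jc c x e) (at x) v)"

lemma JB_apply: "c \<in> \<A> \<Longrightarrow> x \<in> snd c ` fst c \<Longrightarrow> blinfun_apply (JB c x) = Jc c x"
  unfolding JB_def using Jc_linear by (intro bounded_linear_Blinfun_apply) (simp add: linear_conv_bounded_linear)

lemma Jc_deriv:
  assumes "c \<in> \<A>" "x \<in> snd c ` fst c"
  shows "((\<lambda>x. Jc c x e) has_derivative frechet_derivative (\<lambda>x. Jc c x e) (at x)) (at x)"
  by (rule Ck_Suc_derivative[OF Jc_Ck assms(2)]) (rule assms)

lemma DJB_apply:
  assumes c: "c \<in> \<A>" "x \<in> snd c ` fst c"
  shows "DJB c v x e = frechet_derivative (\<lambda>x. Jc c x e) (at x) v"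
proof -
  let ?D = "\<lambda>e. frechet_derivative (\<lambda>x. Jc c x e) (at x)"
  have "?D (a *\<^sub>R e + b *\<^sub>R e') v = a *\<^sub>R ?D e v + b *\<^sub>R ?D e' v" for a b e e'
  proof -
    have "((\<lambda>x. a *\<^sub>R Jc c x e + b *\<^sub>R Jc c x e') has_derivative (\<lambda>v. a *\<^sub>R ?D e v + b *\<^sub>R ?D e' v)) (at x)"
      by (intro has_derivative_add has_derivative_scaleR_right Jc_deriv[OF c])
    then have "((\<lambda>x. Jc c x (a *\<^sub>R e + b *\<^sub>R e')) has_derivative (\<lambda>v. a *\<^sub>R ?D e v + b *\<^sub>R ?D e' v)) (at x)"
      by (rule has_derivative_transform_within_open[OF _ chart(2)[OF c(1)] c(2)])
         (simp add: linear_add[OF Jc_linear[OF c(1)]] linear_scale[OF Jc_linear[OF c(1)]])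
    from frechet_derivative_at[OF this] show ?thesis by metis
  qed
  note * = this
  have "linear (\<lambda>e. ?D e v)" by (rule linearI) (use *[of 1 _ 1] *[of _ _ 0 0] in auto)
  then show ?thesis unfolding DJB_def by (subst bounded_linear_Blinfun_apply) (auto simp: linear_conv_bounded_linear)
qed

lemma normal_coordinates_chart:
  assumes c: "c \<in> \<A>" and r0: "r0 > 0" "cball p r0 \<subseteq> snd c ` fst c" and P: "linear P"
  shows "normal_coordinates (JB c) (DJB c) p r0 P"
proof (rule normal_coordinates.intro)
  have U: "x \<in> cball p r0 \<Longrightarrow> x \<in> snd c ` fst c" for x using r0 by auto
  show "r0 > 0" by (rule r0)
  show "linear P" by (rule P)
  show "JB c x (JB c x e) = - e" if "x \<in> cball p r0" for x e
    using that by (simp add: JB_apply[OF c] Jc_Jc[OF c] U)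
  show "regular_on (cball p r0) (JB c)"
  proof (rule regular_on_blinfun)
    fix \<beta> :: 'e
    have "regular_on (cball p r0) (\<lambda>x. Jc c x \<beta>)"
      by (rule four_point_C2[OF Jc_Ck[OF c] _ _ r0(2)]) auto
    then show "regular_on (cball p r0) (\<lambda>x. JB c x \<beta>)"
      by (subst regular_on_cong[of _ _ "\<lambda>x. Jc c x \<beta>"]) (simp_all add: JB_apply[OF c] U)
  qed
  show "regular_on (cball p r0) (DJB c v)" for v
  proof (rule regular_on_blinfun)
    fix \<beta> :: 'e
    have "Ck_on (Suc 2) (snd c ` fst c) (\<lambda>x. Jc c x \<beta>)" by (rule Jc_Ck[OF c])
    then have "Ck_on 2 (snd c ` fst c) (\<lambda>x. frechet_derivative (\<lambda>x. Jc c x \<beta>) (at x) v)" by (simp only: Ck_on.simps)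
    then have "regular_on (cball p r0) (\<lambda>x. frechet_derivative (\<lambda>x. Jc c x \<beta>) (at x) v)"
      by (rule four_point_C2[OF _ _ _ r0(2)]) auto
    then show "regular_on (cball p r0) (\<lambda>x. DJB c v x \<beta>)"
      by (subst regular_on_cong[of _ _ "\<lambda>x. frechet_derivative (\<lambda>x. Jc c x \<beta>) (at x) v"]) (simp_all add: DJB_apply[OF c] U)
  qed
  show "(JB c has_derivative (\<lambda>v. DJB c v x)) (at x)" if "x \<in> cball p r0" for x
  proof (rule has_derivative_blinfun)
    fix \<beta> :: 'e
    have "((\<lambda>x. Jc c x \<beta>) has_derivative (\<lambda>v. DJB c v x \<beta>)) (at x)"
      using Jc_deriv[OF c U[OF that], of \<beta>] by (simp add: DJB_apply[OF c U[OF that]])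
    then show "((\<lambda>y. JB c y \<beta>) has_derivative (\<lambda>v. DJB c v x \<beta>)) (at x)"
      by (rule has_derivative_transform_within_open[OF _ chart(2)[OF c] U[OF that]]) (simp add: JB_apply[OF c])
  qed
qed

text \<open>Being a \<open>J\<close>-complex disc is the Cauchy-Riemann equation for \<open>JB\<close> in a
  single chart.\<close>

lemma J_disc_from_chart:
  assumes c: "c \<in> \<A>" and G: "\<And>z. z \<in> ball 0 1 \<Longrightarrow> G z \<in> snd c ` fst c" "\<And>z. z \<in> ball 0 1 \<Longrightarrow> (G has_derivative G' z) (at z)"
    and G': "continuous_on (ball 0 1) (\<lambda>z. G' z 1)" "continuous_on (ball 0 1) (\<lambda>z. G' z \<i>)"
    and hol: "\<And>z. z \<in> ball 0 1 \<Longrightarrow> G' z \<i> = JB c (G z) (G' z 1)"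
  shows "J_complex_disc \<A> J (inv_chart c \<circ> G)"
  unfolding J_complex_disc_def
proof (intro conjI ballI allI)
  have ex: "G' z v = Re v *\<^sub>R G' z 1 + Im v *\<^sub>R G' z \<i>" if "z \<in> ball 0 1" for z v
    by (rule linear_complex_expand[OF has_derivative_linear[OF G(2)[OF that]]])
  show "Ck_into \<A> 1 (ball 0 1) (inv_chart c \<circ> G)"
  proof (rule C1_into_chart[OF c G])
    show "continuous_on (ball 0 1) (\<lambda>z. G' z v)" for v
      by (subst continuous_on_cong[OF refl ex]) (auto intro!: continuous_intros G')
  qed auto
  fix z :: complex and w assume z: "z \<in> ball 0 1"
  have "G' z (\<i> * w) = Re w *\<^sub>R G' z \<i> - Im w *\<^sub>R G' z 1"
    by (subst ex[OF z]) simp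
  also have "\<dots> = Jc c (G z) (Re w *\<^sub>R G' z 1 + Im w *\<^sub>R G' z \<i>)"
  proof -
    note lin = Jc_linear[OF c G(1)[OF z]]
    have h: "G' z \<i> = Jc c (G z) (G' z 1)" using hol[OF z] by (simp add: JB_apply[OF c G(1)[OF z]])
    then have h2: "Jc c (G z) (G' z \<i>) = - G' z 1" by (simp add: Jc_Jc[OF c G(1)[OF z]])
    show ?thesis unfolding linear_add[OF lin] linear_scale[OF lin] h2 h[symmetric] by simp
  qed
  also have "\<dots> = Jc c (G z) (G' z w)" by (subst (2) ex[OF z]) simp
  finally show "differential \<A> (inv_chart c \<circ> G) z (\<i> * w) = J ((inv_chart c \<circ> G) z) (differential \<A> (inv_chart c \<circ> G) z w)"
    unfolding differential_chart[OF c G(1)[OF z] G(2)[OF z]] using J_coord_vec[OF c G(1)[OF z]] by simp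
qed

end

section \<open>Slices, Riemannian distance and limits\<close>

context smooth_manifold
begin

text \<open>The velocity of the straight line through the point in the direction \<open>X\<close>.\<close>

lemma coord_vec_tangent_slice:
  assumes c: "c \<in> \<A>" and N0: "subspace N0" and N: "snd c ` (fst c \<inter> N) = snd c ` fst c \<inter> N0"
    and p: "p \<in> fst c" "p \<in> N" and X: "X \<in> N0"
  shows "coord_vec \<A> c p X \<in> tangent_space_of \<A> N p"
proof -
  let ?x = "snd c p"
  define G where "G t = ?x + t *\<^sub>R X" for t :: real
  have xU: "?x \<in> snd c ` fst c" and xN0: "?x \<in> N0" using p N by blast+
  have Gc: "continuous_on UNIV G" unfolding G_def by (intro continuous_intros)
  have "open (G -` (snd c ` fst c))" using open_vimage[OF chart(2)[OF c] Gc] .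
  moreover have "0 \<in> G -` (snd c ` fst c)" using xU by (simp add: G_def)
  ultimately obtain \<epsilon> where \<epsilon>: "\<epsilon> > 0" "\<And>t. \<bar>t\<bar> < \<epsilon> \<Longrightarrow> G t \<in> snd c ` fst c"
    by (auto simp: open_dist dist_real_def Ball_def)
  have GU: "G t \<in> snd c ` fst c" if "t \<in> {-\<epsilon><..<\<epsilon>}" for t using \<epsilon>(2)[of t] that by auto
  let ?\<gamma> = "inv_chart c \<circ> G"
  have "Ck_into \<A> k {-\<epsilon><..<\<epsilon>} ?\<gamma>" for k
    unfolding Ck_into_def
  proof (intro conjI ballI)
    show "continuous_on {-\<epsilon><..<\<epsilon>} ?\<gamma>"
      by (intro continuous_on_compose continuous_on_subset[OF Gc] continuous_on_subset[OF chart_inverse(4)[OF c]]) (use GU in auto)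
    fix d assume d: "d \<in> \<A>"
    let ?T = "snd c ` (fst c \<inter> fst d)"
    have S: "{-\<epsilon><..<\<epsilon>} \<inter> ?\<gamma> -` fst d = {-\<epsilon><..<\<epsilon>} \<inter> G -` ?T"
    proof -
      have "inv_chart c (G t) \<in> fst d \<longleftrightarrow> G t \<in> ?T" if "t \<in> {-\<epsilon><..<\<epsilon>}" for t
        using chart_inverse[OF c] GU[OF that] by auto (metis IntI chart_inverse(1)[OF c] image_eqI)
      then show ?thesis by (intro set_eqI) (simp only: Int_iff vimage_eq comp_apply, blast)
    qed
    have "open ({-\<epsilon><..<\<epsilon>} \<inter> G -` ?T)"
      by (intro open_Int open_vimage Gc chart_image_open[OF c chart(1)[OF d]]) auto
    then have "Ck_on k ({-\<epsilon><..<\<epsilon>} \<inter> G -` ?T) (\<lambda>t. coord_change c d (?x + t *\<^sub>R X))"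
      by (rule Ck_on_affine_curve[OF _ _ change_Ck[OF c d]]) (auto simp: G_def)
    then show "Ck_on k ({-\<epsilon><..<\<epsilon>} \<inter> ?\<gamma> -` fst d) (snd d \<circ> ?\<gamma>)"
      unfolding S by (simp add: coord_change_def comp_def G_def)
  qed
  moreover have "?\<gamma> ` {-\<epsilon><..<\<epsilon>} \<subseteq> N"
  proof clarify
    fix t assume "t \<in> {-\<epsilon><..<\<epsilon>}"
    then have "G t \<in> snd c ` fst c \<inter> N0"
      using GU N0 X xN0 by (auto simp: G_def intro: subspace_add subspace_scale)
    then obtain q where "q \<in> fst c" "q \<in> N" "G t = snd c q" using N by blast
    then show "?\<gamma> t \<in> N" using chart_inverse(3)[OF c] by simp
  qed
  moreover have "?\<gamma> 0 = p" using chart_inverse(3)[OF c p(1)] by (simp add: G_def)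
  moreover have "differential \<A> ?\<gamma> 0 1 = coord_vec \<A> c p X"
  proof -
    have "(G has_derivative (\<lambda>v. v *\<^sub>R X)) (at 0)" unfolding G_def[abs_def] by (auto intro!: derivative_eq_intros)
    from differential_chart[OF c _ this, of 1] show ?thesis
      using xU chart_inverse(3)[OF c p(1)] by (simp add: G_def)
  qed
  ultimately show ?thesis unfolding tangent_space_of_def using \<epsilon>(1) by (intro CollectI exI[of _ ?\<gamma>]) auto
qed

text \<open>On a small closed ball the metric coefficients are bounded, which bounds the length of straight
  segments.\<close>

lemma riemannian_dist_chart:
  assumes g: "riemannian_metric \<A> g" and c: "c \<in> \<A>" and p: "p \<in> snd c ` fst c"
  shows "\<exists>r>0. \<exists>C\<ge>0. ball p r \<subseteq> snd c ` fst c \<and> (\<forall>x\<in>ball p r. \<forall>y\<in>ball p r.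
     riemannian_dist \<A> g (inv_chart c x) (inv_chart c y) \<le> ennreal (C * norm (x - y)))"
proof -
  let ?U = "snd c ` fst c"
  define B where "B x e e' = g (inv_chart c x) (coord_vec \<A> c (inv_chart c x) e) (coord_vec \<A> c (inv_chart c x) e')" for x e e'
  obtain r where r: "r > 0" "cball p r \<subseteq> ?U"
    using open_contains_cball[THEN iffD1, OF chart(2)[OF c]] p by blast
  have Bc: "continuous_on ?U (\<lambda>x. B x e e')" for e e'
  proof -
    have "Ck_on 0 ?U (\<lambda>x. B x e e')"
      using g c unfolding riemannian_metric_def smooth_on_def B_def Let_def by blast
    then show ?thesis by simp
  qed
  have lin: "linear (\<lambda>e. B x e e')" "B x e e' = B x e' e" if x: "x \<in> ?U" for x e e'
  proof -
    note t = coord_vec_tangent[OF c chart_inverse(1)[OF c x]]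
    have *: "B x (a *\<^sub>R v + b *\<^sub>R w) e' = a * B x v e' + b * B x w e'" for a b v w
      using g t unfolding riemannian_metric_def B_def coord_vec_linear[OF c chart_inverse(1)[OF c x]] by blast
    show "linear (\<lambda>e. B x e e')" by (rule linearI) (use *[of 1 _ 1] *[of _ _ 0 0] in auto)
    show "B x e e' = B x e' e" using g t unfolding riemannian_metric_def B_def by blast
  qed
  have exp1: "B x e e' = (\<Sum>i\<in>Basis. (e \<bullet> i) * B x i e')" if x: "x \<in> ?U" for x e e'
  proof -
    have "B x e e' = B x (\<Sum>i\<in>Basis. (e \<bullet> i) *\<^sub>R i) e'" by (simp add: euclidean_representation)
    also have "\<dots> = (\<Sum>i\<in>Basis. (e \<bullet> i) * B x i e')"
      by (simp only: linear_sum[OF lin(1)[OF x]] linear_scale[OF lin(1)[OF x]] real_scaleR_def)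
    finally show ?thesis .
  qed
  have "\<exists>m\<ge>0. \<forall>x\<in>cball p r. \<bar>B x i j\<bar> \<le> m" for i j
  proof -
    have "bounded ((\<lambda>x. B x i j) ` cball p r)"
      by (intro compact_imp_bounded compact_continuous_image continuous_on_subset[OF Bc r(2)]) auto
    then obtain m where "\<forall>y\<in>(\<lambda>x. B x i j) ` cball p r. norm y \<le> m" unfolding bounded_iff by blast
    then show ?thesis by (intro exI[of _ "max 0 m"]) auto
  qed
  then obtain m where m: "\<And>i j. m i j \<ge> 0" "\<And>i j x. x \<in> cball p r \<Longrightarrow> \<bar>B x i j\<bar> \<le> m i j" by metis
  define M where "M = (\<Sum>i\<in>Basis. \<Sum>j\<in>Basis. m i j)"
  have M: "M \<ge> 0" unfolding M_def by (intro sum_nonneg m)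
  have Bbd: "B x e e \<le> M * (norm e)\<^sup>2" if x: "x \<in> cball p r" for x e
  proof -
    have xU: "x \<in> ?U" using x r by auto
    have "B x e e = (\<Sum>i\<in>Basis. (e \<bullet> i) * (\<Sum>j\<in>Basis. (e \<bullet> j) * B x j i))"
      by (subst exp1[OF xU], subst lin(2)[OF xU], subst exp1[OF xU]) simp
    also have "\<dots> = (\<Sum>i\<in>Basis. \<Sum>j\<in>Basis. (e \<bullet> i) * (e \<bullet> j) * B x j i)"
      by (simp add: sum_distrib_left mult.assoc)
    also have "\<dots> \<le> (\<Sum>i\<in>Basis. \<Sum>j\<in>Basis. norm e * norm e * m j i)"
    proof (intro sum_mono)
      fix i j :: 'e assume ij: "i \<in> Basis" "j \<in> Basis"
      have "(e \<bullet> i) * (e \<bullet> j) * B x j i \<le> \<bar>e \<bullet> i\<bar> * \<bar>e \<bullet> j\<bar> * \<bar>B x j i\<bar>"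
        by (metis abs_ge_self abs_mult)
      also have "\<dots> \<le> norm e * norm e * m j i"
        using ij by (intro mult_mono Basis_le_norm m(2)[OF x]) auto
      finally show "(e \<bullet> i) * (e \<bullet> j) * B x j i \<le> norm e * norm e * m j i" .
    qed
    also have "\<dots> = M * (norm e)\<^sup>2"
      unfolding M_def by (subst sum.swap) (simp add: sum_distrib_left sum_distrib_right power2_eq_square mult_ac)
    finally show ?thesis .
  qed
  show ?thesis
  proof (rule exI[of _ r], intro conjI r exI[of _ "sqrt M"] ballI)
    show "sqrt M \<ge> 0" using M by simp
    show sub: "ball p r \<subseteq> ?U" using r by (meson ball_subset_cball order_trans)
    fix x y assume xy: "x \<in> ball p r" "y \<in> ball p r"
    define G where "G s = x + s *\<^sub>R (y - x)" for s :: real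
    let ?\<gamma> = "inv_chart c \<circ> G"
    have Gb: "G s \<in> ball p r" if "s \<in> {0..1}" for s
    proof -
      have "G s = (1 - s) *\<^sub>R x + s *\<^sub>R y" by (simp add: G_def algebra_simps)
      then show ?thesis using convexD_alt[OF convex_ball xy, of s] that by auto
    qed
    have GU: "G s \<in> ?U" if "s \<in> {0..1}" for s using Gb[OF that] sub by auto
    have dG: "(G has_derivative (\<lambda>v. v *\<^sub>R (y - x))) (at s)" for s
      unfolding G_def[abs_def] by (auto intro!: derivative_eq_intros)
    have path: "piecewise_C1_path \<A> ?\<gamma>"
      unfolding piecewise_C1_path_def
    proof (intro conjI exI[of _ "{}"])
      have "continuous_on {0..1} G" unfolding G_def by (intro continuous_intros)
      then show "continuous_on {0..1} ?\<gamma>"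
        by (rule continuous_on_compose[OF _ continuous_on_subset[OF chart_inverse(4)[OF c]]]) (use GU in auto)
      show "Ck_into \<A> 1 ({0<..<1} - {}) ?\<gamma>"
        by (rule C1_into_chart[OF c _ dG]) (use GU in auto)
    qed simp
    have len: "curve_length \<A> g ?\<gamma> \<le> ennreal (sqrt M * norm (x - y))"
    proof -
      have "curve_length \<A> g ?\<gamma> \<le> (\<integral>\<^sup>+ t. ennreal (sqrt M * norm (x - y)) * indicator {0..1::real} t \<partial>lborel)"
        unfolding curve_length_def
      proof (rule nn_integral_mono)
        fix t :: real
        show "ennreal (sqrt (g (?\<gamma> t) (differential \<A> ?\<gamma> t 1) (differential \<A> ?\<gamma> t 1))) * indicator {0..1} t
          \<le> ennreal (sqrt M * norm (x - y)) * indicator {0..1} t"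
        proof (cases "t \<in> {0..1}")
          case True
          have "g (?\<gamma> t) (differential \<A> ?\<gamma> t 1) (differential \<A> ?\<gamma> t 1) = B (G t) (y - x) (y - x)"
            unfolding differential_chart[OF c GU[OF True] dG] B_def by simp
          also have "\<dots> \<le> M * (norm (y - x))\<^sup>2" using Gb[OF True] by (intro Bbd) auto
          finally have "sqrt (g (?\<gamma> t) (differential \<A> ?\<gamma> t 1) (differential \<A> ?\<gamma> t 1)) \<le> sqrt M * norm (x - y)"
            using real_sqrt_le_mono by (fastforce simp: real_sqrt_mult norm_minus_commute)
          then show ?thesis using True by (simp add: ennreal_leI)
        qed simp
      qed
      also have "\<dots> = ennreal (sqrt M * norm (x - y))"
        by (subst nn_integral_cmult_indicator) auto
      finally show ?thesis .
    qed
    have "riemannian_dist \<A> g (inv_chart c x) (inv_chart c y) \<le> curve_length \<A> g ?\<gamma>"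
      unfolding riemannian_dist_def
      by (rule INF_lower) (use path in \<open>simp add: G_def\<close>)
    then show "riemannian_dist \<A> g (inv_chart c x) (inv_chart c y) \<le> ennreal (sqrt M * norm (x - y))"
      using len by (rule order_trans)
  qed
qed

end

context almost_complex_manifold
begin

lemma totally_real_slice:
  assumes c: "c \<in> \<A>" and N0: "subspace N0" and N: "snd c ` (fst c \<inter> N) = snd c ` fst c \<inter> N0"
    and p: "p \<in> fst c" "p \<in> N" and tr: "totally_real \<A> J N"
    and X: "X \<in> N0" "Jc c (snd c p) X \<in> N0"
  shows "X = 0"
proof -
  have xU: "snd c p \<in> snd c ` fst c" using p by blast
  have ip: "inv_chart c (snd c p) = p" using chart_inverse(3)[OF c p(1)] .
  have "coord_vec \<A> c p (Jc c (snd c p) X) = J p (coord_vec \<A> c p X)"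
    using J_coord_vec[OF c xU] unfolding ip by simp
  then have "coord_vec \<A> c p (Jc c (snd c p) X) \<in> tangent_space_of \<A> N p \<inter> J p ` tangent_space_of \<A> N p"
    using coord_vec_tangent_slice[OF c N0 N p] X by (metis IntI imageI)
  then have "coord_vec \<A> c p (Jc c (snd c p) X) = (\<lambda>c. 0)"
    using tr p(2) unfolding totally_real_def by auto
  then have "Jc c (snd c p) X = 0" using coord_vec_same[OF c p(1), of "Jc c (snd c p) X"] by metis
  then show "X = 0" using Jc_Jc[OF c xU, of X] linear_0[OF Jc_linear[OF c xU]] by simp
qed

end

lemma tendsto_minus_infinity_near:
  fixes u :: "'a \<Rightarrow> ereal" and D :: "'a \<Rightarrow> ennreal"
  assumes "(u \<longlongrightarrow> -\<infinity>) (inf (filtercomap D (nhds 0)) (principal L))"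
  shows "\<exists>\<epsilon>>0. \<forall>q\<in>L. D q \<le> ennreal \<epsilon> \<longrightarrow> u q < ereal K"
proof -
  have "\<forall>\<^sub>F q in inf (filtercomap D (nhds 0)) (principal L). u q < ereal K"
    using order_tendstoD(2)[OF assms, of "ereal K"] by simp
  then have "\<forall>\<^sub>F q in filtercomap D (nhds 0). q \<in> L \<longrightarrow> u q < ereal K"
    by (simp add: eventually_inf_principal)
  then obtain Q where Q: "\<forall>\<^sub>F x in nhds 0. Q x" "\<And>q. Q (D q) \<Longrightarrow> q \<in> L \<longrightarrow> u q < ereal K"
    unfolding eventually_filtercomap by blast
  obtain S where S: "open S" "0 \<in> S" "\<And>x. x \<in> S \<Longrightarrow> Q x" using Q(1) unfolding eventually_nhds by blast
  obtain b where b: "0 < b" "{0..<b} \<subseteq> S"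
    using open_right[OF S(1,2), of top] by auto
  define \<epsilon> where "\<epsilon> = (if b = top then 1 else enn2real b / 2)"
  have e0: "\<epsilon> > 0" using b(1) by (auto simp: \<epsilon>_def enn2real_positive_iff less_top)
  have eb: "ennreal \<epsilon> < b"
  proof (cases "b = top")
    case False
    then have "ennreal (enn2real b) = b" by (simp add: less_top)
    moreover have "ennreal \<epsilon> < ennreal (enn2real b)" using e0 False by (intro ennreal_lessI) (auto simp: \<epsilon>_def)
    ultimately show ?thesis by simp
  qed (simp add: \<epsilon>_def)
  show ?thesis
  proof (intro exI[of _ \<epsilon>] conjI e0 ballI impI)
    fix q assume q: "q \<in> L" "D q \<le> ennreal \<epsilon>"
    then have "D q \<in> S" using b(2) eb by (auto intro: order_le_less_trans)
    then show "u q < ereal K" using S(3) Q(2) q(1) by blast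
  qed
qed

section \<open>Subharmonic functions and the half-disc\<close>

text \<open>The positive and the negative parts are compared separately, because the negative part of
  \<open>f\<close> may have infinite integral.\<close>

lemma ereal_integral_le:
  fixes f :: "'x \<Rightarrow> ereal" and w :: "'x \<Rightarrow> real"
  assumes w: "integrable M w" and le: "\<And>x. x \<in> space M \<Longrightarrow> f x \<le> ereal (w x)"
  shows "ereal_integral M f \<le> ereal (\<integral>x. w x \<partial>M)"
proof -
  let ?p = "\<integral>\<^sup>+ x. ennreal (w x) \<partial>M" and ?n = "\<integral>\<^sup>+ x. ennreal (- w x) \<partial>M"
  have fin: "?p < top" "?n < top" using w by (auto simp: real_integrable_def less_top)
  have 1: "(\<integral>\<^sup>+ x. e2ennreal (f x) \<partial>M) \<le> ?p"
    by (intro nn_integral_mono) (use e2ennreal_mono[OF le] in simp)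
  have 2: "?n \<le> (\<integral>\<^sup>+ x. e2ennreal (- f x) \<partial>M)"
  proof (intro nn_integral_mono)
    fix x assume "x \<in> space M"
    then have "ereal (- w x) \<le> - f x" using le[of x] by (metis ereal_minus_le_minus uminus_ereal.simps(1))
    from e2ennreal_mono[OF this] show "ennreal (- w x) \<le> e2ennreal (- f x)" by simp
  qed
  have "ereal_integral M f \<le> enn2ereal ?p - enn2ereal ?n"
    unfolding ereal_integral_def
    by (intro ereal_minus_mono) (use 1 2 in \<open>simp_all add: less_eq_ennreal.rep_eq\<close>)
  also have "\<dots> = ereal (enn2real ?p) - ereal (enn2real ?n)"
    using fin by (cases ?p; cases ?n) (auto simp: enn2ereal_ennreal)
  also have "\<dots> = ereal (\<integral>x. w x \<partial>M)" by (simp add: real_lebesgue_integral_def[OF w])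
  finally show ?thesis .
qed

text \<open>The submean value inequality on the circle of radius \<open>r\<close>, with \<open>- K\<close> on an
  arc and \<open>C\<close> elsewhere.\<close>

lemma subharmonic_two_constants:
  assumes v: "subharmonic_on (ball 0 1) v" and C: "\<And>z. z \<in> ball 0 1 \<Longrightarrow> v z \<le> ereal C"
    and r: "0 < r" "r < 1" and ab: "0 \<le> \<alpha>" "\<alpha> \<le> \<beta>" "\<beta> \<le> 2 * pi"
    and K: "\<And>t. \<alpha> \<le> t \<Longrightarrow> t \<le> \<beta> \<Longrightarrow> v (of_real r * cis t) \<le> ereal (- K)"
  shows "v 0 \<le> ereal (C - (C + K) * ((\<beta> - \<alpha>) / (2 * pi)))"
proof -
  let ?M = "uniform_measure lborel {0..2 * pi}"
  have e1: "emeasure ?M (space ?M) = 1"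
    by (simp add: emeasure_uniform_measure_1)
  interpret finite_measure ?M by (rule finite_measureI) (unfold e1, simp)
  define w where "w t = C - (C + K) * indicator {\<alpha>..\<beta>} t" for t
  have int: "integrable ?M (indicator {\<alpha>..\<beta>} :: real \<Rightarrow> real)"
    by (rule integrable_real_indicator) (use emeasure_finite[of "{\<alpha>..\<beta>}"] in \<open>simp_all add: less_top\<close>)
  have wi: "integrable ?M w" unfolding w_def
    by (intro Bochner_Integration.integrable_diff integrable_const integrable_mult_right int)
  have m: "measure ?M {\<alpha>..\<beta>} = (\<beta> - \<alpha>) / (2 * pi)"
  proof -
    have "{0..2 * pi} \<inter> {\<alpha>..\<beta>} = {\<alpha>..\<beta>}" using ab by auto
    then show ?thesis using ab by (subst measure_uniform_measure) auto
  qed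
  have m1: "measure ?M (space ?M) = 1" using e1 by (simp add: measure_def)
  have "(\<integral>t. w t \<partial>?M) = C - (C + K) * ((\<beta> - \<alpha>) / (2 * pi))"
    unfolding w_def
    by (subst Bochner_Integration.integral_diff) (use m m1 in \<open>auto intro!: integrable_mult_right int\<close>)
  moreover have "v 0 \<le> ereal_integral ?M (\<lambda>t. v (0 + of_real r * cis t))"
  proof -
    have "cball 0 r \<subseteq> ball (0::complex) 1" using r by auto
    then show ?thesis using v r(1) unfolding subharmonic_on_def by blast
  qed
  moreover have "ereal_integral ?M (\<lambda>t. v (0 + of_real r * cis t)) \<le> ereal (\<integral>t. w t \<partial>?M)"
  proof (rule ereal_integral_le[OF wi])
    fix t :: real
    show "v (0 + of_real r * cis t) \<le> ereal (w t)"
    proof (cases "t \<in> {\<alpha>..\<beta>}")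
      case True then show ?thesis using K[of t] by (simp add: w_def)
    next
      case False
      have "of_real r * cis t \<in> ball 0 1" using r by (simp add: norm_mult)
      then show ?thesis using C False by (simp add: w_def)
    qed
  qed
  ultimately show ?thesis by (metis order_trans)
qed

text \<open>The Cayley transform of the unit disc to the upper half plane; it maps the lower half of the unit
  circle to the positive real axis.\<close>

definition cayley :: "complex \<Rightarrow> complex" where "cayley z = \<i> * ((1 + z) / (1 - z))"

text \<open>The conformal map of the unit disc to the upper half of the unit disc: the half plane is mapped to a
  quadrant by the square root and the quadrant to the half-disc by a Cayley transform. The lower half
  of the unit circle corresponds to the diameter.\<close>

definition half_disc_map :: "complex \<Rightarrow> complex" where
  "half_disc_map z = (csqrt (cayley z) - 1) / (csqrt (cayley z) + 1)"

definition half_disc_map' :: "complex \<Rightarrow> complex" where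
  "half_disc_map' z = 2 / (csqrt (cayley z) + 1)\<^sup>2 * (inverse (2 * csqrt (cayley z)) * (\<i> * (2 / (1 - z)\<^sup>2)))"

lemma cayley_Re_Im:
  assumes "z \<noteq> 1"
  shows "Im (cayley z) = (1 - (norm z)\<^sup>2) / (norm (1 - z))\<^sup>2" "Re (cayley z) = - 2 * Im z / (norm (1 - z))\<^sup>2"
proof -
  have n: "(norm (1 - z))\<^sup>2 = (1 - Re z)\<^sup>2 + (Im z)\<^sup>2" by (simp add: cmod_power2)
  have "Im (cayley z) = ((1 + Re z) * (1 - Re z) - Im z * Im z) / ((1 - Re z)\<^sup>2 + (Im z)\<^sup>2)"
    unfolding cayley_def Im_i_times Re_divide by simp
  also have "(1 + Re z) * (1 - Re z) - Im z * Im z = 1 - (norm z)\<^sup>2"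
    unfolding cmod_power2 by (simp add: power2_eq_square algebra_simps)
  finally show "Im (cayley z) = (1 - (norm z)\<^sup>2) / (norm (1 - z))\<^sup>2" unfolding n .
  have "Re (cayley z) = - ((Im z * (1 - Re z) + (1 + Re z) * Im z) / ((1 - Re z)\<^sup>2 + (Im z)\<^sup>2))"
    unfolding cayley_def Re_i_times Im_divide by simp
  also have "\<dots> = - 2 * Im z / (norm (1 - z))\<^sup>2" unfolding n by (simp add: algebra_simps)
  finally show "Re (cayley z) = - 2 * Im z / (norm (1 - z))\<^sup>2" .
qed

lemma csqrt_upper:
  assumes "Im m > 0 \<or> Im m = 0 \<and> Re m > 0"
  shows "Re (csqrt m) > 0" "Im m > 0 \<Longrightarrow> Im (csqrt m) > 0" "Im m = 0 \<Longrightarrow> Im (csqrt m) = 0" "m \<notin> \<real>\<^sub>\<le>\<^sub>0"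
proof -
  define w where "w = csqrt m"
  have sq: "m = w\<^sup>2" unfolding w_def by (rule power2_csqrt[symmetric])
  have i: "Im m = 2 * Re w * Im w" unfolding sq by (simp add: power2_eq_square)
  have re: "Re m = (Re w)\<^sup>2 - (Im w)\<^sup>2" unfolding sq by (simp add: power2_eq_square)
  have p: "Re w \<ge> 0" unfolding w_def using csqrt_principal[of m] by auto
  have r: "Re w > 0"
  proof (rule ccontr)
    assume "\<not> Re w > 0"
    then have "Re w = 0" using p by simp
    then have "Im m = 0" "Re m \<le> 0" using i re by simp_all
    then show False using assms by linarith
  qed
  then show "Re (csqrt m) > 0" unfolding w_def .
  have "Im m > 0 \<Longrightarrow> Im w > 0" using i r by (simp add: zero_less_mult_iff)
  then show "Im m > 0 \<Longrightarrow> Im (csqrt m) > 0" unfolding w_def .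
  have "Im m = 0 \<Longrightarrow> Im w = 0" using i r by simp
  then show "Im m = 0 \<Longrightarrow> Im (csqrt m) = 0" unfolding w_def .
  show "m \<notin> \<real>\<^sub>\<le>\<^sub>0" using assms by (auto simp: complex_nonpos_Reals_iff)
qed

lemma cayley_bounds:
  assumes "Re w > 0"
  shows "w + 1 \<noteq> 0" "norm ((w - 1) / (w + 1)) < 1" "Im ((w - 1) / (w + 1)) = 2 * Im w / (norm (w + 1))\<^sup>2"
proof -
  show n: "w + 1 \<noteq> 0" using assms by (auto simp: complex_eq_iff)
  have "(norm (w - 1))\<^sup>2 < (norm (w + 1))\<^sup>2"
    using assms unfolding cmod_power2 by (simp add: power2_eq_square algebra_simps)
  then have "norm (w - 1) < norm (w + 1)" by (rule power_less_imp_less_base) simp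
  then show "norm ((w - 1) / (w + 1)) < 1" using n by (simp add: norm_divide)
  show "Im ((w - 1) / (w + 1)) = 2 * Im w / (norm (w + 1))\<^sup>2"
    by (simp add: Im_divide cmod_power2 algebra_simps)
qed

lemma cayley_cases:
  shows "norm z < 1 \<Longrightarrow> Im (cayley z) > 0"
    and "norm z \<le> 1 \<Longrightarrow> Im z < 0 \<Longrightarrow> Im (cayley z) > 0 \<or> Im (cayley z) = 0 \<and> Re (cayley z) > 0"
    and "norm z = 1 \<Longrightarrow> Im z < 0 \<Longrightarrow> Im (cayley z) = 0 \<and> Re (cayley z) > 0"
proof -
  show 1: "norm z < 1 \<Longrightarrow> Im (cayley z) > 0"
  proof -
    assume z: "norm z < 1"
    then have "z \<noteq> 1" by auto
    moreover have "(norm z)\<^sup>2 < 1" using z by (simp add: power_less_one_iff abs_square_less_1)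
    ultimately show ?thesis by (simp add: cayley_Re_Im)
  qed
  show 2: "norm z = 1 \<Longrightarrow> Im z < 0 \<Longrightarrow> Im (cayley z) = 0 \<and> Re (cayley z) > 0"
  proof -
    assume z: "norm z = 1" "Im z < 0"
    then have "z \<noteq> 1" by auto
    then show ?thesis using z by (simp add: cayley_Re_Im divide_neg_pos)
  qed
  show "norm z \<le> 1 \<Longrightarrow> Im z < 0 \<Longrightarrow> Im (cayley z) > 0 \<or> Im (cayley z) = 0 \<and> Re (cayley z) > 0"
    using 1 2 by force
qed

lemma half_disc_map_props:
  shows "norm z < 1 \<Longrightarrow> Im (half_disc_map z) > 0"
    and "norm z < 1 \<Longrightarrow> norm (half_disc_map z) < 1"
    and "norm z = 1 \<Longrightarrow> Im z < 0 \<Longrightarrow> Im (half_disc_map z) = 0 \<and> norm (half_disc_map z) < 1"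
    and "norm z < 1 \<Longrightarrow> (half_disc_map has_field_derivative half_disc_map' z) (at z)"
    and "norm z \<le> 1 \<Longrightarrow> Im z < 0 \<Longrightarrow> isCont half_disc_map z"
proof -
  assume z: "norm z < 1"
  note m = csqrt_upper[of "cayley z"]
  have i: "Im (cayley z) > 0" by (rule cayley_cases(1)[OF z])
  have z1: "z \<noteq> 1" using z by auto
  show "Im (half_disc_map z) > 0" "norm (half_disc_map z) < 1"
    unfolding half_disc_map_def using cayley_bounds[OF m(1)] m(2) i by auto
  have dm: "(cayley has_field_derivative \<i> * (2 / (1 - z)\<^sup>2)) (at z)"
    unfolding cayley_def using z1
    by (auto intro!: derivative_eq_intros simp: power2_eq_square algebra_simps)
  have "((\<lambda>z. csqrt (cayley z)) has_field_derivative inverse (2 * csqrt (cayley z)) * (\<i> * (2 / (1 - z)\<^sup>2))) (at z)"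
    using i m(4) by (intro DERIV_chain2[OF has_field_derivative_csqrt dm]) auto
  then have "((\<lambda>z. (csqrt (cayley z) - 1) / (csqrt (cayley z) + 1)) has_field_derivative
      ((inverse (2 * csqrt (cayley z)) * (\<i> * (2 / (1 - z)\<^sup>2)) - 0) * (csqrt (cayley z) + 1) -
       (csqrt (cayley z) - 1) * (inverse (2 * csqrt (cayley z)) * (\<i> * (2 / (1 - z)\<^sup>2)) + 0)) /
       ((csqrt (cayley z) + 1) * (csqrt (cayley z) + 1))) (at z)"
    using cayley_bounds(1)[OF m(1)] i
    by (intro DERIV_divide DERIV_diff DERIV_add DERIV_const) auto
  moreover have "((X - 0) * (w + 1) - (w - 1) * (X + 0)) / ((w + 1) * (w + 1)) = 2 / (w + 1)\<^sup>2 * X" for X w :: complex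
    by (simp add: power2_eq_square algebra_simps)
  ultimately show "(half_disc_map has_field_derivative half_disc_map' z) (at z)"
    unfolding half_disc_map_def[abs_def] half_disc_map'_def by (simp only:)
next
  assume z: "norm z = 1" "Im z < 0"
  note m = csqrt_upper[of "cayley z"]
  have i: "Im (cayley z) = 0 \<and> Re (cayley z) > 0" by (rule cayley_cases(3)[OF z])
  show "Im (half_disc_map z) = 0 \<and> norm (half_disc_map z) < 1"
    unfolding half_disc_map_def using cayley_bounds[OF m(1)] m(3) i by auto
next
  assume z: "norm z \<le> 1" "Im z < 0"
  note m = csqrt_upper[OF cayley_cases(2)[OF z]]
  have z1: "z \<noteq> 1" using z by auto
  have "isCont cayley z" unfolding cayley_def using z1 by (intro continuous_intros) auto
  then have "isCont (\<lambda>z. csqrt (cayley z)) z"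
    using continuous_at_csqrt[OF m(4)] by (rule isCont_o2)
  then show "isCont half_disc_map z"
    unfolding half_disc_map_def[abs_def] using cayley_bounds(1)[OF m(1)] by (intro continuous_intros) auto
qed

lemma half_disc_map'_continuous: "continuous_on (ball 0 1) half_disc_map'"
proof -
  have mc: "continuous_on (ball 0 1) cayley"
    unfolding cayley_def by (intro continuous_intros) auto
  have "continuous_on (ball 0 1) (\<lambda>z. csqrt (cayley z))"
  proof (rule continuous_at_imp_continuous_on, intro ballI)
    fix z :: complex assume "z \<in> ball 0 1"
    then have z: "norm z < 1" by simp
    have "isCont cayley z" using mc z by (simp add: continuous_on_eq_continuous_at)
    then show "isCont (\<lambda>z. csqrt (cayley z)) z"
      using continuous_at_csqrt[OF csqrt_upper(4)] cayley_cases(1)[OF z] by (intro isCont_o2[of z cayley csqrt]) auto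
  qed
  moreover have "csqrt (cayley z) + 1 \<noteq> 0" "csqrt (cayley z) \<noteq> 0" if "z \<in> ball 0 1" for z
    using cayley_bounds(1)[OF csqrt_upper(1)] csqrt_upper(1)[of "cayley z"] cayley_cases(1)[of z] that by auto
  ultimately show ?thesis unfolding half_disc_map'_def
    by (intro continuous_intros) auto
qed

lemma half_disc_map_zero: "\<exists>\<tau>. 0 < \<tau> \<and> \<tau> < 1 \<and> half_disc_map 0 = \<i> * of_real \<tau>"
proof -
  define w where "w = csqrt \<i>"
  have w2: "w\<^sup>2 = \<i>" unfolding w_def by (rule power2_csqrt)
  have "(norm w)\<^sup>2 = 1" using w2 by (metis norm_ii norm_power)
  then have n: "(Re w)\<^sup>2 + (Im w)\<^sup>2 = 1" by (simp add: cmod_power2)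
  have h: "half_disc_map 0 = (w - 1) / (w + 1)" by (simp add: half_disc_map_def cayley_def w_def)
  have "Re (half_disc_map 0) = 0"
    unfolding h Re_divide using n by (simp add: power2_eq_square algebra_simps)
  then have eq: "half_disc_map 0 = \<i> * of_real (Im (half_disc_map 0))" by (simp add: complex_eq_iff)
  have "Im (half_disc_map 0) > 0" "norm (half_disc_map 0) < 1" using half_disc_map_props(1,2)[of 0] by auto
  then show ?thesis using eq abs_Im_le_cmod[of "half_disc_map 0"] by (intro exI[of _ "Im (half_disc_map 0)"]) auto
qed

section \<open>Propagation of the value minus infinity\<close>

context normal_coordinates
begin

lemma estimateD:
  assumes "estimate r M"
  shows "r > 0" "M \<ge> 0"
    and "norm Z \<le> r \<Longrightarrow> norm (b - p) \<le> r \<Longrightarrow> b + P Z \<in> cball p r0"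
    and "norm Z \<le> r \<Longrightarrow> norm (b - p) \<le> r \<Longrightarrow> Phi b Z \<in> cball p r0"
    and "norm Z \<le> r \<Longrightarrow> norm (b - p) \<le> r \<Longrightarrow> norm (Amap b Z - id_blinfun) \<le> M * (norm Z + norm (b - p))"
    and "norm Z \<le> r \<Longrightarrow> norm (b - p) \<le> r \<Longrightarrow> norm (Phi b Z - (b + Z)) \<le> M * norm Z * (norm Z + norm (b - p))"
    and "norm Z \<le> r \<Longrightarrow> norm (b - p) \<le> r \<Longrightarrow> norm Z' \<le> r \<Longrightarrow> norm (Amap b Z - Amap b Z') \<le> M * norm (Z - Z')"
    and "0 < \<delta> \<Longrightarrow> \<delta> \<le> 1 \<Longrightarrow> 0 \<le> R \<Longrightarrow> \<delta> * R \<le> r \<Longrightarrow> norm (b - p) \<le> \<delta> \<Longrightarrow> norm (b - p) \<le> r \<Longrightarrow>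
       four_point (cball 0 R) (M * \<delta> * (R + 1)) (\<lambda>Z. Q1 b (\<delta> *\<^sub>R Z))"
    and "0 < \<delta> \<Longrightarrow> \<delta> \<le> 1 \<Longrightarrow> 0 \<le> R \<Longrightarrow> \<delta> * R \<le> r \<Longrightarrow> norm (b - p) \<le> \<delta> \<Longrightarrow> norm (b - p) \<le> r \<Longrightarrow>
       four_point (cball 0 R) (M * \<delta> * (R + 1)) (\<lambda>Z. Q2 b (\<delta> *\<^sub>R Z))"
  using assms unfolding estimate_def by blast+

lemma disc_of_solution:
  fixes F :: "complex \<Rightarrow> 'e"
  assumes est: "estimate r M" and b: "norm (b - p) \<le> r"
    and F: "\<And>z. (F has_derivative F' z) (at z)" "\<And>z. z \<in> S \<Longrightarrow> norm (\<delta> *\<^sub>R F z) \<le> r"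
  shows "z \<in> S \<Longrightarrow> ((\<lambda>z. Phi b (\<delta> *\<^sub>R F z)) has_derivative (\<lambda>v. Amap b (\<delta> *\<^sub>R F z) (\<delta> *\<^sub>R F' z v))) (at z)"
    and "continuous_on UNIV (\<lambda>z. F' z v) \<Longrightarrow> continuous_on S (\<lambda>z. Amap b (\<delta> *\<^sub>R F z) (\<delta> *\<^sub>R F' z v))"
    and "F' z 1 + J p (F' z \<i>) = Q1 b (\<delta> *\<^sub>R F z) (F' z 1 + J p (F' z \<i>)) + Q2 b (\<delta> *\<^sub>R F z) (F' z 1) \<Longrightarrow>
       Amap b (\<delta> *\<^sub>R F z) (\<delta> *\<^sub>R F' z \<i>) = J (Phi b (\<delta> *\<^sub>R F z)) (Amap b (\<delta> *\<^sub>R F z) (\<delta> *\<^sub>R F' z 1))"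
proof -
  show "z \<in> S \<Longrightarrow> ((\<lambda>z. Phi b (\<delta> *\<^sub>R F z)) has_derivative (\<lambda>v. Amap b (\<delta> *\<^sub>R F z) (\<delta> *\<^sub>R F' z v))) (at z)"
    by (rule has_derivative_compose[OF has_derivative_scaleR_right[OF F(1)] Phi_has_derivative[OF estimateD(3)[OF est F(2) b]]])
  have "M-lipschitz_on (cball 0 r) (Amap b)"
    using estimateD(2)[OF est] estimateD(7)[OF est _ b] by (intro lipschitz_onI) (auto simp: dist_norm)
  then have A: "continuous_on (cball 0 r) (Amap b)" by (rule lipschitz_on_continuous_on)
  have Fc: "continuous_on S F"
    using F(1) by (meson continuous_at_imp_continuous_on has_derivative_continuous)
  show "continuous_on UNIV (\<lambda>z. F' z v) \<Longrightarrow> continuous_on S (\<lambda>z. Amap b (\<delta> *\<^sub>R F z) (\<delta> *\<^sub>R F' z v))"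
  proof (rule bounded_bilinear.continuous_on[OF bounded_bilinear_blinfun_apply])
    show "continuous_on S (\<lambda>z. Amap b (\<delta> *\<^sub>R F z))"
      by (rule continuous_on_compose2[OF A]) (use F(2) in \<open>auto intro!: continuous_intros Fc\<close>)
    assume "continuous_on UNIV (\<lambda>z. F' z v)"
    then show "continuous_on S (\<lambda>z. \<delta> *\<^sub>R F' z v)"
      by (intro continuous_on_scaleR continuous_on_const continuous_on_subset[of UNIV _ S]) auto
  qed
  assume "F' z 1 + J p (F' z \<i>) = Q1 b (\<delta> *\<^sub>R F z) (F' z 1 + J p (F' z \<i>)) + Q2 b (\<delta> *\<^sub>R F z) (F' z 1)"
  from holomorphic_from_rhs[OF this]
  show "Amap b (\<delta> *\<^sub>R F z) (\<delta> *\<^sub>R F' z \<i>) = J (Phi b (\<delta> *\<^sub>R F z)) (Amap b (\<delta> *\<^sub>R F z) (\<delta> *\<^sub>R F' z 1))"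
    by (simp add: blinfun.scaleR_right)
qed

end

lemma small_parameter:
  fixes B e :: real assumes "B \<ge> 0" "e > 0"
  shows "\<exists>\<delta>>0. \<delta> \<le> 1 \<and> B * \<delta> \<le> e"
proof (intro exI[of _ "min 1 (e / (B + 1))"] conjI)
  have "B * min 1 (e / (B + 1)) \<le> B * (e / (B + 1))" using assms by (intro mult_left_mono) auto
  also have "\<dots> = e * (B / (B + 1))" by simp
  also have "\<dots> \<le> e * 1" using assms by (intro mult_left_mono) auto
  finally show "B * min 1 (e / (B + 1)) \<le> e" by simp
qed (use assms in auto)

context almost_complex_manifold
begin

text \<open>Affine discs of size \<open>\<delta>\<close> are perturbed. After dilation the structure is as close
  to a constant one as desired, so \<open>full_disc\<close> applies with \<open>P = id\<close>.\<close>

lemma full_discs_near: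
  assumes c: "c \<in> \<A>" and x0: "x0 \<in> snd c ` fst c" and O: "open O'" "O' \<subseteq> snd c ` fst c" "x0 \<in> O'"
  shows "\<exists>\<delta>>0. ball x0 \<delta> \<subseteq> O' \<and> (\<forall>q\<in>ball x0 \<delta>. \<forall>w\<in>ball x0 \<delta>. \<exists>f. J_complex_disc \<A> J f \<and>
     f ` ball 0 1 \<subseteq> inv_chart c ` O' \<and> f 0 = inv_chart c q \<and> f (1/2) = inv_chart c w)"
proof -
  obtain r0 where r0: "r0 > 0" "cball x0 r0 \<subseteq> O'" using O open_contains_cball by blast
  then have r0U: "cball x0 r0 \<subseteq> snd c ` fst c" using O by blast
  interpret nc: normal_coordinates "JB c" "DJB c" x0 r0 "\<lambda>Z. Z"
    by (rule normal_coordinates_chart[OF c r0(1) r0U linear_ident])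
  interpret cs: complex_structure "blinfun_apply (JB c x0)"
    by (rule complex_structure.intro)
       (rule bounded_linear.linear[OF blinfun.bounded_linear_right], rule nc.J_sq[OF nc.p_in])
  have Phi: "nc.Phi b Z = b + Z" for b Z by (simp add: nc.Phi_def nc.\<kappa>_def blinfun.zero_right)
  obtain r M where est: "nc.estimate r M" using nc.estimate_exists by blast
  note rM = nc.estimateD(1,2)[OF est]
  obtain \<epsilon>0 R where \<epsilon>0: "\<epsilon>0 > 0" and R: "R > 0" and disc: "\<forall>\<epsilon> Q1 Q2 q w. 0 \<le> \<epsilon> \<and> \<epsilon> \<le> \<epsilon>0 \<and>
     four_point (cball 0 R) \<epsilon> (Q1 :: 'e \<Rightarrow> 'e \<Rightarrow>\<^sub>L 'e) \<and> four_point (cball 0 R) \<epsilon> (Q2 :: 'e \<Rightarrow> 'e \<Rightarrow>\<^sub>L 'e) \<and>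
     norm q \<le> 1 \<and> norm w \<le> 1 \<longrightarrow>
     (\<exists>F F'. (\<forall>z. (F has_derivative F' z) (at z)) \<and> continuous_on UNIV (\<lambda>z. F' z 1) \<and> continuous_on UNIV (\<lambda>z. F' z \<i>) \<and>
        F 0 = q \<and> F (1/2) = w \<and> (\<forall>z. norm z \<le> 1 \<longrightarrow> F z \<in> cball 0 R \<and>
          F' z 1 + JB c x0 (F' z \<i>) = Q1 (F z) (F' z 1 + JB c x0 (F' z \<i>)) + Q2 (F z) (F' z 1)))"
    using cs.full_disc[OF zero_le_one] by blast
  note disc = disc[rule_format]
  have "1 + R + M * (R + 1) \<ge> 0" "min (min r \<epsilon>0) r0 > 0" using R rM \<epsilon>0 r0 by auto
  from small_parameter[OF this] obtain \<delta> where \<delta>: "\<delta> > 0" "\<delta> \<le> 1" "(1 + R + M * (R + 1)) * \<delta> \<le> min (min r \<epsilon>0) r0" by blast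
  have "0 \<le> R * \<delta>" "0 \<le> M * (R + 1) * \<delta>" using R rM \<delta> by auto
  then have \<delta>': "\<delta> * R \<le> r" "M * \<delta> * (R + 1) \<le> \<epsilon>0" "0 \<le> M * \<delta> * (R + 1)" "\<delta> * R \<le> r0" "\<delta> \<le> r0"
    using \<delta>(1,3) by (auto simp: algebra_simps)
  have b0: "norm (x0 - x0) \<le> \<delta>" "norm (x0 - x0) \<le> r" using \<delta> rM by auto
  have inO: "x0 + \<delta> *\<^sub>R Z \<in> cball x0 r0" if "Z \<in> cball 0 R" for Z
  proof -
    have "\<delta> * norm Z \<le> \<delta> * R" using that \<delta> by (intro mult_left_mono) auto
    moreover have "dist x0 (x0 + \<delta> *\<^sub>R Z) = \<delta> * norm Z" using \<delta>(1) by (simp add: dist_norm)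
    ultimately show ?thesis using \<delta>'(4) by simp
  qed
  show ?thesis
  proof (intro exI[of _ \<delta>] conjI ballI \<delta>)
    have "ball x0 \<delta> \<subseteq> cball x0 r0" using \<delta>'(5) by auto
    then show "ball x0 \<delta> \<subseteq> O'" using r0 by blast
    fix q w assume qw: "q \<in> ball x0 \<delta>" "w \<in> ball x0 \<delta>"
    define q' w' where "q' = (1 / \<delta>) *\<^sub>R (q - x0)" and "w' = (1 / \<delta>) *\<^sub>R (w - x0)"
    have n: "norm q' \<le> 1" "norm w' \<le> 1"
      using qw \<delta>(1) by (auto simp: q'_def w'_def dist_norm norm_minus_commute divide_le_eq)
    note fp = nc.estimateD(8,9)[OF est \<delta>(1,2) less_imp_le[OF R] \<delta>'(1) b0]
    obtain F F' where F: "\<And>z. (F has_derivative F' z) (at z)" "continuous_on UNIV (\<lambda>z. F' z 1)" "continuous_on UNIV (\<lambda>z. F' z \<i>)"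
        "F 0 = q'" "F (1/2) = w'" "\<And>z. norm z \<le> 1 \<Longrightarrow> F z \<in> cball 0 R"
        "\<And>z. norm z \<le> 1 \<Longrightarrow> F' z 1 + JB c x0 (F' z \<i>) = nc.Q1 x0 (\<delta> *\<^sub>R F z) (F' z 1 + JB c x0 (F' z \<i>)) + nc.Q2 x0 (\<delta> *\<^sub>R F z) (F' z 1)"
      using disc[OF conjI[OF \<delta>'(3) conjI[OF \<delta>'(2) conjI[OF fp(1) conjI[OF fp(2) conjI[OF n]]]]]] by blast
    have Fr: "norm (\<delta> *\<^sub>R F z) \<le> r" if "z \<in> ball 0 1" for z
    proof -
      have "\<delta> * norm (F z) \<le> \<delta> * R" using F(6)[of z] that \<delta> by (intro mult_left_mono) auto
      moreover have "norm (\<delta> *\<^sub>R F z) = \<delta> * norm (F z)" using \<delta>(1) by simp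
      ultimately show ?thesis using \<delta>'(1) by linarith
    qed
    note G = nc.disc_of_solution[OF est b0(2) F(1) Fr]
    define G where "G z = nc.Phi x0 (\<delta> *\<^sub>R F z)" for z
    have GO: "G z \<in> cball x0 r0" if "z \<in> ball 0 1" for z
      unfolding G_def Phi using inO F(6)[of z] that by simp
    show "\<exists>f. J_complex_disc \<A> J f \<and> f ` ball 0 1 \<subseteq> inv_chart c ` O' \<and> f 0 = inv_chart c q \<and> f (1/2) = inv_chart c w"
    proof (intro exI[of _ "inv_chart c \<circ> G"] conjI)
      show "J_complex_disc \<A> J (inv_chart c \<circ> G)"
        unfolding G_def[abs_def]
        by (rule J_disc_from_chart[OF c, where G'="\<lambda>z v. nc.Amap x0 (\<delta> *\<^sub>R F z) (\<delta> *\<^sub>R F' z v)"])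
           (use GO r0U in \<open>auto simp: G_def intro!: G F\<close>)
      show "(inv_chart c \<circ> G) ` ball 0 1 \<subseteq> inv_chart c ` O'"
      proof (rule image_subsetI)
        fix z :: complex assume "z \<in> ball 0 1"
        then have "G z \<in> O'" using GO r0(2) by blast
        then show "(inv_chart c \<circ> G) z \<in> inv_chart c ` O'" by simp
      qed
      show "(inv_chart c \<circ> G) 0 = inv_chart c q" "(inv_chart c \<circ> G) (1/2) = inv_chart c w"
        using \<delta>(1) by (simp_all add: G_def Phi F q'_def w'_def)
    qed
  qed
qed

text \<open>The submean value property along a \<open>J\<close>-complex disc.\<close>

lemma psh_two_constants:
  assumes u: "plurisubharmonic_on \<A> J \<Omega> u" and C: "\<And>q. q \<in> \<Omega> \<Longrightarrow> u q \<le> ereal C"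
    and f: "J_complex_disc \<A> J f" "f ` ball 0 1 \<subseteq> \<Omega>"
    and r: "0 < r" "r < 1" and ab: "0 \<le> \<alpha>" "\<alpha> \<le> \<beta>" "\<beta> \<le> 2 * pi"
    and K: "\<And>t. \<alpha> \<le> t \<Longrightarrow> t \<le> \<beta> \<Longrightarrow> u (f (of_real r * cis t)) \<le> ereal (- K)"
  shows "u (f 0) \<le> ereal (C - (C + K) * ((\<beta> - \<alpha>) / (2 * pi)))"
proof -
  have "subharmonic_on (ball 0 1) (u \<circ> f)" using u f unfolding plurisubharmonic_on_def by blast
  then have "(u \<circ> f) 0 \<le> ereal (C - (C + K) * ((\<beta> - \<alpha>) / (2 * pi)))"
  proof (rule subharmonic_two_constants[OF _ _ r ab])
    show "(u \<circ> f) z \<le> ereal C" if "z \<in> ball 0 1" for z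
    proof -
      have "f z \<in> \<Omega>" using f(2) that by blast
      then show ?thesis using C by simp
    qed
    show "(u \<circ> f) (of_real r * cis t) \<le> ereal (- K)" if "\<alpha> \<le> t" "t \<le> \<beta>" for t using K[OF that] by simp
  qed
  then show ?thesis unfolding comp_def .
qed

lemma ereal_minus_infinity_if:
  assumes s: "s > (0::real)" and le: "\<And>K. x \<le> ereal (C - (C + K) * s)"
  shows "x = -\<infinity>"
proof (rule ccontr)
  assume "x \<noteq> -\<infinity>"
  moreover have "x \<noteq> \<infinity>" using le[of 0] by auto
  ultimately obtain y where y: "x = ereal y" by (cases x) auto
  have "y \<le> C - (C + ((C - y + 1) / s - C)) * s" using le[of "(C - y + 1) / s - C"] unfolding y by simp
  also have "\<dots> = y - 1" using s by simp
  finally show False by simp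
qed

text \<open>The interior \<open>W\<close> of the set where \<open>u = - \<infinity>\<close> is relatively
  closed. Near a boundary point every point \<open>q\<close> is the centre of a
  \<open>J\<close>-complex disc that passes through a point of \<open>W\<close> at \<open>1/2\<close>.
  An arc of the circle of radius \<open>1/2\<close> then lies in \<open>W\<close>, and the submean
  value inequality gives \<open>u q = - \<infinity>\<close>.\<close>

lemma propagation:
  assumes u: "plurisubharmonic_on \<A> J \<Omega> u" and C: "\<And>q. q \<in> \<Omega> \<Longrightarrow> u q \<le> ereal C"
    and \<Omega>: "open \<Omega>" "connected \<Omega>"
    and W0: "open W0" "W0 \<noteq> {}" "W0 \<subseteq> \<Omega>" "\<And>q. q \<in> W0 \<Longrightarrow> u q = -\<infinity>"
  shows "\<forall>q\<in>\<Omega>. u q = -\<infinity>"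
proof -
  define W where "W = interior {q\<in>\<Omega>. u q = -\<infinity>}"
  have Wo: "open W" "W \<subseteq> \<Omega>" "\<And>q. q \<in> W \<Longrightarrow> u q = -\<infinity>"
    unfolding W_def using interior_subset by blast+
  have W0W: "W0 \<subseteq> W" unfolding W_def by (rule interior_maximal) (use W0 in auto)
  have key: "p \<in> W" if p: "p \<in> \<Omega>" "p \<in> closure W" for p
  proof -
    obtain c where c: "c \<in> \<A>" "p \<in> fst c" using smooth unfolding smooth_structure_def by blast
    let ?O = "snd c ` (fst c \<inter> \<Omega>)"
    have O: "open ?O" by (rule chart_image_open[OF c(1) \<Omega>(1)])
    have pO: "?O \<subseteq> snd c ` fst c" "snd c p \<in> ?O" using c p by blast+
    obtain \<delta> where \<delta>: "\<delta> > 0" "ball (snd c p) \<delta> \<subseteq> ?O" and disc: "\<forall>q\<in>ball (snd c p) \<delta>. \<forall>w\<in>ball (snd c p) \<delta>.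
        \<exists>f. J_complex_disc \<A> J f \<and> f ` ball 0 1 \<subseteq> inv_chart c ` ?O \<and> f 0 = inv_chart c q \<and> f (1/2) = inv_chart c w"
      using full_discs_near[OF c(1) imageI[OF c(2)] O pO] by blast
    have OO: "inv_chart c ` ?O \<subseteq> \<Omega>" using chart_inverse(3)[OF c(1)] by auto
    define V where "V = fst c \<inter> snd c -` ball (snd c p) \<delta>"
    have V: "open V" unfolding V_def
      by (rule continuous_open_preimage[OF chart_inverse(5)[OF c(1)] chart(1)[OF c(1)] open_ball])
    have pV: "p \<in> V" using c \<delta> by (simp add: V_def)
    obtain w where w: "w \<in> W" "w \<in> V" using p(2) pV open_Int_closure_eq_empty[OF V, of W] by blast
    have uV: "q \<in> \<Omega> \<and> u q = -\<infinity>" if q: "q \<in> V" for q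
    proof -
      obtain f where f: "J_complex_disc \<A> J f" "f ` ball 0 1 \<subseteq> inv_chart c ` ?O" "f 0 = q" "f (1/2) = w"
      proof -
        have "snd c q \<in> ball (snd c p) \<delta>" "snd c w \<in> ball (snd c p) \<delta>" "inv_chart c (snd c q) = q" "inv_chart c (snd c w) = w"
          using q w(2) chart_inverse(3)[OF c(1)] unfolding V_def by blast+
        then show thesis using disc that by metis
      qed
      have f\<Omega>: "f ` ball 0 1 \<subseteq> \<Omega>" using f(2) OO by blast
      have q\<Omega>: "q \<in> \<Omega>" using f\<Omega> f(3) by force
      have fc: "continuous_on (ball 0 1) f" using f(1) unfolding J_complex_disc_def Ck_into_def by blast
      define h where "h t = f (of_real (1/2) * cis t)" for t :: real
      have hc: "continuous_on UNIV h" unfolding h_def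
        by (rule continuous_on_compose2[OF fc]) (auto intro!: continuous_intros simp: norm_mult)
      have "open (h -` W)" by (rule open_vimage[OF Wo(1) hc])
      moreover have "0 \<in> h -` W" using w(1) f(4) by (simp add: h_def)
      ultimately obtain e where e: "e > 0" "ball 0 e \<subseteq> h -` W" using open_contains_ball by blast
      \<comment> \<open>The arc is capped so that it is contained in one turn of the circle.\<close>
      define \<beta> where "\<beta> = min (e / 2) pi"
      have \<beta>: "0 < \<beta>" "\<beta> \<le> 2 * pi" using e pi_gt_zero by (auto simp: \<beta>_def min_def)
      have "u (f 0) \<le> ereal (C - (C + K) * ((\<beta> - 0) / (2 * pi)))" for K
      proof (rule psh_two_constants[OF u C f(1) f\<Omega>, of "1/2"])
        fix t assume t: "0 \<le> t" "t \<le> \<beta>"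
        then have "t \<in> ball 0 e" using e by (auto simp: \<beta>_def)
        then have "h t \<in> W" using e by auto
        then show "u (f (of_real (1/2) * cis t)) \<le> ereal (- K)" using Wo(3) by (simp add: h_def)
      qed (use \<beta> in auto)
      then have "u (f 0) = -\<infinity>" by (rule ereal_minus_infinity_if[rotated]) (use \<beta> in auto)
      then show ?thesis using q\<Omega> f(3) by simp
    qed
    have "V \<subseteq> W" unfolding W_def by (rule interior_maximal[OF _ V]) (use uV in auto)
    then show "p \<in> W" using pV by blast
  qed
  have "W \<inter> \<Omega> = {} \<or> (- closure W) \<inter> \<Omega> = {}"
    by (rule connectedD[OF \<Omega>(2) Wo(1)]) (use key closure_subset in \<open>auto simp: open_Compl\<close>)
  moreover have "W \<inter> \<Omega> \<noteq> {}" using W0W W0 Wo by blast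
  ultimately have "\<Omega> \<subseteq> W" using key by blast
  then show ?thesis using Wo(3) by blast
qed

end

section \<open>Half-discs attached to a totally real plane\<close>

text \<open>The space is the direct sum of \<open>N0\<close> and \<open>J0 N0\<close>, and
  \<open>\<sigma>\<close> changes the sign on the second summand.\<close>

lemma real_form_exists:
  fixes J0 :: "'e::euclidean_space \<Rightarrow> 'e"
  assumes J0: "complex_structure J0" and N0: "subspace N0" "DIM('e) = 2 * dim N0"
    and tr: "\<And>X. X \<in> N0 \<Longrightarrow> J0 X \<in> N0 \<Longrightarrow> X = 0"
  shows "\<exists>\<sigma>. real_form J0 \<sigma> \<and> (\<forall>X. \<sigma> X = X \<longleftrightarrow> X \<in> N0)"
proof -
  interpret complex_structure J0 by (rule J0)
  have inj: "inj J0" by (rule inj_on_inverseI[of _ "\<lambda>x. - J0 x"]) (simp add: J_J)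
  have sub: "subspace (J0 ` N0)" by (rule linear_subspace_image[OF linJ N0(1)])
  have d: "dim (J0 ` N0) = dim N0" by (rule dim_image_eq[OF linJ]) (use inj inj_on_subset in auto)
  have "N0 \<inter> J0 ` N0 = {0}" using tr subspace_0[OF N0(1)] linear_0[OF linJ] by force
  then have "dim {x + y |x y. x \<in> N0 \<and> y \<in> J0 ` N0} = DIM('e)"
    using dim_sums_Int[OF N0(1) sub] N0(2) d by simp
  then have full: "{x + y |x y. x \<in> N0 \<and> y \<in> J0 ` N0} = UNIV"
    using subspace_sums[OF N0(1) sub] dim_eq_full[of "{x + y |x y. x \<in> N0 \<and> y \<in> J0 ` N0}"]
      span_eq_iff[of "{x + y |x y. x \<in> N0 \<and> y \<in> J0 ` N0}"] by presburger
  \<comment> \<open>By dimension the direct sum is the whole space.\<close>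
  have ex: "\<exists>X Y. X \<in> N0 \<and> Y \<in> N0 \<and> X + J0 Y = Z" for Z
  proof -
    have "Z \<in> {x + y |x y. x \<in> N0 \<and> y \<in> J0 ` N0}" unfolding full by simp
    then show ?thesis by blast
  qed
  have "\<exists>a. \<forall>Z. \<exists>Y. a Z \<in> N0 \<and> Y \<in> N0 \<and> a Z + J0 Y = Z"
    by (rule choice, rule allI, rule ex)
  then obtain a where a: "\<forall>Z. \<exists>Y. a Z \<in> N0 \<and> Y \<in> N0 \<and> a Z + J0 Y = Z" ..
  have "\<exists>y. \<forall>Z. a Z \<in> N0 \<and> y Z \<in> N0 \<and> a Z + J0 (y Z) = Z"
    by (rule choice, rule a)
  then obtain y where y: "\<forall>Z. a Z \<in> N0 \<and> y Z \<in> N0 \<and> a Z + J0 (y Z) = Z" ..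
  have ay: "a Z \<in> N0" "y Z \<in> N0" "a Z + J0 (y Z) = Z" for Z using y[rule_format, of Z] by simp_all
  have uniq: "a Z = X \<and> y Z = Y" if "X \<in> N0" "Y \<in> N0" "X + J0 Y = Z" for Z X Y
  proof -
    have e: "a Z - X = J0 (Y - y Z)" using ay(3)[of Z] that(3) by (simp add: linear_diff[OF linJ] algebra_simps)
    have "J0 (Y - y Z) \<in> N0" unfolding e[symmetric] by (intro subspace_diff N0 ay that)
    then have "Y - y Z = 0" by (intro tr subspace_diff N0 ay that)
    then show ?thesis using e linear_0[OF linJ] by simp
  qed
  have add: "a (Z + W) = a Z + a W \<and> y (Z + W) = y Z + y W" for Z W
  proof (rule uniq)
    have "a Z + a W + J0 (y Z + y W) = (a Z + J0 (y Z)) + (a W + J0 (y W))" by (simp add: linear_add[OF linJ])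
    then show "a Z + a W + J0 (y Z + y W) = Z + W" unfolding ay(3) .
  qed (rule subspace_add[OF N0(1) ay(1) ay(1)], rule subspace_add[OF N0(1) ay(2) ay(2)])
  have scale: "a (r *\<^sub>R Z) = r *\<^sub>R a Z \<and> y (r *\<^sub>R Z) = r *\<^sub>R y Z" for Z r
  proof (rule uniq)
    have "r *\<^sub>R a Z + J0 (r *\<^sub>R y Z) = r *\<^sub>R (a Z + J0 (y Z))" by (simp add: linear_scale[OF linJ] scaleR_add_right)
    then show "r *\<^sub>R a Z + J0 (r *\<^sub>R y Z) = r *\<^sub>R Z" unfolding ay(3) .
  qed (rule subspace_scale[OF N0(1) ay(1)], rule subspace_scale[OF N0(1) ay(2)])
  define \<sigma> where "\<sigma> Z = a Z - J0 (y Z)" for Z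
  have "real_form J0 \<sigma>"
  proof (intro real_form.intro real_form_axioms.intro)
    show "complex_structure J0" by (rule J0)
    show "linear \<sigma>" unfolding \<sigma>_def
      by (rule linearI) (auto simp: add scale linear_add[OF linJ] linear_scale[OF linJ] algebra_simps)
    show "\<sigma> (\<sigma> Z) = Z" for Z
    proof -
      have "a (\<sigma> Z) = a Z \<and> y (\<sigma> Z) = - y Z"
        by (rule uniq[OF ay(1) subspace_neg[OF N0(1) ay(2)]]) (simp add: \<sigma>_def linear_neg[OF linJ])
      then show ?thesis using ay(3)[of Z] by (simp add: \<sigma>_def[of "\<sigma> Z"] linear_neg[OF linJ])
    qed
    show "\<sigma> (J0 Z) = - J0 (\<sigma> Z)" for Z
    proof -
      have "a (J0 Z) = - y Z \<and> y (J0 Z) = a Z"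
      proof (rule uniq)
        have "- y Z + J0 (a Z) = J0 (a Z + J0 (y Z))" by (simp add: linear_add[OF linJ] J_J)
        then show "- y Z + J0 (a Z) = J0 Z" unfolding ay(3) .
      qed (rule subspace_neg[OF N0(1) ay(2)], rule ay(1))
      then show ?thesis by (simp add: \<sigma>_def linear_diff[OF linJ] J_J)
    qed
  qed
  moreover have "\<sigma> X = X \<longleftrightarrow> X \<in> N0" for X
  proof
    assume "X \<in> N0"
    then have "a X = X \<and> y X = 0" by (rule uniq[OF _ subspace_0[OF N0(1)]]) (simp add: linear_0[OF linJ])
    then show "\<sigma> X = X" by (simp add: \<sigma>_def linear_0[OF linJ])
  next
    assume "\<sigma> X = X"
    then have "a X - J0 (y X) = a X + J0 (y X)" using ay(3)[of X] unfolding \<sigma>_def by simp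
    then have "J0 (y X) = - J0 (y X)" by (simp only: diff_conv_add_uminus add_left_cancel)
    then have "2 *\<^sub>R J0 (y X) = 0" unfolding scaleR_2 by (metis add.right_inverse)
    then have "J0 (y X) = 0" by simp
    then show "X \<in> N0" using ay(1)[of X] ay(3)[of X] by simp
  qed
  ultimately show ?thesis by blast
qed

context almost_complex_manifold
begin

text \<open>Half-discs attached to the translates \<open>b + N0\<close> of a totally real plane. The points
  \<open>q\<close> that are reached fill a ball which does not depend on the translate. The discs are
  nearly affine with velocity \<open>s v0\<close>, so their derivative in the imaginary direction is
  close to \<open>s Jc c x0 v0\<close>. They arise from solutions of the dilated equation in the
  coordinates \<open>Phi b\<close>, which map \<open>N0\<close> to \<open>b + N0\<close> by
  translation.\<close>

lemma attached_discs:
  assumes c: "c \<in> \<A>" and N0: "subspace N0" "DIM('e) = 2 * dim N0"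
    and tr: "\<And>X. X \<in> N0 \<Longrightarrow> Jc c x0 X \<in> N0 \<Longrightarrow> X = 0" and v0: "v0 \<in> N0"
    and \<theta>: "\<theta> > 0" "cball x0 \<theta> \<subseteq> snd c ` fst c" and \<tau>: "\<tau> > 0"
  shows "\<exists>y0. \<exists>\<epsilon>1>0. \<exists>\<epsilon>2>0. \<exists>s>0. \<forall>b q. norm (b - x0) \<le> \<epsilon>2 \<and> q \<in> ball y0 \<epsilon>1 \<longrightarrow>
    (\<exists>G G'. (\<forall>z\<in>cball 0 1. (G has_derivative G' z) (at z)) \<and>
       continuous_on (cball 0 1) (\<lambda>z. G' z 1) \<and> continuous_on (cball 0 1) (\<lambda>z. G' z \<i>) \<and>
       G (\<i> * of_real \<tau>) = q \<and> (\<forall>z\<in>cball 0 1. G z \<in> cball x0 \<theta>) \<and>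
       (\<forall>z\<in>cball 0 1. Im z \<ge> 0 \<longrightarrow> G' z \<i> = JB c (G z) (G' z 1) \<and> norm ((1 / s) *\<^sub>R G' z \<i> - Jc c x0 v0) \<le> \<theta>) \<and>
       (\<forall>x::real. \<bar>x\<bar> \<le> 1 \<longrightarrow> (\<exists>X\<in>N0. norm X \<le> \<theta> \<and> G (of_real x) = b + X)))"
proof -
  have x0U: "x0 \<in> snd c ` fst c" using \<theta> by auto
  define J0 where "J0 = blinfun_apply (JB c x0)"
  have J0c: "J0 = Jc c x0" unfolding J0_def by (rule JB_apply[OF c x0U])
  have JJ0: "J0 (J0 x) = - x" for x unfolding J0c by (rule Jc_Jc[OF c x0U])
  have cs: "complex_structure J0"
    by (rule complex_structure.intro) (auto simp: J0c Jc_linear[OF c x0U] Jc_Jc[OF c x0U])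
  obtain \<sigma> where rf: "real_form J0 \<sigma>" and \<sigma>N: "\<And>X. \<sigma> X = X \<longleftrightarrow> X \<in> N0"
    using real_form_exists[OF cs N0] tr unfolding J0c by blast
  interpret rf: real_form J0 \<sigma> by (rule rf)
  \<comment> \<open>The projection to \<open>N0\<close> along its image under \<open>J0\<close>.\<close>
  define P where "P Z = (1/2) *\<^sub>R (Z + \<sigma> Z)" for Z
  have linP: "linear P" unfolding P_def
    by (rule linearI) (auto simp: linear_add[OF rf.lin\<sigma>] linear_scale[OF rf.lin\<sigma>] algebra_simps)
  have PJ: "P (J0 x) = J0 (x - P x)" for x
  proof -
    have "x - P x = (1/2) *\<^sub>R (x - \<sigma> x)" unfolding P_def by (simp add: algebra_simps scaleR_half_double flip: scaleR_add_left)
    then show ?thesis unfolding P_def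
      by (simp add: rf.\<sigma>_J linear_scale[OF rf.linJ] linear_diff[OF rf.linJ])
  qed
  have P\<sigma>: "P X = X" if "\<sigma> X = X" for X unfolding P_def that by (simp add: scaleR_half_double flip: scaleR_add_left)
  interpret nc: normal_coordinates "JB c" "DJB c" x0 \<theta> P
    by (rule normal_coordinates_chart[OF c \<theta> linP])
  obtain r M where est: "nc.estimate r M" using nc.estimate_exists by blast
  note rM = nc.estimateD(1,2)[OF est]
  \<comment> \<open>The point at which the affine half-disc \<open>z \<mapsto> z v0\<close> arrives at the time \<open>\<i> \<tau>\<close>.\<close>
  define Z0 where "Z0 = \<tau> *\<^sub>R J0 v0"
  define bb where "bb = norm Z0 + 1"
  have bb: "bb \<ge> 0" "bb \<ge> 1" by (simp_all add: bb_def)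
  obtain \<epsilon>0 K1 R where \<epsilon>0: "\<epsilon>0 > 0" and K1: "K1 > 0" and R: "R > 0" and disc: "\<forall>\<epsilon> Q1 Q2 Z. 0 \<le> \<epsilon> \<and> \<epsilon> \<le> \<epsilon>0 \<and>
     four_point (cball 0 R) \<epsilon> (Q1 :: 'e \<Rightarrow> 'e \<Rightarrow>\<^sub>L 'e) \<and> four_point (cball 0 R) \<epsilon> (Q2 :: 'e \<Rightarrow> 'e \<Rightarrow>\<^sub>L 'e) \<and>
     (\<forall>X\<in>cball 0 R. \<sigma> X = X \<longrightarrow> Q2 X = 0) \<and> norm Z \<le> bb \<longrightarrow>
     (\<exists>F F'. (\<forall>z. (F has_derivative F' z) (at z)) \<and> continuous_on UNIV (\<lambda>z. F' z 1) \<and> continuous_on UNIV (\<lambda>z. F' z \<i>) \<and>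
        F (\<i> * of_real \<tau>) = Z \<and> (\<forall>x::real. \<sigma> (F (of_real x)) = F (of_real x)) \<and>
        (\<forall>z. norm z \<le> 1 \<longrightarrow> F z \<in> cball 0 R) \<and>
        (\<forall>z. norm z \<le> 1 \<and> Im z \<ge> 0 \<longrightarrow>
          F' z 1 + J0 (F' z \<i>) = Q1 (F z) (F' z 1 + J0 (F' z \<i>)) + Q2 (F z) (F' z 1)) \<and>
        (\<forall>z. norm (F' z 1 - rf.im_at \<tau> Z) \<le> K1 * \<epsilon>) \<and> (\<forall>z. norm (F' z \<i> - J0 (rf.im_at \<tau> Z)) \<le> K1 * \<epsilon>))"
    using rf.half_disc[OF bb(1) \<tau>] by (elim exE conjE) (rule that; assumption)
  note disc = disc[rule_format]
  have imZ0: "rf.im_at \<tau> Z0 = v0"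
  proof -
    have "\<sigma> v0 = v0" using v0 \<sigma>N by blast
    then have "Z0 - \<sigma> Z0 = (2 * \<tau>) *\<^sub>R J0 v0"
      unfolding Z0_def by (simp add: linear_scale[OF rf.lin\<sigma>] rf.\<sigma>_J algebra_simps flip: scaleR_add_left)
    then show ?thesis unfolding rf.im_at_def using \<tau> by (simp add: linear_scale[OF rf.linJ] JJ0)
  qed
  define kk where "kk = (1 + onorm \<sigma>) * (1 + onorm J0 / \<tau>)"
  have kk: "kk \<ge> 0" unfolding kk_def using rf.onorm_\<sigma>_nonneg rf.onorm_J_nonneg \<tau> by simp
  have imZ: "norm (rf.im_at \<tau> Z - v0) \<le> kk * m" if "norm (Z - Z0) \<le> m" for Z m
    using rf.norm_re_im_at(2)[OF \<tau> that] unfolding rf.im_at_diff imZ0 kk_def by simp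
  have "onorm J0 * kk \<ge> 0" using kk rf.onorm_J_nonneg by simp
  from small_parameter[OF this, of "\<theta> / 2"] \<theta> obtain \<eta> where \<eta>: "\<eta> > 0" "\<eta> \<le> 1" "onorm J0 * kk * \<eta> \<le> \<theta> / 2" by auto
  define Wb where "Wb = onorm J0 * (norm v0 + kk) + K1 * \<epsilon>0"
  have Wb: "Wb \<ge> 0" unfolding Wb_def using kk rf.onorm_J_nonneg K1 \<epsilon>0 by simp
  \<comment> \<open>\<open>\<delta>\<close> has to beat finitely many constants; their sum handles all of them at once.\<close>
  define Bc where "Bc = R + M * (R + 1) + (M * (R + 1) * Wb + K1 * (M * (R + 1))) + M * bb * (bb + 1)"
  have parts: "R \<ge> 0" "M * (R + 1) \<ge> 0" "M * (R + 1) * Wb + K1 * (M * (R + 1)) \<ge> 0" "M * bb * (bb + 1) \<ge> 0"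
    using R rM Wb K1 bb by auto
  have "Bc + bb \<ge> 0" "min (min r \<epsilon>0) (min (\<theta> / 2) (\<eta> / 4)) > 0" unfolding Bc_def using parts bb rM \<epsilon>0 \<theta> \<eta> by auto
  from small_parameter[OF this] obtain \<delta> where \<delta>: "\<delta> > 0" "\<delta> \<le> 1" "(Bc + bb) * \<delta> \<le> min (min r \<epsilon>0) (min (\<theta> / 2) (\<eta> / 4))" by blast
  have small: "x * \<delta> \<le> min (min r \<epsilon>0) (min (\<theta> / 2) (\<eta> / 4))" if "x \<le> Bc + bb" for x
    using mult_right_mono[OF that, of \<delta>] \<delta> by linarith
  have d1: "\<delta> * R \<le> r" "\<delta> * R \<le> \<theta>" using small[of R] parts bb \<theta> by (auto simp: Bc_def mult.commute)
  have d2: "M * \<delta> * (R + 1) \<le> \<epsilon>0" using small[of "M * (R + 1)"] parts bb \<delta> by (auto simp: Bc_def mult_ac)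
  have d2': "0 \<le> M * \<delta> * (R + 1)" using rM R \<delta> by simp
  have d3: "(M * (R + 1) * Wb + K1 * (M * (R + 1))) * \<delta> \<le> \<theta> / 2"
    using small[of "M * (R + 1) * Wb + K1 * (M * (R + 1))"] parts bb by (auto simp: Bc_def)
  have d4: "M * bb * (bb + 1) * \<delta> \<le> \<eta> / 4" using small[of "M * bb * (bb + 1)"] parts bb by (auto simp: Bc_def)
  have d5: "\<delta> * bb \<le> r" using small[of bb] parts bb by (auto simp: Bc_def mult.commute)
  define y0 where "y0 = x0 + \<delta> *\<^sub>R Z0"
  define \<epsilon>2 where "\<epsilon>2 = min (\<delta> * \<eta> / 4) r"
  have e2: "\<epsilon>2 > 0" using \<delta> \<eta> rM by (simp add: \<epsilon>2_def)
  have \<delta>\<eta>: "\<delta> * \<eta> \<le> \<delta>" using \<delta> \<eta> mult_left_mono[of \<eta> 1 \<delta>] by simp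
  show ?thesis
  proof (rule exI[of _ y0], rule exI[of _ "\<delta> * \<eta> / 2"], rule conjI, goal_cases)
    case 1 then show ?case using \<delta> \<eta> by simp
  next
    case 2 show ?case
    proof (rule exI[of _ \<epsilon>2], rule conjI[OF e2], rule exI[of _ \<delta>], rule conjI[OF \<delta>(1)], intro allI impI, elim conjE)
      fix b q assume b: "norm (b - x0) \<le> \<epsilon>2" and q: "q \<in> ball y0 (\<delta> * \<eta> / 2)"
      have b1: "norm (b - x0) \<le> r" "norm (b - x0) \<le> \<delta> * \<eta> / 4" using b by (auto simp: \<epsilon>2_def)
      have b2: "norm (b - x0) \<le> \<delta>" using b1 \<delta>\<eta> \<delta> by linarith
      have nb: "norm Z \<le> bb" if "Z \<in> cball Z0 \<eta>" for Z
        using that \<eta> norm_triangle_ineq2[of Z Z0] by (simp add: bb_def dist_norm norm_minus_commute)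
      have \<delta>Z: "norm (\<delta> *\<^sub>R Z) \<le> r" "norm (\<delta> *\<^sub>R Z) \<le> \<delta> * bb" if "norm Z \<le> bb" for Z
      proof -
        have "\<delta> * norm Z \<le> \<delta> * bb" using that \<delta> by (intro mult_left_mono) auto
        moreover have "norm (\<delta> *\<^sub>R Z) = \<delta> * norm Z" using \<delta> by simp
        ultimately show "norm (\<delta> *\<^sub>R Z) \<le> r" "norm (\<delta> *\<^sub>R Z) \<le> \<delta> * bb" using d5 by linarith+
      qed
      \<comment> \<open>In dilated coordinates \<open>Phi b\<close> is close to the identity, hence its image of the ball about \<open>Z0\<close> contains a smaller ball by Brouwer.\<close>
      define f where "f Z = (1 / \<delta>) *\<^sub>R (nc.Phi b (\<delta> *\<^sub>R Z) - x0)" for Z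
      have fy: "norm (f Z - Z) \<le> \<eta> / 2" if Z: "norm Z \<le> bb" for Z
      proof -
        have 1: "f Z - Z = (1 / \<delta>) *\<^sub>R ((nc.Phi b (\<delta> *\<^sub>R Z) - (b + \<delta> *\<^sub>R Z)) + (b - x0))"
          using \<delta> by (simp add: f_def algebra_simps)
        have "norm (nc.Phi b (\<delta> *\<^sub>R Z) - (b + \<delta> *\<^sub>R Z)) \<le> M * norm (\<delta> *\<^sub>R Z) * (norm (\<delta> *\<^sub>R Z) + norm (b - x0))"
          by (rule nc.estimateD(6)[OF est \<delta>Z(1)[OF Z] b1(1)])
        also have "\<dots> \<le> M * (\<delta> * bb) * (\<delta> * bb + \<delta>)"
          using \<delta>Z(2)[OF Z] b2 rM \<delta> bb by (intro mult_mono add_mono) auto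
        also have "\<dots> = \<delta> * (M * bb * (bb + 1) * \<delta>)" by (simp add: algebra_simps)
        also have "\<dots> \<le> \<delta> * (\<eta> / 4)" using \<delta> d4 by (intro mult_left_mono) auto
        finally have "norm ((nc.Phi b (\<delta> *\<^sub>R Z) - (b + \<delta> *\<^sub>R Z)) + (b - x0)) \<le> \<delta> * (\<eta> / 4) + \<delta> * \<eta> / 4"
          using b1(2) by (intro norm_triangle_le add_mono)
        also have "\<dots> = \<delta> * (\<eta> / 2)" by simp
        finally have 2: "norm ((nc.Phi b (\<delta> *\<^sub>R Z) - (b + \<delta> *\<^sub>R Z)) + (b - x0)) \<le> \<delta> * (\<eta> / 2)" .
        have "norm (f Z - Z) = norm ((nc.Phi b (\<delta> *\<^sub>R Z) - (b + \<delta> *\<^sub>R Z)) + (b - x0)) / \<delta>"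
          unfolding 1 using \<delta> by simp
        also have "\<dots> \<le> \<eta> / 2" using 2 \<delta> by (simp add: divide_le_eq mult.commute)
        finally show ?thesis .
      qed
      have "\<exists>Z\<in>cball Z0 \<eta>. f Z = (1 / \<delta>) *\<^sub>R (q - x0)"
      proof (rule brouwer_surjective_cball[where S="{(1 / \<delta>) *\<^sub>R (q - x0)}"])
        have "(f has_derivative (\<lambda>v. (1 / \<delta>) *\<^sub>R (nc.Amap b (\<delta> *\<^sub>R Z) (\<delta> *\<^sub>R v) - 0))) (at Z)" if "Z \<in> cball Z0 \<eta>" for Z
          unfolding f_def[abs_def]
          by (intro has_derivative_scaleR_right has_derivative_diff has_derivative_const
              has_derivative_compose[OF has_derivative_scaleR_right[OF has_derivative_ident]
                nc.Phi_has_derivative[OF nc.estimateD(3)[OF est \<delta>Z(1)[OF nb[OF that]] b1(1)]]])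
        then show "continuous_on (cball Z0 \<eta>) f"
          by (meson continuous_at_imp_continuous_on has_derivative_continuous)
        show "\<eta> > 0" by (rule \<eta>)
        fix x y assume x: "x \<in> {(1 / \<delta>) *\<^sub>R (q - x0)}" and y: "y \<in> cball Z0 \<eta>"
        have "x - Z0 = (1 / \<delta>) *\<^sub>R (q - y0)" using x \<delta> by (simp add: y0_def algebra_simps)
        then have "norm (x - Z0) = norm (q - y0) / \<delta>" using \<delta> by simp
        moreover have "norm (q - y0) \<le> \<delta> * \<eta> / 2" using q by (simp add: dist_norm norm_minus_commute)
        ultimately have 1: "norm (x - Z0) \<le> \<eta> / 2" using \<delta> by (simp add: divide_le_eq mult.commute)
        have "norm ((x - Z0) + (y - f y)) \<le> \<eta> / 2 + \<eta> / 2"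
          by (intro norm_triangle_le add_mono 1) (use fy[OF nb[OF y]] in \<open>simp add: norm_minus_commute\<close>)
        then show "x + (y - f y) \<in> cball Z0 \<eta>" by (simp add: dist_norm norm_minus_commute algebra_simps)
      qed simp
      then obtain Z where Z: "Z \<in> cball Z0 \<eta>" "f Z = (1 / \<delta>) *\<^sub>R (q - x0)" by blast
      have PhiZ: "nc.Phi b (\<delta> *\<^sub>R Z) = q" using Z(2) \<delta> unfolding f_def by simp
      let ?\<epsilon> = "M * \<delta> * (R + 1)"
      note fp = nc.estimateD(8,9)[OF est \<delta>(1,2) parts(1) d1(1) b2 b1(1)]
      have Q2z: "\<forall>X\<in>cball 0 R. \<sigma> X = X \<longrightarrow> nc.Q2 b (\<delta> *\<^sub>R X) = 0"
      proof (intro ballI impI)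
        fix X assume X: "X \<in> cball 0 R" "\<sigma> X = X"
        have PX: "P (\<delta> *\<^sub>R X) = \<delta> *\<^sub>R X" using X by (intro P\<sigma>) (simp add: linear_scale[OF rf.lin\<sigma>])
        have "\<delta> * norm X \<le> \<delta> * R" using X \<delta> by (intro mult_left_mono) auto
        moreover have "norm (\<delta> *\<^sub>R X) = \<delta> * norm X" using \<delta> by simp
        ultimately have "norm (\<delta> *\<^sub>R X) \<le> r" using d1 by linarith
        from nc.estimateD(3)[OF est this b1(1)] show "nc.Q2 b (\<delta> *\<^sub>R X) = 0"
          unfolding PX by (intro nc.Q2_zero PX) (use PJ in \<open>simp add: J0_def\<close>)
      qed
      obtain F F' where F: "\<And>z. (F has_derivative F' z) (at z)" "continuous_on UNIV (\<lambda>z. F' z 1)" "continuous_on UNIV (\<lambda>z. F' z \<i>)"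
          "F (\<i> * of_real \<tau>) = Z" "\<And>x::real. \<sigma> (F (of_real x)) = F (of_real x)"
          "\<And>z. norm z \<le> 1 \<Longrightarrow> F z \<in> cball 0 R"
          "\<And>z. norm z \<le> 1 \<and> Im z \<ge> 0 \<Longrightarrow>
          F' z 1 + J0 (F' z \<i>) = nc.Q1 b (\<delta> *\<^sub>R F z) (F' z 1 + J0 (F' z \<i>)) + nc.Q2 b (\<delta> *\<^sub>R F z) (F' z 1)"
          "\<And>z. norm (F' z \<i> - J0 (rf.im_at \<tau> Z)) \<le> K1 * ?\<epsilon>"
        using disc[OF conjI[OF d2' conjI[OF d2 conjI[OF fp(1) conjI[OF fp(2) conjI[OF Q2z nb[OF Z(1)]]]]]]] by blast
      have F\<delta>: "norm (\<delta> *\<^sub>R F z) \<le> \<delta> * R" if "z \<in> cball 0 1" for z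
      proof -
        have "\<delta> * norm (F z) \<le> \<delta> * R" using F(6)[of z] that \<delta> by (intro mult_left_mono) auto
        then show ?thesis using \<delta> by simp
      qed
      have Fr: "norm (\<delta> *\<^sub>R F z) \<le> r" if "z \<in> cball 0 1" for z using F\<delta>[OF that] d1 by linarith
      note G = nc.disc_of_solution[OF est b1(1) F(1) Fr, unfolded J0_def[symmetric]]
      let ?G = "\<lambda>z. nc.Phi b (\<delta> *\<^sub>R F z)"
      let ?G' = "\<lambda>z v. nc.Amap b (\<delta> *\<^sub>R F z) (\<delta> *\<^sub>R F' z v)"
      show "\<exists>G G'. (\<forall>z\<in>cball 0 1. (G has_derivative G' z) (at z)) \<and>
       continuous_on (cball 0 1) (\<lambda>z. G' z 1) \<and> continuous_on (cball 0 1) (\<lambda>z. G' z \<i>) \<and>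
       G (\<i> * of_real \<tau>) = q \<and> (\<forall>z\<in>cball 0 1. G z \<in> cball x0 \<theta>) \<and>
       (\<forall>z\<in>cball 0 1. Im z \<ge> 0 \<longrightarrow> G' z \<i> = JB c (G z) (G' z 1) \<and> norm ((1 / \<delta>) *\<^sub>R G' z \<i> - Jc c x0 v0) \<le> \<theta>) \<and>
       (\<forall>x::real. \<bar>x\<bar> \<le> 1 \<longrightarrow> (\<exists>X\<in>N0. norm X \<le> \<theta> \<and> G (of_real x) = b + X))"
      proof (rule exI[of _ ?G], rule exI[of _ ?G'], intro conjI ballI allI impI)
        show "(?G has_derivative ?G' z) (at z)" if "z \<in> cball 0 1" for z by (rule G(1)[OF _ that])
        show "continuous_on (cball 0 1) (\<lambda>z. ?G' z 1)" by (rule G(2)[OF _ F(2)])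
        show "continuous_on (cball 0 1) (\<lambda>z. ?G' z \<i>)" by (rule G(2)[OF _ F(3)])
        show "?G (\<i> * of_real \<tau>) = q" using PhiZ F(4) by simp
        show "?G z \<in> cball x0 \<theta>" if "z \<in> cball 0 1" for z by (rule nc.estimateD(4)[OF est Fr[OF that] b1(1)])
      next
        fix z assume z: "z \<in> cball 0 1" "Im z \<ge> 0"
        show "?G' z \<i> = JB c (?G z) (?G' z 1)" 
          by (rule G(3)[of "cball 0 1", unfolded J0_def, OF _ F(7)[unfolded J0_def]]) (use z in auto)
        let ?A = "nc.Amap b (\<delta> *\<^sub>R F z)" and ?w = "F' z \<i>" and ?v = "rf.im_at \<tau> Z"
        have v: "norm (?v - v0) \<le> kk * \<eta>" using Z(1) by (intro imZ) (simp add: dist_norm norm_minus_commute)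
        have Jv: "norm (J0 (?v - v0)) \<le> \<theta> / 2"
          using rf.norm_J_le[of "?v - v0"] mult_left_mono[OF v rf.onorm_J_nonneg] \<eta>(3) by (simp add: mult.assoc)
        have wb: "norm ?w \<le> Wb"
        proof -
          have "norm ?v \<le> norm v0 + kk" using v norm_triangle_ineq2[of ?v v0] mult_left_mono[OF \<eta>(2) kk] by simp
          then have "norm (J0 ?v) \<le> onorm J0 * (norm v0 + kk)"
            using rf.norm_J_le[of ?v] mult_left_mono[OF _ rf.onorm_J_nonneg] order_trans by blast
          moreover have "K1 * ?\<epsilon> \<le> K1 * \<epsilon>0" using K1 d2 by (intro mult_left_mono) auto
          ultimately show ?thesis using F(8)[of z] norm_triangle_ineq2[of ?w "J0 ?v"] unfolding Wb_def by linarith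
        qed
        have A: "norm (?A - id_blinfun) \<le> M * (\<delta> * R + \<delta>)"
          by (rule order_trans[OF nc.estimateD(5)[OF est Fr[OF z(1)] b1(1)]])
             (intro mult_left_mono add_mono F\<delta> z b2 rM)
        have "(1 / \<delta>) *\<^sub>R ?G' z \<i> - Jc c x0 v0 = (?A - id_blinfun) ?w + ((?w - J0 ?v) + J0 (?v - v0))"
          using \<delta> by (simp add: J0c[symmetric] blinfun.scaleR_right blinfun.diff_left linear_diff[OF rf.linJ])
        also have "norm \<dots> \<le> M * (\<delta> * R + \<delta>) * Wb + (K1 * ?\<epsilon> + \<theta> / 2)"
        proof (intro norm_triangle_le add_mono F(8) Jv)
          show "norm ((?A - id_blinfun) ?w) \<le> M * (\<delta> * R + \<delta>) * Wb"
            using norm_blinfun[of "?A - id_blinfun" ?w] mult_mono[OF A wb] rM \<delta> R by simp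
        qed
        also have "\<dots> = (M * (R + 1) * Wb + K1 * (M * (R + 1))) * \<delta> + \<theta> / 2" by (simp add: algebra_simps)
        also have "\<dots> \<le> \<theta>" using d3 by linarith
        finally show "norm ((1 / \<delta>) *\<^sub>R ?G' z \<i> - Jc c x0 v0) \<le> \<theta>" .
      next
        fix x :: real assume x: "\<bar>x\<bar> \<le> 1"
        have s: "\<sigma> (\<delta> *\<^sub>R F (of_real x)) = \<delta> *\<^sub>R F (of_real x)" using F(5)[of x] by (simp add: linear_scale[OF rf.lin\<sigma>])
        have PX: "P (\<delta> *\<^sub>R F (of_real x)) = \<delta> *\<^sub>R F (of_real x)" by (rule P\<sigma>[OF s])
        show "\<exists>X\<in>N0. norm X \<le> \<theta> \<and> ?G (of_real x) = b + X"
        proof (rule bexI[of _ "\<delta> *\<^sub>R F (of_real x)"], rule conjI)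
          show "norm (\<delta> *\<^sub>R F (of_real x)) \<le> \<theta>" using F\<delta>[of "of_real x"] x d1 by simp
          show "?G (of_real x) = b + \<delta> *\<^sub>R F (of_real x)"
            unfolding nc.Phi_def nc.\<kappa>_def PX by (simp add: blinfun.zero_right)
          show "\<delta> *\<^sub>R F (of_real x) \<in> N0" using s \<sigma>N by blast
        qed
      qed
    qed
  qed
qed

end

section \<open>Half-discs inside the domain\<close>

context smooth_manifold
begin

text \<open>The slice condition is stated for images; injectivity of the chart turns it into a condition on
  points.\<close>

lemma slice_mem:
  assumes c: "c \<in> \<A>" and sl: "snd c ` (fst c \<inter> X) = snd c ` fst c \<inter> T" and q: "q \<in> fst c"
  shows "q \<in> X \<longleftrightarrow> snd c q \<in> T"
proof
  assume "q \<in> X" then show "snd c q \<in> T" using q sl by blast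
next
  assume "snd c q \<in> T"
  then have "snd c q \<in> snd c ` (fst c \<inter> X)" unfolding sl using q by blast
  then obtain q' where q': "q' \<in> fst c" "q' \<in> X" "snd c q = snd c q'" by blast
  have "q = q'" using chart_inverse(3)[OF c q] chart_inverse(3)[OF c q'(1)] q'(3) by metis
  then show "q \<in> X" using q'(2) by simp
qed

text \<open>The half-slice of full dimension gives the domain by a strict linear inequality in a chart.\<close>

lemma domain_boundary_chart:
  assumes \<Omega>: "smoothly_bounded_domain \<A> \<Omega>" and p: "p \<in> frontier \<Omega>"
  shows "\<exists>d\<in>\<A>. \<exists>\<mu>. p \<in> fst d \<and> \<mu> \<noteq> 0 \<and>
    (\<forall>q\<in>fst d. (q \<in> \<Omega> \<longleftrightarrow> 0 < snd d q \<bullet> \<mu>) \<and> (q \<in> frontier \<Omega> \<longleftrightarrow> snd d q \<bullet> \<mu> = 0))"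
proof -
  have op: "open \<Omega>" and sub: "submanifold_with_boundary \<A> (DIM('e)) (closure \<Omega>) (frontier \<Omega>)"
    using \<Omega> unfolding smoothly_bounded_domain_def by blast+
  have pc: "p \<in> closure \<Omega>" using p unfolding frontier_def by blast
  obtain d S where d: "d \<in> \<A>" "p \<in> fst d" and S: "subspace S" "dim S = DIM('e)" and alt: "snd d ` (fst d \<inter> closure \<Omega>) = snd d ` fst d \<inter> S \<and> fst d \<inter> frontier \<Omega> = {} \<or>
         (\<exists>\<nu>\<in>S. \<nu> \<noteq> 0 \<and>
            snd d ` (fst d \<inter> closure \<Omega>) = snd d ` fst d \<inter> {x\<in>S. 0 \<le> x \<bullet> \<nu>} \<and>
            snd d ` (fst d \<inter> frontier \<Omega>) = snd d ` fst d \<inter> {x\<in>S. x \<bullet> \<nu> = 0})"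
    using sub pc unfolding submanifold_with_boundary_def by meson
  have SU: "S = UNIV" using S dim_eq_full[of S] span_eq_iff[of S] by simp
  obtain \<mu> where \<mu>: "\<mu> \<noteq> 0" and c1: "snd d ` (fst d \<inter> closure \<Omega>) = snd d ` fst d \<inter> {x\<in>S. 0 \<le> x \<bullet> \<mu>}"
      and c2: "snd d ` (fst d \<inter> frontier \<Omega>) = snd d ` fst d \<inter> {x\<in>S. x \<bullet> \<mu> = 0}"
    using alt p d(2) by blast
  have "(q \<in> \<Omega> \<longleftrightarrow> 0 < snd d q \<bullet> \<mu>) \<and> (q \<in> frontier \<Omega> \<longleftrightarrow> snd d q \<bullet> \<mu> = 0)" if q: "q \<in> fst d" for q
  proof -
    have "q \<in> \<Omega> \<longleftrightarrow> q \<in> closure \<Omega> \<and> q \<notin> frontier \<Omega>"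
      using op closure_subset[of \<Omega>] unfolding frontier_def by (auto simp: interior_open)
    then show ?thesis unfolding slice_mem[OF d(1) c1 q] slice_mem[OF d(1) c2 q] SU by auto
  qed
  then show ?thesis using d \<mu> by blast
qed

text \<open>Continuity of the chart derivative in the point and the vector together.\<close>

lemma change_D_near:
  assumes c: "c \<in> \<A>" and d: "d \<in> \<A>" and x0: "x0 \<in> snd c ` (fst c \<inter> fst d)" and pos: "0 < change_D c d x0 w0 \<bullet> \<mu>"
  shows "\<exists>\<theta>>0. cball x0 \<theta> \<subseteq> snd c ` (fst c \<inter> fst d) \<and>
     (\<forall>x\<in>cball x0 \<theta>. \<forall>w. norm (w - w0) \<le> \<theta> \<longrightarrow> 0 < change_D c d x w \<bullet> \<mu>)"
proof -
  let ?O = "snd c ` (fst c \<inter> fst d)"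
  have O: "open ?O" by (rule chart_image_open[OF c chart(1)[OF d]])
  define h where "h p = (\<Sum>\<beta>\<in>Basis. (snd p \<bullet> \<beta>) * (change_D c d (fst p) \<beta> \<bullet> \<mu>))" for p :: "'e \<times> 'e"
  have h: "h (x, w) = change_D c d x w \<bullet> \<mu>" if "x \<in> ?O" for x w
  proof -
    note lin = change_D_linear[OF c d that]
    have "change_D c d x w = change_D c d x (\<Sum>\<beta>\<in>Basis. (w \<bullet> \<beta>) *\<^sub>R \<beta>)" by (simp add: euclidean_representation)
    also have "\<dots> = (\<Sum>\<beta>\<in>Basis. (w \<bullet> \<beta>) *\<^sub>R change_D c d x \<beta>)" by (simp add: linear_sum[OF lin] linear_scale[OF lin])
    finally show ?thesis by (simp add: h_def inner_sum_left)
  qed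
  have "continuous_on (?O \<times> UNIV) h" unfolding h_def
    by (intro continuous_intros continuous_on_compose2[OF change_D_continuous[OF c d]]) auto
  then have "open ((?O \<times> UNIV) \<inter> h -` {0<..})"
    by (rule continuous_open_preimage) (use O in \<open>auto intro: open_Times\<close>)
  moreover have "(x0, w0) \<in> (?O \<times> UNIV) \<inter> h -` {0<..}" using h[OF x0] x0 pos by simp
  ultimately obtain A B where AB: "open A" "open B" "x0 \<in> A" "w0 \<in> B" "A \<times> B \<subseteq> (?O \<times> UNIV) \<inter> h -` {0<..}"
    using open_prod_elim[of "(?O \<times> UNIV) \<inter> h -` {0<..}" "(x0, w0)"] by (metis mem_Times_iff fst_conv snd_conv)
  obtain r1 where r1: "r1 > 0" "cball x0 r1 \<subseteq> A" using AB open_contains_cball by blast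
  obtain r2 where r2: "r2 > 0" "cball w0 r2 \<subseteq> B" using AB open_contains_cball by blast
  show ?thesis
  proof (rule exI[of _ "min r1 r2"], intro conjI ballI allI impI)
    have in1: "x \<in> A" if "x \<in> cball x0 (min r1 r2)" for x using that r1 by auto
    show "cball x0 (min r1 r2) \<subseteq> ?O" using in1 AB(4,5) by blast
    fix x w assume x: "x \<in> cball x0 (min r1 r2)" and w: "norm (w - w0) \<le> min r1 r2"
    have "w \<in> B" using w r2 by (auto simp: dist_norm norm_minus_commute)
    then have "(x, w) \<in> (?O \<times> UNIV) \<inter> h -` {0<..}" using AB(5) in1[OF x] by blast
    then show "0 < change_D c d x w \<bullet> \<mu>" using h[of x w] by auto
  qed (use r1 r2 in auto)
qed

text \<open>Along \<open>N\<close> the defining function of the domain vanishes identically, and so does its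
  derivative along \<open>N\<close>.\<close>

lemma change_D_slice_zero:
  assumes c: "c \<in> \<A>" and d: "d \<in> \<A>" and p: "p \<in> fst c" "p \<in> fst d" "p \<in> N"
    and N0: "subspace N0" and N: "snd c ` (fst c \<inter> N) = snd c ` fst c \<inter> N0"
    and zero: "\<And>q. q \<in> fst d \<Longrightarrow> q \<in> N \<Longrightarrow> snd d q \<bullet> \<mu> = 0" and X: "X \<in> N0"
  shows "change_D c d (snd c p) X \<bullet> \<mu> = 0"
proof -
  let ?O = "snd c ` (fst c \<inter> fst d)" and ?x = "snd c p"
  have xO: "?x \<in> ?O" using p by blast
  have xN: "?x \<in> N0" using p N by blast
  define l where "l t = ?x + t *\<^sub>R X" for t :: real
  have l: "(l has_derivative (\<lambda>t. t *\<^sub>R X)) (at 0)" "l 0 = ?x" unfolding l_def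
    by (auto intro!: derivative_eq_intros)
  have op: "open (l -` ?O)"
    by (rule open_vimage[OF chart_image_open[OF c chart(1)[OF d]]]) (auto simp: l_def intro!: continuous_intros)
  have "((\<lambda>t. coord_change c d (l t)) has_derivative (\<lambda>t. change_D c d ?x (t *\<^sub>R X))) (at 0)"
    by (rule has_derivative_compose[OF l(1)]) (use change_deriv[OF c d xO] l(2) in simp)
  then have D: "((\<lambda>t. coord_change c d (l t) \<bullet> \<mu>) has_derivative (\<lambda>t. change_D c d ?x (t *\<^sub>R X) \<bullet> \<mu>)) (at 0)"
    by (rule has_derivative_inner_left)
  have "((\<lambda>t. 0) has_derivative (\<lambda>t. change_D c d ?x (t *\<^sub>R X) \<bullet> \<mu>)) (at (0::real))"
  proof (rule has_derivative_transform_within_open[OF D op])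
    show "0 \<in> l -` ?O" using xO l(2) by simp
    fix t assume "t \<in> l -` ?O"
    then obtain q where q: "q \<in> fst c" "q \<in> fst d" "l t = snd c q" by blast
    have "l t \<in> N0" unfolding l_def using xN X N0 by (intro subspace_add subspace_scale)
    then have "q \<in> N" using slice_mem[OF c N q(1)] q(3) by simp
    then show "coord_change c d (l t) \<bullet> \<mu> = 0"
      using zero[OF q(2)] q chart_inverse(3)[OF c q(1)] by (simp add: coord_change_def)
  qed
  from has_derivative_unique[OF this has_derivative_const] have "(\<lambda>t. change_D c d ?x (t *\<^sub>R X) \<bullet> \<mu>) = (\<lambda>t. 0)" .
  from fun_cong[OF this, of 1] show ?thesis by simp
qed

end

context almost_complex_manifold
begin

text \<open>A vector whose defining derivative is positive splits as \<open>X + J Y\<close> with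
  \<open>X\<close> and \<open>Y\<close> tangent to \<open>N\<close>. The first summand does not
  contribute because \<open>N\<close> lies in the boundary of the domain.\<close>

lemma inward_vector:
  assumes c: "c \<in> \<A>" and d: "d \<in> \<A>" and p: "p \<in> fst c" "p \<in> fst d" "p \<in> N"
    and N0: "subspace N0" "DIM('e) = 2 * dim N0" and N: "snd c ` (fst c \<inter> N) = snd c ` fst c \<inter> N0"
    and tr: "\<And>X. X \<in> N0 \<Longrightarrow> Jc c (snd c p) X \<in> N0 \<Longrightarrow> X = 0"
    and zero: "\<And>q. q \<in> fst d \<Longrightarrow> q \<in> N \<Longrightarrow> snd d q \<bullet> \<mu> = 0" and \<mu>: "\<mu> \<noteq> 0"
  shows "\<exists>v0\<in>N0. 0 < change_D c d (snd c p) (Jc c (snd c p) v0) \<bullet> \<mu>"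
proof -
  let ?x = "snd c p"
  have xU: "?x \<in> snd c ` fst c" and xO: "?x \<in> snd c ` (fst c \<inter> fst d)" using p by blast+
  have cs: "complex_structure (Jc c ?x)"
    by (rule complex_structure.intro) (auto simp: Jc_linear[OF c xU] Jc_Jc[OF c xU])
  obtain \<sigma> where rf: "real_form (Jc c ?x) \<sigma>" and \<sigma>N: "\<And>X. \<sigma> X = X \<longleftrightarrow> X \<in> N0"
    using real_form_exists[OF cs N0] tr by blast
  interpret rf: real_form "Jc c ?x" \<sigma> by (rule rf)
  \<comment> \<open>The vector in the chart \<open>c\<close> whose coordinates in the boundary chart are \<open>\<mu>\<close>.\<close>
  define v where "v = change_D d c (snd d p) \<mu>"
  have Dv: "change_D c d ?x v = \<mu>" unfolding v_def
    using change_D_chain[OF d c d p(2,1,2)] change_D_same[OF d imageI[OF p(2)]] by simp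
  have v: "rf.re_at v + Jc c ?x (rf.im_at 1 v) = v" using rf.re_im_at[of 1 v] by simp
  have re: "rf.re_at v \<in> N0" and im: "rf.im_at 1 v \<in> N0"
    using rf.re_at_fixed rf.im_at_fixed \<sigma>N by blast+
  have "\<mu> \<bullet> \<mu> = change_D c d ?x (rf.re_at v + Jc c ?x (rf.im_at 1 v)) \<bullet> \<mu>" unfolding v Dv ..
  also have "\<dots> = change_D c d ?x (rf.re_at v) \<bullet> \<mu> + change_D c d ?x (Jc c ?x (rf.im_at 1 v)) \<bullet> \<mu>"
    by (simp add: linear_add[OF change_D_linear[OF c d xO]] inner_add_left)
  also have "change_D c d ?x (rf.re_at v) \<bullet> \<mu> = 0"
    by (rule change_D_slice_zero[OF c d p N0(1) N zero re])
  finally have "change_D c d ?x (Jc c ?x (rf.im_at 1 v)) \<bullet> \<mu> = \<mu> \<bullet> \<mu>" by simp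
  then show ?thesis using im \<mu> by (intro bexI[of _ "rf.im_at 1 v"]) auto
qed

text \<open>A half-disc \<open>G\<close> enters the domain from its diameter, because the defining function of
  the domain increases in the imaginary direction. Composition with the conformal map to the half-disc
  turns the diameter into an arc of the unit circle, and the bound \<open>- K\<close> persists on a
  quarter of a slightly smaller circle by upper semicontinuity and compactness. The submean value
  inequality does the rest.\<close>

lemma half_disc_estimate:
  assumes u: "plurisubharmonic_on \<A> J \<Omega> u" and C: "\<And>q. q \<in> \<Omega> \<Longrightarrow> u q \<le> ereal C" and op: "open \<Omega>"
    and c: "c \<in> \<A>" and d: "d \<in> \<A>" and \<theta>: "cball x0 \<theta> \<subseteq> snd c ` (fst c \<inter> fst d)"
    and pos: "\<And>x w. x \<in> cball x0 \<theta> \<Longrightarrow> norm (w - w0) \<le> \<theta> \<Longrightarrow> 0 < change_D c d x w \<bullet> \<mu>"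
    and \<Omega>: "\<And>q. q \<in> fst d \<Longrightarrow> q \<in> \<Omega> \<longleftrightarrow> 0 < snd d q \<bullet> \<mu>"
    and s: "s > 0"
    and G: "\<And>z. z \<in> cball 0 1 \<Longrightarrow> (G has_derivative G' z) (at z)"
    and G': "continuous_on (cball 0 1) (\<lambda>z. G' z 1)" "continuous_on (cball 0 1) (\<lambda>z. G' z \<i>)"
    and Gin: "\<And>z. z \<in> cball 0 1 \<Longrightarrow> G z \<in> cball x0 \<theta>"
    and hol: "\<And>z. z \<in> cball 0 1 \<Longrightarrow> 0 \<le> Im z \<Longrightarrow> G' z \<i> = JB c (G z) (G' z 1)"
    and up: "\<And>z. z \<in> cball 0 1 \<Longrightarrow> 0 \<le> Im z \<Longrightarrow> norm ((1 / s) *\<^sub>R G' z \<i> - w0) \<le> \<theta>"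
    and edge: "\<And>x::real. \<bar>x\<bar> \<le> 1 \<Longrightarrow> inv_chart c (G (of_real x)) \<in> \<Omega> \<and> u (inv_chart c (G (of_real x))) < ereal (- K)"
  shows "inv_chart c (G (half_disc_map 0)) \<in> \<Omega> \<and> u (inv_chart c (G (half_disc_map 0))) \<le> ereal (C - (C + K) * (1 / 4))"
proof -
  let ?U = "snd c ` fst c" and ?O = "snd c ` (fst c \<inter> fst d)"
  have GO: "G z \<in> ?O" if "z \<in> cball 0 1" for z using Gin[OF that] \<theta> by blast
  have GU: "G z \<in> ?U" if "z \<in> cball 0 1" for z using GO[OF that] by blast
  have Gd: "inv_chart c (G z) \<in> fst d" if z: "z \<in> cball 0 1" for z
  proof -
    obtain q where "q \<in> fst c" "q \<in> fst d" "G z = snd c q" using GO[OF z] by blast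
    then show ?thesis using chart_inverse(3)[OF c] by metis
  qed
  have G\<Omega>: "inv_chart c (G z) \<in> \<Omega>" if z: "z \<in> cball 0 1" "0 \<le> Im z" for z
  proof -
    define \<zeta> where "\<zeta> t = of_real (Re z) + of_real t * \<i>" for t
    \<comment> \<open>The defining function of the domain along the vertical segment from the diameter to \<open>z\<close>.\<close>
    define \<rho> where "\<rho> t = coord_change c d (G (\<zeta> t)) \<bullet> \<mu>" for t
    have \<rho>d: "\<rho> t = snd d (inv_chart c (G (\<zeta> t))) \<bullet> \<mu>" for t by (simp add: \<rho>_def coord_change_def)
    have \<zeta>1: "\<zeta> t \<in> cball 0 1 \<and> Im (\<zeta> t) = t" if "0 \<le> t" "t \<le> Im z" for t
    proof -
      have "t\<^sup>2 \<le> (Im z)\<^sup>2" using that by (intro power_mono) auto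
      then have "norm (\<zeta> t) \<le> norm z" unfolding cmod_def by (simp add: \<zeta>_def)
      then show ?thesis using z(1) by (simp add: \<zeta>_def)
    qed
    have "\<rho> 0 \<le> \<rho> (Im z)"
    proof (rule DERIV_nonneg_imp_nondecreasing[OF z(2)])
      fix t assume t: "0 \<le> t" "t \<le> Im z"
      note \<zeta>t = \<zeta>1[OF t]
      let ?D = "change_D c d (G (\<zeta> t)) (G' (\<zeta> t) \<i>) \<bullet> \<mu>"
      note lin = change_D_linear[OF c d GO[OF conjunct1[OF \<zeta>t]]]
      note linG = has_derivative_linear[OF G[OF conjunct1[OF \<zeta>t]]]
      have "(\<zeta> has_derivative (\<lambda>h. of_real h * \<i>)) (at t)"
        unfolding \<zeta>_def by (auto intro!: derivative_eq_intros)
      from has_derivative_compose[OF this G[OF conjunct1[OF \<zeta>t]]]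
      have "((\<lambda>t. G (\<zeta> t)) has_derivative (\<lambda>h. G' (\<zeta> t) (of_real h * \<i>))) (at t)" .
      from has_derivative_compose[OF this change_deriv[OF c d GO[OF conjunct1[OF \<zeta>t]]]]
      have "(\<rho> has_derivative (\<lambda>h. change_D c d (G (\<zeta> t)) (G' (\<zeta> t) (of_real h * \<i>)) \<bullet> \<mu>)) (at t)"
        unfolding \<rho>_def by (rule has_derivative_inner_left)
      also have "(\<lambda>h. change_D c d (G (\<zeta> t)) (G' (\<zeta> t) (of_real h * \<i>)) \<bullet> \<mu>) = (*) ?D"
      proof
        fix h :: real
        have "of_real h * \<i> = h *\<^sub>R \<i>" by (simp add: scaleR_conv_of_real)
        then show "change_D c d (G (\<zeta> t)) (G' (\<zeta> t) (of_real h * \<i>)) \<bullet> \<mu> = ?D * h"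
          by (simp add: linear_scale[OF linG] linear_scale[OF lin])
      qed
      finally have "DERIV \<rho> t :> ?D" by (simp add: has_field_derivative_def)
      moreover have "0 < ?D"
      proof -
        have "0 < change_D c d (G (\<zeta> t)) ((1 / s) *\<^sub>R G' (\<zeta> t) \<i>) \<bullet> \<mu>"
          by (rule pos[OF Gin up]) (use \<zeta>t t in auto)
        then show ?thesis using s by (simp add: linear_scale[OF lin] zero_less_divide_iff)
      qed
      ultimately show "\<exists>y. DERIV \<rho> t :> y \<and> 0 \<le> y" by (intro exI[of _ ?D]) auto
    qed
    moreover have "0 < \<rho> 0"
    proof -
      have z0: "\<zeta> 0 \<in> cball 0 1" using \<zeta>1[of 0] z(2) by blast
      have "\<bar>Re z\<bar> \<le> 1" using z(1) abs_Re_le_cmod[of z] by simp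
      from edge[OF this] have "inv_chart c (G (\<zeta> 0)) \<in> \<Omega>" by (simp add: \<zeta>_def)
      then show ?thesis using \<Omega>[OF Gd[OF z0]] by (simp add: \<rho>d)
    qed
    moreover have "\<zeta> (Im z) = z" by (simp add: \<zeta>_def complex_eq_iff)
    ultimately show ?thesis using \<Omega>[OF Gd[OF z(1)]] \<rho>d[of "Im z"] by simp
  qed
  let ?f = "inv_chart c \<circ> (G \<circ> half_disc_map)"
  have hz: "half_disc_map z \<in> cball 0 1 \<and> 0 \<le> Im (half_disc_map z)" if "z \<in> ball 0 1" for z
    using half_disc_map_props(1,2)[of z] that by auto
  have hc: "continuous_on (ball 0 1) half_disc_map"
    by (intro continuous_at_imp_continuous_on ballI DERIV_isCont[OF half_disc_map_props(4)]) simp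
  have J: "J_complex_disc \<A> J ?f"
  proof (rule J_disc_from_chart[OF c, where G'="\<lambda>z v. G' (half_disc_map z) (half_disc_map' z * v)"])
    have ex: "G' (half_disc_map z) v = Re v *\<^sub>R G' (half_disc_map z) 1 + Im v *\<^sub>R G' (half_disc_map z) \<i>" if "z \<in> ball 0 1" for z v
      using hz[OF that] by (intro linear_complex_expand has_derivative_linear[OF G]) simp
    show "(G \<circ> half_disc_map) z \<in> ?U" if "z \<in> ball 0 1" for z using GU hz[OF that] by simp
    show "((G \<circ> half_disc_map) has_derivative (\<lambda>v. G' (half_disc_map z) (half_disc_map' z * v))) (at z)" if z: "z \<in> ball 0 1" for z
    proof -
      have "(half_disc_map has_derivative (*) (half_disc_map' z)) (at z)"
        using half_disc_map_props(4)[of z] z by (simp add: has_field_derivative_def)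
      from has_derivative_compose[OF this G[OF conjunct1[OF hz[OF z]]]] show ?thesis by (simp add: comp_def)
    qed
    have cc: "continuous_on (ball 0 1) (\<lambda>z. G' (half_disc_map z) 1)" "continuous_on (ball 0 1) (\<lambda>z. G' (half_disc_map z) \<i>)"
      using hz by (auto intro!: continuous_on_compose2[OF G'(1) hc] continuous_on_compose2[OF G'(2) hc])
    have cv: "continuous_on (ball 0 1) (\<lambda>z. G' (half_disc_map z) (half_disc_map' z * v))" for v
      by (subst continuous_on_cong[OF refl ex]) (auto intro!: continuous_intros cc half_disc_map'_continuous)
    show "continuous_on (ball 0 1) (\<lambda>z. G' (half_disc_map z) (half_disc_map' z * 1))"
      "continuous_on (ball 0 1) (\<lambda>z. G' (half_disc_map z) (half_disc_map' z * \<i>))" by (rule cv)+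
    fix z :: complex assume z: "z \<in> ball 0 1"
    define w where "w = half_disc_map z"
    have w: "w \<in> cball 0 1" "0 \<le> Im w" using hz[OF z] by (auto simp: w_def)
    have h1: "JB c (G w) (G' w 1) = G' w \<i>" using hol[OF w] by simp
    then have h2: "JB c (G w) (G' w \<i>) = - G' w 1"
      using Jc_Jc[OF c GU[OF w(1)]] by (metis JB_apply[OF c GU[OF w(1)]])
    have ew: "G' w v = Re v *\<^sub>R G' w 1 + Im v *\<^sub>R G' w \<i>" for v using ex[OF z] unfolding w_def .
    have "JB c (G w) (G' w (half_disc_map' z)) = Re (half_disc_map' z) *\<^sub>R G' w \<i> - Im (half_disc_map' z) *\<^sub>R G' w 1"
      unfolding ew[of "half_disc_map' z"] by (simp add: blinfun.add_right blinfun.scaleR_right h1 h2)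
    also have "\<dots> = G' w (half_disc_map' z * \<i>)" unfolding ew[of "half_disc_map' z * \<i>"] by simp
    finally show "G' (half_disc_map z) (half_disc_map' z * \<i>) = JB c ((G \<circ> half_disc_map) z) (G' (half_disc_map z) (half_disc_map' z * 1))"
      unfolding w_def by simp
  qed
  have f\<Omega>: "?f ` ball 0 1 \<subseteq> \<Omega>" using G\<Omega> hz by auto
  define V where "V = {q \<in> \<Omega>. u q < ereal (- K)}"
  have V: "open V"
  proof -
    have "openin (top_of_set \<Omega>) V" using u unfolding plurisubharmonic_on_def usc_on_def V_def by blast
    then show ?thesis using op openin_open_trans by blast
  qed
  have pi: "0 < pi" by (rule pi_gt_zero)
  \<comment> \<open>Polar coordinates of a sector at the lower quarter of the circle. On its outer arc \<open>u < - K\<close>, and the radii for which this fails form a compact set.\<close>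
  define A where "A = {1/2..1::real} \<times> {5 * pi / 4..7 * pi / 4}"
  define F where "F p = inv_chart c (G (half_disc_map (of_real (fst p) * cis (snd p))))" for p :: "real \<times> real"
  have A1: "norm (of_real (fst p) * cis (snd p)) = fst p \<and> fst p \<le> 1 \<and> Im (of_real (fst p) * cis (snd p)) < 0" if "p \<in> A" for p
  proof -
    have "5 * pi / 4 \<le> snd p" "snd p \<le> 7 * pi / 4" using that by (auto simp: A_def)
    then have "pi < snd p" "snd p < 2 * pi" using pi by linarith+
    then have "sin (snd p) < 0" by (rule sin_lt_zero)
    then show ?thesis using that by (auto simp: A_def norm_mult mult_pos_neg)
  qed
  let ?E = "{z. norm z \<le> 1 \<and> Im z < 0}"
  have hE: "half_disc_map z \<in> cball 0 1" if "z \<in> ?E" for z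
    using that half_disc_map_props(2,3)[of z] by fastforce
  have Fc: "continuous_on A F"
  proof -
    have 1: "continuous_on ?E half_disc_map"
      by (rule continuous_at_imp_continuous_on) (use half_disc_map_props(5) in auto)
    have 2: "continuous_on (cball 0 1) (\<lambda>z. inv_chart c (G z))"
      by (rule continuous_on_compose2[OF chart_inverse(4)[OF c], of _ G])
         (use G GU in \<open>auto intro!: continuous_at_imp_continuous_on has_derivative_continuous\<close>)
    have 3: "continuous_on A (\<lambda>p. of_real (fst p) * cis (snd p))"
      by (intro continuous_intros)
    have 4: "continuous_on A (\<lambda>p. half_disc_map (of_real (fst p) * cis (snd p)))"
      by (rule continuous_on_compose2[OF 1 3]) (use A1 in fastforce)
    show ?thesis unfolding F_def
    proof (rule continuous_on_compose2[OF 2 4])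
      have "half_disc_map (of_real (fst p) * cis (snd p)) \<in> cball 0 1" if "p \<in> A" for p
        by (rule hE) (use A1[OF that] in simp)
      then show "(\<lambda>p. half_disc_map (of_real (fst p) * cis (snd p))) ` A \<subseteq> cball 0 1" by blast
    qed
  qed
  obtain r where r: "0 < r" "r < 1" and rV: "\<And>t. 5 * pi / 4 \<le> t \<Longrightarrow> t \<le> 7 * pi / 4 \<Longrightarrow> F (r, t) \<in> V"
  proof -
    have cA: "compact A" unfolding A_def by (intro compact_Times compact_Icc)
    have "closed (A \<inter> F -` (- V))"
      by (rule continuous_closed_preimage[OF Fc compact_imp_closed[OF cA]]) (use V in auto)
    then have "compact (A \<inter> (A \<inter> F -` (- V)))" using cA by (rule compact_Int_closed[rotated])
    then have "compact (A \<inter> F -` (- V))" by (simp add: Int_absorb1)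
    then have "compact (fst ` (A \<inter> F -` (- V)))"
      by (rule compact_continuous_image[rotated]) (intro continuous_intros)
    then have "open (- (fst ` (A \<inter> F -` (- V))))" by (intro open_Compl compact_imp_closed)
    moreover have "1 \<in> - (fst ` (A \<inter> F -` (- V)))"
    proof
      assume "1 \<in> fst ` (A \<inter> F -` (- V))"
      then obtain t where t: "(1, t) \<in> A" "F (1, t) \<notin> V" by auto
      define z where "z = cis t"
      have z: "norm z = 1" "Im z < 0" using A1[OF t(1)] by (auto simp: z_def)
      then have h: "Im (half_disc_map z) = 0" "norm (half_disc_map z) < 1" using half_disc_map_props(3) by blast+
      then have hr: "half_disc_map z = of_real (Re (half_disc_map z))" by (simp add: complex_eq_iff)
      have "\<bar>Re (half_disc_map z)\<bar> \<le> 1" using abs_Re_le_cmod[of "half_disc_map z"] h by linarith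
      from edge[OF this] have "F (1, t) \<in> V" unfolding hr[symmetric] by (simp add: F_def V_def z_def)
      then show False using t(2) by simp
    qed
    ultimately have "\<exists>e>0. ball 1 e \<subseteq> - (fst ` (A \<inter> F -` (- V)))"
      by (rule open_contains_ball[THEN iffD1, THEN bspec])
    then obtain e where e: "e > 0" "ball 1 e \<subseteq> - (fst ` (A \<inter> F -` (- V)))" by (elim exE conjE)
    define r where "r = max (1/2) (1 - e / 2)"
    have r: "0 < r" "r < 1" "1/2 \<le> r" "r \<in> ball 1 e" using e by (auto simp: r_def dist_real_def)
    have "F (r, t) \<in> V" if "5 * pi / 4 \<le> t" "t \<le> 7 * pi / 4" for t
    proof (rule ccontr)
      assume "F (r, t) \<notin> V"
      then have "(r, t) \<in> A \<inter> F -` (- V)" using that r by (simp add: A_def)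
      then have "r \<in> fst ` (A \<inter> F -` (- V))" by force
      then show False using e(2) r(4) by blast
    qed
    then show thesis by (rule that[OF r(1,2)])
  qed
  have "u (?f 0) \<le> ereal (C - (C + K) * ((7 * pi / 4 - 5 * pi / 4) / (2 * pi)))"
  proof (rule psh_two_constants[OF u C J f\<Omega> r])
    show "u (?f (of_real r * cis t)) \<le> ereal (- K)" if "5 * pi / 4 \<le> t" "t \<le> 7 * pi / 4" for t
      using rV[OF that] by (simp add: V_def F_def less_imp_le)
  qed (use pi in auto)
  moreover have "(7 * pi / 4 - 5 * pi / 4) / (2 * pi) = 1 / 4" using pi by (simp add: field_simps)
  ultimately have "u (?f 0) \<le> ereal (C - (C + K) * (1 / 4))" by simp
  moreover have "?f 0 \<in> \<Omega>" using f\<Omega> by (metis centre_in_ball image_subset_iff zero_less_one)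
  ultimately show ?thesis by simp
qed

end

section \<open>The boundary uniqueness theorem\<close>

text \<open>The edge of a half-slice is a subspace of codimension one in it.\<close>

lemma dim_orthogonal_slice:
  fixes S :: "'e::euclidean_space set"
  assumes S: "subspace S" and \<nu>: "\<nu> \<in> S" "\<nu> \<noteq> 0"
  shows "subspace {x\<in>S. x \<bullet> \<nu> = 0}" "dim {x\<in>S. x \<bullet> \<nu> = 0} + 1 = dim S"
proof -
  show "subspace {x\<in>S. x \<bullet> \<nu> = 0}"
    using S by (auto simp: subspace_def inner_add_left)
  have "span {\<nu>} \<subseteq> S" using \<nu> S by (intro span_minimal) auto
  from dim_subspace_orthogonal_to_vectors[OF subspace_span S this]
  have "dim {y \<in> S. \<forall>x\<in>span {\<nu>}. orthogonal x y} + dim (span {\<nu>}) = dim S" .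
  moreover have "{y \<in> S. \<forall>x\<in>span {\<nu>}. orthogonal x y} = {x\<in>S. x \<bullet> \<nu> = 0}"
    by (auto simp: span_singleton orthogonal_def inner_commute)
  moreover have "dim (span {\<nu>}) = 1" using \<nu>(2) by (simp add: dim_insert)
  ultimately show "dim {x\<in>S. x \<bullet> \<nu> = 0} + 1 = dim S" by simp
qed

context almost_complex_manifold
begin

text \<open>The plane \<open>N0\<close> is moved by \<open>t \<nu>\<close> into the half-slice \<open>L\<close>.
  For small \<open>t\<close> the diameters of the attached half-discs lie in \<open>L\<close> and as
  close to \<open>N\<close> as required for \<open>u < - K\<close>, while the set of points reached
  stays the same. Letting \<open>K\<close> tend to infinity gives \<open>u = - \<infinity>\<close> on
  an open set.\<close>

theorem minus_infinity_near_totally_real_edge: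
  assumes n: "DIM('e) = 2 * n" and g: "riemannian_metric \<A> g" and \<Omega>: "smoothly_bounded_domain \<A> \<Omega>"
    and L: "L \<subseteq> \<Omega>" and N: "N \<noteq> {}" "N \<subseteq> frontier \<Omega>" and tr: "totally_real \<A> J N"
    and LN: "submanifold_with_boundary \<A> (n + 1) (L \<union> N) N"
    and u: "plurisubharmonic_on \<A> J \<Omega> u" and C: "\<And>q. q \<in> \<Omega> \<Longrightarrow> u q \<le> ereal C"
    and lim: "(u \<longlongrightarrow> -\<infinity>) (inf (filtercomap (\<lambda>q. riemannian_setdist \<A> g q N) (nhds 0)) (principal L))"
  shows "\<forall>q\<in>\<Omega>. u q = -\<infinity>"
proof -
  have op: "open \<Omega>" and con: "connected \<Omega>" using \<Omega> unfolding smoothly_bounded_domain_def by blast+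
  obtain p where p: "p \<in> N" using N(1) by blast
  then have pLN: "p \<in> L \<union> N" by blast
  obtain c S where c: "c \<in> \<A>" "p \<in> fst c" and S: "subspace S" "dim S = n + 1" and alt: "snd c ` (fst c \<inter> (L \<union> N)) = snd c ` fst c \<inter> S \<and> fst c \<inter> N = {} \<or>
         (\<exists>\<nu>\<in>S. \<nu> \<noteq> 0 \<and>
            snd c ` (fst c \<inter> (L \<union> N)) = snd c ` fst c \<inter> {x\<in>S. 0 \<le> x \<bullet> \<nu>} \<and>
            snd c ` (fst c \<inter> N) = snd c ` fst c \<inter> {x\<in>S. x \<bullet> \<nu> = 0})"
    using LN pLN unfolding submanifold_with_boundary_def by meson
  obtain \<nu> where \<nu>: "\<nu> \<in> S" "\<nu> \<noteq> 0" and LNsl: "snd c ` (fst c \<inter> (L \<union> N)) = snd c ` fst c \<inter> {x\<in>S. 0 \<le> x \<bullet> \<nu>}"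
      and Nsl: "snd c ` (fst c \<inter> N) = snd c ` fst c \<inter> {x\<in>S. x \<bullet> \<nu> = 0}"
    using alt p c(2) by blast
  define N0 where "N0 = {x\<in>S. x \<bullet> \<nu> = 0}"
  note Nsl = Nsl[folded N0_def]
  have N0: "subspace N0" "DIM('e) = 2 * dim N0"
    using dim_orthogonal_slice[OF S(1) \<nu>] S(2) n by (simp_all add: N0_def)
  define x0 where "x0 = snd c p"
  have xN0: "x0 \<in> N0" using slice_mem[OF c(1) Nsl c(2)] p by (simp add: x0_def)
  have trc: "X = 0" if "X \<in> N0" "Jc c x0 X \<in> N0" for X
    using totally_real_slice[OF c(1) N0(1) Nsl c(2) p tr] that by (simp add: x0_def)
  have "p \<in> frontier \<Omega>" using p N(2) by blast
  then obtain d \<mu> where d: "d \<in> \<A>" "p \<in> fst d" and \<mu>: "\<mu> \<noteq> 0" and d\<Omega>: "\<And>q. q \<in> fst d \<Longrightarrow> q \<in> \<Omega> \<longleftrightarrow> 0 < snd d q \<bullet> \<mu>"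
      and dF: "\<And>q. q \<in> fst d \<Longrightarrow> q \<in> frontier \<Omega> \<longleftrightarrow> snd d q \<bullet> \<mu> = 0"
    using domain_boundary_chart[OF \<Omega>] by blast
  have dN: "snd d q \<bullet> \<mu> = 0" if "q \<in> fst d" "q \<in> N" for q using dF[OF that(1)] that(2) N(2) by blast
  obtain v0 where v0: "v0 \<in> N0" "0 < change_D c d x0 (Jc c x0 v0) \<bullet> \<mu>"
    using inward_vector[OF c(1) d(1) c(2) d(2) p N0 Nsl trc[unfolded x0_def] dN \<mu>] unfolding x0_def by blast
  have x0O: "x0 \<in> snd c ` (fst c \<inter> fst d)" and x0U: "x0 \<in> snd c ` fst c" unfolding x0_def using c d by blast+
  obtain \<theta>0 where \<theta>0: "\<theta>0 > 0" "cball x0 \<theta>0 \<subseteq> snd c ` (fst c \<inter> fst d)"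
      and pos0: "\<forall>x\<in>cball x0 \<theta>0. \<forall>w. norm (w - Jc c x0 v0) \<le> \<theta>0 \<longrightarrow> 0 < change_D c d x w \<bullet> \<mu>"
    using change_D_near[OF c(1) d(1) x0O v0(2)] by blast
  obtain r Cr where r: "r > 0" "Cr \<ge> 0" "ball x0 r \<subseteq> snd c ` fst c" and rd: "\<forall>x\<in>ball x0 r. \<forall>y\<in>ball x0 r.
     riemannian_dist \<A> g (inv_chart c x) (inv_chart c y) \<le> ennreal (Cr * norm (x - y))"
    using riemannian_dist_chart[OF g c(1) x0U] by blast
  define \<theta> where "\<theta> = min \<theta>0 (r / 2)"
  have \<theta>: "\<theta> > 0" "\<theta> \<le> \<theta>0" "\<theta> < r" using \<theta>0 r by (auto simp: \<theta>_def)
  have \<theta>O: "cball x0 \<theta> \<subseteq> snd c ` (fst c \<inter> fst d)" using \<theta>0(2) subset_cball[OF \<theta>(2)] by blast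
  then have \<theta>U: "cball x0 \<theta> \<subseteq> snd c ` fst c" by blast
  have pos: "0 < change_D c d x w \<bullet> \<mu>" if "x \<in> cball x0 \<theta>" "norm (w - Jc c x0 v0) \<le> \<theta>" for x w
  proof -
    have "x \<in> cball x0 \<theta>0" "norm (w - Jc c x0 v0) \<le> \<theta>0" using that \<theta>(2) by auto
    then show ?thesis using pos0 by blast
  qed
  obtain \<tau> where \<tau>: "0 < \<tau>" "half_disc_map 0 = \<i> * of_real \<tau>" using half_disc_map_zero by blast
  obtain y0 \<epsilon>1 \<epsilon>2 s where e: "\<epsilon>1 > 0" "\<epsilon>2 > 0" "s > 0" and discs: "\<forall>b q. norm (b - x0) \<le> \<epsilon>2 \<and> q \<in> ball y0 \<epsilon>1 \<longrightarrow>
    (\<exists>G G'. (\<forall>z\<in>cball 0 1. (G has_derivative G' z) (at z)) \<and>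
       continuous_on (cball 0 1) (\<lambda>z. G' z 1) \<and> continuous_on (cball 0 1) (\<lambda>z. G' z \<i>) \<and>
       G (\<i> * of_real \<tau>) = q \<and> (\<forall>z\<in>cball 0 1. G z \<in> cball x0 \<theta>) \<and>
       (\<forall>z\<in>cball 0 1. Im z \<ge> 0 \<longrightarrow> G' z \<i> = JB c (G z) (G' z 1) \<and> norm ((1 / s) *\<^sub>R G' z \<i> - Jc c x0 v0) \<le> \<theta>) \<and>
       (\<forall>x::real. \<bar>x\<bar> \<le> 1 \<longrightarrow> (\<exists>X\<in>N0. norm X \<le> \<theta> \<and> G (of_real x) = b + X)))"
    by (rule exE[OF attached_discs[OF c(1) N0 _ v0(1) \<theta>(1) \<theta>U \<tau>(1)]], erule trc, assumption)
       (elim exE conjE, rule that; assumption)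
  have key: "q \<in> cball x0 \<theta> \<and> inv_chart c q \<in> \<Omega> \<and> u (inv_chart c q) \<le> ereal (C - (C + K) * (1 / 4))"
    if q: "q \<in> ball y0 \<epsilon>1" for q K
  proof -
    obtain \<epsilon> where \<epsilon>: "\<epsilon> > 0" and near: "\<And>q. q \<in> L \<Longrightarrow> riemannian_setdist \<A> g q N \<le> ennreal \<epsilon> \<Longrightarrow> u q < ereal (- K)"
      using tendsto_minus_infinity_near[OF lim, of "- K"] by blast
    have "(1 + Cr) * norm \<nu> \<ge> 0" "min \<epsilon>2 \<epsilon> > 0" using r e \<epsilon> by auto
    from small_parameter[OF this] obtain t where t: "t > 0" "(1 + Cr) * norm \<nu> * t \<le> min \<epsilon>2 \<epsilon>" by blast
    have "0 \<le> norm \<nu> * t" "0 \<le> Cr * (norm \<nu> * t)" using t r by auto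
    then have t': "norm \<nu> * t \<le> \<epsilon>2" "Cr * (norm \<nu> * t) \<le> \<epsilon>" using t(2) by (auto simp: algebra_simps)
    \<comment> \<open>The translate of the edge into the half-slice.\<close>
    define b where "b = x0 + t *\<^sub>R \<nu>"
    have b: "norm (b - x0) \<le> \<epsilon>2" using t t' by (simp add: b_def mult.commute)
    obtain G G' where G: "\<And>z. z \<in> cball 0 1 \<Longrightarrow> (G has_derivative G' z) (at z)"
      "continuous_on (cball 0 1) (\<lambda>z. G' z 1)" "continuous_on (cball 0 1) (\<lambda>z. G' z \<i>)"
       "G (\<i> * of_real \<tau>) = q" "\<And>z. z \<in> cball 0 1 \<Longrightarrow> G z \<in> cball x0 \<theta>"
       "\<And>z. z \<in> cball 0 1 \<Longrightarrow> Im z \<ge> 0 \<Longrightarrow> G' z \<i> = JB c (G z) (G' z 1)"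
       "\<And>z. z \<in> cball 0 1 \<Longrightarrow> Im z \<ge> 0 \<Longrightarrow> norm ((1 / s) *\<^sub>R G' z \<i> - Jc c x0 v0) \<le> \<theta>"
       "\<And>x::real. \<bar>x\<bar> \<le> 1 \<Longrightarrow> \<exists>X\<in>N0. norm X \<le> \<theta> \<and> G (of_real x) = b + X"
      using discs[rule_format, OF conjI[OF b q]] by blast
    have edge: "inv_chart c (G (of_real x)) \<in> \<Omega> \<and> u (inv_chart c (G (of_real x))) < ereal (- K)"
      if x: "\<bar>x\<bar> \<le> 1" for x :: real
    proof -
      obtain X where X: "X \<in> N0" "norm X \<le> \<theta>" "G (of_real x) = b + X" using G(8)[OF x] by blast
      let ?y = "G (of_real x)" and ?y' = "x0 + X"
      have y: "?y \<in> cball x0 \<theta>" using G(5)[of "of_real x"] x by simp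
      then have yU: "?y \<in> snd c ` fst c" and yr: "?y \<in> ball x0 r" using \<theta>U \<theta>(3) by auto
      have yy: "?y = ?y' + t *\<^sub>R \<nu>" using X(3) by (simp add: b_def)
      have y'N0: "?y' \<in> N0" by (rule subspace_add[OF N0(1) xN0 X(1)])
      have yS: "?y \<in> S" unfolding yy using y'N0 \<nu>(1) S(1) by (auto simp: N0_def intro!: subspace_add subspace_scale)
      have yn: "?y \<bullet> \<nu> = t * (\<nu> \<bullet> \<nu>)" unfolding yy using y'N0 by (simp add: N0_def inner_add_left)
      then have yp: "?y \<bullet> \<nu> > 0" using t \<nu>(2) by simp
      note iy = chart_inverse(1,2)[OF c(1) yU]
      \<comment> \<open>The point has a positive \<open>\<nu>\<close>-component, so it is in the half-slice and not on its edge.\<close>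
      have qL: "inv_chart c ?y \<in> L"
        using slice_mem[OF c(1) LNsl iy(1)] slice_mem[OF c(1) Nsl iy(1)] yS yp unfolding iy(2) N0_def by auto
      have y'c: "?y' \<in> cball x0 \<theta>" using X(2) by (simp add: dist_norm)
      then have y'U: "?y' \<in> snd c ` fst c" and y'r: "?y' \<in> ball x0 r" using \<theta>U \<theta>(3) by auto
      note iy' = chart_inverse(1,2)[OF c(1) y'U]
      have q'N: "inv_chart c ?y' \<in> N"
        using slice_mem[OF c(1) Nsl iy'(1)] y'N0 unfolding iy'(2) by blast
      have "riemannian_setdist \<A> g (inv_chart c ?y) N \<le> riemannian_dist \<A> g (inv_chart c ?y) (inv_chart c ?y')"
        unfolding riemannian_setdist_def by (rule INF_lower[OF q'N])
      also have "\<dots> \<le> ennreal (Cr * norm (?y - ?y'))" using rd yr y'r by blast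
      also have "\<dots> \<le> ennreal \<epsilon>" using t t' by (intro ennreal_leI) (simp add: yy mult.commute)
      finally have "u (inv_chart c ?y) < ereal (- K)" by (rule near[OF qL])
      then show ?thesis using qL L by blast
    qed
    have G0: "G (half_disc_map 0) = q" using G(4) \<tau>(2) by simp
    have "q \<in> cball x0 \<theta>" using G(5)[of "half_disc_map 0"] half_disc_map_props(2)[of 0] unfolding G0 by simp
    moreover have "inv_chart c (G (half_disc_map 0)) \<in> \<Omega> \<and> u (inv_chart c (G (half_disc_map 0))) \<le> ereal (C - (C + K) * (1 / 4))"
      by (rule half_disc_estimate[OF u C op c(1) d(1) \<theta>O pos d\<Omega> e(3) G(1-3,5-7) edge])
    ultimately show ?thesis unfolding G0 by blast
  qed
  have minus: "q \<in> snd c ` fst c \<and> inv_chart c q \<in> \<Omega> \<and> u (inv_chart c q) = -\<infinity>" if q: "q \<in> ball y0 \<epsilon>1" for q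
  proof -
    have "u (inv_chart c q) = -\<infinity>"
      by (rule ereal_minus_infinity_if[of "1/4" _ C]) (use key[OF q] in auto)
    then show ?thesis using key[OF q] \<theta>U by blast
  qed
  define W0 where "W0 = fst c \<inter> snd c -` ball y0 \<epsilon>1"
  have W0: "q \<in> \<Omega> \<and> u q = -\<infinity>" if "q \<in> W0" for q
    using minus[of "snd c q"] that chart_inverse(3)[OF c(1), of q] by (simp add: W0_def)
  show ?thesis
  proof (rule propagation[OF u C op con])
    show "open W0" unfolding W0_def
      by (rule continuous_open_preimage[OF chart_inverse(5)[OF c(1)] chart(1)[OF c(1)] open_ball])
    have "inv_chart c y0 \<in> W0"
      using minus[of y0] e(1) chart_inverse(1,2)[OF c(1), of y0] by (simp add: W0_def)
    then show "W0 \<noteq> {}" by blast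
    show "W0 \<subseteq> \<Omega>" using W0 by blast
    show "u q = -\<infinity>" if "q \<in> W0" for q using W0[OF that] by blast
  qed
qed

end

theorem corollary5p6:
  fixes \<A> :: "('a::{t2_space, second_countable_topology}, 'e::euclidean_space) chart set"
    and J :: "'a \<Rightarrow> ('a, 'e) tvec \<Rightarrow> ('a, 'e) tvec"
    and g :: "'a \<Rightarrow> ('a, 'e) tvec \<Rightarrow> ('a, 'e) tvec \<Rightarrow> real"
    and n :: nat
    and \<Omega> L N :: "'a set"
    and u :: "'a \<Rightarrow> ereal"
  assumes "smooth_structure \<A>" and "DIM('e) = 2 * n"
    and "almost_complex_structure \<A> J"
    and "riemannian_metric \<A> g"
    and "smoothly_bounded_domain \<A> \<Omega>"
    and "L \<subseteq> \<Omega>" and "submanifold \<A> (n + 1) L" and "generic_submanifold \<A> J L"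
    and "N \<noteq> {}" and "N \<subseteq> frontier \<Omega>" and "submanifold \<A> n N" and "totally_real \<A> J N"
    and "submanifold_with_boundary \<A> (n + 1) (L \<union> N) N"
    and "plurisubharmonic_on \<A> J \<Omega> u"
    and "\<exists>C::real. \<forall>q\<in>\<Omega>. u q \<le> ereal C"
    and "(u \<longlongrightarrow> -\<infinity>)
           (inf (filtercomap (\<lambda>q. riemannian_setdist \<A> g q N) (nhds 0)) (principal L))"
  shows "\<forall>q\<in>\<Omega>. u q = -\<infinity>"
proof -
  interpret almost_complex_manifold \<A> J
    using assms(1,3) by (simp add: almost_complex_manifold_def almost_complex_manifold_axioms_def smooth_manifold_def)
  obtain C :: real where C: "\<forall>q\<in>\<Omega>. u q \<le> ereal C" using assms(15) by blast
  show ?thesis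
    by (rule minus_infinity_near_totally_real_edge[OF assms(2,4,5,6,9,10,12,13,14) _ assms(16)])
       (use C in blast)
qed

end
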